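(* Let $k$ be an algebraically closed field of characteristic $0$. Let $\mathbf{G}$ be an abelian group of order $2^{m-1}$, let $M(\mathbf{G})=\mathrm{H}^2(\mathbf{G},k^\times)$ be its Schur multiplier, and let $N$ be the number of distinct conjugacy classes of elements of order $2$ in $\mathrm{Aut}(\mathbf{G})$. Then there are at most $$N\left(\frac{|\mathbf{G}|\cdot|M(\mathbf{G})|}{2}-1\right)$$ pairwise nonisomorphic nontrivial semisimple Hopf algebras of dimension $2^m$ over $k$ whose group of group-like elements is isomorphic to $\mathbf{G}$.
   Context: A Hopf algebra is nontrivial if it is noncommutative and noncocommutative. *)

theory Defs
  imports "HOL-Algebra.Algebra" "Jordan_Normal_Form.Missing_VectorSpace"
begin

hide_const (open) Multiset.mult Wellorder_Constructions.zero

text \<open>Tensor products of vector spaces, as the free vector space on the set of pairs modulo the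
  bilinearity relations. Elements of the free space are finitely supported functions that are
  zero outside the basis \<^term>\<open>B\<close>; the ring multiplication and unit of a bare module
  record carry no meaning.\<close>

definition free_module :: "('k, 'r) ring_scheme \<Rightarrow> 'x set \<Rightarrow> ('k, 'x \<Rightarrow> 'k) module" where
  "free_module K B =
    \<lparr>carrier = {f. (\<forall>x\<in>B. f x \<in> carrier K) \<and> (\<forall>x. x \<notin> B \<longrightarrow> f x = \<zero>\<^bsub>K\<^esub>) \<and>
                    finite {x. f x \<noteq> \<zero>\<^bsub>K\<^esub>}},
     mult = undefined, one = undefined,
     zero = (\<lambda>x. \<zero>\<^bsub>K\<^esub>),
     add = (\<lambda>f g x. f x \<oplus>\<^bsub>K\<^esub> g x),
     smult = (\<lambda>a f x. a \<otimes>\<^bsub>K\<^esub> f x)\<rparr>"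

definition basis_vec :: "('k, 'r) ring_scheme \<Rightarrow> 'x \<Rightarrow> 'x \<Rightarrow> 'k" where
  "basis_vec K x = (\<lambda>y. if y = x then \<one>\<^bsub>K\<^esub> else \<zero>\<^bsub>K\<^esub>)"

definition bilinear_relations ::
  "('k, 'r) ring_scheme \<Rightarrow> ('k, 'v, 'a) module_scheme \<Rightarrow> ('k, 'w, 'b) module_scheme
    \<Rightarrow> ('v \<times> 'w \<Rightarrow> 'k) set" where
  "bilinear_relations K V W =
    (let F = free_module K (carrier V \<times> carrier W); e = (\<lambda>v w. basis_vec K (v, w)) in
      {e (v \<oplus>\<^bsub>V\<^esub> v') w \<ominus>\<^bsub>F\<^esub> (e v w \<oplus>\<^bsub>F\<^esub> e v' w) | v v' w.
         v \<in> carrier V \<and> v' \<in> carrier V \<and> w \<in> carrier W} \<union>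
      {e v (w \<oplus>\<^bsub>W\<^esub> w') \<ominus>\<^bsub>F\<^esub> (e v w \<oplus>\<^bsub>F\<^esub> e v w') | v w w'.
         v \<in> carrier V \<and> w \<in> carrier W \<and> w' \<in> carrier W} \<union>
      {e (a \<odot>\<^bsub>V\<^esub> v) w \<ominus>\<^bsub>F\<^esub> a \<odot>\<^bsub>F\<^esub> e v w | a v w.
         a \<in> carrier K \<and> v \<in> carrier V \<and> w \<in> carrier W} \<union>
      {e v (a \<odot>\<^bsub>W\<^esub> w) \<ominus>\<^bsub>F\<^esub> a \<odot>\<^bsub>F\<^esub> e v w | a v w.
         a \<in> carrier K \<and> v \<in> carrier V \<and> w \<in> carrier W})"

definition quotient_module ::
  "('k, 'v, 'a) module_scheme \<Rightarrow> 'v set \<Rightarrow> ('k, 'v set) module" where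
  "quotient_module M N =
    \<lparr>carrier = a_rcosets\<^bsub>M\<^esub> N, mult = undefined, one = undefined,
     zero = N, add = set_add M, smult = (\<lambda>a C. \<Union>x\<in>C. N +>\<^bsub>M\<^esub> (a \<odot>\<^bsub>M\<^esub> x))\<rparr>"

definition tensor_relations ::
  "('k, 'r) ring_scheme \<Rightarrow> ('k, 'v, 'a) module_scheme \<Rightarrow> ('k, 'w, 'b) module_scheme
    \<Rightarrow> ('v \<times> 'w \<Rightarrow> 'k) set" where
  "tensor_relations K V W =
    module.span K (free_module K (carrier V \<times> carrier W)) (bilinear_relations K V W)"

definition tensor ::
  "('k, 'r) ring_scheme \<Rightarrow> ('k, 'v, 'a) module_scheme \<Rightarrow> ('k, 'w, 'b) module_scheme
    \<Rightarrow> ('k, ('v \<times> 'w \<Rightarrow> 'k) set) module" where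
  "tensor K V W =
    quotient_module (free_module K (carrier V \<times> carrier W)) (tensor_relations K V W)"

definition pure_tensor ::
  "('k, 'r) ring_scheme \<Rightarrow> ('k, 'v, 'a) module_scheme \<Rightarrow> ('k, 'w, 'b) module_scheme
    \<Rightarrow> 'v \<Rightarrow> 'w \<Rightarrow> ('v \<times> 'w \<Rightarrow> 'k) set" where
  "pure_tensor K V W v w =
    tensor_relations K V W +>\<^bsub>free_module K (carrier V \<times> carrier W)\<^esub> basis_vec K (v, w)"

text \<open>The linear map out of a tensor product induced by a bilinear map \<^term>\<open>\<beta>\<close> into
  \<^term>\<open>U\<close>: evaluate \<^term>\<open>\<beta>\<close> on any representative of the coset. For bilinear
  \<^term>\<open>\<beta>\<close> the image set below is a singleton.\<close>

definition tensor_lift ::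
  "('k, 'r) ring_scheme \<Rightarrow> ('k, 'u, 'c) module_scheme \<Rightarrow> ('v \<Rightarrow> 'w \<Rightarrow> 'u)
    \<Rightarrow> ('v \<times> 'w \<Rightarrow> 'k) set \<Rightarrow> 'u" where
  "tensor_lift K U \<beta> t =
    the_elem ((\<lambda>f. \<Oplus>\<^bsub>U\<^esub>p\<in>{p. f p \<noteq> \<zero>\<^bsub>K\<^esub>}. f p \<odot>\<^bsub>U\<^esub> \<beta> (fst p) (snd p)) ` t)"

definition tensor_map ::
  "('k, 'r) ring_scheme \<Rightarrow> ('k, 'v2, 'a) module_scheme \<Rightarrow> ('k, 'w2, 'b) module_scheme
    \<Rightarrow> ('v \<Rightarrow> 'v2) \<Rightarrow> ('w \<Rightarrow> 'w2) \<Rightarrow> ('v \<times> 'w \<Rightarrow> 'k) set \<Rightarrow> ('v2 \<times> 'w2 \<Rightarrow> 'k) set" where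
  "tensor_map K V' W' f g =
    tensor_lift K (tensor K V' W') (\<lambda>v w. pure_tensor K V' W' (f v) (g w))"

definition tensor_assoc ::
  "('k, 'r) ring_scheme \<Rightarrow> ('k, 'u, 'a) module_scheme \<Rightarrow> ('k, 'v, 'b) module_scheme
    \<Rightarrow> ('k, 'w, 'c) module_scheme \<Rightarrow> (('u \<times> 'v \<Rightarrow> 'k) set \<times> 'w \<Rightarrow> 'k) set
    \<Rightarrow> ('u \<times> ('v \<times> 'w \<Rightarrow> 'k) set \<Rightarrow> 'k) set" where
  "tensor_assoc K U V W =
    (let T = tensor K U (tensor K V W) in
      tensor_lift K T (\<lambda>t w.
        tensor_lift K T (\<lambda>u v. pure_tensor K U (tensor K V W) u (pure_tensor K V W v w)) t))"

definition tensor_flip ::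
  "('k, 'r) ring_scheme \<Rightarrow> ('k, 'v, 'a) module_scheme \<Rightarrow> ('k, 'w, 'b) module_scheme
    \<Rightarrow> ('v \<times> 'w \<Rightarrow> 'k) set \<Rightarrow> ('w \<times> 'v \<Rightarrow> 'k) set" where
  "tensor_flip K V W = tensor_lift K (tensor K W V) (\<lambda>v w. pure_tensor K W V w v)"

text \<open>HOL-Algebra's locale \<^locale>\<open>algebra\<close> covers commutative algebras only.\<close>

locale assoc_algebra = vec: vectorspace K A + ring A for K (structure) and A (structure) +
  assumes smult_mult_left:
      "\<lbrakk>a \<in> carrier K; x \<in> carrier A; y \<in> carrier A\<rbrakk>
        \<Longrightarrow> (a \<odot>\<^bsub>A\<^esub> x) \<otimes>\<^bsub>A\<^esub> y = a \<odot>\<^bsub>A\<^esub> (x \<otimes>\<^bsub>A\<^esub> y)"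
    and smult_mult_right:
      "\<lbrakk>a \<in> carrier K; x \<in> carrier A; y \<in> carrier A\<rbrakk>
        \<Longrightarrow> x \<otimes>\<^bsub>A\<^esub> (a \<odot>\<^bsub>A\<^esub> y) = a \<odot>\<^bsub>A\<^esub> (x \<otimes>\<^bsub>A\<^esub> y)"

definition alg_hom ::
  "('k, 'r) ring_scheme \<Rightarrow> ('k, 'v, 'a) module_scheme \<Rightarrow> ('k, 'w, 'b) module_scheme
    \<Rightarrow> ('v \<Rightarrow> 'w) set" where
  "alg_hom K A B = ring_hom A B \<inter> module_hom K A B"

definition base_algebra :: "('k, 'r) ring_scheme \<Rightarrow> ('k, 'k) module" where
  "base_algebra K =
    \<lparr>carrier = carrier K, mult = mult K, one = \<one>\<^bsub>K\<^esub>,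
     zero = \<zero>\<^bsub>K\<^esub>, add = add K, smult = mult K\<rparr>"

text \<open>The multiplication is determined by \<open>(a \<otimes> b)(c \<otimes> d) = ac \<otimes> bd\<close>.\<close>

definition tensor_algebra ::
  "('k, 'r) ring_scheme \<Rightarrow> ('k, 'v, 'a) module_scheme \<Rightarrow> ('k, 'w, 'b) module_scheme
    \<Rightarrow> ('k, ('v \<times> 'w \<Rightarrow> 'k) set) module" where
  "tensor_algebra K A B =
    (let T = tensor K A B in
      T\<lparr>mult := (\<lambda>s t.
           tensor_lift K T (\<lambda>a b.
             tensor_lift K T (\<lambda>c d. pure_tensor K A B (a \<otimes>\<^bsub>A\<^esub> c) (b \<otimes>\<^bsub>B\<^esub> d)) t) s),
        one := pure_tensor K A B \<one>\<^bsub>A\<^esub> \<one>\<^bsub>B\<^esub>\<rparr>)"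

record ('k, 'h) hopf = "('k, 'h) module" +
  comult :: "'h \<Rightarrow> ('h \<times> 'h \<Rightarrow> 'k) set"
  counit :: "'h \<Rightarrow> 'k"
  antipode :: "'h \<Rightarrow> 'h"

locale hopf_algebra = assoc_algebra K H
  for K :: "('k, 'r) ring_scheme" (structure) and H :: "('k, 'h, 'a) hopf_scheme" (structure) +
  assumes comult_hom: "comult H \<in> alg_hom K H (tensor_algebra K H H)"
    and counit_hom: "counit H \<in> alg_hom K H (base_algebra K)"
    and antipode_linear: "antipode H \<in> module_hom K H H"
    and coassociative:
      "h \<in> carrier H \<Longrightarrow>
        tensor_assoc K H H H (tensor_map K (tensor K H H) H (comult H) (\<lambda>x. x) (comult H h)) =
        tensor_map K H (tensor K H H) (\<lambda>x. x) (comult H) (comult H h)"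
    and counit_left:
      "h \<in> carrier H \<Longrightarrow> tensor_lift K H (\<lambda>a b. counit H a \<odot>\<^bsub>H\<^esub> b) (comult H h) = h"
    and counit_right:
      "h \<in> carrier H \<Longrightarrow> tensor_lift K H (\<lambda>a b. counit H b \<odot>\<^bsub>H\<^esub> a) (comult H h) = h"
    and antipode_left:
      "h \<in> carrier H \<Longrightarrow>
        tensor_lift K H (\<lambda>a b. antipode H a \<otimes>\<^bsub>H\<^esub> b) (comult H h) = counit H h \<odot>\<^bsub>H\<^esub> \<one>\<^bsub>H\<^esub>"
    and antipode_right:
      "h \<in> carrier H \<Longrightarrow>
        tensor_lift K H (\<lambda>a b. a \<otimes>\<^bsub>H\<^esub> antipode H b) (comult H h) = counit H h \<odot>\<^bsub>H\<^esub> \<one>\<^bsub>H\<^esub>"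

definition hopf_iso ::
  "('k, 'r) ring_scheme \<Rightarrow> ('k, 'h, 'a) hopf_scheme \<Rightarrow> ('k, 'l, 'b) hopf_scheme
    \<Rightarrow> ('h \<Rightarrow> 'l) set" where
  "hopf_iso K H L =
    {f \<in> alg_hom K H L. bij_betw f (carrier H) (carrier L) \<and>
      (\<forall>h\<in>carrier H.
        comult L (f h) = tensor_map K L L f f (comult H h) \<and>
        counit L (f h) = counit H h \<and>
        antipode L (f h) = f (antipode H h))}"

definition left_ideal :: "('h, 'a) ring_scheme \<Rightarrow> 'h set \<Rightarrow> bool" where
  "left_ideal A I \<longleftrightarrow>
    additive_subgroup I A \<and> (\<forall>a\<in>carrier A. \<forall>x\<in>I. a \<otimes>\<^bsub>A\<^esub> x \<in> I)"

text \<open>The left regular module is completely reducible: each of its submodules, i.e. each left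
  ideal, is a direct summand.\<close>

definition semisimple_ring :: "('h, 'a) ring_scheme \<Rightarrow> bool" where
  "semisimple_ring A \<longleftrightarrow>
    (\<forall>I. left_ideal A I \<longrightarrow>
      (\<exists>J. left_ideal A J \<and> I \<inter> J = {\<zero>\<^bsub>A\<^esub>} \<and> I <+>\<^bsub>A\<^esub> J = carrier A))"

definition commutative_alg :: "('h, 'a) ring_scheme \<Rightarrow> bool" where
  "commutative_alg A \<longleftrightarrow> (\<forall>x\<in>carrier A. \<forall>y\<in>carrier A. x \<otimes>\<^bsub>A\<^esub> y = y \<otimes>\<^bsub>A\<^esub> x)"

definition cocommutative :: "('k, 'r) ring_scheme \<Rightarrow> ('k, 'h, 'a) hopf_scheme \<Rightarrow> bool" where
  "cocommutative K H \<longleftrightarrow> (\<forall>h\<in>carrier H. tensor_flip K H H (comult H h) = comult H h)"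

definition nontrivial_hopf :: "('k, 'r) ring_scheme \<Rightarrow> ('k, 'h, 'a) hopf_scheme \<Rightarrow> bool" where
  "nontrivial_hopf K H \<longleftrightarrow> \<not> commutative_alg H \<and> \<not> cocommutative K H"

definition grouplikes :: "('k, 'r) ring_scheme \<Rightarrow> ('k, 'h, 'a) hopf_scheme \<Rightarrow> 'h monoid" where
  "grouplikes K H =
    \<lparr>carrier = {g \<in> carrier H. comult H g = pure_tensor K H H g g \<and> counit H g = \<one>\<^bsub>K\<^esub>},
     mult = mult H, one = \<one>\<^bsub>H\<^esub>\<rparr>"

text \<open>Second cohomology of \<^term>\<open>G\<close> with coefficients in the abelian group
  \<^term>\<open>A\<close> (written multiplicatively), with trivial action, via inhomogeneous cochains.\<close>

definition two_cocycles ::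
  "('g, 'a) monoid_scheme \<Rightarrow> ('c, 'b) monoid_scheme \<Rightarrow> ('g \<times> 'g \<Rightarrow> 'c) monoid" where
  "two_cocycles G A =
    \<lparr>carrier = {f \<in> carrier G \<times> carrier G \<rightarrow>\<^sub>E carrier A.
       \<forall>x\<in>carrier G. \<forall>y\<in>carrier G. \<forall>z\<in>carrier G.
         f (y, z) \<otimes>\<^bsub>A\<^esub> f (x, y \<otimes>\<^bsub>G\<^esub> z) = f (x \<otimes>\<^bsub>G\<^esub> y, z) \<otimes>\<^bsub>A\<^esub> f (x, y)},
     mult = (\<lambda>f g. \<lambda>p\<in>carrier G \<times> carrier G. f p \<otimes>\<^bsub>A\<^esub> g p),
     one = (\<lambda>p\<in>carrier G \<times> carrier G. \<one>\<^bsub>A\<^esub>)\<rparr>"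

definition two_coboundaries ::
  "('g, 'a) monoid_scheme \<Rightarrow> ('c, 'b) monoid_scheme \<Rightarrow> ('g \<times> 'g \<Rightarrow> 'c) set" where
  "two_coboundaries G A =
    {\<lambda>(x, y)\<in>carrier G \<times> carrier G. c y \<otimes>\<^bsub>A\<^esub> inv\<^bsub>A\<^esub> c (x \<otimes>\<^bsub>G\<^esub> y) \<otimes>\<^bsub>A\<^esub> c x | c.
       c \<in> carrier G \<rightarrow> carrier A}"

definition second_cohomology ::
  "('g, 'a) monoid_scheme \<Rightarrow> ('c, 'b) monoid_scheme \<Rightarrow> ('g \<times> 'g \<Rightarrow> 'c) set monoid" where
  "second_cohomology G A = two_cocycles G A Mod two_coboundaries G A"

definition schur_multiplier ::
  "('k, 'r) ring_scheme \<Rightarrow> ('g, 'a) monoid_scheme \<Rightarrow> ('g \<times> 'g \<Rightarrow> 'k) set monoid" where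
  "schur_multiplier K G = second_cohomology G (units_of K)"

definition conjugacy_class :: "('g, 'a) monoid_scheme \<Rightarrow> 'g \<Rightarrow> 'g set" where
  "conjugacy_class G =
    orbit G (\<lambda>g. \<lambda>h\<in>carrier G. g \<otimes>\<^bsub>G\<^esub> h \<otimes>\<^bsub>G\<^esub> inv\<^bsub>G\<^esub> g)"

definition involution_classes :: "('g, 'a) monoid_scheme \<Rightarrow> 'g set set" where
  "involution_classes G = conjugacy_class G ` {x \<in> carrier G. group.ord G x = 2}"

definition char_zero :: "('k, 'r) ring_scheme \<Rightarrow> bool" where
  "char_zero K \<longleftrightarrow> (\<forall>n::nat. 0 < n \<longrightarrow> [n] \<cdot>\<^bsub>K\<^esub> \<one>\<^bsub>K\<^esub> \<noteq> \<zero>\<^bsub>K\<^esub>)"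

end

theory Submission
  imports Defs
begin

text \<open>
  Let \<open>n = |G|\<close>. The group-like elements span a copy of \<open>K G\<close> in \<open>H\<close>, of half the dimension, and a
  nondegenerate bicharacter of \<open>G\<close> provides idempotents \<open>e\<^sub>a\<close> with \<open>\<Delta> e\<^sub>a = \<Sum>\<^bsub>bc = a\<^esub> e\<^sub>b \<otimes> e\<^sub>c\<close>.
  Each \<open>H e\<^sub>a\<close> turns out to be a plane, and on \<open>H e\<^sub>1\<close> the algebra acts through the counit (on the line
  of the integral that semisimplicity provides) and through a second character \<open>\<psi>\<close> with
  \<open>\<psi> * \<psi> = \<epsilon>\<close>. Convolution with \<open>\<psi>\<close> is an involutive algebra automorphism that fixes \<open>K G\<close>, and its
  eigenspace for \<open>-1\<close> has a basis \<open>y\<^sub>a\<close> with \<open>y\<^sub>a \<in> e\<^sub>a H\<close>. This presents \<open>H\<close> by an automorphism \<open>\<tau>\<close> of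
  \<open>G\<close> with \<open>\<tau>\<^sup>2 = 1\<close>, where \<open>y\<^sub>a e\<^bsub>\<tau> a\<^esub> = y\<^sub>a\<close>, by a 2-cocycle \<open>f\<close>, where
  \<open>\<Delta> y\<^sub>a = \<Sum>\<^bsub>bc = a\<^esub> f(b, c) y\<^sub>b \<otimes> y\<^sub>c\<close>, and by scalars \<open>s\<^sub>a\<close>, where \<open>y\<^sub>a y\<^bsub>\<tau> a\<^esub> = s\<^sub>a e\<^sub>a\<close>.

  Relabelling by automorphisms of \<open>G\<close> conjugates \<open>\<tau>\<close>, and rescaling the \<open>y\<^sub>a\<close> changes \<open>f\<close> by a
  coboundary. If \<open>H\<close> is nontrivial then \<open>\<tau> \<noteq> 1\<close>, by noncommutativity, and \<open>f\<close> is not a coboundary, by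
  noncocommutativity. Given \<open>\<tau>\<close> and \<open>f\<close>, two choices of \<open>s\<close> differ by a \<open>\<tau>\<close>-invariant character of
  \<open>G\<close>, and there are at most \<open>n/2\<close> of these. Hence there are at most
  \<open>N (|M| - 1) n/2 \<le> N (n |M|/2 - 1)\<close> classes.
\<close>

text \<open>The plane claim is a dimension count: no \<open>H e\<^sub>a\<close> is a line, and
  \<open>n\<close> independent summands of dimension at least two exhaust dimension
  \<open>2 n\<close>. The identity \<open>\<psi> * \<psi> = \<epsilon>\<close> holds because
  \<open>\<psi> * \<psi>\<close> is a character with value one at \<open>e\<^sub>1\<close>, hence
  one of the two characters of the plane; were it \<open>\<psi>\<close> itself, cancelling with the
  antipode would give \<open>\<psi> = \<epsilon>\<close>. The obstacle is that left and right
  convolution with \<open>\<psi>\<close> are at first different maps: under comultiplication the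
  left one acts on the first tensor factor, the right one on the second. Only when both are shown to
  negate every \<open>y\<^sub>a\<close>, so that \<open>\<psi>\<close> is central in the dual, can
  \<open>\<Delta> y\<^sub>a\<close> be confined to tensors of two eigenvectors. Tensors are cosets
  of functions on pairs, so identities are not computed there but stated for all bilinear maps
  through \<open>sweedler\<close>. The order being a power of two serves the bicharacter: square
  roots in the field suffice to extend characters. The factor \<open>n/2\<close> counts characters
  trivial on one element other than the unit.\<close>

abbreviation (input) mult_in ("_ \<otimes>\<^sub>_ _" [70, 1000, 71] 70) where "x \<otimes>\<^sub>R y \<equiv> x \<otimes>\<^bsub>R\<^esub> y"
abbreviation (input) add_in ("_ \<oplus>\<^sub>_ _" [65, 1000, 66] 65) where "x \<oplus>\<^sub>R y \<equiv> x \<oplus>\<^bsub>R\<^esub> y"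
abbreviation (input) smult_in ("_ \<odot>\<^sub>_ _" [71, 1000, 70] 70) where "a \<odot>\<^sub>M x \<equiv> a \<odot>\<^bsub>M\<^esub> x"
abbreviation (input) minus_in ("_ \<ominus>\<^sub>_ _" [65, 1000, 66] 65) where "x \<ominus>\<^sub>R y \<equiv> x \<ominus>\<^bsub>R\<^esub> y"
abbreviation (input) uminus_in ("\<ominus>\<^sub>_ _" [1000, 81] 80) where "\<ominus>\<^sub>R x \<equiv> \<ominus>\<^bsub>R\<^esub> x"
abbreviation (input) one_in ("\<one>\<^sub>_" [1000] 1000) where "\<one>\<^sub>R \<equiv> \<one>\<^bsub>R\<^esub>"
abbreviation (input) zero_in ("\<zero>\<^sub>_" [1000] 1000) where "\<zero>\<^sub>R \<equiv> \<zero>\<^bsub>R\<^esub>"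

section \<open>Linear and bilinear maps\<close>

lemma module_homI:
  assumes "\<And>x. x \<in> carrier V \<Longrightarrow> f x \<in> carrier U"
    and "\<And>x y. \<lbrakk>x \<in> carrier V; y \<in> carrier V\<rbrakk> \<Longrightarrow> f (x \<oplus>\<^sub>V y) = f x \<oplus>\<^sub>U f y"
    and "\<And>a x. \<lbrakk>a \<in> carrier K; x \<in> carrier V\<rbrakk> \<Longrightarrow> f (a \<odot>\<^sub>V x) = a \<odot>\<^sub>U f x"
  shows "f \<in> module_hom K V U"
  using assms unfolding module_hom_def by auto

lemma module_hom_in: "\<lbrakk>f \<in> module_hom K V U; x \<in> carrier V\<rbrakk> \<Longrightarrow> f x \<in> carrier U"
  using module_hom_closed by blast

lemma module_hom_zero:
  assumes "module K V" "module K U" "f \<in> module_hom K V U"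
  shows "f \<zero>\<^sub>V = \<zero>\<^sub>U"
proof -
  interpret mod_hom K V U f
    using assms by (simp add: mod_hom_def mod_hom_axioms_def)
  show ?thesis by simp
qed

lemma module_hom_minus:
  assumes "module K V" "module K U" "f \<in> module_hom K V U" "x \<in> carrier V" "y \<in> carrier V"
  shows "f (x \<ominus>\<^sub>V y) = f x \<ominus>\<^sub>U f y"
proof -
  interpret mod_hom K V U f
    using assms by (simp add: mod_hom_def mod_hom_axioms_def)
  show ?thesis using assms by simp
qed

lemma module_hom_finsum:
  assumes V: "module K V" and U: "module K U" and f: "f \<in> module_hom K V U" and "finite A"
    and "g \<in> A \<rightarrow> carrier V"
  shows "f (\<Oplus>\<^bsub>V\<^esub>x\<in>A. g x) = (\<Oplus>\<^bsub>U\<^esub>x\<in>A. f (g x))"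
proof -
  interpret V: module K V by (rule V)
  interpret U: module K U by (rule U)
  show ?thesis using \<open>finite A\<close> \<open>g \<in> A \<rightarrow> carrier V\<close>
  proof (induction A)
    case empty
    then show ?case by (simp add: module_hom_zero[OF V U f])
  next
    case (insert x A)
    then show ?case
      by (simp add: Pi_def module_hom_in[OF f] module_hom_add[OF f])
  qed
qed

text \<open>Nothing is asked outside the carriers, so two bilinear maps are compared on the carriers
  only; \<open>tensor_lift_cong\<close> transfers such an agreement to the induced maps.\<close>

definition bilinear_maps where
  "bilinear_maps K V W U = {\<beta>. (\<forall>v\<in>carrier V. \<beta> v \<in> module_hom K W U) \<and>
     (\<forall>w\<in>carrier W. (\<lambda>v. \<beta> v w) \<in> module_hom K V U)}"

lemma bilinear_mapsI:
  assumes "\<And>v. v \<in> carrier V \<Longrightarrow> \<beta> v \<in> module_hom K W U"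
    and "\<And>w. w \<in> carrier W \<Longrightarrow> (\<lambda>v. \<beta> v w) \<in> module_hom K V U"
  shows "\<beta> \<in> bilinear_maps K V W U"
  using assms unfolding bilinear_maps_def by auto

lemma bilinear_mapsD:
  assumes "\<beta> \<in> bilinear_maps K V W U"
  shows "v \<in> carrier V \<Longrightarrow> \<beta> v \<in> module_hom K W U"
    and "w \<in> carrier W \<Longrightarrow> (\<lambda>v. \<beta> v w) \<in> module_hom K V U"
    and "\<lbrakk>v \<in> carrier V; w \<in> carrier W\<rbrakk> \<Longrightarrow> \<beta> v w \<in> carrier U"
  using assms unfolding bilinear_maps_def by (auto dest: module_hom_in)

section \<open>Free modules and quotients\<close>

lemma free_module_module:
  fixes K :: "('k, 'r) ring_scheme" (structure) and B :: "'x set"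
  assumes "cring K"
  shows "module K (free_module K B)"
proof -
  interpret cring K by fact
  have fin: "finite {x. f x \<oplus> g x \<noteq> \<zero>}"
    if "finite {x. f x \<noteq> \<zero>}" "finite {x. g x \<noteq> \<zero>}" for f g :: "'x \<Rightarrow> 'k"
    by (rule finite_subset[of _ "{x. f x \<noteq> \<zero>} \<union> {x. g x \<noteq> \<zero>}"]) (use that in auto)
  have fin': "finite {x. a \<otimes> f x \<noteq> \<zero>}"
    if "finite {x. f x \<noteq> \<zero>}" "a \<in> carrier K" for f :: "'x \<Rightarrow> 'k" and a
    by (rule finite_subset[of _ "{x. f x \<noteq> \<zero>}"]) (use that in auto)
  have car: "f x \<in> carrier K" if "f \<in> carrier (free_module K B)" for f x
    using that by (cases "x \<in> B") (auto simp: free_module_def)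
  show ?thesis
  proof (rule moduleI)
    show "abelian_group (free_module K B)"
    proof (rule abelian_groupI)
      fix f assume f: "f \<in> carrier (free_module K B)"
      have "{x. \<ominus> f x \<noteq> \<zero>} = {x. f x \<noteq> \<zero>}"
        using car[OF f] by auto
      then have "(\<lambda>x. \<ominus> f x) \<in> carrier (free_module K B)"
        using f by (auto simp: free_module_def)
      moreover have "(\<lambda>x. \<ominus> f x) \<oplus>\<^bsub>free_module K B\<^esub> f = \<zero>\<^bsub>free_module K B\<^esub>"
        using car[OF f] by (auto simp: free_module_def l_neg)
      ultimately show "\<exists>g\<in>carrier (free_module K B). g \<oplus>\<^bsub>free_module K B\<^esub> f = \<zero>\<^bsub>free_module K B\<^esub>"
        by blast
    next
      fix f g h
      assume "f \<in> carrier (free_module K B)" "g \<in> carrier (free_module K B)"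
        "h \<in> carrier (free_module K B)"
      note this[THEN car]
      then show "f \<oplus>\<^bsub>free_module K B\<^esub> g \<oplus>\<^bsub>free_module K B\<^esub> h =
         f \<oplus>\<^bsub>free_module K B\<^esub> (g \<oplus>\<^bsub>free_module K B\<^esub> h)"
        by (auto simp: free_module_def a_assoc)
    next
      fix f g
      assume "f \<in> carrier (free_module K B)" "g \<in> carrier (free_module K B)"
      note this[THEN car]
      then show "f \<oplus>\<^bsub>free_module K B\<^esub> g = g \<oplus>\<^bsub>free_module K B\<^esub> f"
        by (auto simp: free_module_def a_comm)
    next
      fix f g
      assume "f \<in> carrier (free_module K B)" "g \<in> carrier (free_module K B)"
      then show "f \<oplus>\<^bsub>free_module K B\<^esub> g \<in> carrier (free_module K B)"
        using fin[of f g] by (auto simp: free_module_def)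
    next
      fix f
      assume "f \<in> carrier (free_module K B)"
      note this[THEN car]
      then show "\<zero>\<^bsub>free_module K B\<^esub> \<oplus>\<^bsub>free_module K B\<^esub> f = f"
        by (auto simp: free_module_def)
    qed (auto simp: free_module_def)
  next
    show "\<And>a x. \<lbrakk>a \<in> carrier K; x \<in> carrier (free_module K B)\<rbrakk>
      \<Longrightarrow> a \<odot>\<^bsub>free_module K B\<^esub> x \<in> carrier (free_module K B)"
      using fin' by (auto simp: free_module_def)
  next
    fix a b f g
    assume "a \<in> carrier K" "b \<in> carrier K"
      and f: "f \<in> carrier (free_module K B)"
    note this(1,2) f[THEN car]
    then show "(a \<oplus> b) \<odot>\<^bsub>free_module K B\<^esub> f =
        a \<odot>\<^bsub>free_module K B\<^esub> f \<oplus>\<^bsub>free_module K B\<^esub> b \<odot>\<^bsub>free_module K B\<^esub> f"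
     "a \<otimes> b \<odot>\<^bsub>free_module K B\<^esub> f = a \<odot>\<^bsub>free_module K B\<^esub> (b \<odot>\<^bsub>free_module K B\<^esub> f)"
      by (auto simp: free_module_def l_distr m_assoc)
    assume g: "g \<in> carrier (free_module K B)"
    show "a \<odot>\<^bsub>free_module K B\<^esub> (f \<oplus>\<^bsub>free_module K B\<^esub> g) =
        a \<odot>\<^bsub>free_module K B\<^esub> f \<oplus>\<^bsub>free_module K B\<^esub> a \<odot>\<^bsub>free_module K B\<^esub> g"
      using \<open>a \<in> carrier K\<close> f[THEN car] g[THEN car] by (auto simp: free_module_def r_distr)
  next
    fix f assume "f \<in> carrier (free_module K B)"
    from car[OF this] show "\<one> \<odot>\<^bsub>free_module K B\<^esub> f = f"
      by (auto simp: free_module_def)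
  qed (fact assms)
qed

lemma free_module_simps:
  "f \<oplus>\<^bsub>free_module K B\<^esub> g = (\<lambda>x. f x \<oplus>\<^sub>K g x)"
  "\<zero>\<^bsub>free_module K B\<^esub> = (\<lambda>x. \<zero>\<^sub>K)"
  "a \<odot>\<^bsub>free_module K B\<^esub> f = (\<lambda>x. a \<otimes>\<^sub>K f x)"
  by (simp_all add: free_module_def)

lemma free_module_carrierD:
  assumes "f \<in> carrier (free_module K B)"
  shows "x \<in> B \<Longrightarrow> f x \<in> carrier K" "x \<notin> B \<Longrightarrow> f x = \<zero>\<^sub>K" "finite {x. f x \<noteq> \<zero>\<^sub>K}"
    "{x. f x \<noteq> \<zero>\<^sub>K} \<subseteq> B"
  using assms by (auto simp: free_module_def)

lemma basis_vec_in:
  assumes "cring K" "x \<in> B"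
  shows "basis_vec K x \<in> carrier (free_module K B)"
proof -
  interpret cring K by fact
  have "{y. basis_vec K x y \<noteq> \<zero>\<^sub>K} \<subseteq> {x}"
    by (auto simp: basis_vec_def)
  then show ?thesis
    using assms(2) finite_subset by (fastforce simp: free_module_def basis_vec_def)
qed

lemma free_module_induct [consumes 2, case_names zero step]:
  assumes "cring K" and "f \<in> carrier (free_module K B)"
    and "P (\<lambda>x. \<zero>\<^sub>K)"
    and step: "\<And>f a x. \<lbrakk>f \<in> carrier (free_module K B); a \<in> carrier K; x \<in> B; P f\<rbrakk> \<Longrightarrow>
      P (f \<oplus>\<^bsub>free_module K B\<^esub> a \<odot>\<^bsub>free_module K B\<^esub> basis_vec K x)"
  shows "P f"
proof -
  interpret cring K by fact
  have "P f" if "finite A" "f \<in> carrier (free_module K B)" "{x. f x \<noteq> \<zero>\<^sub>K} = A" for A f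
    using that
  proof (induction A arbitrary: f)
    case empty
    then have "f = (\<lambda>x. \<zero>\<^sub>K)" by auto
    then show ?case using assms by simp
  next
    case (insert x A)
    define g where "g = f(x := \<zero>\<^sub>K)"
    have supp: "{y. g y \<noteq> \<zero>\<^sub>K} = A"
      using insert unfolding g_def by auto
    have g: "g \<in> carrier (free_module K B)"
      using insert supp unfolding g_def free_module_def by auto
    have x: "x \<in> B" using insert by (auto dest: free_module_carrierD)
    then have fx: "f x \<in> carrier K" using insert by (auto dest: free_module_carrierD)
    have "\<And>y. f y \<in> carrier K"
      using insert(4) by (metis free_module_carrierD(1,2) zero_closed)
    then have "f = g \<oplus>\<^bsub>free_module K B\<^esub> f x \<odot>\<^bsub>free_module K B\<^esub> basis_vec K x"
      using fx by (auto simp: g_def free_module_simps basis_vec_def)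
    then show ?case
      using step[OF g fx x insert.IH[OF g supp]] by simp
  qed
  then show ?thesis using assms(2) free_module_carrierD(3) by blast
qed

text \<open>This is the sum that \<open>tensor_lift\<close> evaluates on each representative of a
  coset, with the bilinear map uncurried to \<open>g\<close>.\<close>

definition free_lift where
  "free_lift K U g f = (\<Oplus>\<^bsub>U\<^esub>x\<in>{x. f x \<noteq> \<zero>\<^sub>K}. f x \<odot>\<^sub>U g x)"

text \<open>The support changes when functions are added or scaled. Padding with zero terms lets
  several values be compared over one common finite index set.\<close>

lemma free_lift_superset:
  assumes "module K U" "f \<in> carrier (free_module K B)" "g \<in> B \<rightarrow> carrier U"
    and "finite A" "{x. f x \<noteq> \<zero>\<^sub>K} \<subseteq> A" "A \<subseteq> B"
  shows "free_lift K U g f = (\<Oplus>\<^bsub>U\<^esub>x\<in>A. f x \<odot>\<^sub>U g x)"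
proof -
  interpret module K U by fact
  have "f x \<odot>\<^sub>U g x \<in> carrier U" if "x \<in> A" for x
    using that assms(3,6) free_module_carrierD(1)[OF assms(2), of x] by (intro smult_closed) auto
  then show ?thesis
    unfolding free_lift_def
    using assms(3-6)
    by (intro M.add.finprod_mono_neutral_cong_left) (auto simp: subset_eq Pi_iff)
qed

lemma free_lift_hom:
  assumes U: "module K U" and g: "g \<in> B \<rightarrow> carrier U"
  shows "free_lift K U g \<in> module_hom K (free_module K B) U"
proof -
  interpret module K U by fact
  interpret F: module K "free_module K B"
    by (rule free_module_module) unfold_locales
  have gc: "g x \<in> carrier U" if "x \<in> B" for x using g that by auto
  show ?thesis
  proof (rule module_homI)
    fix f assume f: "f \<in> carrier (free_module K B)"
    note fD = free_module_carrierD[OF f]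
    have fg: "f x \<odot>\<^sub>U g x \<in> carrier U" if "x \<in> B" for x
      using fD(1) that gc by auto
    show "free_lift K U g f \<in> carrier U"
      unfolding free_lift_def using subsetD[OF fD(4)] fg by (intro M.finsum_closed) auto
    {
      fix a assume a: "a \<in> carrier K"
      have "a \<odot>\<^bsub>free_module K B\<^esub> f \<in> carrier (free_module K B)" using a f by simp
      then have "free_lift K U g (a \<odot>\<^bsub>free_module K B\<^esub> f) =
          (\<Oplus>\<^bsub>U\<^esub>x\<in>{x. f x \<noteq> \<zero>\<^sub>K}. (a \<otimes>\<^sub>K f x) \<odot>\<^sub>U g x)"
        by (subst free_lift_superset[OF U _ g fD(3) _ fD(4)]) (use a in \<open>auto simp: free_module_simps\<close>)
      also have "... = (\<Oplus>\<^bsub>U\<^esub>x\<in>{x. f x \<noteq> \<zero>\<^sub>K}. a \<odot>\<^sub>U (f x \<odot>\<^sub>U g x))"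
        using fD(1) gc a subsetD[OF fD(4)] by (intro M.finsum_cong') (auto intro!: smult_assoc1)
      also have "... = a \<odot>\<^sub>U free_lift K U g f"
        unfolding free_lift_def using fD(3) fg a subsetD[OF fD(4)] by (subst finsum_smult_ldistr) auto
      finally show "free_lift K U g (a \<odot>\<^bsub>free_module K B\<^esub> f) = a \<odot>\<^sub>U free_lift K U g f" .
    }
    {
      fix f' assume f': "f' \<in> carrier (free_module K B)"
      note f'D = free_module_carrierD[OF f']
      have fg': "f' x \<odot>\<^sub>U g x \<in> carrier U" if "x \<in> B" for x
          using f'D(1) that gc by auto
      define A where "A = {x. f x \<noteq> \<zero>\<^sub>K} \<union> {x. f' x \<noteq> \<zero>\<^sub>K}"
      have A: "finite A" "A \<subseteq> B" using fD f'D unfolding A_def by auto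
      have "free_lift K U g (f \<oplus>\<^bsub>free_module K B\<^esub> f') = (\<Oplus>\<^bsub>U\<^esub>x\<in>A. (f x \<oplus>\<^sub>K f' x) \<odot>\<^sub>U g x)"
        by (subst free_lift_superset[OF U F.M.a_closed[OF f f'] g A(1) _ A(2)])
          (auto simp: free_module_simps A_def)
      also have "... = (\<Oplus>\<^bsub>U\<^esub>x\<in>A. f x \<odot>\<^sub>U g x \<oplus>\<^sub>U f' x \<odot>\<^sub>U g x)"
        using fD(1) f'D(1) gc subsetD[OF A(2)] by (intro M.finsum_cong') (auto intro!: smult_l_distr)
      also have "... = (\<Oplus>\<^bsub>U\<^esub>x\<in>A. f x \<odot>\<^sub>U g x) \<oplus>\<^sub>U (\<Oplus>\<^bsub>U\<^esub>x\<in>A. f' x \<odot>\<^sub>U g x)"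
        using fg fg' subsetD[OF A(2)] by (intro M.finsum_addf) auto
      also have "... = free_lift K U g f \<oplus>\<^sub>U free_lift K U g f'"
        using free_lift_superset[OF U f g A(1) _ A(2)] free_lift_superset[OF U f' g A(1) _ A(2)]
        by (auto simp: A_def)
      finally show "free_lift K U g (f \<oplus>\<^bsub>free_module K B\<^esub> f') =
        free_lift K U g f \<oplus>\<^sub>U free_lift K U g f'" .
    }
  qed
qed

lemma free_lift_basis_vec:
  assumes U: "module K U" and g: "g \<in> B \<rightarrow> carrier U" and x: "x \<in> B"
  shows "free_lift K U g (basis_vec K x) = g x"
proof -
  interpret module K U by fact
  have gx: "g x \<in> carrier U" using g x by auto
  have "free_lift K U g (basis_vec K x) = (\<Oplus>\<^bsub>U\<^esub>y\<in>{x}. basis_vec K x y \<odot>\<^sub>U g y)"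
    by (rule free_lift_superset[OF U basis_vec_in[OF _ x] g])
      (use x in \<open>auto simp: basis_vec_def R.is_cring\<close>)
  also have "... = g x"
    using gx by (simp add: basis_vec_def)
  finally show ?thesis .
qed

lemma free_module_hom_eq:
  assumes K: "cring K" and U: "module K U"
    and L: "L \<in> module_hom K (free_module K B) U" and L': "L' \<in> module_hom K (free_module K B) U"
    and eq: "\<And>x. x \<in> B \<Longrightarrow> L (basis_vec K x) = L' (basis_vec K x)"
    and f: "f \<in> carrier (free_module K B)"
  shows "L f = L' f"
proof (rule free_module_induct[OF K f, where P = "\<lambda>f. L f = L' f"])
  note F = free_module_module[OF K, of B]
  show "L (\<lambda>x. \<zero>\<^sub>K) = L' (\<lambda>x. \<zero>\<^sub>K)"
    using module_hom_zero[OF F U L] module_hom_zero[OF F U L'] by (simp only: free_module_simps)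
  fix f a x assume f: "f \<in> carrier (free_module K B)" and a: "a \<in> carrier K" and x: "x \<in> B"
    and "L f = L' f"
  have ab: "a \<odot>\<^bsub>free_module K B\<^esub> basis_vec K x \<in> carrier (free_module K B)"
    using a basis_vec_in[OF K x] by (rule module.smult_closed[OF F])
  show "L (f \<oplus>\<^bsub>free_module K B\<^esub> a \<odot>\<^bsub>free_module K B\<^esub> basis_vec K x) =
      L' (f \<oplus>\<^bsub>free_module K B\<^esub> a \<odot>\<^bsub>free_module K B\<^esub> basis_vec K x)"
    by (simp only: module_hom_add[OF L f ab] module_hom_add[OF L' f ab] \<open>L f = L' f\<close> eq[OF x]
        module_hom_smult[OF L a basis_vec_in[OF K x]] module_hom_smult[OF L' a basis_vec_in[OF K x]])
qed

lemma quotient_module: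
  assumes M: "module K M" and N: "Module.submodule N K M"
  shows "module K (quotient_module M N)"
    and "(\<lambda>x. N +>\<^bsub>M\<^esub> x) \<in> module_hom K M (quotient_module M N)"
    and "t \<in> carrier (quotient_module M N) \<longleftrightarrow> (\<exists>x\<in>carrier M. t = N +>\<^bsub>M\<^esub> x)"
proof -
  interpret M: module K M by fact
  interpret N: Module.submodule N K M by fact
  interpret N: abelian_subgroup N M
    using N.subgroup_axioms M.abelian_group_axioms
    by (intro abelian_subgroupI3) (auto simp: additive_subgroup_def)
  let ?Q = "quotient_module M N"
  have Qc: "t \<in> carrier ?Q \<longleftrightarrow> (\<exists>x\<in>carrier M. t = N +>\<^bsub>M\<^esub> x)" for t
    unfolding quotient_module_def partial_object.simps A_RCOSETS_def' by blast
  then show "t \<in> carrier ?Q \<longleftrightarrow> (\<exists>x\<in>carrier M. t = N +>\<^bsub>M\<^esub> x)" .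
  have Qadd: "(N +>\<^bsub>M\<^esub> x) \<oplus>\<^bsub>?Q\<^esub> (N +>\<^bsub>M\<^esub> y) = N +>\<^bsub>M\<^esub> (x \<oplus>\<^sub>M y)"
    if "x \<in> carrier M" "y \<in> carrier M" for x y
    using that N.a_rcos_sum by (simp add: quotient_module_def)
  \<comment> \<open>\<open>quotient_module\<close> scales a coset by a union over all its elements;
    independence of the representative is what makes this union a single coset.\<close>
  have Qsm: "a \<odot>\<^bsub>?Q\<^esub> (N +>\<^bsub>M\<^esub> x) = N +>\<^bsub>M\<^esub> (a \<odot>\<^sub>M x)"
    if a: "a \<in> carrier K" and x: "x \<in> carrier M" for a x
  proof -
    have "N +>\<^bsub>M\<^esub> (a \<odot>\<^sub>M y) = N +>\<^bsub>M\<^esub> (a \<odot>\<^sub>M x)" if y: "y \<in> N +>\<^bsub>M\<^esub> x" for y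
    proof -
      obtain h where h: "h \<in> N" "y = h \<oplus>\<^sub>M x" using y by (auto simp: a_r_coset_def')
      then have hM: "h \<in> carrier M" using N.a_subset by auto
      have "a \<odot>\<^sub>M y = a \<odot>\<^sub>M h \<oplus>\<^sub>M a \<odot>\<^sub>M x" using h hM a x by (simp add: M.smult_r_distr)
      then have "a \<odot>\<^sub>M y \<in> N +>\<^bsub>M\<^esub> (a \<odot>\<^sub>M x)"
        using N.smult_closed[OF a h(1)] by (auto simp: a_r_coset_def')
      then show ?thesis
        using N.a_repr_independence'[of "a \<odot>\<^sub>M y" "a \<odot>\<^sub>M x"] a x by simp
    qed
    moreover have "x \<in> N +>\<^bsub>M\<^esub> x" using x N.a_rcos_self by simp
    ultimately have "(\<Union>y\<in>N +>\<^bsub>M\<^esub> x. N +>\<^bsub>M\<^esub> (a \<odot>\<^sub>M y)) = N +>\<^bsub>M\<^esub> (a \<odot>\<^sub>M x)" by blast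
    then show ?thesis by (simp only: quotient_module_def module.simps)
  qed
  have Qz: "\<zero>\<^bsub>?Q\<^esub> = N +>\<^bsub>M\<^esub> \<zero>\<^sub>M"
    unfolding M.M.a_coset_add_zero[OF N.a_subset] by (simp only: quotient_module_def ring.simps)
  have "abelian_group ?Q"
  proof (rule abelian_groupI)
    fix s assume "s \<in> carrier ?Q"
    then obtain x where x: "x \<in> carrier M" "s = N +>\<^bsub>M\<^esub> x" unfolding Qc by blast
    have "(N +>\<^bsub>M\<^esub> (\<ominus>\<^bsub>M\<^esub> x)) \<oplus>\<^bsub>?Q\<^esub> s = \<zero>\<^bsub>?Q\<^esub>"
      unfolding x(2) Qz Qadd[OF M.M.a_inv_closed[OF x(1)] x(1)] M.M.l_neg[OF x(1)] ..
    then show "\<exists>t\<in>carrier ?Q. t \<oplus>\<^bsub>?Q\<^esub> s = \<zero>\<^bsub>?Q\<^esub>"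
    proof (rule bexI)
      show "N +>\<^bsub>M\<^esub> (\<ominus>\<^bsub>M\<^esub> x) \<in> carrier ?Q"
        unfolding Qc using M.a_inv_closed[OF x(1)] by (rule bexI[rotated]) (rule refl)
    qed
  next
    fix s t assume "s \<in> carrier ?Q" "t \<in> carrier ?Q"
    then obtain x y where x: "x \<in> carrier M" "s = N +>\<^bsub>M\<^esub> x" and y: "y \<in> carrier M" "t = N +>\<^bsub>M\<^esub> y"
      unfolding Qc by blast
    show "s \<oplus>\<^bsub>?Q\<^esub> t = t \<oplus>\<^bsub>?Q\<^esub> s"
      unfolding x(2) y(2) by (simp only: Qadd[OF x(1) y(1)] Qadd[OF y(1) x(1)] M.M.a_comm[OF x(1) y(1)])
    show "s \<oplus>\<^bsub>?Q\<^esub> t \<in> carrier ?Q"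
      unfolding x(2) y(2) Qc Qadd[OF x(1) y(1)] using M.M.a_closed[OF x(1) y(1)] by blast
    show "\<zero>\<^bsub>?Q\<^esub> \<oplus>\<^bsub>?Q\<^esub> s = s"
      unfolding x(2) Qz Qadd[OF M.M.zero_closed x(1)] M.M.l_zero[OF x(1)] ..
    fix u assume "u \<in> carrier ?Q"
    then obtain z where z: "z \<in> carrier M" "u = N +>\<^bsub>M\<^esub> z" unfolding Qc by blast
    show "s \<oplus>\<^bsub>?Q\<^esub> t \<oplus>\<^bsub>?Q\<^esub> u = s \<oplus>\<^bsub>?Q\<^esub> (t \<oplus>\<^bsub>?Q\<^esub> u)"
      unfolding x(2) y(2) z(2)
      by (simp only: Qadd x(1) y(1) z(1) M.M.a_closed M.M.a_assoc)
  next
    show "\<zero>\<^bsub>?Q\<^esub> \<in> carrier ?Q"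
      unfolding Qc Qz by blast
  qed
  then show "module K ?Q"
  proof (rule moduleI[rotated])
    fix a b s t assume ab: "a \<in> carrier K" "b \<in> carrier K" and "s \<in> carrier ?Q" "t \<in> carrier ?Q"
    then obtain x y where x: "x \<in> carrier M" "s = N +>\<^bsub>M\<^esub> x" and y: "y \<in> carrier M" "t = N +>\<^bsub>M\<^esub> y"
      unfolding Qc by blast
    note cl = ab x(1) y(1) M.smult_closed M.M.a_closed M.R.a_closed M.R.m_closed
    show "a \<odot>\<^bsub>?Q\<^esub> (s \<oplus>\<^bsub>?Q\<^esub> t) = a \<odot>\<^bsub>?Q\<^esub> s \<oplus>\<^bsub>?Q\<^esub> a \<odot>\<^bsub>?Q\<^esub> t"
      unfolding x(2) y(2) by (simp only: Qadd Qsm cl M.smult_r_distr)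
  next
    fix a b s assume ab: "a \<in> carrier K" "b \<in> carrier K" and "s \<in> carrier ?Q"
    then obtain x where x: "x \<in> carrier M" "s = N +>\<^bsub>M\<^esub> x"
      unfolding Qc by blast
    note cl = ab x(1) M.smult_closed M.M.a_closed M.R.a_closed M.R.m_closed
    show "(a \<oplus>\<^sub>K b) \<odot>\<^bsub>?Q\<^esub> s = a \<odot>\<^bsub>?Q\<^esub> s \<oplus>\<^bsub>?Q\<^esub> b \<odot>\<^bsub>?Q\<^esub> s"
      unfolding x(2) by (simp only: Qadd Qsm cl M.smult_l_distr)
    show "a \<otimes>\<^sub>K b \<odot>\<^bsub>?Q\<^esub> s = a \<odot>\<^bsub>?Q\<^esub> (b \<odot>\<^bsub>?Q\<^esub> s)"
      unfolding x(2) by (simp only: Qsm cl M.smult_assoc1)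
    show "a \<odot>\<^bsub>?Q\<^esub> s \<in> carrier ?Q"
      unfolding x(2) Qc Qsm[OF ab(1) x(1)] using cl by blast
  next
    fix s assume "s \<in> carrier ?Q"
    then obtain x where x: "x \<in> carrier M" "s = N +>\<^bsub>M\<^esub> x"
      unfolding Qc by blast
    show "\<one>\<^sub>K \<odot>\<^bsub>?Q\<^esub> s = s"
      unfolding x(2) by (simp only: Qsm x(1) M.R.one_closed M.smult_one)
  qed (rule M.R.is_cring)
  show "(\<lambda>x. N +>\<^bsub>M\<^esub> x) \<in> module_hom K M ?Q"
  proof (rule module_homI)
    fix x assume "x \<in> carrier M"
    then show "N +>\<^bsub>M\<^esub> x \<in> carrier ?Q" unfolding Qc by blast
  qed (simp_all only: Qadd Qsm)
qed

section \<open>The universal property of the tensor product\<close>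

lemma tensor_relations:
  assumes V: "module K V" and W: "module K W"
  shows "Module.submodule (tensor_relations K V W) K (free_module K (carrier V \<times> carrier W))"
    and "bilinear_relations K V W \<subseteq> tensor_relations K V W"
    and "bilinear_relations K V W \<subseteq> carrier (free_module K (carrier V \<times> carrier W))"
proof -
  interpret V: module K V by fact
  interpret W: module K W by fact
  define F where "F = free_module K (carrier V \<times> carrier W)"
  interpret F: module K F unfolding F_def by (rule free_module_module) unfold_locales
  have b: "basis_vec K (v, w) \<in> carrier F" if "v \<in> carrier V" "w \<in> carrier W" for v w
    unfolding F_def using that V.R.is_cring by (intro basis_vec_in) auto
  show sub: "bilinear_relations K V W \<subseteq> carrier (free_module K (carrier V \<times> carrier W))"
    unfolding bilinear_relations_def F_def[symmetric] Let_def using b by auto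
  then show "bilinear_relations K V W \<subseteq> tensor_relations K V W"
    unfolding tensor_relations_def F_def[symmetric] by (rule F.in_own_span)
  show "Module.submodule (tensor_relations K V W) K (free_module K (carrier V \<times> carrier W))"
  proof -
    \<comment> \<open>This notion of submodule has no axiom for negatives; scaling by minus one
      supplies the additive inverses that \<open>Module.submodule\<close> requires.\<close>
    have "LinearCombinations.submodule K (F.span (bilinear_relations K V W)) F"
      using sub unfolding F_def[symmetric] by (rule F.span_is_submodule)
    then interpret S: LinearCombinations.submodule K "F.span (bilinear_relations K V W)" F .
    show ?thesis
      unfolding tensor_relations_def F_def[symmetric]
    proof (rule F.submoduleI)
      fix a assume a: "a \<in> F.span (bilinear_relations K V W)"
      then have "a \<in> carrier F" using S.subset by auto
      then have "\<ominus>\<^sub>F a = (\<ominus>\<^bsub>K\<^esub> \<one>\<^sub>K) \<odot>\<^sub>F a" by (simp add: F.smult_minus_1)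
      then show "\<ominus>\<^sub>F a \<in> F.span (bilinear_relations K V W)" using a by (simp add: S.smult_closed)
    qed (use S.subset S.smult_closed S.m_closed S.zero_closed in auto)
  qed
qed

lemma tensor_module:
  assumes V: "module K V" and W: "module K W"
  shows "module K (tensor K V W)"
  unfolding tensor_def using assms
  by (intro quotient_module(1) tensor_relations free_module_module module.axioms(1))

text \<open>The generating relations go to zero because \<open>\<beta>\<close> is bilinear, and the
  kernel of a linear map is a submodule, so it contains their span.\<close>

lemma free_lift_relations:
  assumes V: "module K V" and W: "module K W" and U: "module K U"
    and \<beta>: "\<beta> \<in> bilinear_maps K V W U" and f: "f \<in> tensor_relations K V W"
  shows "free_lift K U (\<lambda>p. \<beta> (fst p) (snd p)) f = \<zero>\<^sub>U"
proof -
  interpret V: module K V by fact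
  interpret W: module K W by fact
  interpret U: module K U by fact
  define F where "F = free_module K (carrier V \<times> carrier W)"
  interpret F: module K F unfolding F_def by (rule free_module_module) unfold_locales
  define L where "L = free_lift K U (\<lambda>p. \<beta> (fst p) (snd p))"
  have \<beta>c: "(\<lambda>p. \<beta> (fst p) (snd p)) \<in> carrier V \<times> carrier W \<rightarrow> carrier U"
    using bilinear_mapsD[OF \<beta>] by auto
  have Lh: "L \<in> module_hom K F U"
    unfolding L_def F_def using U \<beta>c by (rule free_lift_hom)
  interpret L: mod_hom K F U L
    using Lh by (simp add: mod_hom_def mod_hom_axioms_def F.module_axioms U)
  have b: "basis_vec K (v, w) \<in> carrier F" if "v \<in> carrier V" "w \<in> carrier W" for v w
    unfolding F_def using that V.R.is_cring by (intro basis_vec_in) auto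
  have Lb: "L (basis_vec K (v, w)) = \<beta> v w" if "v \<in> carrier V" "w \<in> carrier W" for v w
    unfolding L_def using free_lift_basis_vec[OF U \<beta>c] that by auto
  have \<beta>in: "\<beta> v w \<in> carrier U" if "v \<in> carrier V" "w \<in> carrier W" for v w
    using bilinear_mapsD(3)[OF \<beta>] that by auto
  note hom = bilinear_mapsD(1,2)[OF \<beta>]
  have ker: "L r = \<zero>\<^sub>U" if "r \<in> bilinear_relations K V W" for r
    using that unfolding bilinear_relations_def F_def[symmetric] Let_def
    by (auto simp: b Lb \<beta>in L.f_add L.f_smult module_hom_add[OF hom(1)] module_hom_add[OF hom(2)]
        module_hom_smult[OF hom(1)] module_hom_smult[OF hom(2)])
  interpret Lk: LinearCombinations.submodule K L.ker F by (rule L.ker_is_submodule)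
  have "tensor_relations K V W \<subseteq> L.ker"
    unfolding tensor_relations_def F_def[symmetric]
    using ker tensor_relations(3)[OF V W, folded F_def] L.ker_is_submodule
    by (intro F.span_is_subset) (auto simp: L.ker_def)
  then have "f \<in> L.ker" using f by blast
  then show ?thesis unfolding L_def[symmetric] by (simp add: L.ker_def)
qed

text \<open>The \<open>the_elem\<close> in \<open>tensor_lift\<close> is legitimate here: two
  representatives of a coset differ by an element on which the lift vanishes, so the image of the
  coset is a singleton.\<close>

lemma tensor_lift_coset:
  assumes V: "module K V" and W: "module K W" and U: "module K U"
    and \<beta>: "\<beta> \<in> bilinear_maps K V W U" and f: "f \<in> carrier (free_module K (carrier V \<times> carrier W))"
  shows "tensor_lift K U \<beta> (tensor_relations K V W +>\<^bsub>free_module K (carrier V \<times> carrier W)\<^esub> f) =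
    free_lift K U (\<lambda>p. \<beta> (fst p) (snd p)) f"
proof -
  interpret U: module K U by fact
  let ?L = "free_lift K U (\<lambda>p. \<beta> (fst p) (snd p))"
  define F where "F = free_module K (carrier V \<times> carrier W)"
  interpret F: module K F unfolding F_def by (rule free_module_module) unfold_locales
  interpret N: Module.submodule "tensor_relations K V W" K F
    unfolding F_def by (rule tensor_relations(1)[OF V W])
  have \<beta>c: "(\<lambda>p. \<beta> (fst p) (snd p)) \<in> carrier V \<times> carrier W \<rightarrow> carrier U"
    using bilinear_mapsD[OF \<beta>] by auto
  have Lh: "?L \<in> module_hom K F U"
    unfolding F_def using U \<beta>c by (rule free_lift_hom)
  have L: "?L g = ?L f" if "g \<in> tensor_relations K V W +>\<^bsub>F\<^esub> f" for g
  proof -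
    from that obtain r where r: "r \<in> tensor_relations K V W" "g = r \<oplus>\<^sub>F f"
      unfolding a_r_coset_def' by blast
    have rF: "r \<in> carrier F" using r N.subset by auto
    have "?L g = ?L r \<oplus>\<^sub>U ?L f"
      unfolding r(2) using rF f by (intro module_hom_add[OF Lh]) (auto simp: F_def)
    then show ?thesis
      using free_lift_relations[OF V W U \<beta> r(1)] module_hom_in[OF Lh, of f] f F_def by simp
  qed
  have "f \<in> tensor_relations K V W +>\<^bsub>F\<^esub> f"
    using N.one_closed f F.M.l_zero[of f] unfolding a_r_coset_def' F_def[symmetric] by force
  then have "?L ` (tensor_relations K V W +>\<^bsub>F\<^esub> f) = {?L f}"
    using L by blast
  moreover have "(\<lambda>f. \<Oplus>\<^bsub>U\<^esub>p\<in>{p. f p \<noteq> \<zero>\<^sub>K}. f p \<odot>\<^sub>U \<beta> (fst p) (snd p)) = ?L"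
    by (auto simp: free_lift_def)
  ultimately show ?thesis
    unfolding tensor_lift_def F_def[symmetric] by (metis the_elem_eq)
qed

lemma pure_tensor_bilinear:
  assumes V: "module K V" and W: "module K W"
  shows "pure_tensor K V W \<in> bilinear_maps K V W (tensor K V W)"
proof -
  interpret V: module K V by fact
  interpret W: module K W by fact
  define F where "F = free_module K (carrier V \<times> carrier W)"
  interpret F: module K F unfolding F_def by (rule free_module_module) unfold_locales
  let ?N = "tensor_relations K V W"
  note sub = tensor_relations[OF V W, folded F_def]
  interpret N: Module.submodule ?N K F by (rule sub(1))
  interpret N: abelian_subgroup ?N F
    using N.subgroup_axioms F.abelian_group_axioms
    by (intro abelian_subgroupI3) (auto simp: additive_subgroup_def)
  note Q = quotient_module[OF F.module_axioms sub(1)]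
  have T: "tensor K V W = quotient_module F ?N" by (simp add: tensor_def F_def)
  have pt: "pure_tensor K V W v w = ?N +>\<^bsub>F\<^esub> basis_vec K (v, w)" for v w
    by (simp add: pure_tensor_def F_def)
  have b: "basis_vec K (v, w) \<in> carrier F" if "v \<in> carrier V" "w \<in> carrier W" for v w
    unfolding F_def using that V.R.is_cring by (intro basis_vec_in) auto
  \<comment> \<open>Each law of bilinearity is one of the generating relations, so every case below
    reduces to a difference of two representatives being a generator.\<close>
  have eq: "?N +>\<^bsub>F\<^esub> f = ?N +>\<^bsub>F\<^esub> g"
    if "f \<in> carrier F" "g \<in> carrier F" "f \<ominus>\<^sub>F g \<in> bilinear_relations K V W" for f g
  proof -
    have "f \<ominus>\<^sub>F g \<in> ?N" using that sub by auto
    moreover have "f = (f \<ominus>\<^sub>F g) \<oplus>\<^sub>F g"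
      using that by (simp add: a_minus_def F.M.a_assoc F.M.l_neg)
    ultimately have "f \<in> ?N +>\<^bsub>F\<^esub> g"
      unfolding a_r_coset_def' by blast
    then show ?thesis using N.a_repr_independence' that by blast
  qed
  note hom = Q(2)[THEN module_hom_add, symmetric] Q(2)[THEN module_hom_smult, symmetric]
  show ?thesis
  proof (rule bilinear_mapsI)
    fix v assume v: "v \<in> carrier V"
    show "pure_tensor K V W v \<in> module_hom K W (tensor K V W)"
    proof (rule module_homI)
      fix w assume w: "w \<in> carrier W"
      show "pure_tensor K V W v w \<in> carrier (tensor K V W)"
        unfolding pt T using module_hom_in[OF Q(2)] b v w by blast
      {
        fix w' assume w': "w' \<in> carrier W"
        have "?N +>\<^bsub>F\<^esub> basis_vec K (v, w \<oplus>\<^sub>W w') =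
            ?N +>\<^bsub>F\<^esub> (basis_vec K (v, w) \<oplus>\<^sub>F basis_vec K (v, w'))"
          using v w w' by (intro eq)
            (auto simp: b, auto simp: bilinear_relations_def Let_def F_def)
        then show "pure_tensor K V W v (w \<oplus>\<^sub>W w') =
            pure_tensor K V W v w \<oplus>\<^bsub>tensor K V W\<^esub> pure_tensor K V W v w'"
          unfolding pt T using b v w w' by (simp add: hom)
      }
      fix a assume a: "a \<in> carrier K"
      have "?N +>\<^bsub>F\<^esub> basis_vec K (v, a \<odot>\<^sub>W w) = ?N +>\<^bsub>F\<^esub> (a \<odot>\<^sub>F basis_vec K (v, w))"
        using v w a by (intro eq)
          (auto simp: b, auto simp: bilinear_relations_def Let_def F_def)
      then show "pure_tensor K V W v (a \<odot>\<^sub>W w) = a \<odot>\<^bsub>tensor K V W\<^esub> pure_tensor K V W v w"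
        unfolding pt T using b v w a by (simp add: hom)
    qed
  next
    fix w assume w: "w \<in> carrier W"
    show "(\<lambda>v. pure_tensor K V W v w) \<in> module_hom K V (tensor K V W)"
    proof (rule module_homI)
      fix v assume v: "v \<in> carrier V"
      show "pure_tensor K V W v w \<in> carrier (tensor K V W)"
        unfolding pt T using module_hom_in[OF Q(2)] b v w by blast
      {
        fix v' assume v': "v' \<in> carrier V"
        have "?N +>\<^bsub>F\<^esub> basis_vec K (v \<oplus>\<^sub>V v', w) =
            ?N +>\<^bsub>F\<^esub> (basis_vec K (v, w) \<oplus>\<^sub>F basis_vec K (v', w))"
          using v w v' by (intro eq)
            (auto simp: b, auto simp: bilinear_relations_def Let_def F_def)
        then show "pure_tensor K V W (v \<oplus>\<^sub>V v') w =
            pure_tensor K V W v w \<oplus>\<^bsub>tensor K V W\<^esub> pure_tensor K V W v' w"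
          unfolding pt T using b v w v' by (simp add: hom)
      }
      fix a assume a: "a \<in> carrier K"
      have "?N +>\<^bsub>F\<^esub> basis_vec K (a \<odot>\<^sub>V v, w) = ?N +>\<^bsub>F\<^esub> (a \<odot>\<^sub>F basis_vec K (v, w))"
        using v w a by (intro eq)
          (auto simp: b, auto simp: bilinear_relations_def Let_def F_def)
      then show "pure_tensor K V W (a \<odot>\<^sub>V v) w = a \<odot>\<^bsub>tensor K V W\<^esub> pure_tensor K V W v w"
        unfolding pt T using b v w a by (simp add: hom)
    qed
  qed
qed

context
  fixes K :: "('k, 'r) ring_scheme" and V :: "('k, 'v, 'a) module_scheme"
    and W :: "('k, 'w, 'b) module_scheme"
  assumes V: "module K V" and W: "module K W"
begin

lemma pure_tensor_in:
  "\<lbrakk>v \<in> carrier V; w \<in> carrier W\<rbrakk> \<Longrightarrow> pure_tensor K V W v w \<in> carrier (tensor K V W)"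
  using bilinear_mapsD(3)[OF pure_tensor_bilinear[OF V W]] .

lemma tensor_lift_pure:
  assumes U: "module K U" and \<beta>: "\<beta> \<in> bilinear_maps K V W U"
    and "v \<in> carrier V" "w \<in> carrier W"
  shows "tensor_lift K U \<beta> (pure_tensor K V W v w) = \<beta> v w"
proof -
  have K: "cring K" using U by (simp add: module_def)
  have \<beta>c: "(\<lambda>p. \<beta> (fst p) (snd p)) \<in> carrier V \<times> carrier W \<rightarrow> carrier U"
    using bilinear_mapsD[OF \<beta>] by auto
  show ?thesis
    unfolding pure_tensor_def using assms
    by (subst tensor_lift_coset[OF V W U \<beta> basis_vec_in[OF K]])
      (auto simp: free_lift_basis_vec[OF U \<beta>c])
qed

lemma tensor_lift_hom:
  assumes U: "module K U" and \<beta>: "\<beta> \<in> bilinear_maps K V W U"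
  shows "tensor_lift K U \<beta> \<in> module_hom K (tensor K V W) U"
proof -
  have K: "cring K" using U by (simp add: module_def)
  define F where "F = free_module K (carrier V \<times> carrier W)"
  have F: "module K F" unfolding F_def by (rule free_module_module[OF K])
  then interpret F: module K F .
  let ?N = "tensor_relations K V W"
  let ?L = "free_lift K U (\<lambda>p. \<beta> (fst p) (snd p))"
  note N = tensor_relations(1)[OF V W, folded F_def]
  note Q = quotient_module[OF F N]
  have T: "tensor K V W = quotient_module F ?N" by (simp add: tensor_def F_def)
  have \<beta>c: "(\<lambda>p. \<beta> (fst p) (snd p)) \<in> carrier V \<times> carrier W \<rightarrow> carrier U"
    using bilinear_mapsD[OF \<beta>] by auto
  have Lh: "?L \<in> module_hom K F U"
    unfolding F_def using U \<beta>c by (rule free_lift_hom)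
  have lift: "tensor_lift K U \<beta> (?N +>\<^bsub>F\<^esub> f) = ?L f" if "f \<in> carrier F" for f
    using tensor_lift_coset[OF V W U \<beta>] that by (simp add: F_def)
  note hom = Q(2)[THEN module_hom_add, symmetric] Q(2)[THEN module_hom_smult, symmetric]
  show ?thesis
    unfolding T
    by (rule module_homI)
      (auto simp: Q(3) hom lift module_hom_in[OF Lh] module_hom_add[OF Lh] module_hom_smult[OF Lh])
qed

text \<open>Uniqueness in the universal property. Composed with the quotient map, both maps live on
  a free module, where the basis vectors decide, and the cosets of these are the pure
  tensors.\<close>

lemma tensor_hom_eq:
  assumes U: "module K U" and "L \<in> module_hom K (tensor K V W) U" "L' \<in> module_hom K (tensor K V W) U"
    and "\<And>v w. \<lbrakk>v \<in> carrier V; w \<in> carrier W\<rbrakk> \<Longrightarrow> L (pure_tensor K V W v w) = L' (pure_tensor K V W v w)"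
    and t: "t \<in> carrier (tensor K V W)"
  shows "L t = L' t"
proof -
  have K: "cring K" using U by (simp add: module_def)
  define F where "F = free_module K (carrier V \<times> carrier W)"
  have F: "module K F" unfolding F_def by (rule free_module_module[OF K])
  let ?N = "tensor_relations K V W"
  note N = tensor_relations(1)[OF V W, folded F_def]
  note Q = quotient_module[OF F N]
  have T: "tensor K V W = quotient_module F ?N" by (simp add: tensor_def F_def)
  have comp: "(\<lambda>f. M (?N +>\<^bsub>F\<^esub> f)) \<in> module_hom K F U" if "M \<in> module_hom K (tensor K V W) U" for M
    using that unfolding T
    by (intro module_homI)
      (auto simp: module_hom_add[OF Q(2)] module_hom_smult[OF Q(2)] module_hom_in[OF Q(2)]
         module_hom_add module_hom_smult module_hom_in)
  obtain f where f: "f \<in> carrier F" "t = ?N +>\<^bsub>F\<^esub> f" using t unfolding T Q(3) by auto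
  show ?thesis
    unfolding f(2)
  proof (rule free_module_hom_eq[OF K U, where L = "\<lambda>f. L (?N +>\<^bsub>F\<^esub> f)" and L' = "\<lambda>f. L' (?N +>\<^bsub>F\<^esub> f)"])
    show "(\<lambda>f. L (?N +>\<^bsub>F\<^esub> f)) \<in> module_hom K (free_module K (carrier V \<times> carrier W)) U"
      "(\<lambda>f. L' (?N +>\<^bsub>F\<^esub> f)) \<in> module_hom K (free_module K (carrier V \<times> carrier W)) U"
      using comp assms(2,3) F_def by auto
    show "f \<in> carrier (free_module K (carrier V \<times> carrier W))" using f F_def by simp
    show "L (?N +>\<^bsub>F\<^esub> basis_vec K x) = L' (?N +>\<^bsub>F\<^esub> basis_vec K x)"
      if "x \<in> carrier V \<times> carrier W" for x
      using assms(4)[of "fst x" "snd x"] that by (auto simp: pure_tensor_def F_def)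
  qed
qed

lemma tensor_lift_comp:
  assumes U: "module K U" and U': "module K U'" and \<beta>: "\<beta> \<in> bilinear_maps K V W U"
    and L: "L \<in> module_hom K U U'" and t: "t \<in> carrier (tensor K V W)"
  shows "L (tensor_lift K U \<beta> t) = tensor_lift K U' (\<lambda>v w. L (\<beta> v w)) t"
proof -
  have comp: "(\<lambda>x. L (g x)) \<in> module_hom K Z U'" if "g \<in> module_hom K Z U" for g and Z :: "('k, 'x, 'y) module_scheme"
    using that
    by (intro module_homI) (auto simp: module_hom_add[OF L] module_hom_smult[OF L] module_hom_in[OF L]
         module_hom_add module_hom_smult module_hom_in)
  have \<beta>': "(\<lambda>v w. L (\<beta> v w)) \<in> bilinear_maps K V W U'"
    using bilinear_mapsD[OF \<beta>] by (intro bilinear_mapsI comp) auto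
  show ?thesis
    by (rule tensor_hom_eq[OF U' comp[OF tensor_lift_hom[OF U \<beta>]] tensor_lift_hom[OF U' \<beta>'] _ t])
      (simp add: tensor_lift_pure[OF U \<beta>] tensor_lift_pure[OF U' \<beta>'])
qed

text \<open>Writes any tensor as the value of a lift. Applied to \<open>comult H h\<close>, it turns
  statements about arbitrary bilinear maps into statements about the comultiplication
  itself.\<close>

lemma tensor_lift_pure_tensor:
  assumes t: "t \<in> carrier (tensor K V W)"
  shows "tensor_lift K (tensor K V W) (pure_tensor K V W) t = t"
proof -
  have id: "(\<lambda>t. t) \<in> module_hom K (tensor K V W) (tensor K V W)"
    by (rule module_homI) auto
  show ?thesis
    by (rule tensor_hom_eq[OF tensor_module[OF V W]
          tensor_lift_hom[OF tensor_module[OF V W] pure_tensor_bilinear[OF V W]] id _ t])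
      (simp add: tensor_lift_pure[OF tensor_module[OF V W] pure_tensor_bilinear[OF V W]])
qed

end

section \<open>Sweedler calculus\<close>

text \<open>The ground field as a module over itself: linear functionals become module
  homomorphisms, and all results on lifts apply to them.\<close>

lemma base_algebra_module:
  assumes "field K"
  shows "module K (base_algebra K)"
proof -
  interpret field K by fact
  show ?thesis
  proof (rule moduleI)
    show "abelian_group (base_algebra K)"
    proof (rule abelian_groupI)
      fix x assume "x \<in> carrier (base_algebra K)"
      then show "\<exists>y\<in>carrier (base_algebra K). y \<oplus>\<^bsub>base_algebra K\<^esub> x = \<zero>\<^bsub>base_algebra K\<^esub>"
        by (intro bexI[of _ "\<ominus>\<^sub>K x"]) (auto simp: base_algebra_def l_neg)
    qed (auto simp: base_algebra_def a_ac)
  qed (simp_all add: base_algebra_def is_cring l_distr r_distr m_assoc)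
qed

lemma base_algebra_simps [simp]:
  "carrier (base_algebra K) = carrier K" "add (base_algebra K) = add K"
  "mult (base_algebra K) = mult K" "module.smult (base_algebra K) = mult K"
  "one (base_algebra K) = one K" "zero (base_algebra K) = zero K"
  by (simp_all add: base_algebra_def)

lemma module_hom_id: "(\<lambda>x. x) \<in> module_hom K V V"
  by (rule module_homI) auto

lemma module_hom_comp:
  assumes "L \<in> module_hom K U U'" "f \<in> module_hom K V U"
  shows "(\<lambda>x. L (f x)) \<in> module_hom K V U'"
  using assms
  by (intro module_homI) (auto simp: module_hom_add module_hom_smult module_hom_in)

lemma module_hom_cong:
  assumes "f \<in> module_hom K V U" "\<And>x. x \<in> carrier V \<Longrightarrow> f x = g x" "module K V"
  shows "g \<in> module_hom K V U"
proof -
  interpret module K V by fact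
  show ?thesis
    using assms(1,2)
    by (intro module_homI)
      (metis module_hom_in, metis module_hom_add M.a_closed, metis module_hom_smult smult_closed)
qed

lemma module_hom_smult_left:
  assumes "module K U" "f \<in> module_hom K V U" "a \<in> carrier K"
  shows "(\<lambda>x. a \<odot>\<^sub>U f x) \<in> module_hom K V U"
proof -
  interpret module K U by fact
  show ?thesis
    using assms(2,3)
    by (intro module_homI)
      (auto simp: module_hom_add module_hom_smult module_hom_in smult_r_distr
        smult_assoc1[symmetric] R.m_comm)
qed

lemma module_hom_smult_right:
  assumes "module K U" "\<phi> \<in> module_hom K V (base_algebra K)" "u \<in> carrier U"
  shows "(\<lambda>x. \<phi> x \<odot>\<^sub>U u) \<in> module_hom K V U"
proof -
  interpret module K U by fact
  have "\<phi> x \<in> carrier K" if "x \<in> carrier V" for x using module_hom_in[OF assms(2) that] by simp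
  then show ?thesis
    using assms(2,3)
    by (intro module_homI)
      (auto simp: module_hom_add module_hom_smult smult_l_distr smult_assoc1)
qed

lemma module_hom_plus:
  assumes "module K U" "f \<in> module_hom K V U" "g \<in> module_hom K V U"
  shows "(\<lambda>x. f x \<oplus>\<^sub>U g x) \<in> module_hom K V U"
proof -
  interpret module K U by fact
  show ?thesis
    using assms(2,3)
    by (intro module_homI)
      (auto simp: module_hom_add module_hom_smult module_hom_in smult_r_distr M.a_ac)
qed

lemma module_hom_sum:
  assumes "module K U" "module K V" "\<And>i. i \<in> I \<Longrightarrow> f i \<in> module_hom K V U"
  shows "(\<lambda>x. \<Oplus>\<^bsub>U\<^esub>i\<in>I. f i x) \<in> module_hom K V U"
proof -
  interpret module K U by fact
  have const: "(\<lambda>x. \<zero>\<^sub>U) \<in> module_hom K V U" by (rule module_homI) auto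
  show ?thesis
  proof (cases "finite I")
    case True
    then show ?thesis
      using assms(3)
    proof (induction I)
      case empty
      then show ?case using const by simp
    next
      case (insert i I)
      have "(\<lambda>x. f i x \<oplus>\<^sub>U (\<Oplus>\<^bsub>U\<^esub>i\<in>I. f i x)) \<in> module_hom K V U"
        using insert by (intro module_hom_plus assms(1)) auto
      moreover have "f i x \<oplus>\<^sub>U (\<Oplus>\<^bsub>U\<^esub>i\<in>I. f i x) = (\<Oplus>\<^bsub>U\<^esub>i\<in>insert i I. f i x)"
        if "x \<in> carrier V" for x
      proof (rule M.finsum_insert[symmetric])
        show "(\<lambda>i. f i x) \<in> I \<rightarrow> carrier U" using module_hom_in[OF insert.prems that] by auto
        show "f i x \<in> carrier U" using module_hom_in[OF insert.prems that] by auto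
      qed (use insert in auto)
      ultimately show ?case
        using assms(2) by (rule module_hom_cong)
    qed
  next
    case False
    then show ?thesis using const by simp
  qed
qed

lemma bilinear_hom_left:
  assumes "\<beta> \<in> bilinear_maps K V W U" "f \<in> module_hom K Z V" "w \<in> carrier W"
  shows "(\<lambda>x. \<beta> (f x) w) \<in> module_hom K Z U"
  using module_hom_comp[OF bilinear_mapsD(2)[OF assms(1,3)] assms(2)] .

lemma bilinear_hom_right:
  assumes "\<beta> \<in> bilinear_maps K V W U" "f \<in> module_hom K Z W" "v \<in> carrier V"
  shows "(\<lambda>x. \<beta> v (f x)) \<in> module_hom K Z U"
  using module_hom_comp[OF bilinear_mapsD(1)[OF assms(1,3)] assms(2)] .

lemma bilinear_comp:
  assumes L: "L \<in> module_hom K U U'" and \<beta>: "\<beta> \<in> bilinear_maps K V W U"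
  shows "(\<lambda>v w. L (\<beta> v w)) \<in> bilinear_maps K V W U'"
  by (rule bilinear_mapsI[OF module_hom_comp[OF L bilinear_mapsD(1)[OF \<beta>]]
        module_hom_comp[OF L bilinear_mapsD(2)[OF \<beta>]]])

lemma tensor_lift_in:
  assumes "module K V" "module K W" "module K U" "\<beta> \<in> bilinear_maps K V W U"
    and "t \<in> carrier (tensor K V W)"
  shows "tensor_lift K U \<beta> t \<in> carrier U"
  using module_hom_in[OF tensor_lift_hom[OF assms(1-4)] assms(5)] .

lemma tensor_lift_cong:
  assumes V: "module K V" and W: "module K W" and U: "module K U"
    and \<beta>: "\<beta> \<in> bilinear_maps K V W U"
    and eq: "\<And>v w. \<lbrakk>v \<in> carrier V; w \<in> carrier W\<rbrakk> \<Longrightarrow> \<beta> v w = \<beta>' v w"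
    and t: "t \<in> carrier (tensor K V W)"
  shows "tensor_lift K U \<beta> t = tensor_lift K U \<beta>' t"
proof -
  have \<beta>': "\<beta>' \<in> bilinear_maps K V W U"
  proof (rule bilinear_mapsI)
    show "\<beta>' v \<in> module_hom K W U" if "v \<in> carrier V" for v
      using bilinear_mapsD(1)[OF \<beta> that] eq[OF that] W by (rule module_hom_cong)
    show "(\<lambda>v. \<beta>' v w) \<in> module_hom K V U" if "w \<in> carrier W" for w
      using bilinear_mapsD(2)[OF \<beta> that] eq[OF _ that] V by (rule module_hom_cong)
  qed
  show ?thesis
    by (rule tensor_hom_eq[OF V W U tensor_lift_hom[OF V W U \<beta>] tensor_lift_hom[OF V W U \<beta>'] _ t])
      (simp add: tensor_lift_pure[OF V W U \<beta>] tensor_lift_pure[OF V W U \<beta>'] eq)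
qed

text \<open>In an iterated Sweedler sum the inner bilinear map depends on a variable of the outer
  one; this gives linearity in that variable.\<close>

lemma tensor_lift_param_hom:
  assumes V: "module K V" and W: "module K W" and U: "module K U" and Z: "module K Z"
    and \<gamma>: "\<And>x. x \<in> carrier Z \<Longrightarrow> \<gamma> x \<in> bilinear_maps K V W U"
    and lin: "\<And>v w. \<lbrakk>v \<in> carrier V; w \<in> carrier W\<rbrakk> \<Longrightarrow> (\<lambda>x. \<gamma> x v w) \<in> module_hom K Z U"
    and t: "t \<in> carrier (tensor K V W)"
  shows "(\<lambda>x. tensor_lift K U (\<gamma> x) t) \<in> module_hom K Z U"
proof -
  interpret Z: module K Z by fact
  note hom = tensor_lift_hom[OF V W U \<gamma>]
  show ?thesis
  proof (rule module_homI)
    fix x assume x: "x \<in> carrier Z"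
    show "tensor_lift K U (\<gamma> x) t \<in> carrier U" using module_hom_in[OF hom[OF x] t] .
    show "tensor_lift K U (\<gamma> (a \<odot>\<^sub>Z x)) t = a \<odot>\<^sub>U tensor_lift K U (\<gamma> x) t" if a: "a \<in> carrier K" for a
      by (rule tensor_hom_eq[OF V W U hom[OF Z.smult_closed[OF a x]] module_hom_smult_left[OF U hom[OF x] a] _ t])
        (simp add: tensor_lift_pure[OF V W U \<gamma>] x a module_hom_smult[OF lin])
    show "tensor_lift K U (\<gamma> (x \<oplus>\<^sub>Z y)) t = tensor_lift K U (\<gamma> x) t \<oplus>\<^sub>U tensor_lift K U (\<gamma> y) t"
      if y: "y \<in> carrier Z" for y
      by (rule tensor_hom_eq[OF V W U hom[OF Z.M.a_closed[OF x y]] module_hom_plus[OF U hom[OF x] hom[OF y]] _ t])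
        (simp add: tensor_lift_pure[OF V W U \<gamma>] x y module_hom_add[OF lin])
  qed
qed

lemma tensor_lift_sum:
  assumes V: "module K V" and W: "module K W" and U: "module K U" and fin: "finite I"
    and \<gamma>: "\<And>i. i \<in> I \<Longrightarrow> \<gamma> i \<in> bilinear_maps K V W U"
    and t: "t \<in> carrier (tensor K V W)"
  shows "tensor_lift K U (\<lambda>v w. \<Oplus>\<^bsub>U\<^esub>i\<in>I. \<gamma> i v w) t = (\<Oplus>\<^bsub>U\<^esub>i\<in>I. tensor_lift K U (\<gamma> i) t)"
proof -
  interpret U: module K U by fact
  have b: "(\<lambda>v w. \<Oplus>\<^bsub>U\<^esub>i\<in>I. \<gamma> i v w) \<in> bilinear_maps K V W U"
    using bilinear_mapsD(1,2)[OF \<gamma>] by (intro bilinear_mapsI module_hom_sum U V W)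
  have "(\<lambda>t. \<Oplus>\<^bsub>U\<^esub>i\<in>I. tensor_lift K U (\<gamma> i) t) \<in> module_hom K (tensor K V W) U"
    by (intro module_hom_sum tensor_module U tensor_lift_hom V W \<gamma>)
  moreover have "tensor_lift K U (\<lambda>v w. \<Oplus>\<^bsub>U\<^esub>i\<in>I. \<gamma> i v w) (pure_tensor K V W v w) =
      (\<Oplus>\<^bsub>U\<^esub>i\<in>I. tensor_lift K U (\<gamma> i) (pure_tensor K V W v w))"
    if "v \<in> carrier V" "w \<in> carrier W" for v w
    unfolding tensor_lift_pure[OF V W U b that] using bilinear_mapsD(3)[OF \<gamma> that]
    by (intro U.M.finsum_cong') (auto simp: tensor_lift_pure[OF V W U \<gamma> that])
  ultimately show ?thesis
    by (intro tensor_hom_eq[OF V W U tensor_lift_hom[OF V W U b] _ _ t])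
qed

context hopf_algebra
begin

abbreviation HH where "HH \<equiv> tensor K H H"

lemma H_module: "module K H" by (rule vec.module_axioms)
lemma K_field: "field K" by (rule vec.field_axioms)
lemma K_module: "module K (base_algebra K)" by (rule base_algebra_module[OF K_field])
lemma HH_module: "module K HH" by (rule tensor_module[OF H_module H_module])

lemma counit_module_hom: "counit H \<in> module_hom K H (base_algebra K)"
  using counit_hom by (simp add: alg_hom_def)

lemma counit_in: "h \<in> carrier H \<Longrightarrow> counit H h \<in> carrier K"
  using module_hom_in[OF counit_module_hom] by simp

lemma antipode_in: "h \<in> carrier H \<Longrightarrow> antipode H h \<in> carrier H"
  by (rule module_hom_in[OF antipode_linear])

lemma comult_module_hom: "comult H \<in> module_hom K H HH"
  using comult_hom by (simp add: alg_hom_def tensor_algebra_def Let_def module_hom_def)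

lemma comult_in: "h \<in> carrier H \<Longrightarrow> comult H h \<in> carrier HH"
  using module_hom_in[OF comult_module_hom] .

lemma mult_left_hom:
  assumes "f \<in> module_hom K V H" "h \<in> carrier H"
  shows "(\<lambda>x. f x \<otimes>\<^sub>H h) \<in> module_hom K V H"
  using assms
  by (intro module_homI) (auto simp: module_hom_add module_hom_smult module_hom_in l_distr smult_mult_left)

lemma mult_right_hom:
  assumes "f \<in> module_hom K V H" "h \<in> carrier H"
  shows "(\<lambda>x. h \<otimes>\<^sub>H f x) \<in> module_hom K V H"
  using assms
  by (intro module_homI) (auto simp: module_hom_add module_hom_smult module_hom_in r_distr smult_mult_right)

lemma scalar_mult_left_hom:
  assumes "f \<in> module_hom K V (base_algebra K)" "a \<in> carrier K"
  shows "(\<lambda>x. f x \<otimes> a) \<in> module_hom K V (base_algebra K)"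
  using module_hom_smult_right[OF K_module assms(1), of a] assms(2) by simp

lemma scalar_mult_right_hom:
  assumes "f \<in> module_hom K V (base_algebra K)" "a \<in> carrier K"
  shows "(\<lambda>x. a \<otimes> f x) \<in> module_hom K V (base_algebra K)"
  using module_hom_smult_left[OF K_module assms] by simp

text \<open>\<open>sweedler U \<beta> h\<close> is the sum that Sweedler notation writes as \<open>\<beta>(h\<^sub>1, h\<^sub>2)\<close>.\<close>

definition sweedler where "sweedler U \<beta> h = tensor_lift K U \<beta> (comult H h)"

lemma sweedler_in:
  assumes "module K U" "\<beta> \<in> bilinear_maps K H H U" "h \<in> carrier H"
  shows "sweedler U \<beta> h \<in> carrier U"
  unfolding sweedler_def by (rule tensor_lift_in[OF H_module H_module assms(1,2) comult_in[OF assms(3)]])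

lemma sweedler_hom:
  assumes "module K U" "\<beta> \<in> bilinear_maps K H H U" "f \<in> module_hom K V H"
  shows "(\<lambda>x. sweedler U \<beta> (f x)) \<in> module_hom K V U"
  unfolding sweedler_def
  by (rule module_hom_comp[OF tensor_lift_hom[OF H_module H_module assms(1,2)]
        module_hom_comp[OF comult_module_hom assms(3)]])

lemma sweedler_param_hom:
  assumes "module K U" "module K Z"
    and "\<And>x. x \<in> carrier Z \<Longrightarrow> \<gamma> x \<in> bilinear_maps K H H U"
    and "\<And>a b. \<lbrakk>a \<in> carrier H; b \<in> carrier H\<rbrakk> \<Longrightarrow> (\<lambda>x. \<gamma> x a b) \<in> module_hom K Z U"
    and "h \<in> carrier H"
  shows "(\<lambda>x. sweedler U (\<gamma> x) h) \<in> module_hom K Z U"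
  unfolding sweedler_def
  by (rule tensor_lift_param_hom[OF H_module H_module assms(1-4) comult_in[OF assms(5)]])

lemma sweedler_cong:
  assumes "module K U" "\<beta> \<in> bilinear_maps K H H U" "h \<in> carrier H"
    and "\<And>a b. \<lbrakk>a \<in> carrier H; b \<in> carrier H\<rbrakk> \<Longrightarrow> \<beta> a b = \<beta>' a b"
  shows "sweedler U \<beta> h = sweedler U \<beta>' h"
  unfolding sweedler_def using assms by (intro tensor_lift_cong[OF H_module H_module] comult_in)

lemma sweedler_comp:
  assumes "module K U" "module K U'" "\<beta> \<in> bilinear_maps K H H U" "L \<in> module_hom K U U'"
    and "h \<in> carrier H"
  shows "L (sweedler U \<beta> h) = sweedler U' (\<lambda>a b. L (\<beta> a b)) h"
  unfolding sweedler_def using assms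
  by (intro tensor_lift_comp[OF H_module H_module] comult_in)

lemma sweedler_sum:
  assumes "module K U" "finite I" "\<And>i. i \<in> I \<Longrightarrow> \<gamma> i \<in> bilinear_maps K H H U" "h \<in> carrier H"
  shows "sweedler U (\<lambda>a b. \<Oplus>\<^bsub>U\<^esub>i\<in>I. \<gamma> i a b) h = (\<Oplus>\<^bsub>U\<^esub>i\<in>I. sweedler U (\<gamma> i) h)"
  unfolding sweedler_def using assms by (intro tensor_lift_sum[OF H_module H_module] comult_in)

lemma sweedler_pure:
  assumes "module K U" "\<beta> \<in> bilinear_maps K H H U" "g \<in> carrier H" "h \<in> carrier H"
    and "comult H x = pure_tensor K H H g h"
  shows "sweedler U \<beta> x = \<beta> g h"
  unfolding sweedler_def assms(5) using assms(1-4) by (intro tensor_lift_pure H_module)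

lemma comult_sweedler:
  assumes "h \<in> carrier H"
  shows "sweedler HH (pure_tensor K H H) h = comult H h"
  unfolding sweedler_def using assms by (intro tensor_lift_pure_tensor H_module comult_in)

lemma pure_bilinear: "pure_tensor K H H \<in> bilinear_maps K H H HH"
  by (rule pure_tensor_bilinear[OF H_module H_module])

text \<open>The product of \<open>tensor_algebra\<close> is itself a double lift, and the linear map
  induced by \<open>\<beta>\<close> can be moved inside both lifts.\<close>

lemma sweedler_mult:
  assumes U: "module K U" and \<beta>: "\<beta> \<in> bilinear_maps K H H U" and h: "h \<in> carrier H" and k: "k \<in> carrier H"
  shows "sweedler U \<beta> (h \<otimes>\<^sub>H k) =
    sweedler U (\<lambda>a b. sweedler U (\<lambda>c d. \<beta> (a \<otimes>\<^sub>H c) (b \<otimes>\<^sub>H d)) k) h"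
proof -
  let ?T = "HH"
  have in1: "(\<lambda>c d. \<gamma> (a \<otimes>\<^sub>H c) (b \<otimes>\<^sub>H d)) \<in> bilinear_maps K H H Z"
    if "\<gamma> \<in> bilinear_maps K H H Z" "a \<in> carrier H" "b \<in> carrier H" for \<gamma> a b and Z :: "('k, 'z, 'y) module_scheme"
    by (rule bilinear_mapsI[OF
          bilinear_hom_right[OF that(1) mult_right_hom[OF module_hom_id that(3)] m_closed[OF that(2)]]
          bilinear_hom_left[OF that(1) mult_right_hom[OF module_hom_id that(2)] m_closed[OF that(3)]]])
  have in2: "(\<lambda>a b. sweedler Z (\<lambda>c d. \<gamma> (a \<otimes>\<^sub>H c) (b \<otimes>\<^sub>H d)) k) \<in> bilinear_maps K H H Z"
    if Z: "module K Z" and \<gamma>: "\<gamma> \<in> bilinear_maps K H H Z" for \<gamma> and Z :: "('k, 'z, 'y) module_scheme"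
    by (rule bilinear_mapsI[OF
          sweedler_param_hom[OF Z H_module in1[OF \<gamma>] bilinear_hom_right[OF \<gamma>] k]
          sweedler_param_hom[OF Z H_module in1[OF \<gamma>] bilinear_hom_left[OF \<gamma>] k]])
      (intro mult_left_hom module_hom_id m_closed | assumption)+
  have "comult H (h \<otimes>\<^sub>H k) =
      sweedler ?T (\<lambda>a b. sweedler ?T (\<lambda>c d. pure_tensor K H H (a \<otimes>\<^sub>H c) (b \<otimes>\<^sub>H d)) k) h"
    using comult_hom h k by (simp add: alg_hom_def ring_hom_def tensor_algebra_def Let_def sweedler_def)
  then have "sweedler U \<beta> (h \<otimes>\<^sub>H k) = tensor_lift K U \<beta> ..."
    by (simp add: sweedler_def)
  also have "... = sweedler U (\<lambda>a b. tensor_lift K U \<beta>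
      (sweedler ?T (\<lambda>c d. pure_tensor K H H (a \<otimes>\<^sub>H c) (b \<otimes>\<^sub>H d)) k)) h"
    by (rule sweedler_comp[OF HH_module U in2[OF HH_module pure_bilinear] tensor_lift_hom[OF H_module H_module U \<beta>] h])
  also have "... = sweedler U (\<lambda>a b. sweedler U (\<lambda>c d. \<beta> (a \<otimes>\<^sub>H c) (b \<otimes>\<^sub>H d)) k) h"
  proof (rule sweedler_cong[symmetric, OF U in2[OF U \<beta>] h])
    fix a b assume a: "a \<in> carrier H" and b: "b \<in> carrier H"
    have "tensor_lift K U \<beta> (sweedler ?T (\<lambda>c d. pure_tensor K H H (a \<otimes>\<^sub>H c) (b \<otimes>\<^sub>H d)) k) =
        sweedler U (\<lambda>c d. tensor_lift K U \<beta> (pure_tensor K H H (a \<otimes>\<^sub>H c) (b \<otimes>\<^sub>H d))) k"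
      by (rule sweedler_comp[OF HH_module U in1[OF pure_bilinear a b] tensor_lift_hom[OF H_module H_module U \<beta>] k])
    also have "... = sweedler U (\<lambda>c d. \<beta> (a \<otimes>\<^sub>H c) (b \<otimes>\<^sub>H d)) k"
      by (rule sweedler_cong[symmetric, OF U in1[OF \<beta> a b] k])
        (simp add: tensor_lift_pure[OF H_module H_module U \<beta>] a b)
    finally show "sweedler U (\<lambda>c d. \<beta> (a \<otimes>\<^sub>H c) (b \<otimes>\<^sub>H d)) k =
      tensor_lift K U \<beta> (sweedler ?T (\<lambda>c d. pure_tensor K H H (a \<otimes>\<^sub>H c) (b \<otimes>\<^sub>H d)) k)" ..
  qed
  finally show ?thesis .
qed

text \<open>Coassociativity is an identity in a triple tensor product. It is used only after
  applying a linear map out of that product, which amounts to a trilinear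
  \<open>\<gamma>\<close>.\<close>

lemma sweedler_assoc:
  assumes U: "module K U"
    and \<gamma>1: "\<And>b c. \<lbrakk>b \<in> carrier H; c \<in> carrier H\<rbrakk> \<Longrightarrow> (\<lambda>a. \<gamma> a b c) \<in> module_hom K H U"
    and \<gamma>2: "\<And>a c. \<lbrakk>a \<in> carrier H; c \<in> carrier H\<rbrakk> \<Longrightarrow> (\<lambda>b. \<gamma> a b c) \<in> module_hom K H U"
    and \<gamma>3: "\<And>a b. \<lbrakk>a \<in> carrier H; b \<in> carrier H\<rbrakk> \<Longrightarrow> (\<lambda>c. \<gamma> a b c) \<in> module_hom K H U"
    and h: "h \<in> carrier H"
  shows "sweedler U (\<lambda>a c. sweedler U (\<lambda>a b. \<gamma> a b c) a) h = sweedler U (\<lambda>a b. sweedler U (\<gamma> a) b) h"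
proof -
  let ?H2 = "HH"
  let ?H3 = "tensor K H ?H2"
  note H = H_module and H2 = HH_module
  have H3: "module K ?H3" by (rule tensor_module[OF H H2])
  note p = pure_tensor_bilinear[OF H H] and p3 = pure_tensor_bilinear[OF H H2]
    and p3' = pure_tensor_bilinear[OF H2 H]
  \<comment> \<open>The linear map on the right-bracketed triple tensor product that
    \<open>\<gamma>\<close> induces. Its values on the two sides of the coassociativity axiom are
    the two iterated sums.\<close>
  define \<Gamma> where "\<Gamma> = tensor_lift K U (\<lambda>u s. tensor_lift K U (\<gamma> u) s)"
  have bl: "\<gamma> u \<in> bilinear_maps K H H U" if "u \<in> carrier H" for u
    by (rule bilinear_mapsI[OF \<gamma>3[OF that] \<gamma>2[OF that]])
  have b\<Gamma>: "(\<lambda>u s. tensor_lift K U (\<gamma> u) s) \<in> bilinear_maps K H ?H2 U"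
    by (rule bilinear_mapsI[OF tensor_lift_hom[OF H H U bl] tensor_lift_param_hom[OF H H U H bl \<gamma>1]])
  then have \<Gamma>: "\<Gamma> \<in> module_hom K ?H3 U"
    unfolding \<Gamma>_def by (rule tensor_lift_hom[OF H H2 U])
  have \<Gamma>p: "\<Gamma> (pure_tensor K H ?H2 u s) = tensor_lift K U (\<gamma> u) s"
    if "u \<in> carrier H" "s \<in> carrier ?H2" for u s
    unfolding \<Gamma>_def by (rule tensor_lift_pure[OF H H2 U b\<Gamma> that])
  have in3: "(\<lambda>u v. pure_tensor K H ?H2 u (pure_tensor K H H v w)) \<in> bilinear_maps K H H ?H3"
    if "w \<in> carrier H" for w
    by (rule bilinear_mapsI[OF bilinear_hom_right[OF p3 bilinear_hom_left[OF p module_hom_id that]]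
          bilinear_hom_left[OF p3 module_hom_id pure_tensor_in[OF H H _ that]]])
  have inp3: "(\<lambda>w. pure_tensor K H ?H2 u (pure_tensor K H H v w)) \<in> module_hom K H ?H3"
    if "u \<in> carrier H" "v \<in> carrier H" for u v
    by (rule bilinear_hom_right[OF p3 bilinear_mapsD(1)[OF p that(2)] that(1)])
  have as: "(\<lambda>t w. tensor_lift K ?H3 (\<lambda>u v. pure_tensor K H ?H2 u (pure_tensor K H H v w)) t)
      \<in> bilinear_maps K ?H2 H ?H3"
    by (rule bilinear_mapsI[OF tensor_lift_param_hom[OF H H H3 H in3 inp3] tensor_lift_hom[OF H H H3 in3]])
  have ash: "tensor_assoc K H H H \<in> module_hom K (tensor K ?H2 H) ?H3"
    unfolding tensor_assoc_def Let_def by (rule tensor_lift_hom[OF H2 H H3 as])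
  have asp: "tensor_assoc K H H H (pure_tensor K ?H2 H t w) =
      tensor_lift K ?H3 (\<lambda>u v. pure_tensor K H ?H2 u (pure_tensor K H H v w)) t"
    if "t \<in> carrier ?H2" "w \<in> carrier H" for t w
    unfolding tensor_assoc_def Let_def by (rule tensor_lift_pure[OF H2 H H3 as that])
  have m1: "(\<lambda>v w. pure_tensor K ?H2 H (comult H v) w) \<in> bilinear_maps K H H (tensor K ?H2 H)"
    by (rule bilinear_mapsI[OF bilinear_mapsD(1)[OF p3' comult_in] bilinear_hom_left[OF p3' comult_module_hom]])
  have m2: "(\<lambda>v w. pure_tensor K H ?H2 v (comult H w)) \<in> bilinear_maps K H H ?H3"
    by (rule bilinear_mapsI[OF bilinear_hom_right[OF p3 comult_module_hom] bilinear_mapsD(2)[OF p3 comult_in]])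
  have T3': "module K (tensor K ?H2 H)" by (rule tensor_module[OF H2 H])
  have "\<Gamma> (tensor_map K H ?H2 (\<lambda>x. x) (comult H) (comult H h)) =
      sweedler U (\<lambda>v w. \<Gamma> (pure_tensor K H ?H2 v (comult H w))) h"
    unfolding tensor_map_def sweedler_def[symmetric] by (rule sweedler_comp[OF H3 U m2 \<Gamma> h])
  also have "... = sweedler U (\<lambda>a b. sweedler U (\<gamma> a) b) h"
  proof (rule sweedler_cong[OF U _ h])
    show "(\<lambda>v w. \<Gamma> (pure_tensor K H ?H2 v (comult H w))) \<in> bilinear_maps K H H U"
      by (rule bilinear_comp[OF \<Gamma> m2])
  qed (simp only: \<Gamma>p comult_in sweedler_def)
  finally have R: "\<Gamma> (tensor_map K H ?H2 (\<lambda>x. x) (comult H) (comult H h)) =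
    sweedler U (\<lambda>a b. sweedler U (\<gamma> a) b) h" .
  have "\<Gamma> (tensor_assoc K H H H (tensor_map K ?H2 H (comult H) (\<lambda>x. x) (comult H h))) =
     sweedler U (\<lambda>v w. \<Gamma> (tensor_assoc K H H H (pure_tensor K ?H2 H (comult H v) w))) h"
    unfolding tensor_map_def sweedler_def[symmetric]
    by (rule sweedler_comp[OF T3' U m1 module_hom_comp[OF \<Gamma> ash] h])
  also have "... = sweedler U (\<lambda>a c. sweedler U (\<lambda>a b. \<gamma> a b c) a) h"
  proof (rule sweedler_cong[OF U _ h])
    show "(\<lambda>v w. \<Gamma> (tensor_assoc K H H H (pure_tensor K ?H2 H (comult H v) w))) \<in> bilinear_maps K H H U"
      by (rule bilinear_comp[OF module_hom_comp[OF \<Gamma> ash] m1])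
    fix v w assume v: "v \<in> carrier H" and w: "w \<in> carrier H"
    have "\<Gamma> (tensor_assoc K H H H (pure_tensor K ?H2 H (comult H v) w)) =
        sweedler U (\<lambda>u v'. \<Gamma> (pure_tensor K H ?H2 u (pure_tensor K H H v' w))) v"
      unfolding asp[OF comult_in[OF v] w] sweedler_def[symmetric]
      by (rule sweedler_comp[OF H3 U in3[OF w] \<Gamma> v])
    also have "... = sweedler U (\<lambda>a b. \<gamma> a b w) v"
    proof (rule sweedler_cong[OF U _ v])
      show "(\<lambda>u v'. \<Gamma> (pure_tensor K H ?H2 u (pure_tensor K H H v' w))) \<in> bilinear_maps K H H U"
        by (rule bilinear_comp[OF \<Gamma> in3[OF w]])
    qed (simp only: \<Gamma>p pure_tensor_in[OF H H] tensor_lift_pure[OF H H U bl] w)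
    finally show "\<Gamma> (tensor_assoc K H H H (pure_tensor K ?H2 H (comult H v) w)) = sweedler U (\<lambda>a b. \<gamma> a b w) v" .
  qed
  finally show ?thesis
    unfolding R[symmetric] by (simp only: coassociative[OF h])
qed

text \<open>Here and in the next three results a counit or antipode axiom is composed with an
  arbitrary linear map \<open>L\<close>, the form in which it can be used inside a longer Sweedler
  sum.\<close>

lemma sweedler_counit_left:
  assumes U: "module K U" and L: "L \<in> module_hom K H U" and h: "h \<in> carrier H"
  shows "sweedler U (\<lambda>a b. counit H a \<odot>\<^sub>U L b) h = L h"
proof -
  have b: "(\<lambda>a b. counit H a \<odot>\<^sub>H b) \<in> bilinear_maps K H H H"
    by (rule bilinear_mapsI[OF module_hom_smult_left[OF H_module module_hom_id counit_in]
          module_hom_smult_right[OF H_module counit_module_hom]])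
  have "L h = L (sweedler H (\<lambda>a b. counit H a \<odot>\<^sub>H b) h)"
    by (simp only: sweedler_def counit_left[OF h])
  also have "... = sweedler U (\<lambda>a b. L (counit H a \<odot>\<^sub>H b)) h"
    by (rule sweedler_comp[OF H_module U b L h])
  also have "... = sweedler U (\<lambda>a b. counit H a \<odot>\<^sub>U L b) h"
    by (rule sweedler_cong[OF U bilinear_comp[OF L b] h]) (rule module_hom_smult[OF L counit_in])
  finally show ?thesis ..
qed

lemma sweedler_counit_right:
  assumes U: "module K U" and L: "L \<in> module_hom K H U" and h: "h \<in> carrier H"
  shows "sweedler U (\<lambda>a b. counit H b \<odot>\<^sub>U L a) h = L h"
proof -
  have b: "(\<lambda>a b. counit H b \<odot>\<^sub>H a) \<in> bilinear_maps K H H H"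
    by (rule bilinear_mapsI[OF module_hom_smult_right[OF H_module counit_module_hom]
          module_hom_smult_left[OF H_module module_hom_id counit_in]])
  have "L h = L (sweedler H (\<lambda>a b. counit H b \<odot>\<^sub>H a) h)"
    by (simp only: sweedler_def counit_right[OF h])
  also have "... = sweedler U (\<lambda>a b. L (counit H b \<odot>\<^sub>H a)) h"
    by (rule sweedler_comp[OF H_module U b L h])
  also have "... = sweedler U (\<lambda>a b. counit H b \<odot>\<^sub>U L a) h"
    by (rule sweedler_cong[OF U bilinear_comp[OF L b] h]) (rule module_hom_smult[OF L counit_in])
  finally show ?thesis ..
qed

lemma sweedler_antipode_left:
  assumes U: "module K U" and L: "L \<in> module_hom K H U" and h: "h \<in> carrier H"
  shows "sweedler U (\<lambda>a b. L (antipode H a \<otimes>\<^sub>H b)) h = counit H h \<odot>\<^sub>U L \<one>\<^sub>H"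
proof -
  have b: "(\<lambda>a b. antipode H a \<otimes>\<^sub>H b) \<in> bilinear_maps K H H H"
    by (rule bilinear_mapsI[OF mult_right_hom[OF module_hom_id antipode_in] mult_left_hom[OF antipode_linear]])
  have "sweedler U (\<lambda>a b. L (antipode H a \<otimes>\<^sub>H b)) h = L (sweedler H (\<lambda>a b. antipode H a \<otimes>\<^sub>H b) h)"
    by (rule sweedler_comp[OF H_module U b L h, symmetric])
  then show ?thesis
    by (simp only: sweedler_def antipode_left[OF h] module_hom_smult[OF L counit_in[OF h] one_closed])
qed

lemma sweedler_antipode_right:
  assumes U: "module K U" and L: "L \<in> module_hom K H U" and h: "h \<in> carrier H"
  shows "sweedler U (\<lambda>a b. L (a \<otimes>\<^sub>H antipode H b)) h = counit H h \<odot>\<^sub>U L \<one>\<^sub>H"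
proof -
  have b: "(\<lambda>a b. a \<otimes>\<^sub>H antipode H b) \<in> bilinear_maps K H H H"
    by (rule bilinear_mapsI[OF mult_right_hom[OF antipode_linear] mult_left_hom[OF module_hom_id antipode_in]])
  have "sweedler U (\<lambda>a b. L (a \<otimes>\<^sub>H antipode H b)) h = L (sweedler H (\<lambda>a b. a \<otimes>\<^sub>H antipode H b) h)"
    by (rule sweedler_comp[OF H_module U b L h, symmetric])
  then show ?thesis
    by (simp only: sweedler_def antipode_right[OF h] module_hom_smult[OF L counit_in[OF h] one_closed])
qed

end

section \<open>Coordinates in finite-dimensional spaces\<close>

lemma (in abelian_monoid) finsum_single:
  assumes "finite I" "i \<in> I" "f i \<in> carrier G" "\<And>j. \<lbrakk>j \<in> I; j \<noteq> i\<rbrakk> \<Longrightarrow> f j = \<zero>"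
  shows "(\<Oplus>j\<in>I. f j) = f i"
proof -
  have "(\<Oplus>j\<in>I. f j) = (\<Oplus>j\<in>{i}. f j)"
    by (rule add.finprod_mono_neutral_cong_right) (use assms in \<open>auto, metis zero_closed\<close>)
  then show ?thesis using assms by simp
qed

lemma (in abelian_monoid) finsum_two:
  assumes "finite I" "i \<in> I" "k \<in> I" "i \<noteq> k" "f i \<in> carrier G" "f k \<in> carrier G"
    and "\<And>j. \<lbrakk>j \<in> I; j \<noteq> i; j \<noteq> k\<rbrakk> \<Longrightarrow> f j = \<zero>"
  shows "(\<Oplus>j\<in>I. f j) = f i \<oplus> f k"
proof -
  have "(\<Oplus>j\<in>I. f j) = (\<Oplus>j\<in>{i, k}. f j)"
    by (rule add.finprod_mono_neutral_cong_right) (use assms in \<open>auto, metis zero_closed\<close>)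
  then show ?thesis using assms by simp
qed

context vectorspace
begin

text \<open>The exchange lemma enlarges \<open>B\<close> to a spanning set with at most
  \<open>dim\<close> elements, and such a spanning set is a basis.\<close>

lemma basis_extension:
  assumes fd: "fin_dim" and li: "lin_indpt B" and B: "B \<subseteq> carrier V"
  shows "\<exists>A. finite A \<and> basis A \<and> B \<subseteq> A"
proof -
  obtain \<beta> where \<beta>: "finite \<beta>" "basis \<beta>" using finite_basis_exists[OF fd] by blast
  then have \<beta>': "\<beta> \<subseteq> carrier V" "span \<beta> = carrier V" by (auto simp: basis_def)
  have fB: "finite B" using li_le_dim[OF fd B li] by simp
  obtain C where C: "finite C" "C \<subseteq> carrier V" "int (card C) \<le> int (card \<beta>) - int (card B)"
    "span (B \<union> C) = span \<beta>"
    using replacement[OF fB \<beta>(1) \<beta>'(1) li] B \<beta>' by auto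
  have "card (B \<union> C) \<le> dim"
    using C(3) card_Un_le[of B C] dim_basis[OF \<beta>] by linarith
  then have "basis (B \<union> C)"
    using fB C B \<beta>' by (intro dim_gen_is_basis) auto
  then show ?thesis using fB C by blast
qed

lemma basis_coordinate:
  assumes fin: "finite A" and A: "basis A" and b: "b \<in> A"
  shows "\<exists>\<xi>\<in>module_hom K V (base_algebra K). \<xi> b = \<one>\<^sub>K \<and> (\<forall>x\<in>A - {b}. \<xi> x = \<zero>\<^sub>K)"
proof -
  have AV: "A \<subseteq> carrier V" using A by (simp add: basis_def)
  \<comment> \<open>The coefficient family of \<open>v\<close>, defined by unique existence;
    linearity of a single coefficient then follows from uniqueness alone.\<close>
  define c where "c v = (THE a. a \<in> A \<rightarrow>\<^sub>E carrier K \<and> lincomb a A = v)" for v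
  have ex1: "\<exists>!a. a \<in> A \<rightarrow>\<^sub>E carrier K \<and> lincomb a A = v" if "v \<in> carrier V" for v
    using basis_criterion[OF fin AV] A that by blast
  have cin: "c v \<in> A \<rightarrow>\<^sub>E carrier K" and clin: "lincomb (c v) A = v" if "v \<in> carrier V" for v
    using theI'[OF ex1[OF that]] unfolding c_def by blast+
  have cK: "c v x \<in> carrier K" if "v \<in> carrier V" "x \<in> A" for v x
    using cin[OF that(1)] that(2) by auto
  have cuniq: "c v x = a x" if a: "a \<in> A \<rightarrow> carrier K" "lincomb a A = v" and x: "x \<in> A" for a v x
  proof -
    have v: "v \<in> carrier V" using a AV by auto
    have "lincomb (restrict a A) A = lincomb a A"
      by (rule lincomb_cong) (use a AV in auto)
    then have "restrict a A \<in> A \<rightarrow>\<^sub>E carrier K \<and> lincomb (restrict a A) A = v" using a by auto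
    then have "c v = restrict a A" using ex1[OF v] cin[OF v] clin[OF v] by blast
    then show ?thesis using x by simp
  qed
  define \<xi> where "\<xi> v = c v b" for v
  have "\<xi> \<in> module_hom K V (base_algebra K)"
  proof (rule module_homI)
    fix v assume v: "v \<in> carrier V"
    show "\<xi> v \<in> carrier (base_algebra K)" using cK[OF v b] by (simp add: \<xi>_def)
    {
      fix w assume w: "w \<in> carrier V"
      have "lincomb (\<lambda>x. c v x \<oplus>\<^sub>K c w x) A = v \<oplus>\<^sub>V w"
        using cK[OF v] cK[OF w] fin AV by (subst lincomb_sum) (auto simp: clin v w)
      then show "\<xi> (v \<oplus>\<^sub>V w) = \<xi> v \<oplus>\<^bsub>base_algebra K\<^esub> \<xi> w"
        unfolding \<xi>_def using cK[OF v] cK[OF w] b by (subst cuniq) auto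
    }
    fix k assume k: "k \<in> carrier K"
    have "lincomb (\<lambda>x. k \<otimes>\<^sub>K c v x) A = k \<odot>\<^sub>V v"
      using cK[OF v] AV k by (subst lincomb_smult) (auto simp: clin v)
    then show "\<xi> (k \<odot>\<^sub>V v) = k \<odot>\<^bsub>base_algebra K\<^esub> \<xi> v"
      unfolding \<xi>_def using cK[OF v] b k by (subst cuniq) auto
  qed
  moreover have "\<xi> x = (if x = b then \<one>\<^sub>K else \<zero>\<^sub>K)" if x: "x \<in> A" for x
  proof -
    have xV: "x \<in> carrier V" using x AV by auto
    have "lincomb (\<lambda>y. if y = x then \<one>\<^sub>K else \<zero>\<^sub>K) A = (if x = x then \<one>\<^sub>K else \<zero>\<^sub>K) \<odot>\<^sub>V x"
      unfolding lincomb_def using fin x xV AV by (intro M.finsum_single) auto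
    then have "lincomb (\<lambda>y. if y = x then \<one>\<^sub>K else \<zero>\<^sub>K) A = x" using xV by simp
    then show ?thesis unfolding \<xi>_def using b by (subst cuniq[of "\<lambda>y. if y = x then \<one>\<^sub>K else \<zero>\<^sub>K"]) auto
  qed
  ultimately show ?thesis using b by (intro bexI[of _ \<xi>]) auto
qed

lemma dual_functional:
  assumes "fin_dim" "lin_indpt B" "B \<subseteq> carrier V" "b \<in> B"
  shows "\<exists>\<xi>\<in>module_hom K V (base_algebra K). \<xi> b = \<one>\<^sub>K \<and> (\<forall>x\<in>B - {b}. \<xi> x = \<zero>\<^sub>K)"
proof -
  obtain A where A: "finite A" "basis A" "B \<subseteq> A" using basis_extension[OF assms(1-3)] by blast
  have "b \<in> A" using A(3) assms(4) by blast
  from basis_coordinate[OF A(1,2) this] show ?thesis using A(3) by blast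
qed

lemma nonzero_functional:
  assumes "fin_dim" "x \<in> carrier V" "x \<noteq> \<zero>\<^sub>V"
  shows "\<exists>\<xi>\<in>module_hom K V (base_algebra K). \<xi> x = \<one>\<^sub>K"
proof -
  have "lin_indpt {x}"
  proof (rule finite_lin_indpt2)
    fix a assume a: "a \<in> {x} \<rightarrow> carrier K" "lincomb a {x} = \<zero>\<^sub>V"
    have "a x \<odot>\<^sub>V x = \<zero>\<^sub>V" using a assms by (simp add: lincomb_def)
    have "a x = \<zero>\<^sub>K"
    proof (rule ccontr)
      assume "a x \<noteq> \<zero>\<^sub>K"
      then have u: "a x \<in> carrier K" "inv\<^bsub>K\<^esub> a x \<in> carrier K" "inv\<^bsub>K\<^esub> a x \<otimes>\<^sub>K a x = \<one>\<^sub>K"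
        using a(1) field_Units by (auto simp: Units_l_inv)
      have "x = (inv\<^bsub>K\<^esub> a x \<otimes>\<^sub>K a x) \<odot>\<^sub>V x" using u assms(2) by simp
      also have "... = \<zero>\<^sub>V"
        unfolding smult_assoc1[OF u(2,1) assms(2)] \<open>a x \<odot>\<^sub>V x = \<zero>\<^sub>V\<close> by (rule smult_r_null[OF u(2)])
      finally show False using assms(3) by simp
    qed
    then show "\<forall>v\<in>{x}. a v = \<zero>\<^sub>K" by simp
  qed (use assms in auto)
  then show ?thesis using dual_functional[of "{x}" x] assms by auto
qed

text \<open>An indexed version, because the bases below are labelled by \<open>G\<close> together
  with a sign bit. Independence of the family makes the indexing injective, so the cardinality
  condition turns it into a basis.\<close>

lemma family_coordinates:
  assumes fd: "fin_dim" and I: "finite I" "card I = dim" and v: "\<And>i. i \<in> I \<Longrightarrow> v i \<in> carrier V"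
    and indep: "\<And>c i. \<lbrakk>\<And>i. i \<in> I \<Longrightarrow> c i \<in> carrier K; (\<Oplus>\<^bsub>V\<^esub>i\<in>I. c i \<odot>\<^sub>V v i) = \<zero>\<^sub>V; i \<in> I\<rbrakk> \<Longrightarrow> c i = \<zero>\<^sub>K"
  shows "\<exists>\<xi>. (\<forall>i\<in>I. \<xi> i \<in> module_hom K V (base_algebra K)) \<and>
    (\<forall>x\<in>carrier V. x = (\<Oplus>\<^bsub>V\<^esub>i\<in>I. \<xi> i x \<odot>\<^sub>V v i)) \<and>
    (\<forall>i\<in>I. \<forall>j\<in>I. \<xi> i (v j) = (if i = j then \<one>\<^sub>K else \<zero>\<^sub>K))"
proof -
  have inj: "inj_on v I"
  proof (rule inj_onI, rule ccontr)
    fix i j assume ij: "i \<in> I" "j \<in> I" "v i = v j" "i \<noteq> j"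
    \<comment> \<open>If two members of the family coincided, the coefficients one and minus one at
      their indices would give a nontrivial relation.\<close>
    define c where "c k = (if k = i then \<one>\<^sub>K else if k = j then \<ominus>\<^sub>K \<one>\<^sub>K else \<zero>\<^sub>K)" for k
    have "(\<Oplus>\<^bsub>V\<^esub>k\<in>I. c k \<odot>\<^sub>V v k) = c i \<odot>\<^sub>V v i \<oplus>\<^sub>V c j \<odot>\<^sub>V v j"
      using I ij v by (intro M.finsum_two) (auto simp: c_def)
    also have "... = \<zero>\<^sub>V" using ij v[of i] by (simp add: c_def smult_minus_1 M.r_neg)
    finally have sum: "(\<Oplus>\<^bsub>V\<^esub>k\<in>I. c k \<odot>\<^sub>V v k) = \<zero>\<^sub>V" .
    have "c k \<in> carrier K" for k by (simp add: c_def)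
    then have "c i = \<zero>\<^sub>K" using indep[OF _ sum ij(1)] by blast
    then show False by (simp add: c_def)
  qed
  have vI: "v ` I \<subseteq> carrier V" using v by auto
  have lc: "lincomb a (v ` I) = (\<Oplus>\<^bsub>V\<^esub>i\<in>I. a (v i) \<odot>\<^sub>V v i)" if "a \<in> v ` I \<rightarrow> carrier K" for a
    unfolding lincomb_def using that v inj by (subst M.add.finprod_reindex) auto
  have "lin_indpt (v ` I)"
  proof (rule finite_lin_indpt2)
    fix a assume a: "a \<in> v ` I \<rightarrow> carrier K" "lincomb a (v ` I) = \<zero>\<^sub>V"
    have "(\<Oplus>\<^bsub>V\<^esub>i\<in>I. a (v i) \<odot>\<^sub>V v i) = \<zero>\<^sub>V"
      using lc[OF a(1)] a(2) by simp
    then show "\<forall>x\<in>v ` I. a x = \<zero>\<^sub>K" using indep[of "\<lambda>i. a (v i)"] a by auto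
  qed (use I vI in auto)
  then have bas: "basis (v ` I)"
    using fd I vI inj by (intro dim_li_is_basis) (auto simp: card_image)
  have "\<exists>\<xi>\<in>module_hom K V (base_algebra K). \<xi> (v i) = \<one>\<^sub>K \<and> (\<forall>x\<in>v ` I - {v i}. \<xi> x = \<zero>\<^sub>K)"
    if "i \<in> I" for i
    using that I bas by (intro basis_coordinate) auto
  then obtain \<xi> where \<xi>: "\<And>i. i \<in> I \<Longrightarrow> \<xi> i \<in> module_hom K V (base_algebra K)"
    "\<And>i. i \<in> I \<Longrightarrow> \<xi> i (v i) = \<one>\<^sub>K" "\<And>i x. i \<in> I \<Longrightarrow> x \<in> v ` I - {v i} \<Longrightarrow> \<xi> i x = \<zero>\<^sub>K"
    by metis
  have \<xi>': "\<xi> i (v j) = (if i = j then \<one>\<^sub>K else \<zero>\<^sub>K)" if "i \<in> I" "j \<in> I" for i j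
    using that \<xi>(2)[of i] \<xi>(3)[of i "v j"] inj by (auto simp: inj_on_eq_iff)
  have "x = (\<Oplus>\<^bsub>V\<^esub>i\<in>I. \<xi> i x \<odot>\<^sub>V v i)" if x: "x \<in> carrier V" for x
  proof -
    have "x \<in> span (v ` I)" using bas x by (simp add: basis_def)
    then obtain a where a: "a \<in> v ` I \<rightarrow> carrier K" "lincomb a (v ` I) = x"
      using finite_in_span[of "v ` I" x] I vI by auto
    have x_eq: "x = (\<Oplus>\<^bsub>V\<^esub>j\<in>I. a (v j) \<odot>\<^sub>V v j)"
      using lc[OF a(1)] a(2) by simp
    have "\<xi> i x = a (v i)" if i: "i \<in> I" for i
    proof -
      have aK: "a (v j) \<in> carrier K" if "j \<in> I" for j using a that by auto
      have "\<xi> i x = (\<Oplus>\<^bsub>base_algebra K\<^esub>j\<in>I. \<xi> i (a (v j) \<odot>\<^sub>V v j))"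
        unfolding x_eq
        by (rule module_hom_finsum[OF module_axioms base_algebra_module[OF field_axioms] \<xi>(1)[OF i] I(1)])
          (use aK v in auto)
      also have "... = \<xi> i (a (v i) \<odot>\<^sub>V v i)"
      proof (rule abelian_monoid.finsum_single)
        show "abelian_monoid (base_algebra K)"
          using base_algebra_module[OF field_axioms] by (simp add: module_def abelian_group_def)
        fix j assume j: "j \<in> I" "j \<noteq> i"
        show "\<xi> i (a (v j) \<odot>\<^sub>V v j) = \<zero>\<^bsub>base_algebra K\<^esub>"
          unfolding module_hom_smult[OF \<xi>(1)[OF i] aK[OF j(1)] v[OF j(1)]]
          using \<xi>'[OF i j(1)] j aK by simp
      qed (use I i aK v module_hom_in[OF \<xi>(1)[OF i]] in auto)
      also have "... = a (v i)"
        unfolding module_hom_smult[OF \<xi>(1)[OF i] aK[OF i] v[OF i]] using \<xi>' i aK by simp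
      finally show ?thesis .
    qed
    then have "(\<Oplus>\<^bsub>V\<^esub>i\<in>I. \<xi> i x \<odot>\<^sub>V v i) = (\<Oplus>\<^bsub>V\<^esub>i\<in>I. a (v i) \<odot>\<^sub>V v i)"
      using a v by (intro M.finsum_cong') auto
    then show ?thesis using x_eq by simp
  qed
  then show ?thesis using \<xi>(1) \<xi>' by blast
qed

end

section \<open>The group algebra of an abelian group of group-like elements\<close>

lemma (in abelian_monoid) finsum_swap:
  assumes "finite A" "finite B" "\<And>i j. \<lbrakk>i \<in> A; j \<in> B\<rbrakk> \<Longrightarrow> f i j \<in> carrier G"
  shows "(\<Oplus>i\<in>A. \<Oplus>j\<in>B. f i j) = (\<Oplus>j\<in>B. \<Oplus>i\<in>A. f i j)"
  using assms(1,3)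
proof (induction A)
  case empty
  then show ?case by simp
next
  case (insert x A)
  have "(\<Oplus>i\<in>insert x A. \<Oplus>j\<in>B. f i j) = (\<Oplus>j\<in>B. f x j) \<oplus> (\<Oplus>i\<in>A. \<Oplus>j\<in>B. f i j)"
    using insert by (intro finsum_insert finsum_closed) auto
  also have "... = (\<Oplus>j\<in>B. f x j) \<oplus> (\<Oplus>j\<in>B. \<Oplus>i\<in>A. f i j)"
    using insert by simp
  also have "... = (\<Oplus>j\<in>B. f x j \<oplus> (\<Oplus>i\<in>A. f i j))"
    using insert by (intro finsum_addf[symmetric] finsum_closed) auto
  also have "... = (\<Oplus>j\<in>B. \<Oplus>i\<in>insert x A. f i j)"
    using insert by (intro finsum_cong') (auto intro!: finsum_closed simp: finsum_insert Pi_iff)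
  finally show ?case .
qed

lemma (in comm_monoid) finprod_translate:
  assumes "group Q" "h \<in> carrier Q" "f \<in> carrier Q \<rightarrow> carrier G"
  shows "finprod G (\<lambda>g. f (h \<otimes>\<^sub>Q g)) (carrier Q) = finprod G f (carrier Q)"
proof -
  interpret Q: group Q by fact
  have inj: "inj_on ((\<otimes>\<^bsub>Q\<^esub>) h) (carrier Q)" using assms(2) by (auto intro!: inj_onI)
  have im: "(\<otimes>\<^bsub>Q\<^esub>) h ` carrier Q = carrier Q"
  proof (intro equalityI subsetI)
    fix g assume "g \<in> carrier Q"
    then show "g \<in> (\<otimes>\<^bsub>Q\<^esub>) h ` carrier Q"
      using assms(2) by (intro image_eqI[of _ _ "inv\<^bsub>Q\<^esub> h \<otimes>\<^sub>Q g"]) (auto simp: Q.m_assoc[symmetric])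
  qed (use assms(2) in auto)
  show ?thesis
    using finprod_reindex[of f "(\<otimes>\<^bsub>Q\<^esub>) h" "carrier Q"] inj assms(3) by (simp add: im)
qed

lemmas (in abelian_monoid) finsum_translate = add.finprod_translate

text \<open>Translating the summation index by \<open>h\<close> multiplies the sum by
  \<open>u h\<close>, which differs from one, and a domain has no zero divisors.\<close>

lemma (in domain) hom_sum_zero:
  assumes Q: "group G" "finite (carrier G)" and u: "u \<in> hom G (units_of R)"
    and h: "h \<in> carrier G" "u h \<noteq> \<one>"
  shows "(\<Oplus>g\<in>carrier G. u g) = \<zero>"
proof -
  interpret Q: group G by fact
  have u_in: "u g \<in> carrier R" if "g \<in> carrier G" for g
    using u that by (auto simp: hom_def units_of_def Units_def)
  let ?S = "\<Oplus>g\<in>carrier G. u g"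
  have S: "?S \<in> carrier R" using u_in by (intro finsum_closed) auto
  have "?S = (\<Oplus>g\<in>carrier G. u (h \<otimes>\<^sub>G g))"
    using u_in by (intro finsum_translate[symmetric, OF Q(1) h(1)]) auto
  also have "... = (\<Oplus>g\<in>carrier G. u h \<otimes> u g)"
    using u u_in h by (intro finsum_cong') (auto simp: hom_def units_of_def)
  also have "... = u h \<otimes> ?S"
    using u_in h Q(2) by (intro finsum_rdistr[symmetric]) auto
  finally have "?S = u h \<otimes> ?S" .
  then have "(u h \<ominus> \<one>) \<otimes> ?S = \<zero>" using S u_in[OF h(1)] by (simp add: minus_eq l_distr l_minus r_neg)
  moreover have "u h \<ominus> \<one> \<noteq> \<zero>" using h(2) u_in[OF h(1)] by simp
  ultimately show ?thesis using integral[of "u h \<ominus> \<one>" ?S] S u_in[OF h(1)] by auto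
qed

lemma base_algebra_finsum: "finsum (base_algebra K) f A = finsum K f A"
  by (simp add: finsum_def finprod_def)

text \<open>The field enters through \<open>b\<close>, \<open>order_nonzero\<close> and
  \<open>two_nonzero\<close> only. The symmetric nondegenerate bicharacter \<open>b\<close> replaces
  an identification of \<open>G\<close> with its character group, and \<open>dim_eq\<close> gives
  the group algebra half of the dimension.\<close>

locale hopf_grouplikes = hopf_algebra K H + G: comm_group G
  for K :: "('k, 'r) ring_scheme" (structure) and H :: "('k, 'h, 'x) hopf_scheme" (structure)
    and G :: "('g, 'e) monoid_scheme" +
  fixes \<iota> :: "'g \<Rightarrow> 'h" and b :: "'g \<Rightarrow> 'g \<Rightarrow> 'k"
  assumes finite_G: "finite (carrier G)"
    and iota_iso: "\<iota> \<in> iso G (grouplikes K H)"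
    and b_hom: "a \<in> carrier G \<Longrightarrow> b a \<in> hom G (units_of K)"
    and b_sym: "\<lbrakk>a \<in> carrier G; c \<in> carrier G\<rbrakk> \<Longrightarrow> b a c = b c a"
    and b_nondegenerate: "\<lbrakk>a \<in> carrier G; \<And>c. c \<in> carrier G \<Longrightarrow> b a c = \<one>\<rbrakk> \<Longrightarrow> a = \<one>\<^sub>G"
    and order_nonzero: "[order G] \<cdot> \<one> \<noteq> \<zero>"
    and two_nonzero: "\<one> \<oplus> \<one> \<noteq> \<zero>"
    and finite_dim: "vectorspace.fin_dim K H"
    and dim_eq: "vectorspace.dim K H = 2 * order G"
begin

abbreviation ginv where "ginv \<equiv> m_inv G"

lemma iota_in: "a \<in> carrier G \<Longrightarrow> \<iota> a \<in> carrier H"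
  and iota_mult: "\<lbrakk>a \<in> carrier G; c \<in> carrier G\<rbrakk> \<Longrightarrow> \<iota> (a \<otimes>\<^sub>G c) = \<iota> a \<otimes>\<^sub>H \<iota> c"
  and iota_comult: "a \<in> carrier G \<Longrightarrow> comult H (\<iota> a) = pure_tensor K H H (\<iota> a) (\<iota> a)"
  and iota_counit: "a \<in> carrier G \<Longrightarrow> counit H (\<iota> a) = \<one>"
  and iota_inj: "inj_on \<iota> (carrier G)"
  using iota_iso by (auto simp: iso_def hom_def grouplikes_def bij_betw_def)

lemma iota_image: "\<iota> ` carrier G = {g \<in> carrier H. comult H g = pure_tensor K H H g g \<and> counit H g = \<one>}"
  using iota_iso by (auto simp: iso_def grouplikes_def bij_betw_def)

text \<open>At this point \<open>grouplikes K H\<close> is just a set with a product. The unit of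
  \<open>H\<close> is group-like, hence equal to some \<open>\<iota> a\<close>, and multiplying it
  by the image of the unit of \<open>G\<close> identifies the two.\<close>

lemma iota_one: "\<iota> \<one>\<^sub>G = \<one>\<^sub>H"
proof -
  have "\<one>\<^sub>H \<in> \<iota> ` carrier G"
    unfolding iota_image using comult_hom counit_hom
    by (auto simp: alg_hom_def ring_hom_def tensor_algebra_def Let_def)
  then obtain a where a: "a \<in> carrier G" "\<iota> a = \<one>\<^sub>H" by auto
  have "\<iota> \<one>\<^sub>G = \<iota> \<one>\<^sub>G \<otimes>\<^sub>H \<iota> a" using iota_in[OF G.one_closed] a(2) by simp
  also have "... = \<iota> a" using iota_mult[OF G.one_closed a(1)] a(1) by simp
  finally show ?thesis using a(2) by simp
qed

lemma sweedler_iota: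
  assumes "module K U" "\<beta> \<in> bilinear_maps K H H U" "a \<in> carrier G"
  shows "sweedler U \<beta> (\<iota> a) = \<beta> (\<iota> a) (\<iota> a)"
  by (rule sweedler_pure[OF assms(1,2) iota_in[OF assms(3)] iota_in[OF assms(3)] iota_comult[OF assms(3)]])

lemma b_in: "\<lbrakk>a \<in> carrier G; c \<in> carrier G\<rbrakk> \<Longrightarrow> b a c \<in> carrier K"
  using b_hom[of a] by (auto simp: hom_def units_of_def Units_def)

lemma b_mult: "\<lbrakk>a \<in> carrier G; c \<in> carrier G; d \<in> carrier G\<rbrakk> \<Longrightarrow> b a (c \<otimes>\<^sub>G d) = b a c \<otimes> b a d"
  using b_hom[of a] by (auto simp: hom_def units_of_def)

lemma b_mult_left: "\<lbrakk>a \<in> carrier G; c \<in> carrier G; d \<in> carrier G\<rbrakk> \<Longrightarrow> b (a \<otimes>\<^sub>G c) d = b a d \<otimes> b c d"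
  using b_mult[of d a c] b_sym by simp

lemma b_one: "a \<in> carrier G \<Longrightarrow> b a \<one>\<^sub>G = \<one>"
proof -
  assume a: "a \<in> carrier G"
  interpret U: group "units_of K" by (rule vec.R.units_group)
  interpret group_hom G "units_of K" "b a" by unfold_locales (rule b_hom[OF a])
  show "b a \<one>\<^sub>G = \<one>" using hom_one by (simp add: units_of_one)
qed

lemma b_one_left: "a \<in> carrier G \<Longrightarrow> b \<one>\<^sub>G a = \<one>"
  using b_one b_sym by simp

lemma b_inverse: "\<lbrakk>a \<in> carrier G; c \<in> carrier G\<rbrakk> \<Longrightarrow> b a c \<otimes> b (ginv a) c = \<one>"
  using b_mult_left[of a "ginv a" c] b_one_left by simp

lemma b_inv_swap:
  assumes "a \<in> carrier G" "c \<in> carrier G"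
  shows "b (ginv a) c = b a (ginv c)"
proof -
  have "b (ginv a) c = b (ginv a) c \<otimes> (b a c \<otimes> b a (ginv c))"
    using b_mult[OF assms G.inv_closed[OF assms(2)]] assms
    by (simp only: G.r_inv b_one b_in G.inv_closed vec.R.r_one flip: b_mult)
  also have "... = (b a c \<otimes> b (ginv a) c) \<otimes> b a (ginv c)"
    using assms b_in by (simp add: vec.R.m_ac)
  also have "... = b a (ginv c)" using assms b_inverse b_in by simp
  finally show ?thesis .
qed

lemma b_sum: "a \<in> carrier G \<Longrightarrow> (\<Oplus> c\<in>carrier G. b a c) = (if a = \<one>\<^sub>G then [order G] \<cdot> \<one> else \<zero>)"
proof -
  assume a: "a \<in> carrier G"
  let ?S = "\<Oplus> c\<in>carrier G. b a c"
  have S: "?S \<in> carrier K" using a b_in by (intro vec.R.finsum_closed) auto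
  show ?thesis
  proof (cases "a = \<one>\<^sub>G")
    case True
    have "?S = (\<Oplus> c\<in>carrier G. \<one>)" using True b_one_left by (intro vec.R.finsum_cong') auto
    also have "... = [order G] \<cdot> \<one>"
      using vec.R.add.finprod_const[of "\<one>" "carrier G"] by (simp add: order_def)
    finally show ?thesis using True by simp
  next
    case False
    then obtain c where c: "c \<in> carrier G" "b a c \<noteq> \<one>" using b_nondegenerate[OF a] by blast
    have "?S = \<zero>" by (rule vec.hom_sum_zero[OF G.is_group finite_G b_hom[OF a] c])
    then show ?thesis using False by simp
  qed
qed

definition \<nu> where "\<nu> = inv ([order G] \<cdot> \<one>)"

lemma nu: "\<nu> \<in> carrier K" "\<nu> \<otimes> ([order G] \<cdot> \<one>) = \<one>" "\<nu> \<noteq> \<zero>"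
proof -
  have "[order G] \<cdot> \<one> \<in> Units K" using order_nonzero vec.field_Units by auto
  then show 1: "\<nu> \<in> carrier K" "\<nu> \<otimes> ([order G] \<cdot> \<one>) = \<one>" unfolding \<nu>_def by auto
  then show "\<nu> \<noteq> \<zero>" using vec.R.l_null[of "[order G] \<cdot> \<one>"] by auto
qed

text \<open>The primitive idempotents of the group algebra; \<open>b\<close> identifies \<open>G\<close> with its character group.\<close>

definition idem where "idem a = (\<Oplus>\<^bsub>H\<^esub> g\<in>carrier G. (\<nu> \<otimes> b (ginv a) g) \<odot>\<^sub>H \<iota> g)"

lemma idem_summand: "\<lbrakk>a \<in> carrier G; g \<in> carrier G\<rbrakk> \<Longrightarrow> (\<nu> \<otimes> b (ginv a) g) \<odot>\<^sub>H \<iota> g \<in> carrier H"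
  using b_in nu iota_in by (intro vec.smult_closed vec.R.m_closed) auto

lemma idem_in: "a \<in> carrier G \<Longrightarrow> idem a \<in> carrier H"
  unfolding idem_def using idem_summand by (intro vec.M.finsum_closed) auto

lemma hom_idem:
  assumes U: "module K U" and L: "L \<in> module_hom K H U" and a: "a \<in> carrier G"
  shows "L (idem a) = (\<Oplus>\<^bsub>U\<^esub> g\<in>carrier G. (\<nu> \<otimes> b (ginv a) g) \<odot>\<^sub>U L (\<iota> g))"
proof -
  interpret U: module K U by fact
  have "L (idem a) = (\<Oplus>\<^bsub>U\<^esub> g\<in>carrier G. L ((\<nu> \<otimes> b (ginv a) g) \<odot>\<^sub>H \<iota> g))"
    unfolding idem_def using idem_summand[OF a]
    by (intro module_hom_finsum[OF H_module U L finite_G]) auto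
  also have "... = (\<Oplus>\<^bsub>U\<^esub> g\<in>carrier G. (\<nu> \<otimes> b (ginv a) g) \<odot>\<^sub>U L (\<iota> g))"
    using a b_in nu iota_in module_hom_in[OF L]
    by (intro U.M.finsum_cong') (auto intro!: module_hom_smult[OF L])
  finally show ?thesis .
qed

text \<open>Shifting the summation index by \<open>h\<close> replaces \<open>g\<close> by the
  quotient of \<open>g\<close> by \<open>h\<close>, and bimultiplicativity extracts the factor
  \<open>b a h\<close>. So \<open>idem a\<close> is a common eigenvector for the character
  \<open>b a\<close>.\<close>

lemma iota_idem:
  assumes h: "h \<in> carrier G" and a: "a \<in> carrier G"
  shows "\<iota> h \<otimes>\<^sub>H idem a = b a h \<odot>\<^sub>H idem a"
proof -
  let ?f = "\<lambda>g. (\<nu> \<otimes> b (ginv a) (ginv h \<otimes>\<^sub>G g)) \<odot>\<^sub>H \<iota> g"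
  have fc: "?f g \<in> carrier H" if "g \<in> carrier G" for g
    using h a that b_in nu iota_in by (intro vec.smult_closed vec.R.m_closed) auto
  have "\<iota> h \<otimes>\<^sub>H idem a = (\<Oplus>\<^bsub>H\<^esub> g\<in>carrier G. (\<nu> \<otimes> b (ginv a) g) \<odot>\<^sub>H (\<iota> h \<otimes>\<^sub>H \<iota> g))"
    by (rule hom_idem[OF H_module mult_right_hom[OF module_hom_id iota_in[OF h]] a])
  also have "... = (\<Oplus>\<^bsub>H\<^esub> g\<in>carrier G. ?f (h \<otimes>\<^sub>G g))"
    using h a b_in nu iota_in
    by (intro vec.M.finsum_cong') (auto simp: iota_mult G.m_assoc[symmetric])
  also have "... = (\<Oplus>\<^bsub>H\<^esub> g\<in>carrier G. ?f g)"
    using fc by (intro vec.M.finsum_translate[OF G.is_group h]) auto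
  also have "... = (\<Oplus>\<^bsub>H\<^esub> g\<in>carrier G. b a h \<odot>\<^sub>H ((\<nu> \<otimes> b (ginv a) g) \<odot>\<^sub>H \<iota> g))"
  proof (rule vec.M.finsum_cong'[OF refl])
    show "(\<lambda>g. b a h \<odot>\<^sub>H ((\<nu> \<otimes> b (ginv a) g) \<odot>\<^sub>H \<iota> g)) \<in> carrier G \<rightarrow> carrier H"
      using h a b_in idem_summand by auto
    fix g assume g: "g \<in> carrier G"
    have "b (ginv a) (ginv h \<otimes>\<^sub>G g) = b a h \<otimes> b (ginv a) g"
      using h a g b_mult[of "ginv a" "ginv h" g] b_inv_swap[of a "ginv h"] by simp
    then have "\<nu> \<otimes> b (ginv a) (ginv h \<otimes>\<^sub>G g) = b a h \<otimes> (\<nu> \<otimes> b (ginv a) g)"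
      using h a g b_in nu by (simp add: vec.R.m_lcomm)
    then show "?f g = b a h \<odot>\<^sub>H ((\<nu> \<otimes> b (ginv a) g) \<odot>\<^sub>H \<iota> g)"
      using h a g b_in nu iota_in by (simp add: vec.smult_assoc1)
  qed
  also have "... = b a h \<odot>\<^sub>H idem a"
    unfolding idem_def using h a b_in idem_summand finite_G
    by (intro vec.finsum_smult_ldistr[symmetric]) auto
  finally show ?thesis .
qed

text \<open>The eigenvalues from \<open>iota_idem\<close> turn the product into a multiple of
  \<open>idem c\<close>, with a character sum for the quotient of \<open>c\<close> by
  \<open>a\<close> as coefficient; \<open>b_sum\<close> evaluates it.\<close>

lemma idem_mult:
  assumes a: "a \<in> carrier G" and c: "c \<in> carrier G"
  shows "idem a \<otimes>\<^sub>H idem c = (if a = c then idem c else \<zero>\<^sub>H)"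
proof -
  have ac: "ginv a \<otimes>\<^sub>G c \<in> carrier G" using a c by simp
  have "idem a \<otimes>\<^sub>H idem c = (\<Oplus>\<^bsub>H\<^esub> g\<in>carrier G. (\<nu> \<otimes> b (ginv a) g) \<odot>\<^sub>H (\<iota> g \<otimes>\<^sub>H idem c))"
    by (rule hom_idem[OF H_module mult_left_hom[OF module_hom_id idem_in[OF c]] a])
  also have "... = (\<Oplus>\<^bsub>H\<^esub> g\<in>carrier G. (\<nu> \<otimes> b (ginv a \<otimes>\<^sub>G c) g) \<odot>\<^sub>H idem c)"
    using a c b_in nu idem_in
    by (intro vec.M.finsum_cong') (auto simp: iota_idem b_mult_left vec.smult_assoc1 vec.R.m_assoc)
  also have "... = (\<Oplus> g\<in>carrier G. \<nu> \<otimes> b (ginv a \<otimes>\<^sub>G c) g) \<odot>\<^sub>H idem c"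
  proof -
    have "(\<lambda>x. x \<odot>\<^sub>H idem c) \<in> module_hom K (base_algebra K) H"
      by (rule module_hom_smult_right[OF H_module module_hom_id idem_in[OF c]])
    from module_hom_finsum[OF K_module H_module this finite_G, of "\<lambda>g. \<nu> \<otimes> b (ginv a \<otimes>\<^sub>G c) g"]
    show ?thesis using ac b_in nu by (simp add: Pi_iff base_algebra_finsum)
  qed
  also have "(\<Oplus> g\<in>carrier G. \<nu> \<otimes> b (ginv a \<otimes>\<^sub>G c) g) = \<nu> \<otimes> (\<Oplus> g\<in>carrier G. b (ginv a \<otimes>\<^sub>G c) g)"
    using ac b_in nu finite_G by (intro vec.R.finsum_rdistr[symmetric]) auto
  also have "... = (if a = c then \<one> else \<zero>)"
  proof -
    have "ginv a \<otimes>\<^sub>G c = \<one>\<^sub>G \<longleftrightarrow> a = c"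
      using a c by (metis G.inv_equality G.inv_inv G.l_inv G.inv_closed)
    then show ?thesis unfolding b_sum[OF ac] using nu by simp
  qed
  finally show ?thesis using idem_in[OF c] by simp
qed

text \<open>After the sums are exchanged, the coefficient of \<open>\<iota> g\<close> is a character
  sum that vanishes unless \<open>g\<close> is the unit.\<close>

lemma sum_idem: "(\<Oplus>\<^bsub>H\<^esub> a\<in>carrier G. idem a) = \<one>\<^sub>H"
proof -
  have "(\<Oplus>\<^bsub>H\<^esub> a\<in>carrier G. idem a) = (\<Oplus>\<^bsub>H\<^esub> g\<in>carrier G. \<Oplus>\<^bsub>H\<^esub> a\<in>carrier G. (\<nu> \<otimes> b (ginv a) g) \<odot>\<^sub>H \<iota> g)"
    unfolding idem_def using finite_G idem_summand by (intro vec.M.finsum_swap) auto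
  also have "... = (\<Oplus>\<^bsub>H\<^esub> g\<in>carrier G. (\<Oplus> a\<in>carrier G. \<nu> \<otimes> b (ginv g) a) \<odot>\<^sub>H \<iota> g)"
  proof (rule vec.M.finsum_cong'[OF refl])
    show "(\<lambda>g. (\<Oplus> a\<in>carrier G. \<nu> \<otimes> b (ginv g) a) \<odot>\<^sub>H \<iota> g) \<in> carrier G \<rightarrow> carrier H"
      using b_in nu iota_in by (auto intro!: vec.smult_closed vec.R.finsum_closed)
    fix g assume g: "g \<in> carrier G"
    have "(\<lambda>x. x \<odot>\<^sub>H \<iota> g) \<in> module_hom K (base_algebra K) H"
      by (rule module_hom_smult_right[OF H_module module_hom_id iota_in[OF g]])
    from module_hom_finsum[OF K_module H_module this finite_G, of "\<lambda>a. \<nu> \<otimes> b (ginv g) a"]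
    have "(\<Oplus> a\<in>carrier G. \<nu> \<otimes> b (ginv g) a) \<odot>\<^sub>H \<iota> g = (\<Oplus>\<^bsub>H\<^esub> a\<in>carrier G. (\<nu> \<otimes> b (ginv g) a) \<odot>\<^sub>H \<iota> g)"
      using g b_in nu by (simp add: Pi_iff base_algebra_finsum)
    also have "... = (\<Oplus>\<^bsub>H\<^esub> a\<in>carrier G. (\<nu> \<otimes> b (ginv a) g) \<odot>\<^sub>H \<iota> g)"
      using g b_in nu iota_in b_inv_swap b_sym
      by (intro vec.M.finsum_cong') auto
    finally show "(\<Oplus>\<^bsub>H\<^esub> a\<in>carrier G. (\<nu> \<otimes> b (ginv a) g) \<odot>\<^sub>H \<iota> g) =
      (\<Oplus> a\<in>carrier G. \<nu> \<otimes> b (ginv g) a) \<odot>\<^sub>H \<iota> g" ..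
  qed
  also have "... = (\<Oplus>\<^bsub>H\<^esub> g\<in>carrier G. (if g = \<one>\<^sub>G then \<one> else \<zero>) \<odot>\<^sub>H \<iota> g)"
  proof (rule vec.M.finsum_cong'[OF refl])
    fix g assume g: "g \<in> carrier G"
    then have ig: "ginv g \<in> carrier G" by simp
    have "(\<Oplus> a\<in>carrier G. \<nu> \<otimes> b (ginv g) a) = \<nu> \<otimes> (\<Oplus> a\<in>carrier G. b (ginv g) a)"
      using ig b_in nu finite_G by (intro vec.R.finsum_rdistr[symmetric]) auto
    also have "... = (if g = \<one>\<^sub>G then \<one> else \<zero>)"
      unfolding b_sum[OF ig] using g nu by simp
    finally show "(\<Oplus> a\<in>carrier G. \<nu> \<otimes> b (ginv g) a) \<odot>\<^sub>H \<iota> g = (if g = \<one>\<^sub>G then \<one> else \<zero>) \<odot>\<^sub>H \<iota> g"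
      by simp
  qed (use iota_in in auto)
  also have "... = (if \<one>\<^sub>G = \<one>\<^sub>G then \<one> else \<zero>) \<odot>\<^sub>H \<iota> \<one>\<^sub>G"
    using finite_G iota_in by (intro vec.M.finsum_single) auto
  finally show ?thesis using iota_one by simp
qed

text \<open>Fourier inversion, obtained by multiplying the decomposition of the unit into
  idempotents by \<open>\<iota> g\<close>.\<close>

lemma iota_eq:
  assumes g: "g \<in> carrier G"
  shows "\<iota> g = (\<Oplus>\<^bsub>H\<^esub> a\<in>carrier G. b a g \<odot>\<^sub>H idem a)"
proof -
  have "\<iota> g = \<iota> g \<otimes>\<^sub>H (\<Oplus>\<^bsub>H\<^esub> a\<in>carrier G. idem a)" using iota_in[OF g] by (simp add: sum_idem)
  also have "... = (\<Oplus>\<^bsub>H\<^esub> a\<in>carrier G. \<iota> g \<otimes>\<^sub>H idem a)"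
    using finite_G iota_in[OF g] idem_in by (intro finsum_rdistr) auto
  also have "... = (\<Oplus>\<^bsub>H\<^esub> a\<in>carrier G. b a g \<odot>\<^sub>H idem a)"
    using g b_in idem_in by (intro vec.M.finsum_cong') (auto simp: iota_idem)
  finally show ?thesis .
qed

text \<open>Only the left factor of \<open>\<iota> g\<close> tensor \<open>\<iota> g\<close> is
  expanded in idempotents. The resulting coefficients \<open>b c g\<close> combine with those of
  \<open>idem a\<close>, and the sum over \<open>g\<close> reassembles an idempotent in the right
  factor.\<close>

lemma sweedler_idem:
  assumes U: "module K U" and \<beta>: "\<beta> \<in> bilinear_maps K H H U" and a: "a \<in> carrier G"
  shows "sweedler U \<beta> (idem a) = (\<Oplus>\<^bsub>U\<^esub> c\<in>carrier G. \<beta> (idem c) (idem (ginv c \<otimes>\<^sub>G a)))"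
proof -
  interpret U: module K U by fact
  note \<beta>_in = bilinear_mapsD(3)[OF \<beta>]
  have "sweedler U \<beta> (idem a) = (\<Oplus>\<^bsub>U\<^esub> g\<in>carrier G. (\<nu> \<otimes> b (ginv a) g) \<odot>\<^sub>U sweedler U \<beta> (\<iota> g))"
    by (rule hom_idem[OF U sweedler_hom[OF U \<beta> module_hom_id] a])
  also have "... = (\<Oplus>\<^bsub>U\<^esub> g\<in>carrier G. \<Oplus>\<^bsub>U\<^esub> c\<in>carrier G. (\<nu> \<otimes> b (ginv (ginv c \<otimes>\<^sub>G a)) g) \<odot>\<^sub>U \<beta> (idem c) (\<iota> g))"
  proof (rule U.M.finsum_cong'[OF refl])
    show "(\<lambda>g. \<Oplus>\<^bsub>U\<^esub> c\<in>carrier G. (\<nu> \<otimes> b (ginv (ginv c \<otimes>\<^sub>G a)) g) \<odot>\<^sub>U \<beta> (idem c) (\<iota> g)) \<in> carrier G \<rightarrow> carrier U"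
      using a b_in nu idem_in iota_in \<beta>_in by (auto intro!: U.M.finsum_closed U.smult_closed)
    fix g assume g: "g \<in> carrier G"
    have "\<beta> (\<iota> g) (\<iota> g) = \<beta> (\<Oplus>\<^bsub>H\<^esub> c\<in>carrier G. b c g \<odot>\<^sub>H idem c) (\<iota> g)"
      by (subst iota_eq[OF g]) simp
    also have "... = (\<Oplus>\<^bsub>U\<^esub> c\<in>carrier G. \<beta> (b c g \<odot>\<^sub>H idem c) (\<iota> g))"
      using g b_in idem_in
      by (intro module_hom_finsum[OF H_module U bilinear_mapsD(2)[OF \<beta> iota_in[OF g]] finite_G]) auto
    also have "... = (\<Oplus>\<^bsub>U\<^esub> c\<in>carrier G. b c g \<odot>\<^sub>U \<beta> (idem c) (\<iota> g))"
      using g b_in idem_in iota_in \<beta>_in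
      by (intro U.M.finsum_cong') (auto simp: module_hom_smult[OF bilinear_mapsD(2)[OF \<beta>]])
    finally have "(\<nu> \<otimes> b (ginv a) g) \<odot>\<^sub>U \<beta> (\<iota> g) (\<iota> g) =
        (\<nu> \<otimes> b (ginv a) g) \<odot>\<^sub>U (\<Oplus>\<^bsub>U\<^esub> c\<in>carrier G. b c g \<odot>\<^sub>U \<beta> (idem c) (\<iota> g))" by simp
    also have "... = (\<Oplus>\<^bsub>U\<^esub> c\<in>carrier G. (\<nu> \<otimes> b (ginv a) g) \<odot>\<^sub>U (b c g \<odot>\<^sub>U \<beta> (idem c) (\<iota> g)))"
      using a g b_in nu idem_in iota_in \<beta>_in finite_G by (intro U.finsum_smult_ldistr) auto
    also have "... = (\<Oplus>\<^bsub>U\<^esub> c\<in>carrier G. (\<nu> \<otimes> b (ginv (ginv c \<otimes>\<^sub>G a)) g) \<odot>\<^sub>U \<beta> (idem c) (\<iota> g))"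
    proof (rule U.M.finsum_cong'[OF refl])
      show "(\<lambda>c. (\<nu> \<otimes> b (ginv (ginv c \<otimes>\<^sub>G a)) g) \<odot>\<^sub>U \<beta> (idem c) (\<iota> g)) \<in> carrier G \<rightarrow> carrier U"
        using a g b_in nu idem_in iota_in \<beta>_in by auto
      fix c assume c: "c \<in> carrier G"
      have "ginv (ginv c \<otimes>\<^sub>G a) = ginv a \<otimes>\<^sub>G c" using a c by (simp add: G.inv_mult_group)
      then have "\<nu> \<otimes> b (ginv (ginv c \<otimes>\<^sub>G a)) g = (\<nu> \<otimes> b (ginv a) g) \<otimes> b c g"
        using a c g b_in nu b_mult_left[of "ginv a" c g] by (simp add: vec.R.m_assoc)
      then show "(\<nu> \<otimes> b (ginv a) g) \<odot>\<^sub>U (b c g \<odot>\<^sub>U \<beta> (idem c) (\<iota> g)) =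
          (\<nu> \<otimes> b (ginv (ginv c \<otimes>\<^sub>G a)) g) \<odot>\<^sub>U \<beta> (idem c) (\<iota> g)"
        using a c g b_in nu idem_in iota_in \<beta>_in by (simp add: U.smult_assoc1)
    qed
    finally show "(\<nu> \<otimes> b (ginv a) g) \<odot>\<^sub>U sweedler U \<beta> (\<iota> g) =
        (\<Oplus>\<^bsub>U\<^esub> c\<in>carrier G. (\<nu> \<otimes> b (ginv (ginv c \<otimes>\<^sub>G a)) g) \<odot>\<^sub>U \<beta> (idem c) (\<iota> g))"
      unfolding sweedler_iota[OF U \<beta> g] .
  qed
  also have "... = (\<Oplus>\<^bsub>U\<^esub> c\<in>carrier G. \<Oplus>\<^bsub>U\<^esub> g\<in>carrier G. (\<nu> \<otimes> b (ginv (ginv c \<otimes>\<^sub>G a)) g) \<odot>\<^sub>U \<beta> (idem c) (\<iota> g))"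
    using a b_in nu idem_in iota_in \<beta>_in finite_G by (intro U.M.finsum_swap) auto
  also have "... = (\<Oplus>\<^bsub>U\<^esub> c\<in>carrier G. \<beta> (idem c) (idem (ginv c \<otimes>\<^sub>G a)))"
  proof (rule U.M.finsum_cong'[OF refl])
    show "(\<lambda>c. \<beta> (idem c) (idem (ginv c \<otimes>\<^sub>G a))) \<in> carrier G \<rightarrow> carrier U"
      using a idem_in \<beta>_in by auto
    fix c assume c: "c \<in> carrier G"
    then show "(\<Oplus>\<^bsub>U\<^esub> g\<in>carrier G. (\<nu> \<otimes> b (ginv (ginv c \<otimes>\<^sub>G a)) g) \<odot>\<^sub>U \<beta> (idem c) (\<iota> g)) =
        \<beta> (idem c) (idem (ginv c \<otimes>\<^sub>G a))"
      using a by (intro hom_idem[OF U bilinear_mapsD(1)[OF \<beta> idem_in[OF c]], symmetric]) auto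
  qed
  finally show ?thesis .
qed

lemma counit_idem:
  assumes a: "a \<in> carrier G"
  shows "counit H (idem a) = (if a = \<one>\<^sub>G then \<one> else \<zero>)"
proof -
  have ia: "ginv a \<in> carrier G" using a by simp
  have "counit H (idem a) = (\<Oplus> g\<in>carrier G. \<nu> \<otimes> b (ginv a) g)"
  proof -
    have "counit H (idem a) = (\<Oplus>\<^bsub>base_algebra K\<^esub> g\<in>carrier G. (\<nu> \<otimes> b (ginv a) g) \<otimes> counit H (\<iota> g))"
      using hom_idem[OF K_module counit_module_hom a] by simp
    also have "... = (\<Oplus>\<^bsub>base_algebra K\<^esub> g\<in>carrier G. \<nu> \<otimes> b (ginv a) g)"
      using ia b_in nu
      by (intro abelian_monoid.finsum_cong' abelian_group.axioms(1) module.axioms(2)[OF K_module])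
        (auto simp: iota_counit)
    finally show ?thesis by (simp add: base_algebra_finsum)
  qed
  also have "... = \<nu> \<otimes> (\<Oplus> g\<in>carrier G. b (ginv a) g)"
    using ia b_in nu finite_G by (intro vec.R.finsum_rdistr[symmetric]) auto
  also have "... = (if a = \<one>\<^sub>G then \<one> else \<zero>)"
    unfolding b_sum[OF ia] using a nu by simp
  finally show ?thesis .
qed

end

section \<open>The order-two character trivial on the group-likes\<close>

lemma (in vectorspace) smult_cancel:
  assumes "c \<in> carrier K" "c \<noteq> \<zero>\<^sub>K" "x \<in> carrier V" "y \<in> carrier V" "c \<odot>\<^sub>V x = c \<odot>\<^sub>V y"
  shows "x = y"
proof -
  have u: "inv\<^bsub>K\<^esub> c \<in> carrier K" "inv\<^bsub>K\<^esub> c \<otimes>\<^sub>K c = \<one>\<^sub>K" using assms(1,2) field_Units by (auto simp: Units_l_inv)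
  have "x = (inv\<^bsub>K\<^esub> c \<otimes>\<^sub>K c) \<odot>\<^sub>V x" using assms(3) u by simp
  also have "... = inv\<^bsub>K\<^esub> c \<odot>\<^sub>V (c \<odot>\<^sub>V y)" unfolding smult_assoc1[OF u(1) assms(1,3)] assms(5) ..
  also have "... = y" using smult_assoc1[OF u(1) assms(1,4)] u(2) assms(4) by simp
  finally show ?thesis .
qed

lemma (in vectorspace) smult_nonzero:
  assumes "c \<in> carrier K" "x \<in> carrier V" "c \<odot>\<^sub>V x = \<zero>\<^sub>V" "x \<noteq> \<zero>\<^sub>V"
  shows "c = \<zero>\<^sub>K"
  using smult_cancel[of c x "\<zero>\<^sub>V"] assms by auto

lemma (in vectorspace) smult_right_cancel:
  assumes "c \<in> carrier K" "d \<in> carrier K" "x \<in> carrier V" "x \<noteq> \<zero>\<^sub>V" "c \<odot>\<^sub>V x = d \<odot>\<^sub>V x"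
  shows "c = d"
proof -
  have "(c \<ominus>\<^sub>K d) \<odot>\<^sub>V x = \<zero>\<^sub>V"
    using assms by (simp add: R.minus_eq smult_l_distr smult_l_minus M.r_neg)
  then have "c \<ominus>\<^sub>K d = \<zero>\<^sub>K" using assms smult_nonzero[of "c \<ominus>\<^sub>K d" x] by simp
  then show ?thesis using assms by (metis R.r_right_minus_eq)
qed

lemma functional_in: "\<lbrakk>\<xi> \<in> module_hom K V (base_algebra K); x \<in> carrier V\<rbrakk> \<Longrightarrow> \<xi> x \<in> carrier K"
  using module_hom_in by force

context hopf_algebra
begin

text \<open>With these rules, linearity of a nested expression in one variable is proved by
  descending through its syntax, and membership in the carriers likewise.\<close>

lemmas lin_rules = module_hom_id mult_left_hom mult_right_hom scalar_mult_left_hom scalar_mult_right_hom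
  module_hom_smult_left[OF H_module] module_hom_smult_right[OF H_module]
  module_hom_comp[OF antipode_linear] module_hom_comp[OF counit_module_hom]
  sweedler_hom[OF K_module] sweedler_hom[OF H_module]
  sweedler_param_hom[OF K_module H_module] sweedler_param_hom[OF H_module H_module]
lemmas closed_rules = m_closed vec.smult_closed vec.R.m_closed antipode_in counit_in

text \<open>The vanishing map is written as an empty sum of bilinear maps, and a Sweedler sum
  commutes with finite sums.\<close>

lemma sweedler_zero:
  assumes U: "module K U" and h: "h \<in> carrier H" and z: "\<And>u v. \<lbrakk>u \<in> carrier H; v \<in> carrier H\<rbrakk> \<Longrightarrow> \<beta> u v = \<zero>\<^sub>U"
  shows "sweedler U \<beta> h = \<zero>\<^sub>U"
proof -
  interpret U: module K U by fact
  have "sweedler U (\<lambda>u v. \<Oplus>\<^bsub>U\<^esub> i\<in>{}. \<beta> u v) h = (\<Oplus>\<^bsub>U\<^esub> i\<in>{}. sweedler U \<beta> h)"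
    using sweedler_sum[OF U finite.emptyI _ h, of "\<lambda>_. \<beta>"] by simp
  moreover have "sweedler U (\<lambda>u v. \<Oplus>\<^bsub>U\<^esub> i\<in>{}. \<beta> u v) h = sweedler U \<beta> h"
    by (rule sweedler_cong[OF U _ h]) (auto simp: z intro!: bilinear_mapsI module_homI)
  ultimately show ?thesis by simp
qed

lemma counit_mult: "\<lbrakk>x \<in> carrier H; y \<in> carrier H\<rbrakk> \<Longrightarrow> counit H (x \<otimes>\<^sub>H y) = counit H x \<otimes> counit H y"
  and counit_one: "counit H \<one>\<^sub>H = \<one>"
  using counit_hom by (auto simp: alg_hom_def ring_hom_def)

lemma counit_smult: "\<lbrakk>c \<in> carrier K; x \<in> carrier H\<rbrakk> \<Longrightarrow> counit H (c \<odot>\<^sub>H x) = c \<otimes> counit H x"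
  using module_hom_smult[OF counit_module_hom] by simp

lemma counit_add: "\<lbrakk>x \<in> carrier H; y \<in> carrier H\<rbrakk> \<Longrightarrow> counit H (x \<oplus>\<^sub>H y) = counit H x \<oplus> counit H y"
  using module_hom_add[OF counit_module_hom] by simp

lemma counit_diff: "\<lbrakk>x \<in> carrier H; y \<in> carrier H\<rbrakk> \<Longrightarrow> counit H (x \<ominus>\<^sub>H y) = counit H x \<ominus> counit H y"
  using module_hom_minus[OF H_module K_module counit_module_hom, of x y]
  by (simp add: a_minus_def a_inv_def m_inv_def)

end

context hopf_grouplikes
begin

text \<open>Distinct group-likes are independent by induction: if \<open>g\<close> were a
  combination of \<open>F\<close>, comparing its comultiplication with that combination would force
  every coefficient to vanish, while the counit of \<open>g\<close> is one.\<close>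

lemma iota_lin_indpt_subset: "finite F \<Longrightarrow> F \<subseteq> \<iota> ` carrier G \<Longrightarrow> vec.lin_indpt F"
proof (induction F rule: finite_induct)
  case empty
  show ?case by (rule vec.finite_lin_indpt2) auto
next
  case (insert g F)
  then have li: "vec.lin_indpt F" and FH: "F \<subseteq> carrier H" and gH: "g \<in> carrier H" using iota_in by auto
  have sw: "sweedler H \<beta> f = \<beta> f f" if "\<beta> \<in> bilinear_maps K H H H" "f \<in> insert g F" for \<beta> f
    using sweedler_iota[OF H_module that(1)] insert.prems that(2) by blast
  have "g \<notin> vec.span F"
  proof
    assume "g \<in> vec.span F"
    then obtain a where a: "a \<in> F \<rightarrow> carrier K" "vec.lincomb a F = g"
      using vec.finite_in_span[OF insert.hyps(1) FH] by blast
    have aK: "f \<in> F \<Longrightarrow> a f \<in> carrier K" for f using a(1) by auto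
    have g_eq: "g = (\<Oplus>\<^bsub>H\<^esub> f\<in>F. a f \<odot>\<^sub>H f)" using a(2) by (simp add: vec.lincomb_def)
    have "a f = \<zero>" if f: "f \<in> F" for f
    proof (rule ccontr)
      assume nz: "a f \<noteq> \<zero>"
      have fH: "f \<in> carrier H" using f FH by auto
      obtain \<xi> where \<xi>: "\<xi> \<in> module_hom K H (base_algebra K)" "\<xi> f = \<one>" "\<forall>x\<in>F - {f}. \<xi> x = \<zero>"
        using vec.dual_functional[OF finite_dim li FH f] by blast
      note \<xi>_in = functional_in[OF \<xi>(1)]
      have bl: "(\<lambda>u v. \<xi> u \<odot>\<^sub>H v) \<in> bilinear_maps K H H H"
        by (rule bilinear_mapsI; (intro lin_rules closed_rules \<xi>_in module_hom_comp[OF \<xi>(1)] | assumption)+)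
      have lc: "L g = (\<Oplus>\<^bsub>U\<^esub> f\<in>F. a f \<odot>\<^sub>U L f)" if "module K U" "L \<in> module_hom K H U" for L and U :: "('k, 'u, 'w) module_scheme"
      proof -
        interpret U: module K U by (rule that)
        have "L g = (\<Oplus>\<^bsub>U\<^esub> f\<in>F. L (a f \<odot>\<^sub>H f))"
          unfolding g_eq using aK FH by (intro module_hom_finsum[OF H_module that insert.hyps(1)]) auto
        also have "... = (\<Oplus>\<^bsub>U\<^esub> f\<in>F. a f \<odot>\<^sub>U L f)"
          using aK FH module_hom_in[OF that(2)]
          by (intro U.M.finsum_cong') (auto intro!: module_hom_smult[OF that(2)])
        finally show ?thesis .
      qed
      have "\<xi> g = (\<Oplus> f\<in>F. a f \<otimes> \<xi> f)"
        using lc[OF K_module \<xi>(1)] by (simp add: base_algebra_finsum)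
      also have "... = a f \<otimes> \<xi> f"
        using aK f \<xi> fH FH \<xi>_in by (intro vec.R.finsum_single insert.hyps(1)) auto
      finally have \<xi>g: "\<xi> g = a f" using \<xi>(2) aK[OF f] by simp
      \<comment> \<open>Apply the functional dual to \<open>f\<close> in the first tensor factor.
        Since \<open>g\<close> is group-like the left side is \<open>\<xi> g\<close> times
        \<open>g\<close>, and on the right only the term of \<open>f\<close> survives.\<close>
      have "sweedler H (\<lambda>u v. \<xi> u \<odot>\<^sub>H v) g = (\<Oplus>\<^bsub>H\<^esub> x\<in>F. a x \<odot>\<^sub>H sweedler H (\<lambda>u v. \<xi> u \<odot>\<^sub>H v) x)"
        by (rule lc[OF H_module sweedler_hom[OF H_module bl module_hom_id]])
      also have "... = (\<Oplus>\<^bsub>H\<^esub> x\<in>F. a x \<odot>\<^sub>H (\<xi> x \<odot>\<^sub>H x))"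
        using aK FH \<xi>_in sw[OF bl] by (intro vec.M.finsum_cong') auto
      also have "... = a f \<odot>\<^sub>H (\<xi> f \<odot>\<^sub>H f)"
        using aK f \<xi> fH FH \<xi>_in by (intro vec.M.finsum_single insert.hyps(1)) (auto simp: subset_eq)
      finally have "a f \<odot>\<^sub>H g = a f \<odot>\<^sub>H f"
        using sw[OF bl, of g] \<xi>g \<xi>(2) fH by simp
      then have "g = f" by (rule vec.smult_cancel[OF aK[OF f] nz gH fH])
      then show False using f insert.hyps(2) by simp
    qed
    then have "g = (\<Oplus>\<^bsub>H\<^esub> f\<in>F. \<zero>\<^sub>H)"
      unfolding g_eq using FH by (intro vec.M.finsum_cong') (auto simp: subset_eq)
    then have "g = \<zero>\<^sub>H" by simp
    moreover have "counit H g = \<one>" using insert.prems iota_counit by auto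
    moreover have "counit H \<zero>\<^sub>H = \<zero>" using module_hom_zero[OF H_module K_module counit_module_hom] by simp
    ultimately show False using vec.one_not_zero by simp
  qed
  then have "\<not> vec.lin_dep (F \<union> {g})"
    using vec.lin_dep_iff_in_span[OF FH li gH insert.hyps(2)] by simp
  then show ?case by simp
qed

lemma iota_lin_indpt: "vec.lin_indpt (\<iota> ` carrier G)" "\<iota> ` carrier G \<subseteq> carrier H"
  using iota_lin_indpt_subset[of "\<iota> ` carrier G"] finite_G iota_in by auto

lemma delta_functional:
  "\<exists>\<xi>\<in>module_hom K H (base_algebra K). \<forall>g\<in>carrier G. \<xi> (\<iota> g) = (if g = \<one>\<^sub>G then \<one> else \<zero>)"
proof -
  have "\<one>\<^sub>H \<in> \<iota> ` carrier G" using iota_one G.one_closed by (metis imageI)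
  then obtain \<xi> where \<xi>: "\<xi> \<in> module_hom K H (base_algebra K)" "\<xi> \<one>\<^sub>H = \<one>"
      "\<forall>x\<in>\<iota> ` carrier G - {\<one>\<^sub>H}. \<xi> x = \<zero>"
    using vec.dual_functional[OF finite_dim iota_lin_indpt] by blast
  have "\<xi> (\<iota> g) = (if g = \<one>\<^sub>G then \<one> else \<zero>)" if g: "g \<in> carrier G" for g
  proof (cases "g = \<one>\<^sub>G")
    case False
    then have "\<iota> g \<noteq> \<one>\<^sub>H" using inj_onD[OF iota_inj, of g "\<one>\<^sub>G"] g iota_one by auto
    then show ?thesis using False \<xi>(3) g by auto
  qed (use \<xi>(2) iota_one in simp)
  then show ?thesis using \<xi>(1) by blast
qed

text \<open>The dimension is twice the number of group-likes, so a basis that extends them has a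
  further member, whose coordinate functional serves.\<close>

lemma annihilating_functional:
  "\<exists>\<zeta>\<in>module_hom K H (base_algebra K). (\<forall>g\<in>carrier G. \<zeta> (\<iota> g) = \<zero>) \<and> (\<exists>x\<in>carrier H. \<zeta> x = \<one>)"
proof -
  obtain A where A: "finite A" "vec.basis A" "\<iota> ` carrier G \<subseteq> A"
    using vec.basis_extension[OF finite_dim iota_lin_indpt] by blast
  have "card (\<iota> ` carrier G) < card A"
    using vec.dim_basis[OF A(1,2)] dim_eq card_image[OF iota_inj] G.order_gt_0_iff_finite finite_G
    by (simp add: order_def)
  then obtain x where x: "x \<in> A" "x \<notin> \<iota> ` carrier G"
    using card_mono[of "\<iota> ` carrier G" A] finite_G by (meson finite_imageI leD subsetI)
  obtain \<zeta> where \<zeta>: "\<zeta> \<in> module_hom K H (base_algebra K)" "\<zeta> x = \<one>" "\<forall>y\<in>A - {x}. \<zeta> y = \<zero>"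
    using vec.basis_coordinate[OF A(1,2) x(1)] by blast
  have "x \<in> carrier H" using x A(2) by (auto simp: vec.basis_def)
  then show ?thesis using \<zeta> x A(3) by (intro bexI[of _ \<zeta>]) auto
qed

text \<open>The coefficient of the unit in \<open>idem a\<close> is \<open>\<nu>\<close>, the
  inverse of the group order.\<close>

lemma idem_nonzero: "a \<in> carrier G \<Longrightarrow> idem a \<noteq> \<zero>\<^sub>H"
proof
  assume a: "a \<in> carrier G" and z: "idem a = \<zero>\<^sub>H"
  obtain \<xi> where \<xi>: "\<xi> \<in> module_hom K H (base_algebra K)"
      "\<forall>g\<in>carrier G. \<xi> (\<iota> g) = (if g = \<one>\<^sub>G then \<one> else \<zero>)"
    using delta_functional by blast
  have ia: "ginv a \<in> carrier G" using a by simp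
  have "\<xi> (idem a) = (\<Oplus> g\<in>carrier G. (\<nu> \<otimes> b (ginv a) g) \<otimes> \<xi> (\<iota> g))"
    using hom_idem[OF K_module \<xi>(1) a] by (simp add: base_algebra_finsum)
  also have "... = (\<nu> \<otimes> b (ginv a) \<one>\<^sub>G) \<otimes> \<xi> (\<iota> \<one>\<^sub>G)"
    using \<xi>(2) ia b_in nu by (intro vec.R.finsum_single finite_G) auto
  also have "... = \<nu>" using \<xi>(2) ia nu b_one by simp
  finally show False
    using z nu(3) module_hom_zero[OF H_module K_module \<xi>(1)] by simp
qed

text \<open>If \<open>h e\<^sub>a\<close> were always a multiple of \<open>e\<^sub>a\<close>, expanding
  \<open>S(h\<^sub>1) h\<^sub>2 e' \<otimes> h\<^sub>3 e''\<close> for \<open>\<Delta> e\<^sub>a = e' \<otimes> e''\<close> in two ways would put every \<open>h\<close> into the group algebra.\<close>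

lemma idem_ideal_not_line:
  assumes a: "a \<in> carrier G"
  shows "\<exists>h\<in>carrier H. \<forall>k\<in>carrier K. h \<otimes>\<^sub>H idem a \<noteq> k \<odot>\<^sub>H idem a"
proof (rule ccontr)
  assume "\<not> ?thesis"
  then have line: "\<exists>k\<in>carrier K. h \<otimes>\<^sub>H idem a = k \<odot>\<^sub>H idem a" if "h \<in> carrier H" for h
    using that by blast
  obtain \<eta> where \<eta>: "\<eta> \<in> module_hom K H (base_algebra K)" "\<eta> (idem a) = \<one>"
    using vec.nonzero_functional[OF finite_dim idem_in[OF a] idem_nonzero[OF a]] by blast
  define \<rho> where "\<rho> h = \<eta> (h \<otimes>\<^sub>H idem a)" for h
  have \<rho>_in: "\<rho> h \<in> carrier K" if "h \<in> carrier H" for h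
    unfolding \<rho>_def using that idem_in[OF a] functional_in[OF \<eta>(1)] by simp
  have \<rho>: "h \<otimes>\<^sub>H idem a = \<rho> h \<odot>\<^sub>H idem a" if h: "h \<in> carrier H" for h
  proof -
    obtain k where k: "k \<in> carrier K" "h \<otimes>\<^sub>H idem a = k \<odot>\<^sub>H idem a" using line[OF h] by blast
    then have "\<rho> h = k"
      unfolding \<rho>_def using module_hom_smult[OF \<eta>(1) k(1) idem_in[OF a]] \<eta>(2) by simp
    then show ?thesis using k by simp
  qed
  obtain \<xi> where \<xi>: "\<xi> \<in> module_hom K H (base_algebra K)"
      "\<And>g. g \<in> carrier G \<Longrightarrow> \<xi> (\<iota> g) = (if g = \<one>\<^sub>G then \<one> else \<zero>)"
    using delta_functional by blast
  obtain \<zeta> x where \<zeta>: "\<zeta> \<in> module_hom K H (base_algebra K)" "\<And>g. g \<in> carrier G \<Longrightarrow> \<zeta> (\<iota> g) = \<zero>"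
      and x: "x \<in> carrier H" "\<zeta> x = \<one>"
    using annihilating_functional by blast
  note \<xi>_in = functional_in[OF \<xi>(1)] and \<zeta>_in = functional_in[OF \<zeta>(1)]
  note rules = lin_rules closed_rules \<xi>_in \<zeta>_in module_hom_comp[OF \<xi>(1)] module_hom_comp[OF \<zeta>(1)]
    idem_in[OF a] x(1)
  have bT: "(\<lambda>c d. \<xi> (antipode H u \<otimes>\<^sub>H c) \<otimes> \<zeta> d) \<in> bilinear_maps K H H (base_algebra K)" if "u \<in> carrier H" for u
    using that by - (rule bilinear_mapsI; (intro rules | assumption)+)
  \<comment> \<open>The twofold expansion for a fixed \<open>x\<close> outside the group algebra, as
    a function of \<open>y\<close> in place of \<open>idem a\<close>. The functional
    \<open>\<xi>\<close> reads the first tensor factor, and \<open>\<zeta>\<close>, which kills the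
    group algebra, reads the second.\<close>
  define W where "W y = sweedler (base_algebra K)
    (\<lambda>u v. sweedler (base_algebra K) (\<lambda>c d. \<xi> (antipode H u \<otimes>\<^sub>H c) \<otimes> \<zeta> d) (v \<otimes>\<^sub>H y)) x" for y
  have bW: "(\<lambda>u v. sweedler (base_algebra K) (\<lambda>c d. \<xi> (antipode H u \<otimes>\<^sub>H c) \<otimes> \<zeta> d) (v \<otimes>\<^sub>H y))
      \<in> bilinear_maps K H H (base_algebra K)" if "y \<in> carrier H" for y
    using that by - (rule bilinear_mapsI; (intro rules bT | assumption)+)
  have W_hom: "W \<in> module_hom K H (base_algebra K)"
    unfolding W_def
    by (rule sweedler_param_hom[OF K_module H_module bW _ x(1)]; (intro rules bT | assumption)+)
  have \<zeta>_idem: "\<zeta> (idem c) = \<zero>" if c: "c \<in> carrier G" for c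
  proof -
    have "\<zeta> (idem c) = (\<Oplus> g\<in>carrier G. (\<nu> \<otimes> b (ginv c) g) \<otimes> \<zeta> (\<iota> g))"
      using hom_idem[OF K_module \<zeta>(1) c] by (simp add: base_algebra_finsum)
    also have "... = (\<Oplus> g\<in>carrier G. \<zero>)"
      using c \<zeta>(2) b_in nu by (intro vec.R.finsum_cong') auto
    finally show ?thesis by simp
  qed
  \<comment> \<open>First evaluation: by assumption the product of \<open>v\<close> with
    \<open>idem a\<close> is a multiple of \<open>idem a\<close>, whose comultiplication stays in
    the group algebra, where \<open>\<zeta>\<close> vanishes.\<close>
  have "W (idem a) = \<zero>"
  proof -
    have "W (idem a) = \<zero>\<^bsub>base_algebra K\<^esub>"
      unfolding W_def
    proof (rule sweedler_zero[OF K_module x(1)])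
      fix u v assume u: "u \<in> carrier H" and v: "v \<in> carrier H"
      let ?s = "sweedler (base_algebra K) (\<lambda>c d. \<xi> (antipode H u \<otimes>\<^sub>H c) \<otimes> \<zeta> d)"
      have "?s (idem a) = (\<Oplus>\<^bsub>base_algebra K\<^esub> c\<in>carrier G. \<xi> (antipode H u \<otimes>\<^sub>H idem c) \<otimes> \<zeta> (idem (ginv c \<otimes>\<^sub>G a)))"
        by (rule sweedler_idem[OF K_module bT[OF u] a])
      also have "... = (\<Oplus> c\<in>carrier G. \<zero>)"
        unfolding base_algebra_finsum using a u \<xi>_in antipode_in idem_in
        by (intro vec.R.finsum_cong') (auto simp: \<zeta>_idem)
      finally have "?s (idem a) = \<zero>" by simp
      moreover have "?s (\<rho> v \<odot>\<^sub>H idem a) = \<rho> v \<otimes> ?s (idem a)"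
        using module_hom_smult[OF sweedler_hom[OF K_module bT[OF u] module_hom_id] \<rho>_in[OF v] idem_in[OF a]] by simp
      ultimately show "?s (v \<otimes>\<^sub>H idem a) = \<zero>\<^bsub>base_algebra K\<^esub>"
        using \<rho>_in[OF v] \<rho>[OF v] by simp
    qed
    then show ?thesis by simp
  qed
  moreover have "W (idem a) = \<nu>"
  proof -
    \<comment> \<open>Second evaluation: for group-like \<open>y\<close> the antipode cancels the
      first two Sweedler factors of \<open>x\<close>. Summed against the coefficients of
      \<open>idem a\<close>, only the unit of \<open>G\<close> contributes, with
      \<open>\<zeta> x = \<one>\<close>.\<close>
    have Wg: "W (\<iota> g) = \<xi> (\<iota> g) \<otimes> \<zeta> (x \<otimes>\<^sub>H \<iota> g)" if g: "g \<in> carrier G" for g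
    proof -
      note gH = iota_in[OF g]
      have bT': "(\<lambda>p q. \<xi> (antipode H u \<otimes>\<^sub>H (p \<otimes>\<^sub>H \<iota> g)) \<otimes> \<zeta> (q \<otimes>\<^sub>H \<iota> g)) \<in> bilinear_maps K H H (base_algebra K)"
        if "u \<in> carrier H" for u
        using that by - (rule bilinear_mapsI; (intro rules gH | assumption)+)
      have "W (\<iota> g) = sweedler (base_algebra K) (\<lambda>u v. sweedler (base_algebra K)
          (\<lambda>p q. \<xi> (antipode H u \<otimes>\<^sub>H (p \<otimes>\<^sub>H \<iota> g)) \<otimes> \<zeta> (q \<otimes>\<^sub>H \<iota> g)) v) x"
        unfolding W_def
      proof (rule sweedler_cong[OF K_module bW[OF gH] x(1)])
        fix u v assume u: "u \<in> carrier H" and v: "v \<in> carrier H"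
        have "sweedler (base_algebra K) (\<lambda>c d. \<xi> (antipode H u \<otimes>\<^sub>H c) \<otimes> \<zeta> d) (v \<otimes>\<^sub>H \<iota> g) =
            sweedler (base_algebra K) (\<lambda>p q. sweedler (base_algebra K)
              (\<lambda>c d. \<xi> (antipode H u \<otimes>\<^sub>H (p \<otimes>\<^sub>H c)) \<otimes> \<zeta> (q \<otimes>\<^sub>H d)) (\<iota> g)) v"
          by (rule sweedler_mult[OF K_module bT[OF u] v gH])
        also have "... = sweedler (base_algebra K) (\<lambda>p q. \<xi> (antipode H u \<otimes>\<^sub>H (p \<otimes>\<^sub>H \<iota> g)) \<otimes> \<zeta> (q \<otimes>\<^sub>H \<iota> g)) v"
        proof (rule sweedler_cong[symmetric, OF K_module bT'[OF u] v])
          fix p q assume p: "p \<in> carrier H" and q: "q \<in> carrier H"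
          have "(\<lambda>c d. \<xi> (antipode H u \<otimes>\<^sub>H (p \<otimes>\<^sub>H c)) \<otimes> \<zeta> (q \<otimes>\<^sub>H d)) \<in> bilinear_maps K H H (base_algebra K)"
            by (rule bilinear_mapsI; (intro rules u p q | assumption)+)
          from sweedler_iota[OF K_module this g]
          show "\<xi> (antipode H u \<otimes>\<^sub>H (p \<otimes>\<^sub>H \<iota> g)) \<otimes> \<zeta> (q \<otimes>\<^sub>H \<iota> g) = sweedler (base_algebra K)
              (\<lambda>c d. \<xi> (antipode H u \<otimes>\<^sub>H (p \<otimes>\<^sub>H c)) \<otimes> \<zeta> (q \<otimes>\<^sub>H d)) (\<iota> g)" ..
        qed
        finally show "sweedler (base_algebra K) (\<lambda>c d. \<xi> (antipode H u \<otimes>\<^sub>H c) \<otimes> \<zeta> d) (v \<otimes>\<^sub>H \<iota> g) =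
          sweedler (base_algebra K) (\<lambda>p q. \<xi> (antipode H u \<otimes>\<^sub>H (p \<otimes>\<^sub>H \<iota> g)) \<otimes> \<zeta> (q \<otimes>\<^sub>H \<iota> g)) v" .
      qed
      also have "... = sweedler (base_algebra K) (\<lambda>y q. sweedler (base_algebra K)
          (\<lambda>u p. \<xi> (antipode H u \<otimes>\<^sub>H (p \<otimes>\<^sub>H \<iota> g)) \<otimes> \<zeta> (q \<otimes>\<^sub>H \<iota> g)) y) x"
        by (rule sweedler_assoc[symmetric, OF K_module _ _ _ x(1)]; (intro rules gH | assumption)+)
      also have "... = sweedler (base_algebra K) (\<lambda>y q. counit H y \<otimes> (\<xi> (\<iota> g) \<otimes> \<zeta> (q \<otimes>\<^sub>H \<iota> g))) x"
      proof (rule sweedler_cong[symmetric, OF K_module _ x(1)])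
        show "(\<lambda>y q. counit H y \<otimes> (\<xi> (\<iota> g) \<otimes> \<zeta> (q \<otimes>\<^sub>H \<iota> g))) \<in> bilinear_maps K H H (base_algebra K)"
          by (rule bilinear_mapsI; (intro rules gH | assumption)+)
        fix y q assume y: "y \<in> carrier H" and q: "q \<in> carrier H"
        have L: "(\<lambda>w. \<xi> (w \<otimes>\<^sub>H \<iota> g) \<otimes> \<zeta> (q \<otimes>\<^sub>H \<iota> g)) \<in> module_hom K H (base_algebra K)"
          by (intro rules gH q)
        have bl: "(\<lambda>u p. \<xi> (antipode H u \<otimes>\<^sub>H (p \<otimes>\<^sub>H \<iota> g)) \<otimes> \<zeta> (q \<otimes>\<^sub>H \<iota> g)) \<in> bilinear_maps K H H (base_algebra K)"
          by (rule bilinear_mapsI; (intro rules gH q | assumption)+)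
        have "sweedler (base_algebra K) (\<lambda>u p. \<xi> (antipode H u \<otimes>\<^sub>H (p \<otimes>\<^sub>H \<iota> g)) \<otimes> \<zeta> (q \<otimes>\<^sub>H \<iota> g)) y =
            sweedler (base_algebra K) (\<lambda>u p. \<xi> ((antipode H u \<otimes>\<^sub>H p) \<otimes>\<^sub>H \<iota> g) \<otimes> \<zeta> (q \<otimes>\<^sub>H \<iota> g)) y"
          by (rule sweedler_cong[OF K_module bl y]) (simp only: m_assoc antipode_in gH)
        also have "... = counit H y \<otimes> (\<xi> (\<one>\<^bsub>H\<^esub> \<otimes>\<^sub>H \<iota> g) \<otimes> \<zeta> (q \<otimes>\<^sub>H \<iota> g))"
          using sweedler_antipode_left[OF K_module L y] by simp
        finally show "counit H y \<otimes> (\<xi> (\<iota> g) \<otimes> \<zeta> (q \<otimes>\<^sub>H \<iota> g)) =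
            sweedler (base_algebra K) (\<lambda>u p. \<xi> (antipode H u \<otimes>\<^sub>H (p \<otimes>\<^sub>H \<iota> g)) \<otimes> \<zeta> (q \<otimes>\<^sub>H \<iota> g)) y"
          using gH by simp
      qed
      also have "... = \<xi> (\<iota> g) \<otimes> \<zeta> (x \<otimes>\<^sub>H \<iota> g)"
      proof -
        have L: "(\<lambda>q. \<xi> (\<iota> g) \<otimes> \<zeta> (q \<otimes>\<^sub>H \<iota> g)) \<in> module_hom K H (base_algebra K)"
          by (intro rules gH)
        show ?thesis using sweedler_counit_left[OF K_module L x(1)] by simp
      qed
      finally show ?thesis .
    qed
    have ia: "ginv a \<in> carrier G" using a by simp
    have "W (idem a) = (\<Oplus> g\<in>carrier G. (\<nu> \<otimes> b (ginv a) g) \<otimes> W (\<iota> g))"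
      using hom_idem[OF K_module W_hom a] by (simp add: base_algebra_finsum)
    also have "... = (\<nu> \<otimes> b (ginv a) \<one>\<^sub>G) \<otimes> W (\<iota> \<one>\<^sub>G)"
      using \<xi>(2) ia b_in nu iota_in \<zeta>_in x(1)
      by (intro vec.R.finsum_single finite_G) (auto simp: Wg)
    also have "... = \<nu>"
      using Wg[OF G.one_closed] \<xi>(2)[OF G.one_closed] x iota_one ia nu b_one by simp
    finally show ?thesis .
  qed
  ultimately show False using nu(3) by simp
qed

text \<open>Independent pairs in the images of the orthogonal projections \<open>P a\<close> make a
  family of \<open>2 n\<close> independent vectors, which is a basis by dimension. \<open>P\<close>
  is abstract because both right and left multiplication by the idempotents are used.\<close>

lemma pair_coordinates:
  assumes P: "\<And>a. a \<in> carrier G \<Longrightarrow> P a \<in> module_hom K H H"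
    and Pe: "\<And>a c. \<lbrakk>a \<in> carrier G; c \<in> carrier G\<rbrakk> \<Longrightarrow> P a (idem c) = (if a = c then idem c else \<zero>\<^sub>H)"
    and Py: "\<And>a c. \<lbrakk>a \<in> carrier G; c \<in> carrier G\<rbrakk> \<Longrightarrow> P a (y c) = (if a = c then y c else \<zero>\<^sub>H)"
    and y_in: "\<And>a. a \<in> carrier G \<Longrightarrow> y a \<in> carrier H"
    and y_indep: "\<And>a k. \<lbrakk>a \<in> carrier G; k \<in> carrier K\<rbrakk> \<Longrightarrow> y a \<noteq> k \<odot>\<^sub>H idem a"
  obtains p q where "\<And>a. a \<in> carrier G \<Longrightarrow> p a \<in> module_hom K H (base_algebra K)"
    and "\<And>a. a \<in> carrier G \<Longrightarrow> q a \<in> module_hom K H (base_algebra K)"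
    and "\<And>x. x \<in> carrier H \<Longrightarrow> x = (\<Oplus>\<^bsub>H\<^esub> a\<in>carrier G. p a x \<odot>\<^sub>H idem a \<oplus>\<^sub>H q a x \<odot>\<^sub>H y a)"
    and "\<And>a x. \<lbrakk>a \<in> carrier G; x \<in> carrier H\<rbrakk> \<Longrightarrow> P a x = p a x \<odot>\<^sub>H idem a \<oplus>\<^sub>H q a x \<odot>\<^sub>H y a"
    and "\<And>a c. \<lbrakk>a \<in> carrier G; c \<in> carrier G\<rbrakk> \<Longrightarrow> p a (idem c) = (if a = c then \<one> else \<zero>)"
    and "\<And>a c. \<lbrakk>a \<in> carrier G; c \<in> carrier G\<rbrakk> \<Longrightarrow> p a (y c) = \<zero>"
    and "\<And>a c. \<lbrakk>a \<in> carrier G; c \<in> carrier G\<rbrakk> \<Longrightarrow> q a (idem c) = \<zero>"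
    and "\<And>a c. \<lbrakk>a \<in> carrier G; c \<in> carrier G\<rbrakk> \<Longrightarrow> q a (y c) = (if a = c then \<one> else \<zero>)"
proof -
  \<comment> \<open>The bit \<open>True\<close> marks an idempotent and \<open>False\<close> its
    companion \<open>y\<close>.\<close>
  define I where "I = carrier G \<times> (UNIV :: bool set)"
  define w where "w i = (if snd i then idem (fst i) else y (fst i))" for i
  have fI: "finite I" using finite_G by (simp add: I_def)
  have cI: "card I = vec.dim" using dim_eq by (simp add: I_def card_cartesian_product order_def)
  have w_in: "w i \<in> carrier H" if "i \<in> I" for i using that idem_in y_in by (auto simp: w_def I_def)
  have Pw: "P a (w i) = (if a = fst i then w i else \<zero>\<^sub>H)" if "a \<in> carrier G" "i \<in> I" for a i
    using that Pe Py by (auto simp: w_def I_def)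
  have P_sum: "P a (\<Oplus>\<^bsub>H\<^esub> i\<in>I. c i \<odot>\<^sub>H w i) = c (a, True) \<odot>\<^sub>H idem a \<oplus>\<^sub>H c (a, False) \<odot>\<^sub>H y a"
    if c: "\<And>i. i \<in> I \<Longrightarrow> c i \<in> carrier K" and a: "a \<in> carrier G" for c a
  proof -
    have "P a (\<Oplus>\<^bsub>H\<^esub> i\<in>I. c i \<odot>\<^sub>H w i) = (\<Oplus>\<^bsub>H\<^esub> i\<in>I. P a (c i \<odot>\<^sub>H w i))"
      using c w_in by (intro module_hom_finsum[OF H_module H_module P[OF a] fI]) auto
    also have "... = P a (c (a, True) \<odot>\<^sub>H w (a, True)) \<oplus>\<^sub>H P a (c (a, False) \<odot>\<^sub>H w (a, False))"
    proof (rule vec.M.finsum_two[OF fI])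
      fix i assume i: "i \<in> I" "i \<noteq> (a, True)" "i \<noteq> (a, False)"
      then have "a \<noteq> fst i" by (cases i) auto
      then show "P a (c i \<odot>\<^sub>H w i) = \<zero>\<^sub>H"
        using Pw[OF a i(1)] c[OF i(1)] by (simp add: module_hom_smult[OF P[OF a] c[OF i(1)] w_in[OF i(1)]])
    qed (use a c w_in module_hom_in[OF P[OF a]] in \<open>auto simp: I_def\<close>)
    also have "... = c (a, True) \<odot>\<^sub>H idem a \<oplus>\<^sub>H c (a, False) \<odot>\<^sub>H y a"
    proof -
      have "P a (c (a, t) \<odot>\<^sub>H w (a, t)) = c (a, t) \<odot>\<^sub>H w (a, t)" for t
      proof -
        have at: "(a, t) \<in> I" using a by (simp add: I_def)
        show ?thesis
          unfolding module_hom_smult[OF P[OF a] c[OF at] w_in[OF at]] Pw[OF a at] by simp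
      qed
      from this[of True] this[of False] show ?thesis by (simp add: w_def)
    qed
    finally show ?thesis .
  qed
  have "\<exists>\<chi>. (\<forall>i\<in>I. \<chi> i \<in> module_hom K H (base_algebra K)) \<and>
    (\<forall>x\<in>carrier H. x = (\<Oplus>\<^bsub>H\<^esub> i\<in>I. \<chi> i x \<odot>\<^sub>H w i)) \<and>
    (\<forall>i\<in>I. \<forall>j\<in>I. \<chi> i (w j) = (if i = j then \<one> else \<zero>))"
  proof (rule vec.family_coordinates[OF finite_dim fI cI w_in])
    fix c i assume c: "\<And>i. i \<in> I \<Longrightarrow> c i \<in> carrier K" and z: "(\<Oplus>\<^bsub>H\<^esub> i\<in>I. c i \<odot>\<^sub>H w i) = \<zero>\<^sub>H" and i: "i \<in> I"
    define a where "a = fst i"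
    have a: "a \<in> carrier G" using i by (auto simp: I_def a_def)
    have cK: "c (a, True) \<in> carrier K" "c (a, False) \<in> carrier K" using a c by (auto simp: I_def)
    have 0: "c (a, True) \<odot>\<^sub>H idem a \<oplus>\<^sub>H c (a, False) \<odot>\<^sub>H y a = \<zero>\<^sub>H"
      using P_sum[of c a, OF c a] z module_hom_zero[OF H_module H_module P[OF a]] by simp
    have F: "c (a, False) = \<zero>"
    proof (rule ccontr)
      assume nz: "c (a, False) \<noteq> \<zero>"
      define k where "k = \<ominus> (inv (c (a, False)) \<otimes> c (a, True))"
      have u: "inv (c (a, False)) \<in> carrier K" "inv (c (a, False)) \<otimes> c (a, False) = \<one>"
        using nz cK vec.field_Units by (auto simp: vec.R.Units_l_inv)
      have k: "k \<in> carrier K" using u cK by (simp add: k_def)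
      have "c (a, False) \<odot>\<^sub>H y a = \<ominus>\<^sub>H (c (a, True) \<odot>\<^sub>H idem a)"
        using 0 cK a idem_in y_in by (metis vec.M.minus_equality vec.M.a_comm vec.smult_closed)
      also have "... = c (a, False) \<odot>\<^sub>H (k \<odot>\<^sub>H idem a)"
      proof -
        have "c (a, False) \<otimes> k = \<ominus> c (a, True)"
          using cK u by (simp add: k_def vec.R.r_minus vec.R.m_assoc[symmetric] vec.R.m_comm[of "c (a, False)"])
        then show ?thesis
          using cK k a idem_in by (simp add: vec.smult_assoc1[symmetric] vec.smult_l_minus)
      qed
      finally have "y a = k \<odot>\<^sub>H idem a"
        using vec.smult_cancel[OF cK(2) nz] y_in a idem_in k by simp
      then show False using y_indep[OF a k] by simp
    qed
    then have "c (a, True) \<odot>\<^sub>H idem a = \<zero>\<^sub>H" using 0 cK a idem_in y_in by simp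
    then have "c (a, True) = \<zero>" using vec.smult_nonzero cK a idem_in idem_nonzero by blast
    then show "c i = \<zero>" using F by (cases i; cases "snd i") (auto simp: a_def)
  qed
  then obtain \<chi> where \<chi>: "\<And>i. i \<in> I \<Longrightarrow> \<chi> i \<in> module_hom K H (base_algebra K)"
    "\<And>x. x \<in> carrier H \<Longrightarrow> x = (\<Oplus>\<^bsub>H\<^esub> i\<in>I. \<chi> i x \<odot>\<^sub>H w i)"
    "\<And>i j. \<lbrakk>i \<in> I; j \<in> I\<rbrakk> \<Longrightarrow> \<chi> i (w j) = (if i = j then \<one> else \<zero>)"
    by blast
  define p where "p a = \<chi> (a, True)" for a
  define q where "q a = \<chi> (a, False)" for a
  have hom: "p a \<in> module_hom K H (base_algebra K)" "q a \<in> module_hom K H (base_algebra K)" if "a \<in> carrier G" for a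
    using \<chi>(1) that by (auto simp: p_def q_def I_def)
  have dual: "p a (idem c) = (if a = c then \<one> else \<zero>)" "p a (y c) = \<zero>"
      "q a (idem c) = \<zero>" "q a (y c) = (if a = c then \<one> else \<zero>)" if "a \<in> carrier G" "c \<in> carrier G" for a c
    using that \<chi>(3)[of "(a, True)" "(c, True)"] \<chi>(3)[of "(a, True)" "(c, False)"]
      \<chi>(3)[of "(a, False)" "(c, True)"] \<chi>(3)[of "(a, False)" "(c, False)"]
    by (auto simp: p_def q_def I_def w_def)
  have proj: "P a x = p a x \<odot>\<^sub>H idem a \<oplus>\<^sub>H q a x \<odot>\<^sub>H y a" if "a \<in> carrier G" "x \<in> carrier H" for a x
  proof -
    have "P a x = P a (\<Oplus>\<^bsub>H\<^esub> i\<in>I. \<chi> i x \<odot>\<^sub>H w i)" using \<chi>(2)[OF that(2)] by simp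
    then show ?thesis
      using P_sum[of "\<lambda>i. \<chi> i x" a] that functional_in[OF \<chi>(1)] by (simp add: p_def q_def)
  qed
  have expand: "x = (\<Oplus>\<^bsub>H\<^esub> a\<in>carrier G. p a x \<odot>\<^sub>H idem a \<oplus>\<^sub>H q a x \<odot>\<^sub>H y a)" if x: "x \<in> carrier H" for x
  proof -
    let ?f = "\<lambda>i. \<chi> i x \<odot>\<^sub>H w i"
    have f: "?f i \<in> carrier H" if "i \<in> I" for i using functional_in[OF \<chi>(1)[OF that] x] w_in[OF that] by simp
    have I_eq: "I = (\<lambda>a. (a, True)) ` carrier G \<union> (\<lambda>a. (a, False)) ` carrier G"
      unfolding I_def by (auto simp: image_iff)
    have "x = (\<Oplus>\<^bsub>H\<^esub> i\<in>I. ?f i)" by (rule \<chi>(2)[OF x])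
    also have "... = (\<Oplus>\<^bsub>H\<^esub> i\<in>(\<lambda>a. (a, True)) ` carrier G. ?f i) \<oplus>\<^sub>H (\<Oplus>\<^bsub>H\<^esub> i\<in>(\<lambda>a. (a, False)) ` carrier G. ?f i)"
      unfolding I_eq using finite_G f by (intro vec.M.finsum_Un_disjoint) (auto simp: I_def)
    also have "(\<Oplus>\<^bsub>H\<^esub> i\<in>(\<lambda>a. (a, True)) ` carrier G. ?f i) = (\<Oplus>\<^bsub>H\<^esub> a\<in>carrier G. ?f (a, True))"
      using f by (intro vec.M.add.finprod_reindex) (auto simp: inj_on_def I_def)
    also have "(\<Oplus>\<^bsub>H\<^esub> i\<in>(\<lambda>a. (a, False)) ` carrier G. ?f i) = (\<Oplus>\<^bsub>H\<^esub> a\<in>carrier G. ?f (a, False))"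
      using f by (intro vec.M.add.finprod_reindex) (auto simp: inj_on_def I_def)
    also have "(\<Oplus>\<^bsub>H\<^esub> a\<in>carrier G. ?f (a, True)) \<oplus>\<^sub>H (\<Oplus>\<^bsub>H\<^esub> a\<in>carrier G. ?f (a, False)) =
        (\<Oplus>\<^bsub>H\<^esub> a\<in>carrier G. ?f (a, True) \<oplus>\<^sub>H ?f (a, False))"
      using f by (intro vec.M.finsum_addf[symmetric]) (auto simp: I_def)
    finally show ?thesis by (simp add: p_def q_def w_def)
  qed
  show thesis
    by (rule that[of p q]) (rule hom expand proj dual; assumption)+
qed

end

text \<open>\<open>\<Lambda>\<close> is a normalised left integral. It is the only trace of
  semisimplicity in the structural part, supplied by \<open>semisimple_integral\<close>.\<close>

locale hopf_grouplikes_integral = hopf_grouplikes +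
  fixes \<Lambda>
  assumes \<Lambda>_in: "\<Lambda> \<in> carrier H" and \<Lambda>_counit: "counit H \<Lambda> = \<one>"
    and \<Lambda>_integral: "h \<in> carrier H \<Longrightarrow> h \<otimes>\<^sub>H \<Lambda> = counit H h \<odot>\<^sub>H \<Lambda>"
begin

text \<open>\<open>\<psi>\<close> is the second of the two characters by which \<open>H\<close> acts on the plane
  \<open>H e = H e\<^sub>1\<close>; the first is the counit, on the line of the integral \<open>\<Lambda> e\<close>.\<close>

lemma exists_character:
  "\<exists>\<psi>\<in>module_hom K H (base_algebra K). (\<forall>x\<in>carrier H. \<forall>y\<in>carrier H. \<psi> (x \<otimes>\<^sub>H y) = \<psi> x \<otimes> \<psi> y) \<and>
    (\<forall>g\<in>carrier G. \<psi> (\<iota> g) = \<one>) \<and> (\<exists>z\<in>carrier H. counit H z = \<zero> \<and> \<psi> z = \<one>) \<and>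
    (\<forall>h\<in>carrier H. sweedler (base_algebra K) (\<lambda>u v. \<psi> u \<otimes> \<psi> v) h = counit H h)"
proof -
  let ?e = "idem \<one>\<^sub>G"
  let ?B = "base_algebra K"
  note eH = idem_in[OF G.one_closed]
  have ee: "?e \<otimes>\<^sub>H ?e = ?e" using idem_mult[OF G.one_closed G.one_closed] by simp
  have \<epsilon>e: "counit H ?e = \<one>" using counit_idem[OF G.one_closed] by simp
  have "\<forall>a\<in>carrier G. \<exists>h\<in>carrier H. \<forall>k\<in>carrier K. h \<otimes>\<^sub>H idem a \<noteq> k \<odot>\<^sub>H idem a"
    using idem_ideal_not_line by blast
  then obtain t where t: "\<And>a. a \<in> carrier G \<Longrightarrow> t a \<in> carrier H"
      "\<And>a k. \<lbrakk>a \<in> carrier G; k \<in> carrier K\<rbrakk> \<Longrightarrow> t a \<otimes>\<^sub>H idem a \<noteq> k \<odot>\<^sub>H idem a"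
    by (metis (no_types))
  \<comment> \<open>A vector of \<open>H e\<^sub>a\<close> off the line of the idempotent; with it
    \<open>pair_coordinates\<close> shows that the left ideal is exactly a plane.\<close>
  define y where "y a = t a \<otimes>\<^sub>H idem a" for a
  have y_in: "y a \<in> carrier H" if "a \<in> carrier G" for a using t(1) idem_in that by (simp add: y_def)
  have y_idem: "y c \<otimes>\<^sub>H idem a = (if a = c then y c else \<zero>\<^sub>H)" if "a \<in> carrier G" "c \<in> carrier G" for a c
    using t(1)[OF that(2)] idem_in that by (auto simp: y_def m_assoc idem_mult)
  obtain p q where pq: "\<And>a. a \<in> carrier G \<Longrightarrow> p a \<in> module_hom K H ?B" "\<And>a. a \<in> carrier G \<Longrightarrow> q a \<in> module_hom K H ?B"
      "\<And>a x. \<lbrakk>a \<in> carrier G; x \<in> carrier H\<rbrakk> \<Longrightarrow> x \<otimes>\<^sub>H idem a = p a x \<odot>\<^sub>H idem a \<oplus>\<^sub>H q a x \<odot>\<^sub>H y a"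
  proof (rule pair_coordinates[where P = "\<lambda>a x. x \<otimes>\<^sub>H idem a" and y = y])
    show "(\<lambda>x. x \<otimes>\<^sub>H idem a) \<in> module_hom K H H" if "a \<in> carrier G" for a
      using idem_in[OF that] by (intro mult_left_hom module_hom_id)
    show "idem c \<otimes>\<^sub>H idem a = (if a = c then idem c else \<zero>\<^sub>H)" if "a \<in> carrier G" "c \<in> carrier G" for a c
      using idem_mult[OF that(2,1)] by auto
    show "y a \<noteq> k \<odot>\<^sub>H idem a" if "a \<in> carrier G" "k \<in> carrier K" for a k using t(2)[OF that] by (simp add: y_def)
  qed (rule y_in y_idem that; assumption)+
  \<comment> \<open>Multiplying by the idempotent moves the integral into the plane and keeps both
    its counit and the integral property.\<close>
  define \<Lambda>0 where "\<Lambda>0 = \<Lambda> \<otimes>\<^sub>H ?e"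
  have \<Lambda>0_in: "\<Lambda>0 \<in> carrier H" using \<Lambda>_in eH by (simp add: \<Lambda>0_def)
  have \<Lambda>0_counit: "counit H \<Lambda>0 = \<one>" using \<Lambda>_in eH \<Lambda>_counit \<epsilon>e by (simp add: \<Lambda>0_def counit_mult)
  have \<Lambda>0_integral: "h \<otimes>\<^sub>H \<Lambda>0 = counit H h \<odot>\<^sub>H \<Lambda>0" if "h \<in> carrier H" for h
    using that \<Lambda>_in eH \<Lambda>_integral[OF that] counit_in[OF that]
    by (simp add: \<Lambda>0_def m_assoc[symmetric] smult_mult_left)
  have \<Lambda>0_e: "\<Lambda>0 \<otimes>\<^sub>H ?e = \<Lambda>0" using \<Lambda>_in eH ee by (simp add: \<Lambda>0_def m_assoc)
  define z where "z = ?e \<ominus>\<^sub>H \<Lambda>0"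
  have z_in: "z \<in> carrier H" using eH \<Lambda>0_in by (simp add: z_def)
  have z_counit: "counit H z = \<zero>" using eH \<Lambda>0_in \<epsilon>e \<Lambda>0_counit by (simp add: z_def counit_diff)
  have z_e: "z \<otimes>\<^sub>H ?e = z" using eH \<Lambda>0_in ee \<Lambda>0_e by (simp add: z_def a_minus_def l_distr l_minus)
  have e_eq: "?e = \<Lambda>0 \<oplus>\<^sub>H z"
    using vec.M.a_lcomm[OF \<Lambda>0_in eH vec.M.a_inv_closed[OF \<Lambda>0_in]] eH \<Lambda>0_in
    by (simp add: z_def a_minus_def vec.M.r_neg)
  \<comment> \<open>If \<open>z\<close> vanished, the idempotent would be the integral
    \<open>\<Lambda>0\<close>, and the plane would collapse to a line.\<close>
  have z_nz: "z \<noteq> \<zero>\<^sub>H"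
  proof
    assume "z = \<zero>\<^sub>H"
    then have "?e = \<Lambda>0" using e_eq \<Lambda>0_in by simp
    then have "h \<otimes>\<^sub>H ?e = counit H h \<odot>\<^sub>H ?e" if "h \<in> carrier H" for h using \<Lambda>0_integral[OF that] by simp
    then show False using idem_ideal_not_line[OF G.one_closed] counit_in by blast
  qed
  \<comment> \<open>The plane is spanned by \<open>?e\<close>, of counit one, and the corrected
    vector \<open>y'\<close>, of counit zero. Hence its counit-zero part is a line, and the nonzero
    \<open>z\<close> spans it.\<close>
  have line: "\<exists>k\<in>carrier K. x = k \<odot>\<^sub>H z" if x: "x \<in> carrier H" "x \<otimes>\<^sub>H ?e = x" "counit H x = \<zero>" for x
  proof -
    let ?y = "y \<one>\<^sub>G"
    define y' where "y' = ?y \<ominus>\<^sub>H counit H ?y \<odot>\<^sub>H ?e"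
    have yH: "?y \<in> carrier H" "counit H ?y \<in> carrier K" using y_in counit_in by auto
    have y'H: "y' \<in> carrier H" using yH eH by (simp add: y'_def)
    have multiple: "x = q \<one>\<^sub>G x \<odot>\<^sub>H y'" if x: "x \<in> carrier H" "x \<otimes>\<^sub>H ?e = x" "counit H x = \<zero>" for x
    proof -
      have c: "p \<one>\<^sub>G x \<in> carrier K" "q \<one>\<^sub>G x \<in> carrier K" using functional_in[OF pq(1)] functional_in[OF pq(2)] x(1) by auto
      have eq: "x = p \<one>\<^sub>G x \<odot>\<^sub>H ?e \<oplus>\<^sub>H q \<one>\<^sub>G x \<odot>\<^sub>H ?y" using pq(3)[OF G.one_closed x(1)] x(2) by simp
      have "\<zero> = counit H (p \<one>\<^sub>G x \<odot>\<^sub>H ?e \<oplus>\<^sub>H q \<one>\<^sub>G x \<odot>\<^sub>H ?y)" using x(3) eq by simp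
      also have "... = p \<one>\<^sub>G x \<oplus> q \<one>\<^sub>G x \<otimes> counit H ?y"
        using c yH eH \<epsilon>e by (simp add: counit_add counit_smult)
      finally have "p \<one>\<^sub>G x = \<ominus> (q \<one>\<^sub>G x \<otimes> counit H ?y)"
        using c yH by (metis vec.R.minus_equality vec.R.m_closed)
      then have "p \<one>\<^sub>G x \<odot>\<^sub>H ?e = \<ominus>\<^sub>H (q \<one>\<^sub>G x \<odot>\<^sub>H (counit H ?y \<odot>\<^sub>H ?e))"
        using c yH eH by (simp add: vec.smult_l_minus vec.smult_assoc1)
      then have "x = \<ominus>\<^sub>H (q \<one>\<^sub>G x \<odot>\<^sub>H (counit H ?y \<odot>\<^sub>H ?e)) \<oplus>\<^sub>H q \<one>\<^sub>G x \<odot>\<^sub>H ?y" using eq by simp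
      also have "... = q \<one>\<^sub>G x \<odot>\<^sub>H y'"
        using c yH eH by (simp add: y'_def a_minus_def vec.smult_r_distr vec.smult_r_minus vec.M.a_comm)
      finally show ?thesis .
    qed
    have qz: "q \<one>\<^sub>G z \<in> carrier K" "q \<one>\<^sub>G x \<in> carrier K" using functional_in[OF pq(2)] z_in x(1) by auto
    have z_eq: "z = q \<one>\<^sub>G z \<odot>\<^sub>H y'" by (rule multiple[OF z_in z_e z_counit])
    then have nz: "q \<one>\<^sub>G z \<noteq> \<zero>" using z_nz y'H by (metis vec.smult_l_null)
    then have u: "inv (q \<one>\<^sub>G z) \<in> carrier K" "inv (q \<one>\<^sub>G z) \<otimes> q \<one>\<^sub>G z = \<one>"
      using qz vec.field_Units by (auto simp: vec.R.Units_l_inv)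
    have y'_eq: "y' = inv (q \<one>\<^sub>G z) \<odot>\<^sub>H z"
    proof -
      have "inv (q \<one>\<^sub>G z) \<odot>\<^sub>H z = inv (q \<one>\<^sub>G z) \<odot>\<^sub>H (q \<one>\<^sub>G z \<odot>\<^sub>H y')" using z_eq by simp
      also have "... = y'" unfolding vec.smult_assoc1[OF u(1) qz(1) y'H, symmetric] u(2) using y'H by simp
      finally show ?thesis ..
    qed
    have "x = q \<one>\<^sub>G x \<odot>\<^sub>H (inv (q \<one>\<^sub>G z) \<odot>\<^sub>H z)" using multiple[OF x] y'_eq by simp
    then have "x = (q \<one>\<^sub>G x \<otimes> inv (q \<one>\<^sub>G z)) \<odot>\<^sub>H z"
      unfolding vec.smult_assoc1[OF qz(2) u(1) z_in] .
    then show ?thesis using qz u by blast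
  qed
  obtain \<eta> where \<eta>: "\<eta> \<in> module_hom K H ?B" "\<eta> z = \<one>"
    using vec.nonzero_functional[OF finite_dim z_in z_nz] by blast
  define \<psi> where "\<psi> h = \<eta> (h \<otimes>\<^sub>H z)" for h
  have \<psi>_hom: "\<psi> \<in> module_hom K H ?B"
    unfolding \<psi>_def using z_in by (intro module_hom_comp[OF \<eta>(1)] mult_left_hom module_hom_id)
  note \<psi>_in = functional_in[OF \<psi>_hom]
  \<comment> \<open>Left multiplication preserves both the plane and the vanishing of the counit, so
    it acts on the line of \<open>z\<close> by a scalar; \<open>\<eta>\<close> merely reads this
    scalar off.\<close>
  have \<psi>: "h \<otimes>\<^sub>H z = \<psi> h \<odot>\<^sub>H z" if h: "h \<in> carrier H" for h
  proof -
    have "(h \<otimes>\<^sub>H z) \<otimes>\<^sub>H ?e = h \<otimes>\<^sub>H z" using h z_in eH z_e by (simp add: m_assoc)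
    moreover have "counit H (h \<otimes>\<^sub>H z) = \<zero>" using h z_in z_counit counit_in by (simp add: counit_mult)
    ultimately obtain k where k: "k \<in> carrier K" "h \<otimes>\<^sub>H z = k \<odot>\<^sub>H z" using line[of "h \<otimes>\<^sub>H z"] h z_in by auto
    then have "\<psi> h = k" unfolding \<psi>_def using module_hom_smult[OF \<eta>(1) k(1) z_in] \<eta>(2) by simp
    then show ?thesis using k by simp
  qed
  have \<psi>_unique: "\<psi> h = k" if "h \<in> carrier H" "k \<in> carrier K" "h \<otimes>\<^sub>H z = k \<odot>\<^sub>H z" for h k
    using vec.smult_right_cancel[OF \<psi>_in[OF that(1)] that(2) z_in z_nz] \<psi>[OF that(1)] that(3) by simp
  have \<psi>_mult: "\<psi> (x \<otimes>\<^sub>H y) = \<psi> x \<otimes> \<psi> y" if "x \<in> carrier H" "y \<in> carrier H" for x y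
  proof (rule \<psi>_unique)
    have "(x \<otimes>\<^sub>H y) \<otimes>\<^sub>H z = \<psi> y \<odot>\<^sub>H (x \<otimes>\<^sub>H z)"
      unfolding m_assoc[OF that z_in] \<psi>[OF that(2)] by (rule smult_mult_right[OF \<psi>_in[OF that(2)] that(1) z_in])
    then show "(x \<otimes>\<^sub>H y) \<otimes>\<^sub>H z = (\<psi> x \<otimes> \<psi> y) \<odot>\<^sub>H z"
      unfolding \<psi>[OF that(1)] vec.R.m_comm[OF \<psi>_in[OF that(1)] \<psi>_in[OF that(2)]]
        vec.smult_assoc1[OF \<psi>_in[OF that(2)] \<psi>_in[OF that(1)] z_in] .
  qed (use that \<psi>_in in auto)
  have \<psi>_iota: "\<psi> (\<iota> g) = \<one>" if g: "g \<in> carrier G" for g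
  proof (rule \<psi>_unique[OF iota_in[OF g]])
    have "\<iota> g \<otimes>\<^sub>H ?e = ?e" using iota_idem[OF g G.one_closed] b_one_left[OF g] eH by simp
    moreover have "\<iota> g \<otimes>\<^sub>H \<Lambda>0 = \<Lambda>0" using \<Lambda>0_integral[OF iota_in[OF g]] iota_counit[OF g] \<Lambda>0_in by simp
    ultimately have "\<iota> g \<otimes>\<^sub>H z = z"
      using iota_in[OF g] eH \<Lambda>0_in by (simp add: z_def a_minus_def r_distr r_minus)
    then show "\<iota> g \<otimes>\<^sub>H z = \<one> \<odot>\<^sub>H z" using z_in by simp
  qed auto
  have \<psi>_\<Lambda>0: "\<psi> \<Lambda>0 = \<zero>"
  proof (rule \<psi>_unique[OF \<Lambda>0_in])
    have "\<Lambda>0 \<otimes>\<^sub>H z = \<Lambda>0 \<ominus>\<^sub>H \<Lambda>0"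
      using \<Lambda>0_in eH \<Lambda>0_e \<Lambda>0_integral[OF \<Lambda>0_in] \<Lambda>0_counit by (simp add: z_def a_minus_def r_distr r_minus)
    then show "\<Lambda>0 \<otimes>\<^sub>H z = \<zero> \<odot>\<^sub>H z" using \<Lambda>0_in z_in by (simp add: a_minus_def vec.M.r_neg)
  qed auto
  \<comment> \<open>\<open>?e\<close> is a left unit for \<open>z\<close> and splits as
    \<open>\<Lambda>0\<close> plus \<open>z\<close>, while \<open>\<Lambda>0\<close> annihilates
    \<open>z\<close>.\<close>
  have z_z: "z \<otimes>\<^sub>H z = z"
  proof -
    have "?e \<otimes>\<^sub>H z = z"
      using \<Lambda>0_in eH ee \<Lambda>0_integral[OF eH] \<epsilon>e by (simp add: z_def a_minus_def r_distr r_minus)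
    moreover have "\<Lambda>0 \<otimes>\<^sub>H z = \<zero>\<^sub>H" using \<psi>[OF \<Lambda>0_in] \<psi>_\<Lambda>0 z_in by simp
    moreover have "?e \<otimes>\<^sub>H z = \<Lambda>0 \<otimes>\<^sub>H z \<oplus>\<^sub>H z \<otimes>\<^sub>H z" by (subst e_eq) (simp add: l_distr \<Lambda>0_in z_in)
    ultimately show ?thesis using z_in by simp
  qed
  have \<psi>_z: "\<psi> z = \<one>" using z_z z_in by (intro \<psi>_unique) auto
  define \<psi>2 where "\<psi>2 = sweedler ?B (\<lambda>u v. \<psi> u \<otimes> \<psi> v)"
  have bl: "(\<lambda>u v. \<psi> u \<otimes> \<psi> v) \<in> bilinear_maps K H H ?B"
    by (rule bilinear_mapsI; (intro lin_rules closed_rules \<psi>_in module_hom_comp[OF \<psi>_hom] | assumption)+)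
  have \<psi>2_hom: "\<psi>2 \<in> module_hom K H ?B"
    unfolding \<psi>2_def using sweedler_hom[OF K_module bl module_hom_id] .
  note \<psi>2_in = functional_in[OF \<psi>2_hom]
  have \<psi>2_mult: "\<psi>2 (x \<otimes>\<^sub>H y) = \<psi>2 x \<otimes> \<psi>2 y" if x: "x \<in> carrier H" and y: "y \<in> carrier H" for x y
  proof -
    have "\<psi>2 (x \<otimes>\<^sub>H y) = sweedler ?B (\<lambda>a b. sweedler ?B (\<lambda>c d. \<psi> (a \<otimes>\<^sub>H c) \<otimes> \<psi> (b \<otimes>\<^sub>H d)) y) x"
      unfolding \<psi>2_def by (rule sweedler_mult[OF K_module bl x y])
    also have "... = sweedler ?B (\<lambda>a b. (\<psi> a \<otimes> \<psi> b) \<otimes> \<psi>2 y) x"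
    proof (rule sweedler_cong[symmetric, OF K_module _ x])
      show "(\<lambda>a b. (\<psi> a \<otimes> \<psi> b) \<otimes> \<psi>2 y) \<in> bilinear_maps K H H ?B"
        by (rule bilinear_mapsI; (intro lin_rules closed_rules \<psi>_in \<psi>2_in[OF y] module_hom_comp[OF \<psi>_hom] | assumption)+)
      fix a b assume a: "a \<in> carrier H" and b: "b \<in> carrier H"
      have "(\<psi> a \<otimes> \<psi> b) \<otimes> \<psi>2 y = sweedler ?B (\<lambda>c d. (\<psi> a \<otimes> \<psi> b) \<otimes> (\<psi> c \<otimes> \<psi> d)) y"
        unfolding \<psi>2_def
        by (rule sweedler_comp[OF K_module K_module bl scalar_mult_right_hom[OF module_hom_id] y])
          (intro closed_rules \<psi>_in a b)
      also have "... = sweedler ?B (\<lambda>c d. \<psi> (a \<otimes>\<^sub>H c) \<otimes> \<psi> (b \<otimes>\<^sub>H d)) y"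
      proof (rule sweedler_cong[OF K_module _ y])
        show "(\<lambda>c d. (\<psi> a \<otimes> \<psi> b) \<otimes> (\<psi> c \<otimes> \<psi> d)) \<in> bilinear_maps K H H ?B"
          by (rule bilinear_mapsI; (intro lin_rules closed_rules \<psi>_in a b module_hom_comp[OF \<psi>_hom] | assumption)+)
        fix c d assume c: "c \<in> carrier H" and d: "d \<in> carrier H"
        then show "(\<psi> a \<otimes> \<psi> b) \<otimes> (\<psi> c \<otimes> \<psi> d) = \<psi> (a \<otimes>\<^sub>H c) \<otimes> \<psi> (b \<otimes>\<^sub>H d)"
          using a b \<psi>_in by (simp add: \<psi>_mult vec.R.m_ac)
      qed
      finally show "(\<psi> a \<otimes> \<psi> b) \<otimes> \<psi>2 y = sweedler ?B (\<lambda>c d. \<psi> (a \<otimes>\<^sub>H c) \<otimes> \<psi> (b \<otimes>\<^sub>H d)) y" .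
    qed
    also have "... = \<psi>2 x \<otimes> \<psi>2 y"
      unfolding \<psi>2_def[THEN fun_cong, of x]
      by (rule sweedler_comp[symmetric, OF K_module K_module bl scalar_mult_left_hom[OF module_hom_id \<psi>2_in[OF y]] x])
    finally show ?thesis .
  qed
  have \<psi>2_e: "\<psi>2 ?e = \<one>"
  proof -
    have "\<psi>2 (\<iota> g) = \<one>" if "g \<in> carrier G" for g
      unfolding \<psi>2_def sweedler_iota[OF K_module bl that] using \<psi>_iota[OF that] by simp
    then have "\<psi>2 ?e = (\<Oplus> g\<in>carrier G. (\<nu> \<otimes> b (ginv \<one>\<^sub>G) g) \<otimes> counit H (\<iota> g))"
      using hom_idem[OF K_module \<psi>2_hom G.one_closed] b_in nu
      by (auto simp: base_algebra_finsum iota_counit intro!: vec.R.finsum_cong')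
    also have "... = counit H ?e"
      using hom_idem[OF K_module counit_module_hom G.one_closed] by (simp add: base_algebra_finsum)
    finally show ?thesis using \<epsilon>e by simp
  qed
  \<comment> \<open>Evaluate the multiplicative functional \<open>\<psi>2\<close> on
    \<open>h\<close> times \<open>?e\<close>, where its value at \<open>?e\<close> is one. Both
    characters of the plane appear, with the constants \<open>\<psi>2 \<Lambda>0\<close> and
    \<open>\<psi>2 z\<close>.\<close>
  have \<psi>2_eq: "\<psi>2 h = counit H h \<otimes> \<psi>2 \<Lambda>0 \<oplus> \<psi> h \<otimes> \<psi>2 z" if h: "h \<in> carrier H" for h
  proof -
    have "h \<otimes>\<^sub>H ?e = counit H h \<odot>\<^sub>H \<Lambda>0 \<oplus>\<^sub>H \<psi> h \<odot>\<^sub>H z"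
      by (subst e_eq) (simp add: r_distr h \<Lambda>0_in z_in \<Lambda>0_integral \<psi>)
    then have "\<psi>2 (h \<otimes>\<^sub>H ?e) = counit H h \<otimes> \<psi>2 \<Lambda>0 \<oplus> \<psi> h \<otimes> \<psi>2 z"
      using h \<Lambda>0_in z_in counit_in \<psi>_in module_hom_add[OF \<psi>2_hom] module_hom_smult[OF \<psi>2_hom] by simp
    then show ?thesis using \<psi>2_mult[OF h eH] \<psi>2_e \<psi>2_in[OF h] by simp
  qed
  have idem_K: "k = \<zero> \<or> k = \<one>" if "k \<in> carrier K" "k \<otimes> k = k" for k
  proof -
    have "k \<otimes> (k \<ominus> \<one>) = \<zero>" using that by (simp add: vec.R.minus_eq vec.R.r_distr vec.R.r_minus vec.R.r_neg)
    then have "k = \<zero> \<or> k \<ominus> \<one> = \<zero>" using vec.integral that by blast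
    then show ?thesis using that by simp
  qed
  have one: "\<psi>2 \<Lambda>0 \<oplus> \<psi>2 z = \<one>"
    using \<psi>2_e e_eq module_hom_add[OF \<psi>2_hom \<Lambda>0_in z_in] by simp
  \<comment> \<open>Since \<open>z\<close> is idempotent the constant is zero or one. The value one
    means \<open>\<psi> * \<psi> = \<psi>\<close>; convolving with \<open>\<psi>\<close> after the
    antipode would make \<open>\<psi>\<close> the counit, although the two differ at
    \<open>z\<close>.\<close>
  have "\<psi>2 z = \<zero>"
  proof (rule ccontr)
    assume "\<psi>2 z \<noteq> \<zero>"
    then have z1: "\<psi>2 z = \<one>" using idem_K[OF \<psi>2_in[OF z_in]] \<psi>2_mult[OF z_in z_in] z_z by simp
    then have "\<psi>2 \<Lambda>0 = \<zero>"
      using one \<psi>2_in[OF \<Lambda>0_in] by (metis vec.R.add.r_cancel_one vec.R.one_closed)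
    then have \<psi>2\<psi>: "\<psi>2 h = \<psi> h" if "h \<in> carrier H" for h
      using \<psi>2_eq[OF that] z1 \<psi>_in[OF that] counit_in[OF that] by simp
    note rules = lin_rules closed_rules \<psi>_in module_hom_comp[OF \<psi>_hom]
    have "\<psi> z = sweedler ?B (\<lambda>a b. counit H b \<otimes> \<psi> a) z"
      using sweedler_counit_right[OF K_module \<psi>_hom z_in] by simp
    also have "... = sweedler ?B (\<lambda>a b. sweedler ?B (\<lambda>c d. \<psi> a \<otimes> (\<psi> c \<otimes> \<psi> (antipode H d))) b) z"
    proof (rule sweedler_cong[OF K_module _ z_in])
      show "(\<lambda>a b. counit H b \<otimes> \<psi> a) \<in> bilinear_maps K H H ?B"
        by (rule bilinear_mapsI; (intro rules | assumption)+)
      fix a b assume a: "a \<in> carrier H" and b: "b \<in> carrier H"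
      have L: "(\<lambda>w. \<psi> a \<otimes> \<psi> w) \<in> module_hom K H ?B" by (intro rules a)
      have "counit H b \<otimes> \<psi> a = sweedler ?B (\<lambda>c d. \<psi> a \<otimes> \<psi> (c \<otimes>\<^sub>H antipode H d)) b"
        using sweedler_antipode_right[OF K_module L b] \<psi>_iota[OF G.one_closed] iota_one \<psi>_in[OF a] by simp
      also have "... = sweedler ?B (\<lambda>c d. \<psi> a \<otimes> (\<psi> c \<otimes> \<psi> (antipode H d))) b"
      proof (rule sweedler_cong[OF K_module _ b])
        show "(\<lambda>c d. \<psi> a \<otimes> \<psi> (c \<otimes>\<^sub>H antipode H d)) \<in> bilinear_maps K H H ?B"
          by (rule bilinear_mapsI; (intro rules a | assumption)+)
      qed (simp only: \<psi>_mult antipode_in)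
      finally show "counit H b \<otimes> \<psi> a = sweedler ?B (\<lambda>c d. \<psi> a \<otimes> (\<psi> c \<otimes> \<psi> (antipode H d))) b" .
    qed
    also have "... = sweedler ?B (\<lambda>x d. sweedler ?B (\<lambda>a c. \<psi> a \<otimes> (\<psi> c \<otimes> \<psi> (antipode H d))) x) z"
      by (rule sweedler_assoc[symmetric, OF K_module _ _ _ z_in]; (intro rules | assumption)+)
    also have "... = sweedler ?B (\<lambda>x d. \<psi> x \<otimes> \<psi> (antipode H d)) z"
    proof (rule sweedler_cong[symmetric, OF K_module _ z_in])
      show "(\<lambda>x d. \<psi> x \<otimes> \<psi> (antipode H d)) \<in> bilinear_maps K H H ?B"
        by (rule bilinear_mapsI; (intro rules | assumption)+)
      fix x d assume x: "x \<in> carrier H" and d: "d \<in> carrier H"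
      have Sd: "\<psi> (antipode H d) \<in> carrier K" using \<psi>_in antipode_in d by simp
      have "\<psi> x \<otimes> \<psi> (antipode H d) = \<psi>2 x \<otimes> \<psi> (antipode H d)" using \<psi>2\<psi>[OF x] by simp
      also have "... = sweedler ?B (\<lambda>a c. (\<psi> a \<otimes> \<psi> c) \<otimes> \<psi> (antipode H d)) x"
        unfolding \<psi>2_def
        by (rule sweedler_comp[OF K_module K_module bl scalar_mult_left_hom[OF module_hom_id Sd] x])
      also have "... = sweedler ?B (\<lambda>a c. \<psi> a \<otimes> (\<psi> c \<otimes> \<psi> (antipode H d))) x"
      proof (rule sweedler_cong[OF K_module _ x])
        show "(\<lambda>a c. (\<psi> a \<otimes> \<psi> c) \<otimes> \<psi> (antipode H d)) \<in> bilinear_maps K H H ?B"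
          by (rule bilinear_mapsI; (intro rules d | assumption)+)
      qed (simp only: vec.R.m_assoc \<psi>_in Sd)
      finally show "\<psi> x \<otimes> \<psi> (antipode H d) = sweedler ?B (\<lambda>a c. \<psi> a \<otimes> (\<psi> c \<otimes> \<psi> (antipode H d))) x" .
    qed
    also have "... = sweedler ?B (\<lambda>x d. \<psi> (x \<otimes>\<^sub>H antipode H d)) z"
    proof (rule sweedler_cong[OF K_module _ z_in])
      show "(\<lambda>x d. \<psi> x \<otimes> \<psi> (antipode H d)) \<in> bilinear_maps K H H ?B"
        by (rule bilinear_mapsI; (intro rules | assumption)+)
    qed (simp only: \<psi>_mult antipode_in)
    also have "... = \<zero>"
      using sweedler_antipode_right[OF K_module \<psi>_hom z_in] z_counit \<psi>_in[OF one_closed] by simp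
    finally show False using \<psi>_z vec.one_not_zero by simp
  qed
  then have "\<psi>2 \<Lambda>0 = \<one>" using one \<psi>2_in[OF \<Lambda>0_in] by simp
  then have "\<psi>2 h = counit H h" if "h \<in> carrier H" for h
    using \<psi>2_eq[OF that] \<open>\<psi>2 z = \<zero>\<close> counit_in[OF that] \<psi>_in[OF that] by simp
  then show ?thesis
    using \<psi>_hom \<psi>_mult \<psi>_iota z_in z_counit \<psi>_z unfolding \<psi>2_def by (intro bexI[of _ \<psi>]) auto
qed

end

section \<open>The crossed product decomposition\<close>

lemma (in hopf_algebra) sweedler_plus:
  assumes U: "module K U" and \<beta>: "\<beta> \<in> bilinear_maps K H H U" and \<gamma>: "\<gamma> \<in> bilinear_maps K H H U" and h: "h \<in> carrier H"
  shows "sweedler U (\<lambda>u v. \<beta> u v \<oplus>\<^sub>U \<gamma> u v) h = sweedler U \<beta> h \<oplus>\<^sub>U sweedler U \<gamma> h"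
proof -
  have s: "(\<lambda>u v. \<beta> u v \<oplus>\<^sub>U \<gamma> u v) \<in> bilinear_maps K H H U"
    using bilinear_mapsD(1,2)[OF \<beta>] bilinear_mapsD(1,2)[OF \<gamma>] by (intro bilinear_mapsI module_hom_plus[OF U])
  note T = tensor_lift_hom[OF H_module H_module U] and P = tensor_lift_pure[OF H_module H_module U]
  show ?thesis
    unfolding sweedler_def
    by (rule tensor_hom_eq[OF H_module H_module U T[OF s] module_hom_plus[OF U T[OF \<beta>] T[OF \<gamma>]] _ comult_in[OF h]])
      (simp add: P[OF s] P[OF \<beta>] P[OF \<gamma>])
qed

text \<open>Meant for pairings such as \<open>\<psi> u\<close> times \<open>v\<close>: since
  \<open>\<psi>\<close> is a character they satisfy \<open>mult\<close>, and convolution with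
  \<open>\<psi>\<close> becomes an algebra homomorphism.\<close>

lemma (in hopf_algebra) sweedler_multiplicative:
  assumes \<beta>: "\<beta> \<in> bilinear_maps K H H H"
    and mult: "\<And>a b c d. \<lbrakk>a \<in> carrier H; b \<in> carrier H; c \<in> carrier H; d \<in> carrier H\<rbrakk> \<Longrightarrow> \<beta> (a \<otimes>\<^sub>H c) (b \<otimes>\<^sub>H d) = \<beta> a b \<otimes>\<^sub>H \<beta> c d"
    and x: "x \<in> carrier H" and y: "y \<in> carrier H"
  shows "sweedler H \<beta> (x \<otimes>\<^sub>H y) = sweedler H \<beta> x \<otimes>\<^sub>H sweedler H \<beta> y"
proof -
  have left: "(\<lambda>u. u \<otimes>\<^sub>H sweedler H \<beta> y) \<in> module_hom K H H"
    by (rule mult_left_hom[OF module_hom_id sweedler_in[OF H_module \<beta> y]])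
  have "sweedler H \<beta> (x \<otimes>\<^sub>H y) = sweedler H (\<lambda>a b. sweedler H (\<lambda>c d. \<beta> (a \<otimes>\<^sub>H c) (b \<otimes>\<^sub>H d)) y) x"
    by (rule sweedler_mult[OF H_module \<beta> x y])
  also have "... = sweedler H (\<lambda>a b. \<beta> a b \<otimes>\<^sub>H sweedler H \<beta> y) x"
  proof (rule sweedler_cong[symmetric, OF H_module bilinear_comp[OF left \<beta>] x])
    fix a b assume a: "a \<in> carrier H" and b: "b \<in> carrier H"
    have right: "(\<lambda>u. \<beta> a b \<otimes>\<^sub>H u) \<in> module_hom K H H"
      by (rule mult_right_hom[OF module_hom_id bilinear_mapsD(3)[OF \<beta> a b]])
    have "\<beta> a b \<otimes>\<^sub>H sweedler H \<beta> y = sweedler H (\<lambda>c d. \<beta> a b \<otimes>\<^sub>H \<beta> c d) y"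
      by (rule sweedler_comp[OF H_module H_module \<beta> right y])
    also have "... = sweedler H (\<lambda>c d. \<beta> (a \<otimes>\<^sub>H c) (b \<otimes>\<^sub>H d)) y"
      by (rule sweedler_cong[OF H_module bilinear_comp[OF right \<beta>] y]) (rule mult[symmetric, OF a b])
    finally show "\<beta> a b \<otimes>\<^sub>H sweedler H \<beta> y = sweedler H (\<lambda>c d. \<beta> (a \<otimes>\<^sub>H c) (b \<otimes>\<^sub>H d)) y" .
  qed
  also have "... = sweedler H \<beta> x \<otimes>\<^sub>H sweedler H \<beta> y"
    by (rule sweedler_comp[symmetric, OF H_module H_module \<beta> left x])
  finally show ?thesis .
qed

section \<open>Convolution with a character of order two, and its eigenspaces\<close>

locale hopf_index_two = hopf_grouplikes +
  fixes \<psi>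
  assumes \<psi>_hom: "\<psi> \<in> module_hom K H (base_algebra K)"
    and \<psi>_mult: "\<lbrakk>x \<in> carrier H; y \<in> carrier H\<rbrakk> \<Longrightarrow> \<psi> (x \<otimes>\<^sub>H y) = \<psi> x \<otimes> \<psi> y"
    and \<psi>_iota: "g \<in> carrier G \<Longrightarrow> \<psi> (\<iota> g) = \<one>"
    and \<psi>_separates: "\<exists>z\<in>carrier H. counit H z = \<zero> \<and> \<psi> z = \<one>"
    and \<psi>_square: "h \<in> carrier H \<Longrightarrow> sweedler (base_algebra K) (\<lambda>u v. \<psi> u \<otimes> \<psi> v) h = counit H h"
begin

lemmas \<psi>_in = functional_in[OF \<psi>_hom]

text \<open>Left and right convolution with \<open>\<psi>\<close>. Both are carried along, since
  each commutes with the comultiplication on one tensor factor only; their equality is reached in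
  \<open>\<theta>_eq\<close>.\<close>

definition \<theta>l where "\<theta>l h = sweedler H (\<lambda>u v. \<psi> u \<odot>\<^sub>H v) h"
definition \<theta>r where "\<theta>r h = sweedler H (\<lambda>u v. \<psi> v \<odot>\<^sub>H u) h"

lemmas \<psi>_rules = lin_rules closed_rules \<psi>_in module_hom_comp[OF \<psi>_hom]

lemma \<theta>l_bilinear: "(\<lambda>u v. \<psi> u \<odot>\<^sub>H v) \<in> bilinear_maps K H H H"
  and \<theta>r_bilinear: "(\<lambda>u v. \<psi> v \<odot>\<^sub>H u) \<in> bilinear_maps K H H H"
  by (rule bilinear_mapsI; (intro \<psi>_rules | assumption)+)+

lemma \<theta>l_hom: "\<theta>l \<in> module_hom K H H"
  unfolding \<theta>l_def by (rule sweedler_hom[OF H_module \<theta>l_bilinear module_hom_id])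

lemma \<theta>r_hom: "\<theta>r \<in> module_hom K H H"
  unfolding \<theta>r_def by (rule sweedler_hom[OF H_module \<theta>r_bilinear module_hom_id])

lemmas \<theta>l_in = module_hom_in[OF \<theta>l_hom] and \<theta>r_in = module_hom_in[OF \<theta>r_hom]

text \<open>Coassociativity: the character consumes the first of three Sweedler factors, so
  regrouping places \<open>\<theta>l\<close> on the first tensor factor.\<close>

lemma sweedler_\<theta>l:
  assumes U: "module K U" and \<beta>: "\<beta> \<in> bilinear_maps K H H U" and h: "h \<in> carrier H"
  shows "sweedler U \<beta> (\<theta>l h) = sweedler U (\<lambda>u v. \<beta> (\<theta>l u) v) h"
proof -
  interpret U: module K U by fact
  note rules = \<psi>_rules module_hom_smult_left[OF U] module_hom_smult_right[OF U] U.smult_closed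
    bilinear_mapsD(3)[OF \<beta>] bilinear_hom_left[OF \<beta>] bilinear_hom_right[OF \<beta>]
    sweedler_hom[OF U] sweedler_param_hom[OF U H_module] \<theta>l_hom \<theta>l_in sweedler_in[OF U \<beta>]
    module_hom_comp[OF sweedler_hom[OF U \<beta> module_hom_id]]
  have "sweedler U \<beta> (\<theta>l h) = sweedler U (\<lambda>a b. sweedler U \<beta> (\<psi> a \<odot>\<^sub>H b)) h"
    unfolding \<theta>l_def
    by (rule sweedler_comp[OF H_module U \<theta>l_bilinear sweedler_hom[OF U \<beta> module_hom_id] h])
  also have "... = sweedler U (\<lambda>a b. sweedler U (\<lambda>c d. \<psi> a \<odot>\<^sub>U \<beta> c d) b) h"
  proof (rule sweedler_cong[OF U bilinear_comp[OF sweedler_hom[OF U \<beta> module_hom_id] \<theta>l_bilinear] h])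
    fix a b assume a: "a \<in> carrier H" and b: "b \<in> carrier H"
    have "sweedler U \<beta> (\<psi> a \<odot>\<^sub>H b) = \<psi> a \<odot>\<^sub>U sweedler U \<beta> b"
      by (rule module_hom_smult[OF sweedler_hom[OF U \<beta> module_hom_id] \<psi>_in[OF a] b])
    also have "... = sweedler U (\<lambda>c d. \<psi> a \<odot>\<^sub>U \<beta> c d) b"
      by (rule sweedler_comp[OF U U \<beta> module_hom_smult_left[OF U module_hom_id \<psi>_in[OF a]] b])
    finally show "sweedler U \<beta> (\<psi> a \<odot>\<^sub>H b) = sweedler U (\<lambda>c d. \<psi> a \<odot>\<^sub>U \<beta> c d) b" .
  qed
  also have "... = sweedler U (\<lambda>x d. sweedler U (\<lambda>a c. \<psi> a \<odot>\<^sub>U \<beta> c d) x) h"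
    by (rule sweedler_assoc[symmetric, OF U _ _ _ h]; (intro rules | assumption)+)
  also have "... = sweedler U (\<lambda>x d. \<beta> (\<theta>l x) d) h"
  proof (rule sweedler_cong[symmetric, OF U _ h])
    show "(\<lambda>x d. \<beta> (\<theta>l x) d) \<in> bilinear_maps K H H U"
      by (rule bilinear_mapsI; (intro rules | assumption)+)
    fix x d assume x: "x \<in> carrier H" and d: "d \<in> carrier H"
    have "\<beta> (\<theta>l x) d = sweedler U (\<lambda>a c. \<beta> (\<psi> a \<odot>\<^sub>H c) d) x"
      unfolding \<theta>l_def
      by (rule sweedler_comp[OF H_module U \<theta>l_bilinear bilinear_mapsD(2)[OF \<beta> d] x])
    also have "... = sweedler U (\<lambda>a c. \<psi> a \<odot>\<^sub>U \<beta> c d) x"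
      by (rule sweedler_cong[OF U bilinear_comp[OF bilinear_mapsD(2)[OF \<beta> d] \<theta>l_bilinear] x])
        (rule module_hom_smult[OF bilinear_mapsD(2)[OF \<beta> d] \<psi>_in])
    finally show "\<beta> (\<theta>l x) d = sweedler U (\<lambda>a c. \<psi> a \<odot>\<^sub>U \<beta> c d) x" .
  qed
  finally show ?thesis .
qed

lemma sweedler_\<theta>r:
  assumes U: "module K U" and \<beta>: "\<beta> \<in> bilinear_maps K H H U" and h: "h \<in> carrier H"
  shows "sweedler U \<beta> (\<theta>r h) = sweedler U (\<lambda>u v. \<beta> u (\<theta>r v)) h"
proof -
  interpret U: module K U by fact
  note rules = \<psi>_rules module_hom_smult_left[OF U] module_hom_smult_right[OF U] U.smult_closed
    bilinear_mapsD(3)[OF \<beta>] bilinear_hom_left[OF \<beta>] bilinear_hom_right[OF \<beta>]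
    sweedler_hom[OF U] sweedler_param_hom[OF U H_module] \<theta>r_hom \<theta>r_in sweedler_in[OF U \<beta>]
  have "sweedler U \<beta> (\<theta>r h) = sweedler U (\<lambda>a b. sweedler U \<beta> (\<psi> b \<odot>\<^sub>H a)) h"
    unfolding \<theta>r_def
    by (rule sweedler_comp[OF H_module U \<theta>r_bilinear sweedler_hom[OF U \<beta> module_hom_id] h])
  also have "... = sweedler U (\<lambda>a b. sweedler U (\<lambda>c d. \<psi> b \<odot>\<^sub>U \<beta> c d) a) h"
  proof (rule sweedler_cong[OF U bilinear_comp[OF sweedler_hom[OF U \<beta> module_hom_id] \<theta>r_bilinear] h])
    fix a b assume a: "a \<in> carrier H" and b: "b \<in> carrier H"
    have "sweedler U \<beta> (\<psi> b \<odot>\<^sub>H a) = \<psi> b \<odot>\<^sub>U sweedler U \<beta> a"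
      by (rule module_hom_smult[OF sweedler_hom[OF U \<beta> module_hom_id] \<psi>_in[OF b] a])
    also have "... = sweedler U (\<lambda>c d. \<psi> b \<odot>\<^sub>U \<beta> c d) a"
      by (rule sweedler_comp[OF U U \<beta> module_hom_smult_left[OF U module_hom_id \<psi>_in[OF b]] a])
    finally show "sweedler U \<beta> (\<psi> b \<odot>\<^sub>H a) = sweedler U (\<lambda>c d. \<psi> b \<odot>\<^sub>U \<beta> c d) a" .
  qed
  also have "... = sweedler U (\<lambda>c x. sweedler U (\<lambda>d b. \<psi> b \<odot>\<^sub>U \<beta> c d) x) h"
    by (rule sweedler_assoc[OF U _ _ _ h]; (intro rules | assumption)+)
  also have "... = sweedler U (\<lambda>c x. \<beta> c (\<theta>r x)) h"
  proof (rule sweedler_cong[symmetric, OF U _ h])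
    show "(\<lambda>c x. \<beta> c (\<theta>r x)) \<in> bilinear_maps K H H U"
      by (rule bilinear_mapsI; (intro rules | assumption)+)
    fix c x assume x: "x \<in> carrier H" and c: "c \<in> carrier H"
    have "\<beta> c (\<theta>r x) = sweedler U (\<lambda>d b. \<beta> c (\<psi> b \<odot>\<^sub>H d)) x"
      unfolding \<theta>r_def
      by (rule sweedler_comp[OF H_module U \<theta>r_bilinear bilinear_mapsD(1)[OF \<beta> c] x])
    also have "... = sweedler U (\<lambda>d b. \<psi> b \<odot>\<^sub>U \<beta> c d) x"
      by (rule sweedler_cong[OF U bilinear_comp[OF bilinear_mapsD(1)[OF \<beta> c] \<theta>r_bilinear] x])
        (rule module_hom_smult[OF bilinear_mapsD(1)[OF \<beta> c] \<psi>_in])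
    finally show "\<beta> c (\<theta>r x) = sweedler U (\<lambda>d b. \<psi> b \<odot>\<^sub>U \<beta> c d) x" .
  qed
  finally show ?thesis .
qed

lemma \<psi>_\<theta>l: "h \<in> carrier H \<Longrightarrow> \<psi> (\<theta>l h) = counit H h"
  and \<psi>_\<theta>r: "h \<in> carrier H \<Longrightarrow> \<psi> (\<theta>r h) = counit H h"
proof -
  assume h: "h \<in> carrier H"
  have bl: "(\<lambda>u v. \<psi> u \<otimes> \<psi> v) \<in> bilinear_maps K H H (base_algebra K)"
    by (rule bilinear_mapsI; (intro \<psi>_rules | assumption)+)
  have "\<psi> (\<theta>l h) = sweedler (base_algebra K) (\<lambda>u v. \<psi> (\<psi> u \<odot>\<^sub>H v)) h"
    unfolding \<theta>l_def by (rule sweedler_comp[OF H_module K_module \<theta>l_bilinear \<psi>_hom h])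
  also have "... = sweedler (base_algebra K) (\<lambda>u v. \<psi> u \<otimes> \<psi> v) h"
    by (rule sweedler_cong[symmetric, OF K_module bl h]) (simp add: module_hom_smult[OF \<psi>_hom \<psi>_in])
  finally show "\<psi> (\<theta>l h) = counit H h" using \<psi>_square[OF h] by simp
  have "\<psi> (\<theta>r h) = sweedler (base_algebra K) (\<lambda>u v. \<psi> (\<psi> v \<odot>\<^sub>H u)) h"
    unfolding \<theta>r_def by (rule sweedler_comp[OF H_module K_module \<theta>r_bilinear \<psi>_hom h])
  also have "... = sweedler (base_algebra K) (\<lambda>u v. \<psi> u \<otimes> \<psi> v) h"
    by (rule sweedler_cong[symmetric, OF K_module bl h])
      (simp add: module_hom_smult[OF \<psi>_hom \<psi>_in] vec.R.m_comm \<psi>_in)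
  finally show "\<psi> (\<theta>r h) = counit H h" using \<psi>_square[OF h] by simp
qed

text \<open>Convolving twice with \<open>\<psi>\<close> is convolving once with
  \<open>\<psi> * \<psi>\<close>, which is the counit.\<close>

lemma \<theta>l_\<theta>l: "h \<in> carrier H \<Longrightarrow> \<theta>l (\<theta>l h) = h"
  and \<theta>r_\<theta>r: "h \<in> carrier H \<Longrightarrow> \<theta>r (\<theta>r h) = h"
proof -
  assume h: "h \<in> carrier H"
  have "\<theta>l (\<theta>l h) = sweedler H (\<lambda>u v. \<psi> (\<theta>l u) \<odot>\<^sub>H v) h"
    unfolding \<theta>l_def[of "\<theta>l h"] by (rule sweedler_\<theta>l[OF H_module \<theta>l_bilinear h])
  also have "... = sweedler H (\<lambda>u v. counit H u \<odot>\<^sub>H v) h"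
    by (rule sweedler_cong[symmetric, OF H_module _ h])
      (rule bilinear_mapsI, (intro \<psi>_rules counit_module_hom | assumption | simp only: \<psi>_\<theta>l)+)
  also have "... = h" using sweedler_counit_left[OF H_module module_hom_id h] .
  finally show "\<theta>l (\<theta>l h) = h" .
  have "\<theta>r (\<theta>r h) = sweedler H (\<lambda>u v. \<psi> (\<theta>r v) \<odot>\<^sub>H u) h"
    unfolding \<theta>r_def[of "\<theta>r h"] by (rule sweedler_\<theta>r[OF H_module \<theta>r_bilinear h])
  also have "... = sweedler H (\<lambda>u v. counit H v \<odot>\<^sub>H u) h"
    by (rule sweedler_cong[symmetric, OF H_module _ h])
      (rule bilinear_mapsI, (intro \<psi>_rules counit_module_hom | assumption | simp only: \<psi>_\<theta>r)+)
  also have "... = h" using sweedler_counit_right[OF H_module module_hom_id h] .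
  finally show "\<theta>r (\<theta>r h) = h" .
qed

text \<open>The two convolutions act at opposite ends of a threefold comultiplication.\<close>

lemma \<theta>l_\<theta>r:
  assumes h: "h \<in> carrier H"
  shows "\<theta>r (\<theta>l h) = \<theta>l (\<theta>r h)"
proof -
  have "\<theta>r (\<theta>l h) = sweedler H (\<lambda>u v. \<psi> v \<odot>\<^sub>H \<theta>l u) h"
    unfolding \<theta>r_def by (rule sweedler_\<theta>l[OF H_module \<theta>r_bilinear h])
  also have "... = sweedler H (\<lambda>u v. \<theta>l (\<psi> v \<odot>\<^sub>H u)) h"
    by (rule sweedler_cong[symmetric, OF H_module bilinear_comp[OF \<theta>l_hom \<theta>r_bilinear] h])
      (rule module_hom_smult[OF \<theta>l_hom \<psi>_in])
  also have "... = \<theta>l (\<theta>r h)"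
    unfolding \<theta>r_def by (rule sweedler_comp[symmetric, OF H_module H_module \<theta>r_bilinear \<theta>l_hom h])
  finally show ?thesis .
qed

lemma counit_\<theta>l: "h \<in> carrier H \<Longrightarrow> counit H (\<theta>l h) = \<psi> h"
  and counit_\<theta>r: "h \<in> carrier H \<Longrightarrow> counit H (\<theta>r h) = \<psi> h"
proof -
  assume h: "h \<in> carrier H"
  have "counit H (\<theta>l h) = sweedler (base_algebra K) (\<lambda>u v. counit H (\<psi> u \<odot>\<^sub>H v)) h"
    unfolding \<theta>l_def by (rule sweedler_comp[OF H_module K_module \<theta>l_bilinear counit_module_hom h])
  also have "... = sweedler (base_algebra K) (\<lambda>u v. counit H v \<otimes> \<psi> u) h"
    by (rule sweedler_cong[OF K_module bilinear_comp[OF counit_module_hom \<theta>l_bilinear] h])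
      (simp add: counit_smult \<psi>_in counit_in vec.R.m_comm)
  also have "... = \<psi> h" using sweedler_counit_right[OF K_module \<psi>_hom h] by simp
  finally show "counit H (\<theta>l h) = \<psi> h" .
  have "counit H (\<theta>r h) = sweedler (base_algebra K) (\<lambda>u v. counit H (\<psi> v \<odot>\<^sub>H u)) h"
    unfolding \<theta>r_def by (rule sweedler_comp[OF H_module K_module \<theta>r_bilinear counit_module_hom h])
  also have "... = sweedler (base_algebra K) (\<lambda>u v. counit H u \<otimes> \<psi> v) h"
    by (rule sweedler_cong[OF K_module bilinear_comp[OF counit_module_hom \<theta>r_bilinear] h])
      (simp add: counit_smult \<psi>_in counit_in vec.R.m_comm)
  also have "... = \<psi> h" using sweedler_counit_left[OF K_module \<psi>_hom h] by simp
  finally show "counit H (\<theta>r h) = \<psi> h" .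
qed

lemma \<theta>_idem:
  assumes a: "a \<in> carrier G"
  shows "\<theta>l (idem a) = idem a" "\<theta>r (idem a) = idem a"
proof -
  have i: "\<theta>l (\<iota> g) = \<iota> g" "\<theta>r (\<iota> g) = \<iota> g" if "g \<in> carrier G" for g
    unfolding \<theta>l_def \<theta>r_def sweedler_iota[OF H_module \<theta>l_bilinear that]
      sweedler_iota[OF H_module \<theta>r_bilinear that]
    using \<psi>_iota[OF that] iota_in[OF that] by simp_all
  have c: "(\<lambda>g. (\<nu> \<otimes> b (ginv a) g) \<odot>\<^sub>H \<iota> g) \<in> carrier G \<rightarrow> carrier H" using idem_summand[OF a] by auto
  show "\<theta>l (idem a) = idem a"
    unfolding hom_idem[OF H_module \<theta>l_hom a] unfolding idem_def
    using c by (auto intro!: vec.M.finsum_cong' simp: i)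
  show "\<theta>r (idem a) = idem a"
    unfolding hom_idem[OF H_module \<theta>r_hom a] unfolding idem_def
    using c by (auto intro!: vec.M.finsum_cong' simp: i)
qed

lemma \<psi>_smult_mult:
  assumes "u \<in> carrier H" "v \<in> carrier H" "w \<in> carrier H" "z \<in> carrier H"
  shows "\<psi> (u \<otimes>\<^sub>H w) \<odot>\<^sub>H (v \<otimes>\<^sub>H z) = (\<psi> u \<odot>\<^sub>H v) \<otimes>\<^sub>H (\<psi> w \<odot>\<^sub>H z)"
  using vec.R.m_comm[OF \<psi>_in[OF assms(1)] \<psi>_in[OF assms(3)]] \<psi>_in[OF assms(1)] \<psi>_in[OF assms(3)] assms
  by (simp add: \<psi>_mult smult_mult_left smult_mult_right vec.smult_assoc1[symmetric])

lemma \<theta>l_mult: "\<lbrakk>x \<in> carrier H; y \<in> carrier H\<rbrakk> \<Longrightarrow> \<theta>l (x \<otimes>\<^sub>H y) = \<theta>l x \<otimes>\<^sub>H \<theta>l y"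
  unfolding \<theta>l_def by (rule sweedler_multiplicative[OF \<theta>l_bilinear \<psi>_smult_mult])

lemma \<theta>r_mult: "\<lbrakk>x \<in> carrier H; y \<in> carrier H\<rbrakk> \<Longrightarrow> \<theta>r (x \<otimes>\<^sub>H y) = \<theta>r x \<otimes>\<^sub>H \<theta>r y"
  unfolding \<theta>r_def by (rule sweedler_multiplicative[OF \<theta>r_bilinear \<psi>_smult_mult])

definition \<delta> where "\<delta> = inv (\<one> \<oplus> \<one>)"

lemma half: "\<delta> \<in> carrier K" "\<ominus> \<delta> \<in> carrier K" "\<delta> \<oplus> \<delta> = \<one>"
proof -
  have "\<one> \<oplus> \<one> \<in> Units K" using two_nonzero vec.field_Units by auto
  then have *: "\<delta> \<in> carrier K" "\<delta> \<otimes> (\<one> \<oplus> \<one>) = \<one>" unfolding \<delta>_def by auto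
  then show "\<delta> \<in> carrier K" "\<ominus> \<delta> \<in> carrier K" "\<delta> \<oplus> \<delta> = \<one>" by (simp_all add: vec.R.r_distr)
qed

lemma self_neg:
  assumes "x \<in> carrier H" "\<ominus>\<^sub>H x = x"
  shows "x = \<zero>\<^sub>H"
proof -
  have "(\<one> \<oplus> \<one>) \<odot>\<^sub>H x = x \<oplus>\<^sub>H \<ominus>\<^sub>H x" using assms by (simp add: vec.smult_l_distr)
  then have "(\<one> \<oplus> \<one>) \<odot>\<^sub>H x = \<zero>\<^sub>H" using assms(1) by (simp add: vec.M.r_neg)
  then show ?thesis using vec.smult_nonzero[of "\<one> \<oplus> \<one>" x] assms(1) two_nonzero by auto
qed

text \<open>The projections onto the eigenspaces for minus one of the involutions
  \<open>\<theta>l\<close> and \<open>\<theta>r\<close>, with \<open>\<delta>\<close> equal to one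
  half.\<close>

definition Pl where "Pl h = \<delta> \<odot>\<^sub>H h \<oplus>\<^sub>H (\<ominus> \<delta>) \<odot>\<^sub>H \<theta>l h"
definition Pr where "Pr h = \<delta> \<odot>\<^sub>H h \<oplus>\<^sub>H (\<ominus> \<delta>) \<odot>\<^sub>H \<theta>r h"

lemma Pl_hom: "Pl \<in> module_hom K H H"
  unfolding Pl_def using half
  by (intro module_hom_plus[OF H_module] module_hom_smult_left[OF H_module] module_hom_id \<theta>l_hom) auto

lemma Pr_hom: "Pr \<in> module_hom K H H"
  unfolding Pr_def using half
  by (intro module_hom_plus[OF H_module] module_hom_smult_left[OF H_module] module_hom_id \<theta>r_hom) auto

lemmas Pl_in = module_hom_in[OF Pl_hom] and Pr_in = module_hom_in[OF Pr_hom]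

lemma module_hom_neg:
  assumes "f \<in> module_hom K H H" "x \<in> carrier H"
  shows "f (\<ominus>\<^bsub>H\<^esub> x) = \<ominus>\<^sub>H f x"
  using module_hom_smult[OF assms(1), of "\<ominus> \<one>" x] assms(2) module_hom_in[OF assms]
  by (simp add: vec.smult_minus_1)

lemma \<theta>l_Pl:
  assumes h: "h \<in> carrier H"
  shows "\<theta>l (Pl h) = \<ominus>\<^sub>H Pl h"
proof -
  have "\<theta>l (Pl h) = \<delta> \<odot>\<^sub>H \<theta>l h \<oplus>\<^sub>H (\<ominus> \<delta>) \<odot>\<^sub>H h"
    unfolding Pl_def using h half \<theta>l_in[OF h]
    by (simp add: module_hom_add[OF \<theta>l_hom] module_hom_smult[OF \<theta>l_hom] \<theta>l_\<theta>l)
  then show ?thesis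
    unfolding Pl_def using h half \<theta>l_in[OF h]
    by (simp add: vec.smult_l_minus vec.M.minus_add vec.M.a_comm)
qed

lemma \<theta>r_Pr:
  assumes h: "h \<in> carrier H"
  shows "\<theta>r (Pr h) = \<ominus>\<^sub>H Pr h"
proof -
  have "\<theta>r (Pr h) = \<delta> \<odot>\<^sub>H \<theta>r h \<oplus>\<^sub>H (\<ominus> \<delta>) \<odot>\<^sub>H h"
    unfolding Pr_def using h half \<theta>r_in[OF h]
    by (simp add: module_hom_add[OF \<theta>r_hom] module_hom_smult[OF \<theta>r_hom] \<theta>r_\<theta>r)
  then show ?thesis
    unfolding Pr_def using h half \<theta>r_in[OF h]
    by (simp add: vec.smult_l_minus vec.M.minus_add vec.M.a_comm)
qed

lemma Pl_id: "\<lbrakk>h \<in> carrier H; \<theta>l h = \<ominus>\<^sub>H h\<rbrakk> \<Longrightarrow> Pl h = h"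
  and Pr_id: "\<lbrakk>h \<in> carrier H; \<theta>r h = \<ominus>\<^sub>H h\<rbrakk> \<Longrightarrow> Pr h = h"
  unfolding Pl_def Pr_def using half
  by (simp_all add: vec.smult_l_minus vec.smult_r_minus vec.smult_l_distr[symmetric])

text \<open>As for \<open>\<theta>l\<close>, the projection passes to the first tensor factor;
  \<open>Pr\<close> passes to the second. An element fixed by both projections thus has both of its
  tensor factors projected.\<close>

lemma sweedler_Pl:
  assumes U: "module K U" and \<beta>: "\<beta> \<in> bilinear_maps K H H U" and h: "h \<in> carrier H"
  shows "sweedler U \<beta> (Pl h) = sweedler U (\<lambda>u v. \<beta> (Pl u) v) h"
proof -
  interpret U: module K U by fact
  note L = sweedler_hom[OF U \<beta> module_hom_id]
  have \<beta>\<theta>: "(\<lambda>u v. \<beta> (\<theta>l u) v) \<in> bilinear_maps K H H U"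
    by (rule bilinear_mapsI[OF bilinear_mapsD(1)[OF \<beta> \<theta>l_in] bilinear_hom_left[OF \<beta> \<theta>l_hom]])
  have m: "(\<lambda>x. k \<odot>\<^sub>U x) \<in> module_hom K U U" if "k \<in> carrier K" for k
    by (rule module_hom_smult_left[OF U module_hom_id that])
  have "sweedler U \<beta> (Pl h) = \<delta> \<odot>\<^sub>U sweedler U \<beta> h \<oplus>\<^sub>U (\<ominus> \<delta>) \<odot>\<^sub>U sweedler U (\<lambda>u v. \<beta> (\<theta>l u) v) h"
    unfolding Pl_def sweedler_\<theta>l[OF U \<beta> h, symmetric] using h half \<theta>l_in[OF h]
    by (simp add: module_hom_add[OF L] module_hom_smult[OF L])
  also have "... = sweedler U (\<lambda>u v. \<delta> \<odot>\<^sub>U \<beta> u v) h \<oplus>\<^sub>U sweedler U (\<lambda>u v. (\<ominus> \<delta>) \<odot>\<^sub>U \<beta> (\<theta>l u) v) h"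
    using sweedler_comp[OF U U \<beta> m[OF half(1)] h] sweedler_comp[OF U U \<beta>\<theta> m[OF half(2)] h] by simp
  also have "... = sweedler U (\<lambda>u v. \<delta> \<odot>\<^sub>U \<beta> u v \<oplus>\<^sub>U (\<ominus> \<delta>) \<odot>\<^sub>U \<beta> (\<theta>l u) v) h"
    by (rule sweedler_plus[symmetric, OF U bilinear_comp[OF m[OF half(1)] \<beta>] bilinear_comp[OF m[OF half(2)] \<beta>\<theta>] h])
  also have "... = sweedler U (\<lambda>u v. \<beta> (Pl u) v) h"
  proof (rule sweedler_cong[symmetric, OF U _ h])
    show "(\<lambda>u v. \<beta> (Pl u) v) \<in> bilinear_maps K H H U"
      by (rule bilinear_mapsI[OF bilinear_mapsD(1)[OF \<beta> Pl_in] bilinear_hom_left[OF \<beta> Pl_hom]])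
    fix u v assume u: "u \<in> carrier H" and v: "v \<in> carrier H"
    note Lv = bilinear_mapsD(2)[OF \<beta> v]
    show "\<beta> (Pl u) v = \<delta> \<odot>\<^sub>U \<beta> u v \<oplus>\<^sub>U (\<ominus> \<delta>) \<odot>\<^sub>U \<beta> (\<theta>l u) v"
      unfolding Pl_def using u half \<theta>l_in[OF u] by (simp add: module_hom_add[OF Lv] module_hom_smult[OF Lv])
  qed
  finally show ?thesis .
qed

lemma sweedler_Pr:
  assumes U: "module K U" and \<beta>: "\<beta> \<in> bilinear_maps K H H U" and h: "h \<in> carrier H"
  shows "sweedler U \<beta> (Pr h) = sweedler U (\<lambda>u v. \<beta> u (Pr v)) h"
proof -
  interpret U: module K U by fact
  note L = sweedler_hom[OF U \<beta> module_hom_id]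
  have \<beta>\<theta>: "(\<lambda>u v. \<beta> u (\<theta>r v)) \<in> bilinear_maps K H H U"
    by (rule bilinear_mapsI[OF bilinear_hom_right[OF \<beta> \<theta>r_hom] bilinear_mapsD(2)[OF \<beta> \<theta>r_in]])
  have m: "(\<lambda>x. k \<odot>\<^sub>U x) \<in> module_hom K U U" if "k \<in> carrier K" for k
    by (rule module_hom_smult_left[OF U module_hom_id that])
  have "sweedler U \<beta> (Pr h) = \<delta> \<odot>\<^sub>U sweedler U \<beta> h \<oplus>\<^sub>U (\<ominus> \<delta>) \<odot>\<^sub>U sweedler U (\<lambda>u v. \<beta> u (\<theta>r v)) h"
    unfolding Pr_def sweedler_\<theta>r[OF U \<beta> h, symmetric] using h half \<theta>r_in[OF h]
    by (simp add: module_hom_add[OF L] module_hom_smult[OF L])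
  also have "... = sweedler U (\<lambda>u v. \<delta> \<odot>\<^sub>U \<beta> u v) h \<oplus>\<^sub>U sweedler U (\<lambda>u v. (\<ominus> \<delta>) \<odot>\<^sub>U \<beta> u (\<theta>r v)) h"
    using sweedler_comp[OF U U \<beta> m[OF half(1)] h] sweedler_comp[OF U U \<beta>\<theta> m[OF half(2)] h] by simp
  also have "... = sweedler U (\<lambda>u v. \<delta> \<odot>\<^sub>U \<beta> u v \<oplus>\<^sub>U (\<ominus> \<delta>) \<odot>\<^sub>U \<beta> u (\<theta>r v)) h"
    by (rule sweedler_plus[symmetric, OF U bilinear_comp[OF m[OF half(1)] \<beta>] bilinear_comp[OF m[OF half(2)] \<beta>\<theta>] h])
  also have "... = sweedler U (\<lambda>u v. \<beta> u (Pr v)) h"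
  proof (rule sweedler_cong[symmetric, OF U _ h])
    show "(\<lambda>u v. \<beta> u (Pr v)) \<in> bilinear_maps K H H U"
      by (rule bilinear_mapsI[OF bilinear_hom_right[OF \<beta> Pr_hom] bilinear_mapsD(2)[OF \<beta> Pr_in]])
    fix u v assume u: "u \<in> carrier H" and v: "v \<in> carrier H"
    note Lu = bilinear_mapsD(1)[OF \<beta> u]
    show "\<beta> u (Pr v) = \<delta> \<odot>\<^sub>U \<beta> u v \<oplus>\<^sub>U (\<ominus> \<delta>) \<odot>\<^sub>U \<beta> u (\<theta>r v)"
      unfolding Pr_def using v half \<theta>r_in[OF v] by (simp add: module_hom_add[OF Lu] module_hom_smult[OF Lu])
  qed
  finally show ?thesis .
qed

text \<open>The \<open>(-1)\<close>-eigenspace \<open>B\<close> of \<open>\<theta>\<close> satisfies \<open>1 \<in> B B\<close>: apply the antipode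
  identity to an \<open>h\<close> in \<open>B\<close> with nonzero counit, and project.\<close>

lemma one_eq_sweedler_Pl:
  "\<exists>h\<in>carrier H. \<one>\<^sub>H = sweedler H (\<lambda>u v. Pl u \<otimes>\<^sub>H Pl (antipode H v)) h"
proof -
  obtain z where z: "z \<in> carrier H" "counit H z = \<zero>" "\<psi> z = \<one>" using \<psi>_separates by blast
  \<comment> \<open>Chosen with \<open>\<theta>l h = - h\<close> and counit
    \<open>\<psi> z - \<epsilon> z = 1\<close>, so that the antipode identity at \<open>h\<close>
    yields the unit.\<close>
  define h where "h = \<theta>l z \<ominus>\<^sub>H z"
  have h: "h \<in> carrier H" using z \<theta>l_in by (simp add: h_def)
  have \<epsilon>h: "counit H h = \<one>" using z \<theta>l_in[OF z(1)] by (simp add: h_def counit_diff counit_\<theta>l vec.R.minus_eq)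
  have "\<theta>l h = z \<ominus>\<^sub>H \<theta>l z"
    unfolding h_def using z(1) \<theta>l_in[OF z(1)]
    by (simp only: module_hom_minus[OF H_module H_module \<theta>l_hom] \<theta>l_\<theta>l)
  also have "... = \<ominus>\<^sub>H h"
    unfolding h_def using z(1) \<theta>l_in[OF z(1)] by (simp add: a_minus_def vec.M.minus_add vec.M.a_comm)
  finally have "\<theta>l h = \<ominus>\<^sub>H h" .
  then have Pl_h: "Pl h = h" by (rule Pl_id[OF h])
  note rules = \<psi>_rules module_hom_comp[OF Pl_hom] Pl_in module_hom_comp[OF \<theta>l_hom] \<theta>l_in
  \<comment> \<open>The complementary projection, onto the vectors fixed by
    \<open>\<theta>l\<close>. It fixes the unit, and on a product whose left factor is negated it
    keeps just the negated part of the right factor.\<close>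
  define Q where "Q x = \<delta> \<odot>\<^sub>H x \<oplus>\<^sub>H \<delta> \<odot>\<^sub>H \<theta>l x" for x
  have Q_hom: "Q \<in> module_hom K H H"
    unfolding Q_def using half
    by (intro module_hom_plus[OF H_module] module_hom_smult_left[OF H_module] module_hom_id \<theta>l_hom) auto
  have bl: "(\<lambda>u v. u \<otimes>\<^sub>H antipode H v) \<in> bilinear_maps K H H H"
    and bl2: "(\<lambda>u v. Pl u \<otimes>\<^sub>H antipode H v) \<in> bilinear_maps K H H H"
    by (rule bilinear_mapsI; (intro rules | assumption)+)+
  have "\<theta>l \<one>\<^sub>H = \<one>\<^sub>H"
    using \<theta>_idem module_hom_finsum[OF H_module H_module \<theta>l_hom finite_G, of idem] idem_in
    unfolding sum_idem[symmetric] by (auto intro!: vec.M.finsum_cong')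
  then have Q_one: "Q \<one>\<^sub>H = \<one>\<^sub>H" using half by (simp add: Q_def vec.smult_l_distr[symmetric])
  have "\<one>\<^sub>H = sweedler H (\<lambda>u v. u \<otimes>\<^sub>H antipode H v) h"
    using sweedler_antipode_right[OF H_module module_hom_id h] \<epsilon>h by simp
  also have "... = sweedler H (\<lambda>u v. Pl u \<otimes>\<^sub>H antipode H v) h"
    using sweedler_Pl[OF H_module bl h] Pl_h by simp
  finally have "\<one>\<^sub>H = Q (sweedler H (\<lambda>u v. Pl u \<otimes>\<^sub>H antipode H v) h)" using Q_one by simp
  also have "Q (sweedler H (\<lambda>u v. Pl u \<otimes>\<^sub>H antipode H v) h) = sweedler H (\<lambda>u v. Q (Pl u \<otimes>\<^sub>H antipode H v)) h"
    by (rule sweedler_comp[OF H_module H_module bl2 Q_hom h])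
  also have "... = sweedler H (\<lambda>u v. Pl u \<otimes>\<^sub>H Pl (antipode H v)) h"
  proof (rule sweedler_cong[OF H_module bilinear_comp[OF Q_hom bl2] h])
    fix u v assume u: "u \<in> carrier H" and v: "v \<in> carrier H"
    have c: "Pl u \<in> carrier H" "antipode H v \<in> carrier H" "\<theta>l (antipode H v) \<in> carrier H"
      using Pl_in[OF u] antipode_in[OF v] \<theta>l_in by auto
    have "Q (Pl u \<otimes>\<^sub>H antipode H v) = \<delta> \<odot>\<^sub>H (Pl u \<otimes>\<^sub>H antipode H v) \<oplus>\<^sub>H \<delta> \<odot>\<^sub>H (\<ominus>\<^bsub>H\<^esub> Pl u \<otimes>\<^sub>H \<theta>l (antipode H v))"
      unfolding Q_def \<theta>l_mult[OF c(1,2)] \<theta>l_Pl[OF u] ..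
    also have "... = Pl u \<otimes>\<^sub>H Pl (antipode H v)"
      unfolding Pl_def[of "antipode H v"] using c half
      by (simp add: r_distr smult_mult_right l_minus vec.smult_l_minus vec.smult_r_minus r_minus)
    finally show "Q (Pl u \<otimes>\<^sub>H antipode H v) = Pl u \<otimes>\<^sub>H Pl (antipode H v)" .
  qed
  finally show ?thesis unfolding Q_one using h by blast
qed

text \<open>Mirror image with the other antipode identity. It ensures that the eigenspace of
  \<open>\<theta>r\<close> also meets every ideal cut out by an idempotent.\<close>

lemma one_eq_sweedler_Pr:
  "\<exists>h\<in>carrier H. \<one>\<^sub>H = sweedler H (\<lambda>u v. Pr (antipode H u) \<otimes>\<^sub>H Pr v) h"
proof -
  obtain z where z: "z \<in> carrier H" "counit H z = \<zero>" "\<psi> z = \<one>" using \<psi>_separates by blast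
  define h where "h = \<theta>r z \<ominus>\<^sub>H z"
  have h: "h \<in> carrier H" using z \<theta>r_in by (simp add: h_def)
  have \<epsilon>h: "counit H h = \<one>" using z \<theta>r_in[OF z(1)] by (simp add: h_def counit_diff counit_\<theta>r vec.R.minus_eq)
  have "\<theta>r h = z \<ominus>\<^sub>H \<theta>r z"
    unfolding h_def using z(1) \<theta>r_in[OF z(1)]
    by (simp only: module_hom_minus[OF H_module H_module \<theta>r_hom] \<theta>r_\<theta>r)
  also have "... = \<ominus>\<^sub>H h"
    unfolding h_def using z(1) \<theta>r_in[OF z(1)] by (simp add: a_minus_def vec.M.minus_add vec.M.a_comm)
  finally have "\<theta>r h = \<ominus>\<^sub>H h" .
  then have Pr_h: "Pr h = h" by (rule Pr_id[OF h])
  note rules = \<psi>_rules module_hom_comp[OF Pr_hom] Pr_in module_hom_comp[OF \<theta>r_hom] \<theta>r_in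
  define Q where "Q x = \<delta> \<odot>\<^sub>H x \<oplus>\<^sub>H \<delta> \<odot>\<^sub>H \<theta>r x" for x
  have Q_hom: "Q \<in> module_hom K H H"
    unfolding Q_def using half
    by (intro module_hom_plus[OF H_module] module_hom_smult_left[OF H_module] module_hom_id \<theta>r_hom) auto
  have bl: "(\<lambda>u v. antipode H u \<otimes>\<^sub>H v) \<in> bilinear_maps K H H H"
    and bl2: "(\<lambda>u v. antipode H u \<otimes>\<^sub>H Pr v) \<in> bilinear_maps K H H H"
    by (rule bilinear_mapsI; (intro rules antipode_linear Pr_hom | assumption)+)+
  have "\<theta>r \<one>\<^sub>H = \<one>\<^sub>H"
    using \<theta>_idem module_hom_finsum[OF H_module H_module \<theta>r_hom finite_G, of idem] idem_in
    unfolding sum_idem[symmetric] by (auto intro!: vec.M.finsum_cong')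
  then have Q_one: "Q \<one>\<^sub>H = \<one>\<^sub>H" using half by (simp add: Q_def vec.smult_l_distr[symmetric])
  have "\<one>\<^sub>H = sweedler H (\<lambda>u v. antipode H u \<otimes>\<^sub>H v) h"
    using sweedler_antipode_left[OF H_module module_hom_id h] \<epsilon>h by simp
  also have "... = sweedler H (\<lambda>u v. antipode H u \<otimes>\<^sub>H Pr v) h"
    using sweedler_Pr[OF H_module bl h] Pr_h by simp
  finally have "\<one>\<^sub>H = Q (sweedler H (\<lambda>u v. antipode H u \<otimes>\<^sub>H Pr v) h)" using Q_one by simp
  also have "Q (sweedler H (\<lambda>u v. antipode H u \<otimes>\<^sub>H Pr v) h) = sweedler H (\<lambda>u v. Q (antipode H u \<otimes>\<^sub>H Pr v)) h"
    by (rule sweedler_comp[OF H_module H_module bl2 Q_hom h])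
  also have "... = sweedler H (\<lambda>u v. Pr (antipode H u) \<otimes>\<^sub>H Pr v) h"
  proof (rule sweedler_cong[OF H_module bilinear_comp[OF Q_hom bl2] h])
    fix u v assume u: "u \<in> carrier H" and v: "v \<in> carrier H"
    have c: "antipode H u \<in> carrier H" "Pr v \<in> carrier H" "\<theta>r (antipode H u) \<in> carrier H"
      using Pr_in[OF v] antipode_in[OF u] \<theta>r_in by auto
    have "Q (antipode H u \<otimes>\<^sub>H Pr v) = \<delta> \<odot>\<^sub>H (antipode H u \<otimes>\<^sub>H Pr v) \<oplus>\<^sub>H \<delta> \<odot>\<^sub>H (\<theta>r (antipode H u) \<otimes>\<^sub>H \<ominus>\<^sub>H Pr v)"
      unfolding Q_def \<theta>r_mult[OF c(1,2)] \<theta>r_Pr[OF v] ..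
    also have "... = Pr (antipode H u) \<otimes>\<^sub>H Pr v"
      unfolding Pr_def[of "antipode H u"] using c half
      by (simp add: l_distr smult_mult_left l_minus vec.smult_l_minus vec.smult_r_minus r_minus)
    finally show "Q (antipode H u \<otimes>\<^sub>H Pr v) = Pr (antipode H u) \<otimes>\<^sub>H Pr v" .
  qed
  finally show ?thesis unfolding Q_one using h by blast
qed

text \<open>Multiply the expression of the unit by \<open>idem a\<close>, which is nonzero. The
  first form yields the vectors \<open>y\<close> and the nonvanishing of the scalars
  \<open>s\<close>, the second the surjectivity of \<open>\<tau>\<close>.\<close>

lemma Pl_products:
  assumes a: "a \<in> carrier G"
  shows "\<exists>u\<in>carrier H. \<exists>v\<in>carrier H. (idem a \<otimes>\<^sub>H Pl u) \<otimes>\<^sub>H Pl v \<noteq> \<zero>\<^sub>H"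
    and "\<exists>u\<in>carrier H. \<exists>v\<in>carrier H. (Pl u \<otimes>\<^sub>H Pl v) \<otimes>\<^sub>H idem a \<noteq> \<zero>\<^sub>H"
proof -
  obtain h where h: "h \<in> carrier H" "\<one>\<^sub>H = sweedler H (\<lambda>u v. Pl u \<otimes>\<^sub>H Pl (antipode H v)) h"
    using one_eq_sweedler_Pl by blast
  note eH = idem_in[OF a]
  note rules = \<psi>_rules module_hom_comp[OF Pl_hom] Pl_in Pl_hom
  have bl: "(\<lambda>u v. Pl u \<otimes>\<^sub>H Pl (antipode H v)) \<in> bilinear_maps K H H H"
    by (rule bilinear_mapsI; (intro rules antipode_linear | assumption)+)
  show "\<exists>u\<in>carrier H. \<exists>v\<in>carrier H. (idem a \<otimes>\<^sub>H Pl u) \<otimes>\<^sub>H Pl v \<noteq> \<zero>\<^sub>H"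
  proof (rule ccontr)
    assume "\<not> ?thesis"
    then have z: "(idem a \<otimes>\<^sub>H Pl u) \<otimes>\<^sub>H Pl v = \<zero>\<^sub>H" if "u \<in> carrier H" "v \<in> carrier H" for u v using that by blast
    have "idem a = idem a \<otimes>\<^sub>H sweedler H (\<lambda>u v. Pl u \<otimes>\<^sub>H Pl (antipode H v)) h" using eH by (simp flip: h(2))
    also have "... = sweedler H (\<lambda>u v. idem a \<otimes>\<^sub>H (Pl u \<otimes>\<^sub>H Pl (antipode H v))) h"
      by (rule sweedler_comp[OF H_module H_module bl mult_right_hom[OF module_hom_id eH] h(1)])
    also have "... = \<zero>\<^sub>H"
      by (rule sweedler_zero[OF H_module h(1)])
        (simp add: m_assoc[symmetric] eH Pl_in antipode_in z)
    finally show False using idem_nonzero[OF a] by simp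
  qed
  show "\<exists>u\<in>carrier H. \<exists>v\<in>carrier H. (Pl u \<otimes>\<^sub>H Pl v) \<otimes>\<^sub>H idem a \<noteq> \<zero>\<^sub>H"
  proof (rule ccontr)
    assume "\<not> ?thesis"
    then have z: "(Pl u \<otimes>\<^sub>H Pl v) \<otimes>\<^sub>H idem a = \<zero>\<^sub>H" if "u \<in> carrier H" "v \<in> carrier H" for u v using that by blast
    have "idem a = sweedler H (\<lambda>u v. Pl u \<otimes>\<^sub>H Pl (antipode H v)) h \<otimes>\<^sub>H idem a" using eH by (simp flip: h(2))
    also have "... = sweedler H (\<lambda>u v. (Pl u \<otimes>\<^sub>H Pl (antipode H v)) \<otimes>\<^sub>H idem a) h"
      by (rule sweedler_comp[OF H_module H_module bl mult_left_hom[OF module_hom_id eH] h(1)])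
    also have "... = \<zero>\<^sub>H"
      by (rule sweedler_zero[OF H_module h(1)]) (simp only: z antipode_in)
    finally show False using idem_nonzero[OF a] by simp
  qed
qed

text \<open>Supplies an eigenvector of \<open>\<theta>r\<close> for comparison with
  \<open>y a\<close>, which is built from \<open>\<theta>l\<close>.\<close>

lemma Pr_nonzero:
  assumes a: "a \<in> carrier G"
  shows "\<exists>u\<in>carrier H. idem a \<otimes>\<^sub>H Pr u \<noteq> \<zero>\<^sub>H"
proof (rule ccontr)
  assume "\<not> ?thesis"
  then have z: "idem a \<otimes>\<^sub>H Pr u = \<zero>\<^sub>H" if "u \<in> carrier H" for u using that by blast
  obtain h where h: "h \<in> carrier H" "\<one>\<^sub>H = sweedler H (\<lambda>u v. Pr (antipode H u) \<otimes>\<^sub>H Pr v) h"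
    using one_eq_sweedler_Pr by blast
  note eH = idem_in[OF a]
  note rules = \<psi>_rules module_hom_comp[OF Pr_hom] Pr_in Pr_hom
  have bl: "(\<lambda>u v. Pr (antipode H u) \<otimes>\<^sub>H Pr v) \<in> bilinear_maps K H H H"
    by (rule bilinear_mapsI; (intro rules antipode_linear | assumption)+)
  have "idem a = idem a \<otimes>\<^sub>H sweedler H (\<lambda>u v. Pr (antipode H u) \<otimes>\<^sub>H Pr v) h" using eH by (simp flip: h(2))
  also have "... = sweedler H (\<lambda>u v. idem a \<otimes>\<^sub>H (Pr (antipode H u) \<otimes>\<^sub>H Pr v)) h"
    by (rule sweedler_comp[OF H_module H_module bl mult_right_hom[OF module_hom_id eH] h(1)])
  also have "... = \<zero>\<^sub>H"
    by (rule sweedler_zero[OF H_module h(1)]) (simp add: m_assoc[symmetric] eH Pr_in antipode_in z)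
  finally show False using idem_nonzero[OF a] by simp
qed

end

text \<open>The last condition is multiplicativity of the comultiplication on the product of
  \<open>y a\<close> and \<open>y (\<tau> a)\<close>. Members of \<open>auto G\<close> are
  extensional, so \<open>\<tau>\<close> is literally an element of the automorphism group;
  \<open>s\<close> is restricted to the carrier only when solutions are counted.\<close>

definition crossed_datum where
  "crossed_datum K G \<tau> f s \<longleftrightarrow> \<tau> \<in> auto G \<and> (\<forall>a\<in>carrier G. \<tau> (\<tau> a) = a) \<and>
    f \<in> carrier (two_cocycles G (units_of K)) \<and> (\<forall>a\<in>carrier G. s a \<in> Units K \<and> s (\<tau> a) = s a) \<and>
    (\<forall>a\<in>carrier G. \<forall>c\<in>carrier G. s (a \<otimes>\<^sub>G c) = f (a, c) \<otimes>\<^sub>K (f (\<tau> a, \<tau> c) \<otimes>\<^sub>K (s a \<otimes>\<^sub>K s c)))"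

text \<open>The Hopf algebra with basis \<open>e\<^sub>a, y\<^sub>a\<close> in which \<open>e\<close> spans the functions on \<open>G\<close>,
  the group of order two acts by \<open>\<tau>\<close>, and \<open>s\<close>, \<open>f\<close> are the cocycle and the dual cocycle.
  \<open>p\<close> and \<open>q\<close> are the coordinate functionals.\<close>

locale crossed_presentation = hopf_algebra K H + G: comm_group G
  for K :: "('k, 'r) ring_scheme" (structure) and H :: "('k, 'h, 'x) hopf_scheme" (structure)
    and G :: "('g, 'e) monoid_scheme" +
  fixes \<tau> :: "'g \<Rightarrow> 'g" and f :: "'g \<times> 'g \<Rightarrow> 'k" and s :: "'g \<Rightarrow> 'k" and e y :: "'g \<Rightarrow> 'h"
    and p q :: "'g \<Rightarrow> 'h \<Rightarrow> 'k"
  assumes finite_G: "finite (carrier G)"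
    and e_in: "a \<in> carrier G \<Longrightarrow> e a \<in> carrier H" and y_in: "a \<in> carrier G \<Longrightarrow> y a \<in> carrier H"
    and p_hom: "a \<in> carrier G \<Longrightarrow> p a \<in> module_hom K H (base_algebra K)"
    and q_hom: "a \<in> carrier G \<Longrightarrow> q a \<in> module_hom K H (base_algebra K)"
    and expand: "x \<in> carrier H \<Longrightarrow> x = (\<Oplus>\<^bsub>H\<^esub> a\<in>carrier G. p a x \<odot>\<^sub>H e a \<oplus>\<^sub>H q a x \<odot>\<^sub>H y a)"
    and p_e: "\<lbrakk>a \<in> carrier G; c \<in> carrier G\<rbrakk> \<Longrightarrow> p a (e c) = (if a = c then \<one> else \<zero>)"
    and p_y: "\<lbrakk>a \<in> carrier G; c \<in> carrier G\<rbrakk> \<Longrightarrow> p a (y c) = \<zero>"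
    and q_e: "\<lbrakk>a \<in> carrier G; c \<in> carrier G\<rbrakk> \<Longrightarrow> q a (e c) = \<zero>"
    and q_y: "\<lbrakk>a \<in> carrier G; c \<in> carrier G\<rbrakk> \<Longrightarrow> q a (y c) = (if a = c then \<one> else \<zero>)"
    and e_e: "\<lbrakk>a \<in> carrier G; c \<in> carrier G\<rbrakk> \<Longrightarrow> e a \<otimes>\<^sub>H e c = (if a = c then e c else \<zero>\<^sub>H)"
    and e_y: "\<lbrakk>a \<in> carrier G; c \<in> carrier G\<rbrakk> \<Longrightarrow> e a \<otimes>\<^sub>H y c = (if a = c then y c else \<zero>\<^sub>H)"
    and y_e: "\<lbrakk>a \<in> carrier G; c \<in> carrier G\<rbrakk> \<Longrightarrow> y a \<otimes>\<^sub>H e c = (if c = \<tau> a then y a else \<zero>\<^sub>H)"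
    and y_y: "\<lbrakk>a \<in> carrier G; c \<in> carrier G\<rbrakk> \<Longrightarrow> y a \<otimes>\<^sub>H y c = (if c = \<tau> a then s a \<odot>\<^sub>H e a else \<zero>\<^sub>H)"
    and sum_e: "(\<Oplus>\<^bsub>H\<^esub> a\<in>carrier G. e a) = \<one>\<^sub>H"
    and comult_e: "a \<in> carrier G \<Longrightarrow> comult H (e a) =
      (\<Oplus>\<^bsub>tensor K H H\<^esub> c\<in>carrier G. pure_tensor K H H (e c) (e (inv\<^bsub>G\<^esub> c \<otimes>\<^sub>G a)))"
    and comult_y: "a \<in> carrier G \<Longrightarrow> comult H (y a) =
      (\<Oplus>\<^bsub>tensor K H H\<^esub> c\<in>carrier G. f (c, inv\<^bsub>G\<^esub> c \<otimes>\<^sub>G a) \<odot>\<^bsub>tensor K H H\<^esub> pure_tensor K H H (y c) (y (inv\<^bsub>G\<^esub> c \<otimes>\<^sub>G a)))"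

context hopf_index_two
begin

lemma self_negK:
  assumes that: "k \<in> carrier K" "\<ominus> k = k"
  shows "k = \<zero>"
proof -
  have "(\<one> \<oplus> \<one>) \<otimes> k = k \<oplus> \<ominus> k" using that by (simp add: vec.R.l_distr)
  then have "(\<one> \<oplus> \<one>) \<otimes> k = \<zero>" using that(1) by (simp add: vec.R.r_neg)
  then show ?thesis using vec.integral[of "\<one> \<oplus> \<one>" k] that(1) two_nonzero by auto
qed

end

text \<open>The bases \<open>e\<^sub>a, y\<^sub>a\<close> of the planes \<open>e\<^sub>a H\<close>, with their coordinate functionals.\<close>

locale hopf_eigenbasis = hopf_index_two +
  fixes y p q
  assumes y_in: "a \<in> carrier G \<Longrightarrow> y a \<in> carrier H" and y_nz: "a \<in> carrier G \<Longrightarrow> y a \<noteq> \<zero>\<^sub>H"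
    and e_y: "\<lbrakk>a \<in> carrier G; c \<in> carrier G\<rbrakk> \<Longrightarrow> idem a \<otimes>\<^sub>H y c = (if a = c then y c else \<zero>\<^sub>H)"
    and \<theta>l_y: "a \<in> carrier G \<Longrightarrow> \<theta>l (y a) = \<ominus>\<^sub>H y a"
    and p_hom: "a \<in> carrier G \<Longrightarrow> p a \<in> module_hom K H (base_algebra K)"
    and q_hom: "a \<in> carrier G \<Longrightarrow> q a \<in> module_hom K H (base_algebra K)"
    and expand: "x \<in> carrier H \<Longrightarrow> x = (\<Oplus>\<^bsub>H\<^esub> a\<in>carrier G. p a x \<odot>\<^sub>H idem a \<oplus>\<^sub>H q a x \<odot>\<^sub>H y a)"
    and proj: "\<lbrakk>a \<in> carrier G; x \<in> carrier H\<rbrakk> \<Longrightarrow> idem a \<otimes>\<^sub>H x = p a x \<odot>\<^sub>H idem a \<oplus>\<^sub>H q a x \<odot>\<^sub>H y a"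
    and p_e: "\<lbrakk>a \<in> carrier G; c \<in> carrier G\<rbrakk> \<Longrightarrow> p a (idem c) = (if a = c then \<one> else \<zero>)"
    and p_y: "\<lbrakk>a \<in> carrier G; c \<in> carrier G\<rbrakk> \<Longrightarrow> p a (y c) = \<zero>"
    and q_e: "\<lbrakk>a \<in> carrier G; c \<in> carrier G\<rbrakk> \<Longrightarrow> q a (idem c) = \<zero>"
    and q_y: "\<lbrakk>a \<in> carrier G; c \<in> carrier G\<rbrakk> \<Longrightarrow> q a (y c) = (if a = c then \<one> else \<zero>)"

text \<open>\<open>Pl_products\<close> puts a nonzero negated vector into each right ideal
  \<open>e\<^sub>a H\<close>. The idempotent there is fixed by \<open>\<theta>l\<close>, so the two
  are independent because two is invertible, and \<open>pair_coordinates\<close> applies with left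
  multiplications.\<close>

lemma (in hopf_index_two) exists_eigenbasis: "\<exists>y p q. hopf_eigenbasis K H G \<iota> b \<psi> y p q"
proof -
  have "\<exists>u\<in>carrier H. idem a \<otimes>\<^sub>H Pl u \<noteq> \<zero>\<^sub>H" if a: "a \<in> carrier G" for a
  proof -
    obtain u v where "u \<in> carrier H" "v \<in> carrier H" "(idem a \<otimes>\<^sub>H Pl u) \<otimes>\<^sub>H Pl v \<noteq> \<zero>\<^sub>H" using Pl_products(1)[OF a] by blast
    then show ?thesis using l_null[OF Pl_in[of v]] by metis
  qed
  then obtain t where t: "\<And>a. a \<in> carrier G \<Longrightarrow> t a \<in> carrier H" "\<And>a. a \<in> carrier G \<Longrightarrow> idem a \<otimes>\<^sub>H Pl (t a) \<noteq> \<zero>\<^sub>H" by metis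
  define y where "y a = idem a \<otimes>\<^sub>H Pl (t a)" for a
  have y_in: "y a \<in> carrier H" if "a \<in> carrier G" for a using t(1) Pl_in idem_in that by (simp add: y_def)
  have y_nz: "y a \<noteq> \<zero>\<^sub>H" if "a \<in> carrier G" for a using t(2) that by (simp add: y_def)
  have e_y: "idem a \<otimes>\<^sub>H y c = (if a = c then y c else \<zero>\<^sub>H)" if "a \<in> carrier G" "c \<in> carrier G" for a c
    using that t(1)[OF that(2)] idem_in Pl_in by (simp add: y_def m_assoc[symmetric] idem_mult)
  have \<theta>l_y: "\<theta>l (y a) = \<ominus>\<^sub>H y a" if "a \<in> carrier G" for a
    using t(1)[OF that] idem_in[OF that] Pl_in
    by (simp add: y_def \<theta>l_mult \<theta>_idem[OF that] \<theta>l_Pl r_minus)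
  have y_indep: "y a \<noteq> k \<odot>\<^sub>H idem a" if a: "a \<in> carrier G" and k: "k \<in> carrier K" for a k
  proof
    assume eq: "y a = k \<odot>\<^sub>H idem a"
    then have "\<theta>l (y a) = y a" using module_hom_smult[OF \<theta>l_hom k idem_in[OF a]] \<theta>_idem[OF a] by simp
    then show False using \<theta>l_y[OF a] self_neg[OF y_in[OF a]] y_nz[OF a] by simp
  qed
  obtain p q where p_hom: "\<And>a. a \<in> carrier G \<Longrightarrow> p a \<in> module_hom K H (base_algebra K)"
    and q_hom: "\<And>a. a \<in> carrier G \<Longrightarrow> q a \<in> module_hom K H (base_algebra K)"
    and expand: "\<And>x. x \<in> carrier H \<Longrightarrow> x = (\<Oplus>\<^bsub>H\<^esub> a\<in>carrier G. p a x \<odot>\<^sub>H idem a \<oplus>\<^sub>H q a x \<odot>\<^sub>H y a)"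
    and proj: "\<And>a x. \<lbrakk>a \<in> carrier G; x \<in> carrier H\<rbrakk> \<Longrightarrow> idem a \<otimes>\<^sub>H x = p a x \<odot>\<^sub>H idem a \<oplus>\<^sub>H q a x \<odot>\<^sub>H y a"
    and p_e: "\<And>a c. \<lbrakk>a \<in> carrier G; c \<in> carrier G\<rbrakk> \<Longrightarrow> p a (idem c) = (if a = c then \<one> else \<zero>)"
    and p_y: "\<And>a c. \<lbrakk>a \<in> carrier G; c \<in> carrier G\<rbrakk> \<Longrightarrow> p a (y c) = \<zero>"
    and q_e: "\<And>a c. \<lbrakk>a \<in> carrier G; c \<in> carrier G\<rbrakk> \<Longrightarrow> q a (idem c) = \<zero>"
    and q_y: "\<And>a c. \<lbrakk>a \<in> carrier G; c \<in> carrier G\<rbrakk> \<Longrightarrow> q a (y c) = (if a = c then \<one> else \<zero>)"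
  proof (rule pair_coordinates[where P = "\<lambda>a x. idem a \<otimes>\<^sub>H x" and y = y])
    show "(\<lambda>x. idem a \<otimes>\<^sub>H x) \<in> module_hom K H H" if "a \<in> carrier G" for a
      using idem_in[OF that] by (intro mult_right_hom module_hom_id)
  qed (rule idem_mult e_y y_in y_indep that; assumption)+
  have "hopf_eigenbasis K H G \<iota> b \<psi> y p q"
    by unfold_locales (rule y_in y_nz e_y \<theta>l_y p_hom q_hom expand proj p_e p_y q_e q_y; assumption)+
  then show ?thesis by blast
qed

context hopf_eigenbasis
begin

lemma p_in:
  assumes that: "a \<in> carrier G" "x \<in> carrier H"
  shows "p a x \<in> carrier K"
  using functional_in[OF p_hom[OF that(1)] that(2)] .

lemma q_in:
  assumes that: "a \<in> carrier G" "x \<in> carrier H"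
  shows "q a x \<in> carrier K"
  using functional_in[OF q_hom[OF that(1)] that(2)] .

lemma
  assumes that: "a \<in> carrier G" "k \<in> carrier K" "l \<in> carrier K" "u \<in> carrier H" "v \<in> carrier H"
  shows p_lin: "p a (k \<odot>\<^sub>H u \<oplus>\<^sub>H l \<odot>\<^sub>H v) = k \<otimes> p a u \<oplus> l \<otimes> p a v"
    and q_lin: "q a (k \<odot>\<^sub>H u \<oplus>\<^sub>H l \<odot>\<^sub>H v) = k \<otimes> q a u \<oplus> l \<otimes> q a v"
  using that module_hom_add[OF p_hom] module_hom_add[OF q_hom]
    module_hom_smult[OF p_hom] module_hom_smult[OF q_hom] by auto

lemma
  assumes that: "a \<in> carrier G" "x \<in> carrier H"
  shows p_idem: "p a (idem a \<otimes>\<^sub>H x) = p a x"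
    and q_idem: "q a (idem a \<otimes>\<^sub>H x) = q a x"
  unfolding proj[OF that] using that p_in q_in idem_in y_in
    by (simp_all add: p_lin q_lin p_e p_y q_e q_y)

lemma idem_ext:
  assumes that: "x \<in> carrier H" "x' \<in> carrier H" "\<And>a. a \<in> carrier G \<Longrightarrow> idem a \<otimes>\<^sub>H x = idem a \<otimes>\<^sub>H x'"
  shows "x = x'"
proof -
  have "z = (\<Oplus>\<^bsub>H\<^esub> a\<in>carrier G. idem a \<otimes>\<^sub>H z)" if "z \<in> carrier H" for z
    using finsum_ldistr[OF finite_G that, of idem] idem_in that sum_idem by (simp add: Pi_iff)
  note this[OF that(1)]
  also have "(\<Oplus>\<^bsub>H\<^esub> a\<in>carrier G. idem a \<otimes>\<^sub>H x) = (\<Oplus>\<^bsub>H\<^esub> a\<in>carrier G. idem a \<otimes>\<^sub>H x')"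
    using that idem_in by (intro vec.M.finsum_cong') auto
  also have "... = x'" using \<open>\<And>z. z \<in> carrier H \<Longrightarrow> z = (\<Oplus>\<^bsub>H\<^esub> a\<in>carrier G. idem a \<otimes>\<^sub>H z)\<close>[OF that(2)] by simp
  finally show ?thesis .
qed

lemma \<theta>l_proj:
  assumes a: "a \<in> carrier G" and x: "x \<in> carrier H"
  shows "idem a \<otimes>\<^sub>H \<theta>l x = p a x \<odot>\<^sub>H idem a \<oplus>\<^sub>H \<ominus> q a x \<odot>\<^sub>H y a"
proof -
  have "idem a \<otimes>\<^sub>H \<theta>l x = \<theta>l (idem a \<otimes>\<^sub>H x)" using \<theta>l_mult[OF idem_in[OF a] x] \<theta>_idem[OF a] by simp
  also have "... = p a x \<odot>\<^sub>H \<theta>l (idem a) \<oplus>\<^sub>H q a x \<odot>\<^sub>H \<theta>l (y a)"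
    unfolding proj[OF a x] using a x p_in q_in idem_in y_in
    by (simp add: module_hom_add[OF \<theta>l_hom] module_hom_smult[OF \<theta>l_hom])
  finally show ?thesis
    using \<theta>_idem[OF a] \<theta>l_y[OF a] q_in[OF a x] y_in[OF a] by (simp add: vec.smult_l_minus vec.smult_r_minus)
qed

lemma
  assumes a: "a \<in> carrier G" and x: "x \<in> carrier H"
  shows p_\<theta>l: "p a (\<theta>l x) = p a x"
    and q_\<theta>l: "q a (\<theta>l x) = \<ominus> q a x"
proof -
  have "p a (\<theta>l x) = p a (idem a \<otimes>\<^sub>H \<theta>l x)" "q a (\<theta>l x) = q a (idem a \<otimes>\<^sub>H \<theta>l x)"
    using p_idem[OF a \<theta>l_in[OF x]] q_idem[OF a \<theta>l_in[OF x]] by simp_all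
  then show "p a (\<theta>l x) = p a x" "q a (\<theta>l x) = \<ominus> q a x"
    unfolding \<theta>l_proj[OF a x] using a x p_in q_in idem_in y_in
    by (simp_all add: p_lin q_lin p_e p_y q_e q_y)
qed

text \<open>\<open>\<theta>l\<close> does not change the coordinate at the idempotent, while here it
  negates the whole vector; that coordinate is its own negative and vanishes.\<close>

lemma B_proj:
  assumes a: "a \<in> carrier G" and x: "x \<in> carrier H" "\<theta>l x = \<ominus>\<^sub>H x"
  shows "idem a \<otimes>\<^sub>H x = q a x \<odot>\<^sub>H y a"
proof -
  have "p a x = \<ominus> p a x"
    using p_\<theta>l[OF a x(1)] x p_in[OF a x(1)] module_hom_smult[OF p_hom[OF a], of "\<ominus> \<one>" x]
    by (simp add: vec.smult_minus_1 vec.R.l_minus)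
  then have "p a x = \<zero>" using self_negK[OF p_in[OF a x(1)]] by simp
  then show ?thesis using proj[OF a x(1)] a x(1) idem_in y_in q_in by simp
qed

lemma fixed_proj:
  assumes a: "a \<in> carrier G" and x: "x \<in> carrier H" "\<theta>l x = x"
  shows "idem a \<otimes>\<^sub>H x = p a x \<odot>\<^sub>H idem a"
proof -
  have "q a x = \<zero>" using q_\<theta>l[OF a x(1)] x(2) self_negK[OF q_in[OF a x(1)]] by simp
  then show ?thesis using proj[OF a x(1)] a x(1) idem_in y_in p_in by simp
qed

text \<open>Take a vector \<open>w\<close> in the same right ideal that \<open>\<theta>r\<close>
  negates. The two involutions commute, so \<open>\<theta>r\<close> also negates
  \<open>\<theta>l w\<close> plus \<open>w\<close>, a multiple of the idempotent, which it fixes.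
  That multiple vanishes, and \<open>w\<close> is proportional to \<open>y a\<close>.\<close>

lemma \<theta>r_y:
  assumes a: "a \<in> carrier G"
  shows "\<theta>r (y a) = \<ominus>\<^sub>H y a"
proof -
  obtain u where u: "u \<in> carrier H" "idem a \<otimes>\<^sub>H Pr u \<noteq> \<zero>\<^sub>H" using Pr_nonzero[OF a] by blast
  define w where "w = idem a \<otimes>\<^sub>H Pr u"
  have w: "w \<in> carrier H" using u idem_in[OF a] Pr_in by (simp add: w_def)
  have \<theta>r_w: "\<theta>r w = \<ominus>\<^sub>H w"
    using u(1) idem_in[OF a] Pr_in by (simp add: w_def \<theta>r_mult \<theta>_idem[OF a] \<theta>r_Pr r_minus)
  have ew: "idem a \<otimes>\<^sub>H w = w"
    using u(1) idem_in[OF a] Pr_in idem_mult[OF a a] by (simp add: w_def m_assoc[symmetric])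
  have pw: "p a w \<in> carrier K" and qw: "q a w \<in> carrier K" using p_in[OF a w] q_in[OF a w] by auto
  have w_eq: "w = p a w \<odot>\<^sub>H idem a \<oplus>\<^sub>H q a w \<odot>\<^sub>H y a" using proj[OF a w] ew by simp
  have \<theta>l_w: "\<theta>l w = p a w \<odot>\<^sub>H idem a \<oplus>\<^sub>H \<ominus> q a w \<odot>\<^sub>H y a"
    using \<theta>l_proj[OF a w] \<theta>l_mult[OF idem_in[OF a] w] \<theta>_idem[OF a] ew by simp
  have "p a w = \<zero>"
  proof -
    have "\<theta>r (\<theta>l w) = \<ominus>\<^sub>H \<theta>l w"
      using \<theta>l_\<theta>r[OF w] \<theta>r_w module_hom_neg[OF \<theta>l_hom w] by simp
    moreover have "\<theta>r (\<theta>l w) \<oplus>\<^sub>H \<theta>r w = \<theta>r (\<theta>l w \<oplus>\<^sub>H w)"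
      using w \<theta>l_in[OF w] by (simp add: module_hom_add[OF \<theta>r_hom])
    moreover have sum: "\<theta>l w \<oplus>\<^sub>H w = (p a w \<oplus> p a w) \<odot>\<^sub>H idem a"
    proof -
      have "\<theta>l w \<oplus>\<^sub>H w = (p a w \<odot>\<^sub>H idem a \<oplus>\<^sub>H \<ominus> q a w \<odot>\<^sub>H y a) \<oplus>\<^sub>H (p a w \<odot>\<^sub>H idem a \<oplus>\<^sub>H q a w \<odot>\<^sub>H y a)"
        using \<theta>l_w w_eq by simp
      also have "... = (p a w \<odot>\<^sub>H idem a \<oplus>\<^sub>H p a w \<odot>\<^sub>H idem a) \<oplus>\<^sub>H (\<ominus> q a w \<odot>\<^sub>H y a \<oplus>\<^sub>H q a w \<odot>\<^sub>H y a)"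
        using pw qw idem_in[OF a] y_in[OF a] by (simp add: vec.M.a_ac)
      also have "... = (p a w \<oplus> p a w) \<odot>\<^sub>H idem a"
        using pw qw idem_in[OF a] y_in[OF a]
        by (simp add: vec.smult_l_distr[symmetric] vec.R.l_neg)
      finally show ?thesis .
    qed
    moreover have "\<theta>r ((p a w \<oplus> p a w) \<odot>\<^sub>H idem a) = (p a w \<oplus> p a w) \<odot>\<^sub>H idem a"
      using pw idem_in[OF a] by (simp add: module_hom_smult[OF \<theta>r_hom] \<theta>_idem[OF a])
    ultimately have "\<ominus>\<^sub>H ((p a w \<oplus> p a w) \<odot>\<^sub>H idem a) = (p a w \<oplus> p a w) \<odot>\<^sub>H idem a"
      using w \<theta>l_in[OF w] \<theta>r_w by (metis vec.M.minus_add vec.M.a_comm)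
    then have "(p a w \<oplus> p a w) \<odot>\<^sub>H idem a = \<zero>\<^sub>H" using self_neg pw idem_in[OF a] by simp
    then have "p a w \<oplus> p a w = \<zero>"
      using vec.smult_nonzero[OF _ idem_in[OF a] _ idem_nonzero[OF a]] pw by simp
    then have "\<ominus> p a w = p a w" using pw by (metis vec.R.minus_equality)
    then show ?thesis by (rule self_negK[OF pw])
  qed
  then have w_eq': "w = q a w \<odot>\<^sub>H y a" using w_eq qw idem_in[OF a] y_in[OF a] by simp
  then have "q a w \<noteq> \<zero>" using u(2) y_in[OF a] w_def by (metis vec.smult_l_null)
  moreover have "q a w \<odot>\<^sub>H \<theta>r (y a) = q a w \<odot>\<^sub>H (\<ominus>\<^bsub>H\<^esub> y a)"
  proof -
    have "q a w \<odot>\<^sub>H \<theta>r (y a) = \<theta>r w" by (subst w_eq') (simp add: module_hom_smult[OF \<theta>r_hom qw y_in[OF a]])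
    also have "... = \<ominus>\<^sub>H (q a w \<odot>\<^sub>H y a)" using \<theta>r_w w_eq' by simp
    finally show ?thesis using qw y_in[OF a] by (simp add: vec.smult_r_minus)
  qed
  ultimately show ?thesis
    using vec.smult_cancel[OF qw] \<theta>r_in[OF y_in[OF a]] y_in[OF a] by simp
qed

text \<open>In other words \<open>\<psi>\<close> is central in the dual algebra. Both involutions
  agree on the idempotents and on the \<open>y a\<close>.\<close>

lemma \<theta>_eq:
  assumes x: "x \<in> carrier H"
  shows "\<theta>r x = \<theta>l x"
proof (rule idem_ext[OF \<theta>r_in[OF x] \<theta>l_in[OF x]])
  fix a assume a: "a \<in> carrier G"
  have "idem a \<otimes>\<^sub>H \<theta>r x = \<theta>r (idem a \<otimes>\<^sub>H x)" using \<theta>r_mult[OF idem_in[OF a] x] \<theta>_idem[OF a] by simp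
  also have "... = p a x \<odot>\<^sub>H \<theta>r (idem a) \<oplus>\<^sub>H q a x \<odot>\<^sub>H \<theta>r (y a)"
    unfolding proj[OF a x] using a x p_in q_in idem_in y_in
    by (simp add: module_hom_add[OF \<theta>r_hom] module_hom_smult[OF \<theta>r_hom])
  also have "... = idem a \<otimes>\<^sub>H \<theta>l x"
    unfolding \<theta>l_proj[OF a x]
    using \<theta>_idem[OF a] \<theta>r_y[OF a] q_in[OF a x] y_in[OF a] by (simp add: vec.smult_l_minus vec.smult_r_minus)
  finally show "idem a \<otimes>\<^sub>H \<theta>r x = idem a \<otimes>\<^sub>H \<theta>l x" .
qed

lemma Pr_Pl:
  assumes that: "x \<in> carrier H"
  shows "Pr x = Pl x"
  using \<theta>_eq[OF that] by (simp add: Pr_def Pl_def)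

lemma Pl_y:
  assumes that: "a \<in> carrier G"
  shows "Pl (y a) = y a"
  by (rule Pl_id[OF y_in[OF that] \<theta>l_y[OF that]])

text \<open>Right multiplication by an idempotent preserves the line of \<open>y a\<close>, the
  negated vectors of its right ideal, so it acts by a scalar equal to its square. As the idempotents
  sum to the unit, one of these scalars is nonzero, hence one.\<close>

lemma exists_source:
  assumes a: "a \<in> carrier G"
  shows "\<exists>c\<in>carrier G. y a \<otimes>\<^sub>H idem c = y a"
proof -
  have "\<exists>c\<in>carrier G. y a \<otimes>\<^sub>H idem c \<noteq> \<zero>\<^sub>H"
  proof (rule ccontr)
    assume z: "\<not> ?thesis"
    have "y a = (\<Oplus>\<^bsub>H\<^esub> c\<in>carrier G. y a \<otimes>\<^sub>H idem c)"
      using finsum_rdistr[OF finite_G y_in[OF a], of idem] idem_in y_in[OF a] sum_idem by (simp add: Pi_iff)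
    also have "... = (\<Oplus>\<^bsub>H\<^esub> c\<in>carrier G. \<zero>\<^sub>H)" using z by (intro vec.M.finsum_cong') auto
    finally show False using y_nz[OF a] by simp
  qed
  then obtain c where c: "c \<in> carrier G" "y a \<otimes>\<^sub>H idem c \<noteq> \<zero>\<^sub>H" by blast
  define x where "x = y a \<otimes>\<^sub>H idem c"
  have x: "x \<in> carrier H" using y_in[OF a] idem_in[OF c(1)] by (simp add: x_def)
  have \<theta>x: "\<theta>l x = \<ominus>\<^sub>H x"
    using y_in[OF a] idem_in[OF c(1)] by (simp add: x_def \<theta>l_mult \<theta>_idem[OF c(1)] \<theta>l_y[OF a] l_minus)
  define k where "k = q a x"
  have k: "k \<in> carrier K" using q_in[OF a x] by (simp add: k_def)
  have xk: "x = k \<odot>\<^sub>H y a"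
  proof -
    have "idem a \<otimes>\<^sub>H x = x" using y_in[OF a] idem_in a c e_y[OF a a] by (simp add: x_def m_assoc[symmetric])
    then show ?thesis using B_proj[OF a x \<theta>x] by (simp add: k_def)
  qed
  have "x \<otimes>\<^sub>H idem c = x" using y_in[OF a] idem_in[OF c(1)] idem_mult[OF c(1) c(1)] by (simp add: x_def m_assoc)
  moreover have "x \<otimes>\<^sub>H idem c = k \<odot>\<^sub>H x"
    by (subst xk) (simp add: smult_mult_left k y_in[OF a] idem_in[OF c(1)] x_def)
  ultimately have "k \<odot>\<^sub>H x = \<one> \<odot>\<^sub>H x" using x by simp
  then have "k = \<one>" using vec.smult_right_cancel[OF k _ x] c(2) by (simp add: x_def)
  then have "y a \<otimes>\<^sub>H idem c = y a" using xk y_in[OF a] by (simp add: x_def)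
  then show ?thesis using c(1) by blast
qed

end

section \<open>Structure constants: the automorphism, the scalars and the cocycle\<close>

locale hopf_twisted_eigenbasis = hopf_eigenbasis +
  fixes \<tau>
  assumes \<tau>: "a \<in> carrier G \<Longrightarrow> \<tau> a \<in> carrier G" "a \<in> carrier G \<Longrightarrow> y a \<otimes>\<^sub>H idem (\<tau> a) = y a"
begin

lemma y_e:
  assumes a: "a \<in> carrier G" and c: "c \<in> carrier G"
  shows "y a \<otimes>\<^sub>H idem c = (if c = \<tau> a then y a else \<zero>\<^sub>H)"
proof (cases "c = \<tau> a")
  case False
  have "y a \<otimes>\<^sub>H idem c = (y a \<otimes>\<^sub>H idem (\<tau> a)) \<otimes>\<^sub>H idem c" using \<tau>(2)[OF a] by simp
  also have "... = y a \<otimes>\<^sub>H (idem (\<tau> a) \<otimes>\<^sub>H idem c)" by (rule m_assoc[OF y_in[OF a] idem_in[OF \<tau>(1)[OF a]] idem_in[OF c]])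
  also have "... = \<zero>\<^sub>H" using idem_mult[OF \<tau>(1)[OF a] c] False y_in[OF a] by auto
  finally show ?thesis using False by simp
qed (use \<tau>(2)[OF a] in simp)

lemma B_expand:
  assumes x: "x \<in> carrier H" "\<theta>l x = \<ominus>\<^sub>H x"
  shows "x = (\<Oplus>\<^bsub>H\<^esub> a\<in>carrier G. q a x \<odot>\<^sub>H y a)"
proof -
  have "x = (\<Oplus>\<^bsub>H\<^esub> a\<in>carrier G. idem a \<otimes>\<^sub>H x)"
    using finsum_ldistr[OF finite_G x(1), of idem] idem_in x(1) sum_idem by (simp add: Pi_iff)
  also have "... = (\<Oplus>\<^bsub>H\<^esub> a\<in>carrier G. q a x \<odot>\<^sub>H y a)"
    using x q_in y_in by (intro vec.M.finsum_cong') (auto simp: B_proj)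
  finally show ?thesis .
qed

text \<open>For each \<open>c\<close> some negated vector survives right multiplication by
  \<open>idem c\<close>. Expanded in the \<open>y a\<close>, it would be killed if no
  \<open>\<tau> a\<close> were equal to \<open>c\<close>.\<close>

lemma \<tau>_surj: "\<tau> ` carrier G = carrier G"
proof (intro equalityI subsetI)
  fix c assume c: "c \<in> carrier G"
  obtain u v where uv: "u \<in> carrier H" "v \<in> carrier H" "(Pl u \<otimes>\<^sub>H Pl v) \<otimes>\<^sub>H idem c \<noteq> \<zero>\<^sub>H" using Pl_products(2)[OF c] by blast
  have Pv: "Pl v \<in> carrier H" "Pl u \<in> carrier H" using Pl_in uv by auto
  have nz: "Pl v \<otimes>\<^sub>H idem c \<noteq> \<zero>\<^sub>H" using uv Pv idem_in[OF c] by (auto simp: m_assoc)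
  show "c \<in> \<tau> ` carrier G"
  proof (rule ccontr)
    assume nc: "c \<notin> \<tau> ` carrier G"
    have "Pl v \<otimes>\<^sub>H idem c = (\<Oplus>\<^bsub>H\<^esub> a\<in>carrier G. q a (Pl v) \<odot>\<^sub>H y a) \<otimes>\<^sub>H idem c"
      using B_expand[OF Pv(1) \<theta>l_Pl[OF uv(2)]] by simp
    also have "... = (\<Oplus>\<^bsub>H\<^esub> a\<in>carrier G. (q a (Pl v) \<odot>\<^sub>H y a) \<otimes>\<^sub>H idem c)"
      using Pv q_in y_in idem_in[OF c] by (intro finsum_ldistr finite_G) auto
    also have "... = (\<Oplus>\<^bsub>H\<^esub> a\<in>carrier G. \<zero>\<^sub>H)"
      using Pv q_in y_in idem_in c nc by (intro vec.M.finsum_cong') (auto simp: smult_mult_left y_e)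
    finally show False using nz by simp
  qed
qed (use \<tau> in auto)

lemma \<tau>_inj: "inj_on \<tau> (carrier G)"
  using \<tau>_surj finite_G by (simp add: eq_card_imp_inj_on)

definition s where "s a = p a (y a \<otimes>\<^sub>H y (\<tau> a))"

text \<open>A product of two negated vectors is fixed by the algebra automorphism
  \<open>\<theta>l\<close>, and the fixed vectors of the right ideal are the multiples of its
  idempotent.\<close>

lemma y_y:
  assumes a: "a \<in> carrier G" and c: "c \<in> carrier G"
  shows "y a \<otimes>\<^sub>H y c = (if c = \<tau> a then s a \<odot>\<^sub>H idem a else \<zero>\<^sub>H)"
proof (cases "c = \<tau> a")
  case True
  let ?x = "y a \<otimes>\<^sub>H y (\<tau> a)"
  have x: "?x \<in> carrier H" using y_in a \<tau> by simp
  have "\<theta>l ?x = ?x" using y_in a \<tau> by (simp add: \<theta>l_mult \<theta>l_y l_minus r_minus)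
  from fixed_proj[OF a x this] have "idem a \<otimes>\<^sub>H ?x = s a \<odot>\<^sub>H idem a" by (simp add: s_def)
  moreover have "idem a \<otimes>\<^sub>H ?x = ?x" using y_in idem_in a \<tau> e_y[OF a a] by (simp add: m_assoc[symmetric])
  ultimately show ?thesis using True by simp
next
  case False
  have "y a \<otimes>\<^sub>H y c = (y a \<otimes>\<^sub>H idem (\<tau> a)) \<otimes>\<^sub>H y c" using \<tau>(2)[OF a] by simp
  also have "... = y a \<otimes>\<^sub>H (idem (\<tau> a) \<otimes>\<^sub>H y c)" by (rule m_assoc[OF y_in[OF a] idem_in[OF \<tau>(1)[OF a]] y_in[OF c]])
  also have "... = \<zero>\<^sub>H" using e_y[OF \<tau>(1)[OF a] c] False y_in[OF a] by auto
  finally show ?thesis using False by simp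
qed

lemma s_in:
  assumes that: "a \<in> carrier G"
  shows "s a \<in> carrier K"
  using p_in y_in \<tau> that by (simp add: s_def)

text \<open>If \<open>s a\<close> vanished, \<open>y a\<close> would annihilate the whole eigenspace
  from the left, against the first part of \<open>Pl_products\<close>.\<close>

lemma s_nz:
  assumes a: "a \<in> carrier G"
  shows "s a \<noteq> \<zero>"
proof
  assume z: "s a = \<zero>"
  obtain u v where uv: "u \<in> carrier H" "v \<in> carrier H" "(idem a \<otimes>\<^sub>H Pl u) \<otimes>\<^sub>H Pl v \<noteq> \<zero>\<^sub>H" using Pl_products(1)[OF a] by blast
  have P: "Pl u \<in> carrier H" "Pl v \<in> carrier H" using Pl_in uv by auto
  have "y a \<otimes>\<^sub>H Pl v = y a \<otimes>\<^sub>H (\<Oplus>\<^bsub>H\<^esub> c\<in>carrier G. q c (Pl v) \<odot>\<^sub>H y c)"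
    using B_expand[OF P(2) \<theta>l_Pl[OF uv(2)]] by simp
  also have "... = (\<Oplus>\<^bsub>H\<^esub> c\<in>carrier G. y a \<otimes>\<^sub>H (q c (Pl v) \<odot>\<^sub>H y c))"
    using P q_in y_in a by (intro finsum_rdistr finite_G) auto
  also have "... = (\<Oplus>\<^bsub>H\<^esub> c\<in>carrier G. \<zero>\<^sub>H)"
    using P q_in y_in a z idem_in by (intro vec.M.finsum_cong') (auto simp: smult_mult_right y_y)
  finally have "y a \<otimes>\<^sub>H Pl v = \<zero>\<^sub>H" by simp
  then have "(idem a \<otimes>\<^sub>H Pl u) \<otimes>\<^sub>H Pl v = \<zero>\<^sub>H"
    using B_proj[OF a P(1) \<theta>l_Pl[OF uv(1)]] q_in[OF a P(1)] y_in[OF a] P by (simp add: smult_mult_left)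
  then show False using uv(3) by simp
qed

text \<open>The product of \<open>y a\<close> and \<open>y (\<tau> a)\<close> is a nonzero multiple
  of \<open>idem a\<close>, yet it is fixed by right multiplication with the idempotent at
  \<open>\<tau> (\<tau> a)\<close>; orthogonality gives the first claim. Bracketing
  \<open>y a\<close>, \<open>y (\<tau> a)\<close>, \<open>y a\<close> in two ways gives the
  second.\<close>

lemma
  assumes a: "a \<in> carrier G"
  shows \<tau>_\<tau>: "\<tau> (\<tau> a) = a"
    and s_\<tau>: "s (\<tau> a) = s a"
proof -
  have c: "y a \<in> carrier H" "y (\<tau> a) \<in> carrier H" "idem a \<in> carrier H" "idem (\<tau> (\<tau> a)) \<in> carrier H" "idem (\<tau> a) \<in> carrier H"
    using y_in idem_in \<tau>(1) a by auto
  have "(y a \<otimes>\<^sub>H y (\<tau> a)) \<otimes>\<^sub>H idem (\<tau> (\<tau> a)) = y a \<otimes>\<^sub>H y (\<tau> a)"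
    using c \<tau> a by (simp add: m_assoc)
  then have "s a \<odot>\<^sub>H (idem a \<otimes>\<^sub>H idem (\<tau> (\<tau> a))) = s a \<odot>\<^sub>H idem a"
    using y_y[OF a \<tau>(1)[OF a]] s_in[OF a] c by (simp add: smult_mult_left)
  then have "idem a \<otimes>\<^sub>H idem (\<tau> (\<tau> a)) = idem a"
    using vec.smult_cancel[OF s_in[OF a] s_nz[OF a]] c by simp
  then show tt: "\<tau> (\<tau> a) = a"
    using idem_mult[OF a \<tau>(1)[OF \<tau>(1)[OF a]]] idem_nonzero[OF a] by (auto split: if_splits)
  have "(y a \<otimes>\<^sub>H y (\<tau> a)) \<otimes>\<^sub>H y a = y a \<otimes>\<^sub>H (y (\<tau> a) \<otimes>\<^sub>H y a)" using c by (simp add: m_assoc)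
  then have "s a \<odot>\<^sub>H y a = s (\<tau> a) \<odot>\<^sub>H y a"
    using y_y[OF a \<tau>(1)[OF a]] y_y[OF \<tau>(1)[OF a] a] tt e_y[OF a a] \<tau>(2)[OF a] c
      s_in[OF a] s_in[OF \<tau>(1)[OF a]]
    by (simp add: smult_mult_left smult_mult_right)
  then show "s (\<tau> a) = s a"
    using vec.smult_right_cancel[OF s_in[OF a] s_in[OF \<tau>(1)[OF a]] y_in[OF a] y_nz[OF a]] by simp
qed

text \<open>The coefficient of \<open>y c\<close> tensor \<open>y d\<close> in the comultiplication
  of \<open>y\<close> at the product of \<open>c\<close> and \<open>d\<close>, read off by
  functionals. It is extensional, as the carrier of \<open>two_cocycles\<close> demands.\<close>

definition f where
  "f = (\<lambda>(c, d)\<in>carrier G \<times> carrier G. sweedler (base_algebra K) (\<lambda>u v. q c (Pl u) \<otimes> q d (Pl v)) (y (c \<otimes>\<^sub>G d)))"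

lemma qPl:
  assumes that: "c \<in> carrier G"
  shows "(\<lambda>u. q c (Pl u)) \<in> module_hom K H (base_algebra K)"
  by (rule module_hom_comp[OF q_hom[OF that] Pl_hom])

lemma qPl_in:
  assumes that: "c \<in> carrier G" "u \<in> carrier H"
  shows "q c (Pl u) \<in> carrier K"
  using q_in[OF that(1) Pl_in[OF that(2)]] .

lemma bqq:
  assumes that: "c \<in> carrier G" "d \<in> carrier G"
  shows "(\<lambda>u v. q c (Pl u) \<otimes> q d (Pl v)) \<in> bilinear_maps K H H (base_algebra K)"
  by (rule bilinear_mapsI[OF scalar_mult_right_hom[OF qPl[OF that(2)] qPl_in[OF that(1)]]
    scalar_mult_left_hom[OF qPl[OF that(1)] qPl_in[OF that(2)]]])

lemma f_in:
  assumes that: "c \<in> carrier G" "d \<in> carrier G"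
  shows "f (c, d) \<in> carrier K"
  using sweedler_in[OF K_module bqq[OF that] y_in[OF G.m_closed[OF that]]] that by (simp add: f_def)

text \<open>Since \<open>y a\<close> equals \<open>idem a\<close> times itself, the known
  comultiplication of \<open>idem a\<close> cuts that of \<open>y a\<close> into pieces, one for
  each factorisation of \<open>a\<close>.\<close>

lemma sweedler_y:
  fixes U :: "('a, 'u, 'w) module_scheme"
  assumes U: "module K U" and \<beta>: "\<beta> \<in> bilinear_maps K H H U" and a: "a \<in> carrier G"
  shows "sweedler U \<beta> (y a) = (\<Oplus>\<^bsub>U\<^esub> c\<in>carrier G. f (c, ginv c \<otimes>\<^sub>G a) \<odot>\<^sub>U \<beta> (y c) (y (ginv c \<otimes>\<^sub>G a)))"
proof -
  interpret U: module K U by (rule U)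
  define \<gamma> where "\<gamma> u' v' = sweedler U (\<lambda>u v. \<beta> (u' \<otimes>\<^sub>H u) (v' \<otimes>\<^sub>H v)) (y a)" for u' v'
  have bin: "(\<lambda>u v. \<beta> (u' \<otimes>\<^sub>H u) (v' \<otimes>\<^sub>H v)) \<in> bilinear_maps K H H U" if "u' \<in> carrier H" "v' \<in> carrier H" for u' v'
    by (rule bilinear_mapsI[OF
          bilinear_hom_right[OF \<beta> mult_right_hom[OF module_hom_id that(2)] m_closed[OF that(1)]]
          bilinear_hom_left[OF \<beta> mult_right_hom[OF module_hom_id that(1)] m_closed[OF that(2)]]])
  have \<gamma>: "\<gamma> \<in> bilinear_maps K H H U"
    unfolding \<gamma>_def
    by (rule bilinear_mapsI[OF
          sweedler_param_hom[OF U H_module bin bilinear_hom_right[OF \<beta>] y_in[OF a]]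
          sweedler_param_hom[OF U H_module bin bilinear_hom_left[OF \<beta>] y_in[OF a]]])
      (intro mult_left_hom module_hom_id m_closed | assumption)+
  have "sweedler U \<beta> (y a) = sweedler U \<beta> (idem a \<otimes>\<^sub>H y a)" using e_y[OF a a] by simp
  also have "... = sweedler U \<gamma> (idem a)"
    unfolding \<gamma>_def by (rule sweedler_mult[OF U \<beta> idem_in[OF a] y_in[OF a]])
  also have "... = (\<Oplus>\<^bsub>U\<^esub> c\<in>carrier G. \<gamma> (idem c) (idem (ginv c \<otimes>\<^sub>G a)))"
    by (rule sweedler_idem[OF U \<gamma> a])
  also have "... = (\<Oplus>\<^bsub>U\<^esub> c\<in>carrier G. f (c, ginv c \<otimes>\<^sub>G a) \<odot>\<^sub>U \<beta> (y c) (y (ginv c \<otimes>\<^sub>G a)))"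
  proof (rule U.M.finsum_cong'[OF refl])
    show "(\<lambda>c. f (c, ginv c \<otimes>\<^sub>G a) \<odot>\<^sub>U \<beta> (y c) (y (ginv c \<otimes>\<^sub>G a))) \<in> carrier G \<rightarrow> carrier U"
      using a f_in bilinear_mapsD(3)[OF \<beta>] y_in by auto
    fix c assume c: "c \<in> carrier G"
    define d where "d = ginv c \<otimes>\<^sub>G a"
    have d: "d \<in> carrier G" "c \<otimes>\<^sub>G d = a" using a c by (auto simp: d_def G.m_assoc[symmetric])
    let ?\<beta> = "\<lambda>u v. \<beta> (idem c \<otimes>\<^sub>H u) (idem d \<otimes>\<^sub>H v)"
    have b: "?\<beta> \<in> bilinear_maps K H H U" by (rule bin[OF idem_in[OF c] idem_in[OF d(1)]])
    have b1: "(\<lambda>u v. ?\<beta> (Pl u) v) \<in> bilinear_maps K H H U"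
      by (rule bilinear_mapsI[OF bilinear_mapsD(1)[OF b Pl_in] bilinear_hom_left[OF b Pl_hom]])
    have b2: "(\<lambda>u v. ?\<beta> (Pl u) (Pr v)) \<in> bilinear_maps K H H U"
      by (rule bilinear_mapsI[OF bilinear_hom_right[OF b Pr_hom Pl_in] bilinear_hom_left[OF b Pl_hom Pr_in]])
    have \<beta>yy: "\<beta> (y c) (y d) \<in> carrier U" using bilinear_mapsD(3)[OF \<beta>] y_in c d by simp
    \<comment> \<open>\<open>y a\<close> is fixed by \<open>Pl\<close> and by \<open>Pr\<close>. The
      first moves a projection into the left tensor factor, the second into the right, and then
      \<open>B_proj\<close> collapses the factors to multiples of \<open>y c\<close> and
      \<open>y d\<close>.\<close>
    have "\<gamma> (idem c) (idem d) = sweedler U ?\<beta> (Pl (y a))" unfolding \<gamma>_def Pl_y[OF a] ..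
    also have "... = sweedler U (\<lambda>u v. ?\<beta> (Pl u) v) (y a)" by (rule sweedler_Pl[OF U b y_in[OF a]])
    also have "... = sweedler U (\<lambda>u v. ?\<beta> (Pl u) v) (Pr (y a))"
      unfolding Pr_Pl[OF y_in[OF a]] Pl_y[OF a] ..
    also have "... = sweedler U (\<lambda>u v. ?\<beta> (Pl u) (Pr v)) (y a)" by (rule sweedler_Pr[OF U b1 y_in[OF a]])
    also have "... = sweedler U (\<lambda>u v. (q c (Pl u) \<otimes> q d (Pl v)) \<odot>\<^sub>U \<beta> (y c) (y d)) (y a)"
    proof (rule sweedler_cong[OF U b2 y_in[OF a]])
      fix u v assume u: "u \<in> carrier H" and v: "v \<in> carrier H"
      have "?\<beta> (Pl u) (Pr v) = \<beta> (q c (Pl u) \<odot>\<^sub>H y c) (q d (Pl v) \<odot>\<^sub>H y d)"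
        unfolding Pr_Pl[OF v] B_proj[OF c Pl_in[OF u] \<theta>l_Pl[OF u]] B_proj[OF d(1) Pl_in[OF v] \<theta>l_Pl[OF v]] ..
      also have "... = q c (Pl u) \<odot>\<^sub>U (q d (Pl v) \<odot>\<^sub>U \<beta> (y c) (y d))"
        unfolding module_hom_smult[OF bilinear_mapsD(2)[OF \<beta> vec.smult_closed[OF qPl_in[OF d(1) v] y_in[OF d(1)]]] qPl_in[OF c u] y_in[OF c]]
          module_hom_smult[OF bilinear_mapsD(1)[OF \<beta> y_in[OF c]] qPl_in[OF d(1) v] y_in[OF d(1)]] ..
      also have "... = (q c (Pl u) \<otimes> q d (Pl v)) \<odot>\<^sub>U \<beta> (y c) (y d)"
        by (rule U.smult_assoc1[symmetric, OF qPl_in[OF c u] qPl_in[OF d(1) v] \<beta>yy])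
      finally show "?\<beta> (Pl u) (Pr v) = (q c (Pl u) \<otimes> q d (Pl v)) \<odot>\<^sub>U \<beta> (y c) (y d)" .
    qed
    also have "... = sweedler (base_algebra K) (\<lambda>u v. q c (Pl u) \<otimes> q d (Pl v)) (y a) \<odot>\<^sub>U \<beta> (y c) (y d)"
      by (rule sweedler_comp[symmetric, OF K_module U bqq[OF c d(1)]
            module_hom_smult_right[OF U module_hom_id \<beta>yy] y_in[OF a]])
    also have "... = f (c, d) \<odot>\<^sub>U \<beta> (y c) (y d)" using c d by (simp add: f_def)
    finally show "\<gamma> (idem c) (idem (ginv c \<otimes>\<^sub>G a)) = f (c, ginv c \<otimes>\<^sub>G a) \<odot>\<^sub>U \<beta> (y c) (y (ginv c \<otimes>\<^sub>G a))"
      unfolding d_def .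
  qed
  finally show ?thesis .
qed

lemma sweedler_yK:
  assumes that: "\<beta> \<in> bilinear_maps K H H (base_algebra K)" "a \<in> carrier G"
  shows "sweedler (base_algebra K) \<beta> (y a) = (\<Oplus> c\<in>carrier G. f (c, ginv c \<otimes>\<^sub>G a) \<otimes> \<beta> (y c) (y (ginv c \<otimes>\<^sub>G a)))"
  using sweedler_y[OF K_module that] by (simp add: base_algebra_finsum)

text \<open>Compares the coefficients of \<open>idem c\<close> tensor \<open>idem d\<close> in the
  comultiplication of the product of \<open>y a\<close> and \<open>y (\<tau> a)\<close>, where
  \<open>a\<close> is the product of \<open>c\<close> and \<open>d\<close>. As \<open>\<tau>\<close>
  is not yet multiplicative, the second index is kept as a quotient of values of
  \<open>\<tau>\<close>.\<close>

lemma relation: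
  assumes c: "c \<in> carrier G" and d: "d \<in> carrier G"
  shows "s (c \<otimes>\<^sub>G d) = f (c, d) \<otimes> (f (\<tau> c, ginv (\<tau> c) \<otimes>\<^sub>G \<tau> (c \<otimes>\<^sub>G d)) \<otimes>
    (s c \<otimes> p d (y d \<otimes>\<^sub>H y (ginv (\<tau> c) \<otimes>\<^sub>G \<tau> (c \<otimes>\<^sub>G d)))))"
proof -
  define a where "a = c \<otimes>\<^sub>G d"
  have a: "a \<in> carrier G" "ginv c \<otimes>\<^sub>G a = d" using c d by (auto simp: a_def G.m_assoc[symmetric])
  define g where "g = ginv (\<tau> c) \<otimes>\<^sub>G \<tau> a"
  have g: "g \<in> carrier G" using a c \<tau>(1) by (simp add: g_def)
  let ?\<beta> = "\<lambda>u v. p c u \<otimes> p d v"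
  have b: "?\<beta> \<in> bilinear_maps K H H (base_algebra K)"
    by (rule bilinear_mapsI[OF scalar_mult_right_hom[OF p_hom[OF d] p_in[OF c]]
          scalar_mult_left_hom[OF p_hom[OF c] p_in[OF d]]])
  have lhs: "sweedler (base_algebra K) ?\<beta> (y a \<otimes>\<^sub>H y (\<tau> a)) = s a"
  proof -
    have "sweedler (base_algebra K) ?\<beta> (y a \<otimes>\<^sub>H y (\<tau> a)) = s a \<otimes> sweedler (base_algebra K) ?\<beta> (idem a)"
      using y_y[OF a(1) \<tau>(1)[OF a(1)]]
        module_hom_smult[OF sweedler_hom[OF K_module b module_hom_id] s_in[OF a(1)] idem_in[OF a(1)]] by simp
    also have "sweedler (base_algebra K) ?\<beta> (idem a) = (\<Oplus> c'\<in>carrier G. p c (idem c') \<otimes> p d (idem (ginv c' \<otimes>\<^sub>G a)))"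
      using sweedler_idem[OF K_module b a(1)] by (simp add: base_algebra_finsum)
    also have "... = p c (idem c) \<otimes> p d (idem (ginv c \<otimes>\<^sub>G a))"
      using c d a idem_in p_in by (intro vec.R.finsum_single finite_G) (auto simp: p_e)
    finally show ?thesis using c d a s_in by (simp add: p_e)
  qed
  have bin: "(\<lambda>u v. p c (u' \<otimes>\<^sub>H u) \<otimes> p d (v' \<otimes>\<^sub>H v)) \<in> bilinear_maps K H H (base_algebra K)" if "u' \<in> carrier H" "v' \<in> carrier H" for u' v'
    by (rule bilinear_mapsI[OF
          bilinear_hom_right[OF b mult_right_hom[OF module_hom_id that(2)] m_closed[OF that(1)]]
          bilinear_hom_left[OF b mult_right_hom[OF module_hom_id that(1)] m_closed[OF that(2)]]])
  have \<gamma>: "(\<lambda>u' v'. sweedler (base_algebra K) (\<lambda>u v. p c (u' \<otimes>\<^sub>H u) \<otimes> p d (v' \<otimes>\<^sub>H v)) (y (\<tau> a))) \<in> bilinear_maps K H H (base_algebra K)"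
    by (rule bilinear_mapsI[OF
          sweedler_param_hom[OF K_module H_module bin bilinear_hom_right[OF b] y_in[OF \<tau>(1)[OF a(1)]]]
          sweedler_param_hom[OF K_module H_module bin bilinear_hom_left[OF b] y_in[OF \<tau>(1)[OF a(1)]]]])
      (intro mult_left_hom module_hom_id m_closed | assumption)+
  have pyy: "p c (y c1 \<otimes>\<^sub>H y c2) = (if c1 = c \<and> c2 = \<tau> c then s c else \<zero>)" if "c1 \<in> carrier G" "c2 \<in> carrier G" for c1 c2
    using y_y[OF that] that c s_in idem_in p_e[OF c] module_hom_smult[OF p_hom[OF c] s_in idem_in]
      module_hom_zero[OF H_module K_module p_hom[OF c]] by auto
  have inner: "sweedler (base_algebra K) (\<lambda>u v. p c (y c1 \<otimes>\<^sub>H u) \<otimes> p d (y (ginv c1 \<otimes>\<^sub>G a) \<otimes>\<^sub>H v)) (y (\<tau> a)) =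
      (if c1 = c then f (\<tau> c, g) \<otimes> (s c \<otimes> p d (y d \<otimes>\<^sub>H y g)) else \<zero>)" if c1: "c1 \<in> carrier G" for c1
  proof -
    have d1: "ginv c1 \<otimes>\<^sub>G a \<in> carrier G" using c1 a by simp
    have "sweedler (base_algebra K) (\<lambda>u v. p c (y c1 \<otimes>\<^sub>H u) \<otimes> p d (y (ginv c1 \<otimes>\<^sub>G a) \<otimes>\<^sub>H v)) (y (\<tau> a)) =
        (\<Oplus> c2\<in>carrier G. f (c2, ginv c2 \<otimes>\<^sub>G \<tau> a) \<otimes>
          (p c (y c1 \<otimes>\<^sub>H y c2) \<otimes> p d (y (ginv c1 \<otimes>\<^sub>G a) \<otimes>\<^sub>H y (ginv c2 \<otimes>\<^sub>G \<tau> a))))"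
      by (rule sweedler_yK[OF bin[OF y_in[OF c1] y_in[OF d1]] \<tau>(1)[OF a(1)]])
    also have "... = (if c1 = c then f (\<tau> c, g) \<otimes> (s c \<otimes> p d (y d \<otimes>\<^sub>H y g)) else \<zero>)"
    proof (cases "c1 = c")
      case True
      have "(\<Oplus> c2\<in>carrier G. f (c2, ginv c2 \<otimes>\<^sub>G \<tau> a) \<otimes>
          (p c (y c1 \<otimes>\<^sub>H y c2) \<otimes> p d (y (ginv c1 \<otimes>\<^sub>G a) \<otimes>\<^sub>H y (ginv c2 \<otimes>\<^sub>G \<tau> a)))) =
        f (\<tau> c, ginv (\<tau> c) \<otimes>\<^sub>G \<tau> a) \<otimes>
          (p c (y c1 \<otimes>\<^sub>H y (\<tau> c)) \<otimes> p d (y (ginv c1 \<otimes>\<^sub>G a) \<otimes>\<^sub>H y (ginv (\<tau> c) \<otimes>\<^sub>G \<tau> a)))"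
        using c c1 d1 a \<tau>(1) f_in p_in y_in s_in d
        by (intro vec.R.finsum_single finite_G) (auto simp: pyy)
      then show ?thesis using True a c \<tau>(1)[OF c] by (simp add: pyy g_def)
    next
      case False
      have "(\<Oplus> c2\<in>carrier G. f (c2, ginv c2 \<otimes>\<^sub>G \<tau> a) \<otimes>
          (p c (y c1 \<otimes>\<^sub>H y c2) \<otimes> p d (y (ginv c1 \<otimes>\<^sub>G a) \<otimes>\<^sub>H y (ginv c2 \<otimes>\<^sub>G \<tau> a)))) = (\<Oplus> c2\<in>carrier G. \<zero>)"
        using False c c1 d1 a \<tau>(1) f_in p_in y_in d
        by (intro vec.R.finsum_cong') (auto simp: pyy)
      then show ?thesis using False by simp
    qed
    finally show ?thesis .
  qed
  have K: "f (\<tau> c, g) \<otimes> (s c \<otimes> p d (y d \<otimes>\<^sub>H y g)) \<in> carrier K"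
    using f_in \<tau>(1) g s_in p_in y_in c d by simp
  have "sweedler (base_algebra K) ?\<beta> (y a \<otimes>\<^sub>H y (\<tau> a)) =
      sweedler (base_algebra K) (\<lambda>u' v'. sweedler (base_algebra K) (\<lambda>u v. p c (u' \<otimes>\<^sub>H u) \<otimes> p d (v' \<otimes>\<^sub>H v)) (y (\<tau> a))) (y a)"
    by (rule sweedler_mult[OF K_module b y_in[OF a(1)] y_in[OF \<tau>(1)[OF a(1)]]])
  also have "... = (\<Oplus> c1\<in>carrier G. f (c1, ginv c1 \<otimes>\<^sub>G a) \<otimes>
      sweedler (base_algebra K) (\<lambda>u v. p c (y c1 \<otimes>\<^sub>H u) \<otimes> p d (y (ginv c1 \<otimes>\<^sub>G a) \<otimes>\<^sub>H v)) (y (\<tau> a)))"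
    by (rule sweedler_yK[OF \<gamma> a(1)])
  also have "... = (\<Oplus> c1\<in>carrier G. f (c1, ginv c1 \<otimes>\<^sub>G a) \<otimes>
      (if c1 = c then f (\<tau> c, g) \<otimes> (s c \<otimes> p d (y d \<otimes>\<^sub>H y g)) else \<zero>))"
    using K f_in a by (intro vec.R.finsum_cong') (auto simp: inner)
  also have "... = f (c, ginv c \<otimes>\<^sub>G a) \<otimes> (if c = c then f (\<tau> c, g) \<otimes> (s c \<otimes> p d (y d \<otimes>\<^sub>H y g)) else \<zero>)"
    using K f_in a c by (intro vec.R.finsum_single finite_G) auto
  finally show ?thesis using lhs a unfolding g_def a_def by simp
qed

text \<open>The left side of \<open>relation\<close> is nonzero, so every factor on the right is.
  The last factor survives only when its second index is \<open>\<tau> d\<close>, which says that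
  \<open>\<tau>\<close> is multiplicative.\<close>

lemma
  assumes c: "c \<in> carrier G" and d: "d \<in> carrier G"
  shows nz: "f (c, d) \<noteq> \<zero>"
    and \<tau>_mult: "\<tau> (c \<otimes>\<^sub>G d) = \<tau> c \<otimes>\<^sub>G \<tau> d"
    and s_mult: "s (c \<otimes>\<^sub>G d) = f (c, d) \<otimes> (f (\<tau> c, \<tau> d) \<otimes> (s c \<otimes> s d))"
proof -
  define g where "g = ginv (\<tau> c) \<otimes>\<^sub>G \<tau> (c \<otimes>\<^sub>G d)"
  have g: "g \<in> carrier G" "\<tau> c \<otimes>\<^sub>G g = \<tau> (c \<otimes>\<^sub>G d)" using c d \<tau>(1) by (auto simp: g_def G.m_assoc[symmetric])
  have rel: "s (c \<otimes>\<^sub>G d) = f (c, d) \<otimes> (f (\<tau> c, g) \<otimes> (s c \<otimes> p d (y d \<otimes>\<^sub>H y g)))"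
    unfolding g_def by (rule relation[OF c d])
  have cl: "f (\<tau> c, g) \<in> carrier K" "s c \<in> carrier K" "p d (y d \<otimes>\<^sub>H y g) \<in> carrier K" "f (c, d) \<in> carrier K"
    using f_in \<tau>(1) s_in p_in y_in g c d by auto
  have "s (c \<otimes>\<^sub>G d) \<noteq> \<zero>" using s_nz c d by simp
  then show "f (c, d) \<noteq> \<zero>" using rel cl by auto
  have "p d (y d \<otimes>\<^sub>H y g) \<noteq> \<zero>" using rel cl \<open>s (c \<otimes>\<^sub>G d) \<noteq> \<zero>\<close> by auto
  then have gd: "g = \<tau> d"
    using y_y[OF d g(1)] module_hom_zero[OF H_module K_module p_hom[OF d]] by (auto split: if_splits)
  then show "\<tau> (c \<otimes>\<^sub>G d) = \<tau> c \<otimes>\<^sub>G \<tau> d" using g by simp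
  have "p d (y d \<otimes>\<^sub>H y g) = s d"
    using y_y[OF d g(1)] gd module_hom_smult[OF p_hom[OF d] s_in[OF d] idem_in[OF d]] p_e[OF d d] s_in[OF d] by simp
  then show "s (c \<otimes>\<^sub>G d) = f (c, d) \<otimes> (f (\<tau> c, \<tau> d) \<otimes> (s c \<otimes> s d))" using rel gd by simp
qed

text \<open>Coassociativity at \<open>y a\<close> for the triple product \<open>a\<close>, tested on
  the coefficient of \<open>y c\<close> tensor \<open>y d\<close> tensor \<open>y h\<close>. Each of
  the nested sums has a single surviving term.\<close>

lemma cocycle:
  assumes c: "c \<in> carrier G" and d: "d \<in> carrier G" and h: "h \<in> carrier G"
  shows "f (d, h) \<otimes> f (c, d \<otimes>\<^sub>G h) = f (c \<otimes>\<^sub>G d, h) \<otimes> f (c, d)"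
proof -
  define a where "a = c \<otimes>\<^sub>G (d \<otimes>\<^sub>G h)"
  have a: "a \<in> carrier G" "a = (c \<otimes>\<^sub>G d) \<otimes>\<^sub>G h" using c d h by (auto simp: a_def G.m_assoc)
  have cancel: "ginv x \<otimes>\<^sub>G (x \<otimes>\<^sub>G z) = z" if "x \<in> carrier G" "z \<in> carrier G" for x z
    using that by (simp add: G.m_assoc[symmetric])
  have inv: "ginv (c \<otimes>\<^sub>G d) \<otimes>\<^sub>G a = h" "ginv c \<otimes>\<^sub>G a = d \<otimes>\<^sub>G h" "ginv c \<otimes>\<^sub>G (c \<otimes>\<^sub>G d) = d" "ginv d \<otimes>\<^sub>G (d \<otimes>\<^sub>G h) = h"
    using cancel[of "c \<otimes>\<^sub>G d" h] cancel[of c "d \<otimes>\<^sub>G h"] cancel[of c d] cancel[of d h] c d h a by (simp_all add: a_def)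
  note rules = lin_rules closed_rules module_hom_comp[OF q_hom[OF c]] module_hom_comp[OF q_hom[OF d]]
    module_hom_comp[OF q_hom[OF h]] q_in[OF c] q_in[OF d] q_in[OF h]
  let ?\<gamma> = "\<lambda>u v w. q c u \<otimes> (q d v \<otimes> q h w)"
  have b1: "(\<lambda>u v. ?\<gamma> u v w) \<in> bilinear_maps K H H (base_algebra K)" if "w \<in> carrier H" for w
    using that by - (rule bilinear_mapsI; (intro rules | assumption)+)
  have b2: "?\<gamma> u \<in> bilinear_maps K H H (base_algebra K)" if "u \<in> carrier H" for u
    using that by - (rule bilinear_mapsI; (intro rules | assumption)+)
  have B1: "(\<lambda>x w. sweedler (base_algebra K) (\<lambda>u v. ?\<gamma> u v w) x) \<in> bilinear_maps K H H (base_algebra K)"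
    by (rule bilinear_mapsI; (intro rules b1 | assumption)+)
  have B2: "(\<lambda>u x. sweedler (base_algebra K) (?\<gamma> u) x) \<in> bilinear_maps K H H (base_algebra K)"
    by (rule bilinear_mapsI; (intro rules b2 | assumption)+)
  have "sweedler (base_algebra K) (\<lambda>x w. sweedler (base_algebra K) (\<lambda>u v. ?\<gamma> u v w) x) (y a) =
      (\<Oplus> c1\<in>carrier G. f (c1, ginv c1 \<otimes>\<^sub>G a) \<otimes> sweedler (base_algebra K) (\<lambda>u v. ?\<gamma> u v (y (ginv c1 \<otimes>\<^sub>G a))) (y c1))"
    by (rule sweedler_yK[OF B1 a(1)])
  also have "... = (\<Oplus> c1\<in>carrier G. f (c1, ginv c1 \<otimes>\<^sub>G a) \<otimes> (\<Oplus> c2\<in>carrier G. f (c2, ginv c2 \<otimes>\<^sub>G c1) \<otimes>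
      ?\<gamma> (y c2) (y (ginv c2 \<otimes>\<^sub>G c1)) (y (ginv c1 \<otimes>\<^sub>G a))))"
    using a f_in y_in q_in c d h
    by (intro vec.R.finsum_cong') (auto simp: sweedler_yK[OF b1] intro!: vec.R.finsum_closed)
  also have "... = (\<Oplus> c1\<in>carrier G. f (c1, ginv c1 \<otimes>\<^sub>G a) \<otimes> (f (c, ginv c \<otimes>\<^sub>G c1) \<otimes>
      ?\<gamma> (y c) (y (ginv c \<otimes>\<^sub>G c1)) (y (ginv c1 \<otimes>\<^sub>G a))))"
  proof (rule vec.R.finsum_cong'[OF refl])
    show "(\<lambda>c1. f (c1, ginv c1 \<otimes>\<^sub>G a) \<otimes> (f (c, ginv c \<otimes>\<^sub>G c1) \<otimes>
      ?\<gamma> (y c) (y (ginv c \<otimes>\<^sub>G c1)) (y (ginv c1 \<otimes>\<^sub>G a)))) \<in> carrier G \<rightarrow> carrier K"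
      using a f_in y_in q_in c d h by auto
    fix c1 assume c1: "c1 \<in> carrier G"
    have "(\<Oplus> c2\<in>carrier G. f (c2, ginv c2 \<otimes>\<^sub>G c1) \<otimes> ?\<gamma> (y c2) (y (ginv c2 \<otimes>\<^sub>G c1)) (y (ginv c1 \<otimes>\<^sub>G a))) =
        f (c, ginv c \<otimes>\<^sub>G c1) \<otimes> ?\<gamma> (y c) (y (ginv c \<otimes>\<^sub>G c1)) (y (ginv c1 \<otimes>\<^sub>G a))"
      using a c1 f_in y_in q_in c d h by (intro vec.R.finsum_single finite_G) (auto simp: q_y)
    then show "f (c1, ginv c1 \<otimes>\<^sub>G a) \<otimes> (\<Oplus> c2\<in>carrier G. f (c2, ginv c2 \<otimes>\<^sub>G c1) \<otimes>
        ?\<gamma> (y c2) (y (ginv c2 \<otimes>\<^sub>G c1)) (y (ginv c1 \<otimes>\<^sub>G a))) =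
      f (c1, ginv c1 \<otimes>\<^sub>G a) \<otimes> (f (c, ginv c \<otimes>\<^sub>G c1) \<otimes> ?\<gamma> (y c) (y (ginv c \<otimes>\<^sub>G c1)) (y (ginv c1 \<otimes>\<^sub>G a)))"
      by simp
  qed
  also have "... = f (c \<otimes>\<^sub>G d, ginv (c \<otimes>\<^sub>G d) \<otimes>\<^sub>G a) \<otimes> (f (c, ginv c \<otimes>\<^sub>G (c \<otimes>\<^sub>G d)) \<otimes>
      ?\<gamma> (y c) (y (ginv c \<otimes>\<^sub>G (c \<otimes>\<^sub>G d))) (y (ginv (c \<otimes>\<^sub>G d) \<otimes>\<^sub>G a)))"
  proof (rule vec.R.finsum_single[OF finite_G])
    fix c1 assume c1: "c1 \<in> carrier G" "c1 \<noteq> c \<otimes>\<^sub>G d"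
    then have "ginv c \<otimes>\<^sub>G c1 \<noteq> d" using c d G.inv_solve_left by metis
    then have "q d (y (ginv c \<otimes>\<^sub>G c1)) = \<zero>" using c c1 d by (simp add: q_y)
    then show "f (c1, ginv c1 \<otimes>\<^sub>G a) \<otimes> (f (c, ginv c \<otimes>\<^sub>G c1) \<otimes>
      ?\<gamma> (y c) (y (ginv c \<otimes>\<^sub>G c1)) (y (ginv c1 \<otimes>\<^sub>G a))) = \<zero>"
      using a c1 f_in y_in q_in c d h by simp
  qed (use a f_in y_in q_in c d h in auto)
  also have "... = f (c \<otimes>\<^sub>G d, h) \<otimes> f (c, d)"
    unfolding inv using f_in c d h by (simp add: q_y)
  finally have L: "sweedler (base_algebra K) (\<lambda>x w. sweedler (base_algebra K) (\<lambda>u v. ?\<gamma> u v w) x) (y a) = f (c \<otimes>\<^sub>G d, h) \<otimes> f (c, d)" .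
  have "sweedler (base_algebra K) (\<lambda>u x. sweedler (base_algebra K) (?\<gamma> u) x) (y a) =
      (\<Oplus> c1\<in>carrier G. f (c1, ginv c1 \<otimes>\<^sub>G a) \<otimes> sweedler (base_algebra K) (?\<gamma> (y c1)) (y (ginv c1 \<otimes>\<^sub>G a)))"
    by (rule sweedler_yK[OF B2 a(1)])
  also have "... = f (c, ginv c \<otimes>\<^sub>G a) \<otimes> sweedler (base_algebra K) (?\<gamma> (y c)) (y (ginv c \<otimes>\<^sub>G a))"
  proof (rule vec.R.finsum_single[OF finite_G c])
    show "f (c, ginv c \<otimes>\<^sub>G a) \<otimes> sweedler (base_algebra K) (?\<gamma> (y c)) (y (ginv c \<otimes>\<^sub>G a)) \<in> carrier K"
      using functional_in[OF sweedler_hom[OF K_module b2[OF y_in[OF c]] module_hom_id]] a c f_in y_in by simp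
    fix c1 assume c1: "c1 \<in> carrier G" "c1 \<noteq> c"
    have "sweedler (base_algebra K) (?\<gamma> (y c1)) (y (ginv c1 \<otimes>\<^sub>G a)) = \<zero>\<^bsub>base_algebra K\<^esub>"
      using a c1 c d h y_in q_in by (intro sweedler_zero[OF K_module]) (auto simp: q_y)
    then show "f (c1, ginv c1 \<otimes>\<^sub>G a) \<otimes> sweedler (base_algebra K) (?\<gamma> (y c1)) (y (ginv c1 \<otimes>\<^sub>G a)) = \<zero>"
      using a c1 f_in by simp
  qed
  also have "sweedler (base_algebra K) (?\<gamma> (y c)) (y (ginv c \<otimes>\<^sub>G a)) =
      (\<Oplus> c1\<in>carrier G. f (c1, ginv c1 \<otimes>\<^sub>G (d \<otimes>\<^sub>G h)) \<otimes> ?\<gamma> (y c) (y c1) (y (ginv c1 \<otimes>\<^sub>G (d \<otimes>\<^sub>G h))))"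
    unfolding inv by (rule sweedler_yK[OF b2[OF y_in[OF c]] G.m_closed[OF d h]])
  also have "... = f (d, ginv d \<otimes>\<^sub>G (d \<otimes>\<^sub>G h)) \<otimes> ?\<gamma> (y c) (y d) (y (ginv d \<otimes>\<^sub>G (d \<otimes>\<^sub>G h)))"
    using f_in y_in q_in c d h by (intro vec.R.finsum_single finite_G) (auto simp: q_y)
  also have "... = f (d, h)" unfolding inv using f_in c d h by (simp add: q_y)
  finally have R: "sweedler (base_algebra K) (\<lambda>u x. sweedler (base_algebra K) (?\<gamma> u) x) (y a) = f (c, d \<otimes>\<^sub>G h) \<otimes> f (d, h)"
    unfolding inv .
  have "sweedler (base_algebra K) (\<lambda>x w. sweedler (base_algebra K) (\<lambda>u v. ?\<gamma> u v w) x) (y a) = sweedler (base_algebra K) (\<lambda>u x. sweedler (base_algebra K) (?\<gamma> u) x) (y a)"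
    by (rule sweedler_assoc[OF K_module _ _ _ y_in[OF a(1)]]; (intro rules | assumption)+)
  then show ?thesis unfolding L R using f_in c d h by (simp add: vec.R.m_comm)
qed

lemma crossed: "\<exists>\<tau> f s. crossed_presentation K H G \<tau> f s idem y p q \<and> crossed_datum K G \<tau> f s"
proof -
  have unit: "k \<in> Units K \<longleftrightarrow> k \<in> carrier K \<and> k \<noteq> \<zero>" for k using vec.field_Units by auto
  have "\<tau> \<in> hom G G" using \<tau>(1) \<tau>_mult by (auto simp: hom_def)
  \<comment> \<open>\<open>\<tau>\<close> was chosen on the carrier only, while members of
    \<open>auto G\<close> must be extensional.\<close>
  define \<tau>' where "\<tau>' = restrict \<tau> (carrier G)"
  have "\<tau>' \<in> auto G"
    using \<tau>(1) \<tau>_mult \<tau>_inj \<tau>_surj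
    by (auto simp: \<tau>'_def auto_def hom_def Bij_def bij_betw_def inj_on_def)
  moreover have "f \<in> carrier (two_cocycles G (units_of K))"
    using f_in nz cocycle unit by (auto simp: two_cocycles_def units_of_def f_def)
  ultimately have "crossed_datum K G \<tau>' f s"
    using \<tau>(1) \<tau>_\<tau> s_in s_nz s_\<tau> s_mult unit by (auto simp: crossed_datum_def \<tau>'_def)
  moreover have "crossed_presentation K H G \<tau>' f s idem y p q"
  proof (intro crossed_presentation.intro crossed_presentation_axioms.intro)
    fix a assume a: "a \<in> carrier G"
    show "comult H (idem a) = (\<Oplus>\<^bsub>HH\<^esub> c\<in>carrier G. pure_tensor K H H (idem c) (idem (ginv c \<otimes>\<^sub>G a)))"
      unfolding comult_sweedler[OF idem_in[OF a], symmetric] by (rule sweedler_idem[OF HH_module pure_bilinear a])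
    show "comult H (y a) = (\<Oplus>\<^bsub>HH\<^esub> c\<in>carrier G.
        f (c, ginv c \<otimes>\<^sub>G a) \<odot>\<^bsub>HH\<^esub> pure_tensor K H H (y c) (y (ginv c \<otimes>\<^sub>G a)))"
      unfolding comult_sweedler[OF y_in[OF a], symmetric] by (rule sweedler_y[OF HH_module pure_bilinear a])
  next
    fix a c assume ac: "a \<in> carrier G" "c \<in> carrier G"
    show "y a \<otimes>\<^sub>H idem c = (if c = \<tau>' a then y a else \<zero>\<^sub>H)"
      and "y a \<otimes>\<^sub>H y c = (if c = \<tau>' a then s a \<odot>\<^sub>H idem a else \<zero>\<^sub>H)"
      using y_e[OF ac] y_y[OF ac] ac by (simp_all add: \<tau>'_def)
  qed (rule hopf_algebra_axioms G.comm_group_axioms finite_G sum_idem idem_in y_in p_hom q_hom expand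
      p_e p_y q_e q_y idem_mult e_y; assumption?)+
  ultimately show ?thesis by blast
qed

end

lemma (in hopf_index_two) exists_crossed_presentation:
  "\<exists>\<tau> f s y p q. crossed_presentation K H G \<tau> f s idem y p q \<and> crossed_datum K G \<tau> f s"
proof -
  obtain y p q where "hopf_eigenbasis K H G \<iota> b \<psi> y p q" using exists_eigenbasis by blast
  then interpret hopf_eigenbasis K H G \<iota> b \<psi> y p q .
  obtain \<tau> where "\<And>a. a \<in> carrier G \<Longrightarrow> \<tau> a \<in> carrier G" "\<And>a. a \<in> carrier G \<Longrightarrow> y a \<otimes>\<^sub>H idem (\<tau> a) = y a"
    using exists_source by metis
  then interpret hopf_twisted_eigenbasis K H G \<iota> b \<psi> y p q \<tau> by unfold_locales
  show ?thesis using crossed by blast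
qed

section \<open>Characters of finite abelian 2-groups\<close>

text \<open>The target of the characters: a multiplicative group such as the units of an algebraically
  closed field of characteristic other than two, with \<open>e\<close> in the role of \<open>-1\<close>.\<close>

locale square_closed_group = comm_group A for A (structure) +
  fixes e
  assumes square_root: "a \<in> carrier A \<Longrightarrow> \<exists>d\<in>carrier A. d \<otimes> d = a"
    and e_in [simp]: "e \<in> carrier A" and e_neq: "e \<noteq> \<one>" and e_square: "e \<otimes> e = \<one>"
    and square_one: "\<lbrakk>x \<in> carrier A; x \<otimes> x = \<one>\<rbrakk> \<Longrightarrow> x = \<one> \<or> x = e"
begin

lemma pow_2_Suc: "x \<in> carrier A \<Longrightarrow> x [^] (2 ^ Suc j :: nat) = (x \<otimes> x) [^] (2 ^ j :: nat)"
  using nat_pow_pow[of x 2 "2 ^ j"] by (simp add: numeral_2_eq_2)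

lemma square_eq:
  assumes "x \<in> carrier A" "y \<in> carrier A" "x \<otimes> x = y \<otimes> y"
  shows "x = y \<or> x = e \<otimes> y"
proof -
  have "(x \<otimes> inv y) \<otimes> (x \<otimes> inv y) = (x \<otimes> x) \<otimes> inv (y \<otimes> y)"
    using assms(1,2) by (simp add: inv_mult m_ac)
  then have "(x \<otimes> inv y) \<otimes> (x \<otimes> inv y) = \<one>" using assms by simp
  then have "x \<otimes> inv y = \<one> \<or> x \<otimes> inv y = e" using assms by (intro square_one) auto
  then show ?thesis using assms by (metis inv_solve_right' inv_solve_right l_one e_in one_closed)
qed

lemma root_2_pow:
  assumes "a \<in> carrier A"
  shows "\<exists>d\<in>carrier A. d [^] (2 ^ j :: nat) = a"
proof (induction j)
  case 0
  then show ?case using assms by auto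
next
  case (Suc j)
  then obtain d where d: "d \<in> carrier A" "d [^] (2 ^ j :: nat) = a" by blast
  obtain c where "c \<in> carrier A" "c \<otimes> c = d" using square_root[OF d(1)] by blast
  then show ?case using pow_2_Suc[of c j] d by blast
qed

text \<open>Induction by squaring: the square of \<open>x\<close> is a power of the square of
  \<open>d\<close>, and the two candidates for \<open>x\<close> differ by the factor
  \<open>e\<close>, itself a power of \<open>d\<close>.\<close>

lemma primitive_root_generates:
  assumes "d \<in> carrier A" "d [^] (2 ^ j :: nat) = e" "x \<in> carrier A" "x [^] (2 ^ Suc j :: nat) = \<one>"
  shows "\<exists>i::nat. x = d [^] i"
  using assms
proof (induction j arbitrary: d x)
  case 0
  then have "x \<otimes> x = \<one>" using pow_2_Suc[of x 0] by simp
  then consider "x = \<one>" | "x = e" using square_one 0 by blast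
  then show ?case
  proof cases
    case 1
    then show ?thesis by (intro exI[of _ 0]) simp
  next
    case 2
    then show ?thesis using 0 by (intro exI[of _ 1]) simp
  qed
next
  case (Suc j)
  have "\<exists>i::nat. x \<otimes> x = (d \<otimes> d) [^] i"
    using Suc.prems by (intro Suc.IH) (simp_all only: pow_2_Suc m_closed)
  then obtain i :: nat where "x \<otimes> x = (d \<otimes> d) [^] i" by blast
  then have "x \<otimes> x = d [^] i \<otimes> d [^] i" using Suc.prems by (simp add: pow_mult_distrib m_comm)
  then consider "x = d [^] i" | "x = e \<otimes> d [^] i" using square_eq Suc.prems by blast
  then show ?case
  proof cases
    case 2
    then have "x = d [^] (2 ^ Suc j + i)" using Suc.prems by (simp only: nat_pow_mult[symmetric])
    then show ?thesis by blast
  qed blast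
qed

text \<open>For positive \<open>q\<close>, a root of \<open>e\<close> of exponent
  \<open>2 ^ (q - 1)\<close> has order exactly \<open>2 ^ q\<close>: its order is a power of two
  dividing this number, and a smaller one would make \<open>e\<close> the unit.\<close>

lemma primitive_root:
  "\<exists>d\<in>carrier A. (\<forall>x\<in>carrier A. x [^] (2 ^ q :: nat) = \<one> \<longrightarrow> (\<exists>i::nat. x = d [^] i)) \<and>
    (\<forall>i::nat. d [^] i = \<one> \<longleftrightarrow> 2 ^ q dvd i)"
proof (cases q)
  case 0
  then show ?thesis by (intro bexI[of _ \<one>]) auto
next
  case (Suc j)
  obtain d where d: "d \<in> carrier A" "d [^] (2 ^ j :: nat) = e" using root_2_pow[OF e_in] by blast
  have "d [^] (2 ^ q :: nat) = \<one>"
    using nat_pow_mult[OF d(1), of "2 ^ j" "2 ^ j"] d e_square by (simp add: Suc mult_2)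
  then have "ord d dvd 2 ^ q" using d pow_eq_id by blast
  then obtain k where k: "k \<le> q" "ord d = 2 ^ k" using divides_primepow_nat[of 2 "ord d" q] by auto
  have "k = q"
  proof (rule ccontr)
    assume "k \<noteq> q"
    then have "ord d dvd 2 ^ j" using k Suc by (simp add: le_imp_power_dvd)
    then show False using d e_neq pow_eq_id by metis
  qed
  then show ?thesis
    using primitive_root_generates[OF d] pow_eq_id[OF d(1)] k d(1) Suc by (intro bexI[of _ d]) auto
qed

text \<open>All these roots are powers of one of them, with exponents reduced modulo
  \<open>2 ^ q\<close>. This is the source of finiteness of the second cohomology.\<close>

lemma finite_roots: "finite {x \<in> carrier A. x [^] (2 ^ q :: nat) = \<one>}"
proof -
  obtain d where d: "d \<in> carrier A" "\<And>x. \<lbrakk>x \<in> carrier A; x [^] (2 ^ q :: nat) = \<one>\<rbrakk> \<Longrightarrow> \<exists>i::nat. x = d [^] i"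
    "\<And>i::nat. d [^] i = \<one> \<longleftrightarrow> 2 ^ q dvd i"
    using primitive_root[of q] by blast
  have "{x \<in> carrier A. x [^] (2 ^ q :: nat) = \<one>} \<subseteq> (\<lambda>i::nat. d [^] i) ` {..<2 ^ q}"
  proof
    fix x assume "x \<in> {x \<in> carrier A. x [^] (2 ^ q :: nat) = \<one>}"
    then obtain i :: nat where i: "x = d [^] i" using d(2) by blast
    have "d [^] i = d [^] (2 ^ q * (i div 2 ^ q) + i mod 2 ^ q)" by simp
    also have "... = d [^] (2 ^ q * (i div 2 ^ q)) \<otimes> d [^] (i mod 2 ^ q)"
      using d(1) by (simp only: nat_pow_mult)
    also have "... = d [^] (i mod 2 ^ q)"
      using d(1) d(3)[of "2 ^ q * (i div 2 ^ q)"] by simp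
    finally show "x \<in> (\<lambda>i::nat. d [^] i) ` {..<2 ^ q}" using i by auto
  qed
  then show ?thesis by (rule finite_subset) simp
qed

text \<open>Adjoining \<open>x\<close> adds only the coset of \<open>x\<close>, because its square
  lies in \<open>C\<close>. A value at \<open>x\<close> is admissible exactly when its square is the
  given value at that square.\<close>

lemma character_extension_step:
  assumes G: "comm_group G" and C: "subgroup C G"
    and \<chi>: "\<chi> \<in> hom (G\<lparr>carrier := C\<rparr>) A"
    and x: "x \<in> carrier G" "x \<notin> C" "x \<otimes>\<^sub>G x \<in> C"
  shows "\<exists>C' \<chi>'. subgroup C' G \<and> C \<subset> C' \<and> \<chi>' \<in> hom (G\<lparr>carrier := C'\<rparr>) A \<and> (\<forall>y\<in>C. \<chi>' y = \<chi> y)"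
proof -
  interpret G: comm_group G by fact
  interpret C: subgroup C G by fact
  have \<chi>m: "\<chi> (y \<otimes>\<^sub>G z) = \<chi> y \<otimes> \<chi> z" and \<chi>c: "\<chi> y \<in> carrier A" if "y \<in> C" "z \<in> C" for y z
    using \<chi> that by (auto simp: hom_def)
  obtain d where d: "d \<in> carrier A" "d \<otimes> d = \<chi> (x \<otimes>\<^sub>G x)"
    using square_root[OF \<chi>c[OF x(3) x(3)]] by blast
  \<comment> \<open>The coset of \<open>x\<close> modulo \<open>C\<close>, described by division by
    \<open>x\<close>, which is also how the new character is computed on it.\<close>
  define D where "D = {y \<in> carrier G. inv\<^bsub>G\<^esub> x \<otimes>\<^sub>G y \<in> C}"
  define \<chi>' where "\<chi>' y = (if y \<in> C then \<chi> y else d \<otimes> \<chi> (inv\<^bsub>G\<^esub> x \<otimes>\<^sub>G y))" for y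
  have disj: "y \<notin> C" if "y \<in> D" for y
  proof
    assume "y \<in> C"
    then have "y \<otimes>\<^sub>G inv\<^bsub>G\<^esub> (inv\<^bsub>G\<^esub> x \<otimes>\<^sub>G y) \<in> C" using that by (auto simp: D_def)
    moreover have "y \<otimes>\<^sub>G inv\<^bsub>G\<^esub> (inv\<^bsub>G\<^esub> x \<otimes>\<^sub>G y) = x"
      using \<open>y \<in> C\<close> x by (simp add: G.inv_mult G.m_ac)
    ultimately show False using x by simp
  qed
  have CD: "y \<otimes>\<^sub>G z \<in> D" "inv\<^bsub>G\<^esub> x \<otimes>\<^sub>G (y \<otimes>\<^sub>G z) = y \<otimes>\<^sub>G (inv\<^bsub>G\<^esub> x \<otimes>\<^sub>G z)" if "y \<in> C" "z \<in> D" for y z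
  proof -
    show eq: "inv\<^bsub>G\<^esub> x \<otimes>\<^sub>G (y \<otimes>\<^sub>G z) = y \<otimes>\<^sub>G (inv\<^bsub>G\<^esub> x \<otimes>\<^sub>G z)"
      using that x by (simp add: D_def G.m_lcomm)
    show "y \<otimes>\<^sub>G z \<in> D" using that eq by (auto simp: D_def)
  qed
  have DD: "y \<otimes>\<^sub>G z \<in> C" "y \<otimes>\<^sub>G z = (x \<otimes>\<^sub>G x) \<otimes>\<^sub>G ((inv\<^bsub>G\<^esub> x \<otimes>\<^sub>G y) \<otimes>\<^sub>G (inv\<^bsub>G\<^esub> x \<otimes>\<^sub>G z))"
    if "y \<in> D" "z \<in> D" for y z
  proof -
    have yz: "y \<in> carrier G" "z \<in> carrier G" using that by (auto simp: D_def)
    have "(x \<otimes>\<^sub>G x) \<otimes>\<^sub>G ((inv\<^bsub>G\<^esub> x \<otimes>\<^sub>G y) \<otimes>\<^sub>G (inv\<^bsub>G\<^esub> x \<otimes>\<^sub>G z)) =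
      (x \<otimes>\<^sub>G inv\<^bsub>G\<^esub> x) \<otimes>\<^sub>G ((x \<otimes>\<^sub>G inv\<^bsub>G\<^esub> x) \<otimes>\<^sub>G (y \<otimes>\<^sub>G z))"
      using yz x(1) by (simp only: G.m_ac G.m_closed G.inv_closed)
    then show eq: "y \<otimes>\<^sub>G z = (x \<otimes>\<^sub>G x) \<otimes>\<^sub>G ((inv\<^bsub>G\<^esub> x \<otimes>\<^sub>G y) \<otimes>\<^sub>G (inv\<^bsub>G\<^esub> x \<otimes>\<^sub>G z))"
      using yz x(1) by simp
    show "y \<otimes>\<^sub>G z \<in> C" unfolding eq using that x by (auto simp: D_def)
  qed
  have sub: "subgroup (C \<union> D) G"
  proof (rule G.subgroupI)
    fix y assume y: "y \<in> C \<union> D"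
    show "inv\<^bsub>G\<^esub> y \<in> C \<union> D"
    proof (cases "y \<in> C")
      case False
      then have yD: "y \<in> D" using y by simp
      then have yG: "y \<in> carrier G" by (simp add: D_def)
      have "inv\<^bsub>G\<^esub> (y \<otimes>\<^sub>G y) \<otimes>\<^sub>G y \<in> D" using DD(1)[OF yD yD] by (intro CD yD) auto
      moreover have "inv\<^bsub>G\<^esub> (y \<otimes>\<^sub>G y) \<otimes>\<^sub>G y = inv\<^bsub>G\<^esub> y"
        using yG by (simp add: G.inv_mult G.m_assoc)
      ultimately show ?thesis by simp
    qed auto
    fix z assume z: "z \<in> C \<union> D"
    have "y \<in> carrier G" "z \<in> carrier G" using y z by (auto simp: D_def)
    then show "y \<otimes>\<^sub>G z \<in> C \<union> D"
      using y z CD(1)[of y z] CD(1)[of z y] DD(1)[of y z] C.m_closed[of y z] G.m_comm[of y z] by auto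
  next
    show "C \<union> D \<noteq> {}" using C.one_closed by blast
    show "C \<union> D \<subseteq> carrier G" by (auto simp: D_def)
  qed
  have hom1: "\<chi>' (y \<otimes>\<^sub>G z) = \<chi>' y \<otimes> \<chi>' z" if "y \<in> C" "z \<in> D" for y z
    using that CD[OF that] disj[of z] disj[of "y \<otimes>\<^sub>G z"] \<chi>m[of y "inv\<^bsub>G\<^esub> x \<otimes>\<^sub>G z"] d
      \<chi>c[of y y] \<chi>c[of "inv\<^bsub>G\<^esub> x \<otimes>\<^sub>G z" y]
    by (simp add: \<chi>'_def m_lcomm D_def)
  have hom2: "\<chi>' (y \<otimes>\<^sub>G z) = \<chi>' y \<otimes> \<chi>' z" if "y \<in> D" "z \<in> D" for y z
  proof -
    have u: "inv\<^bsub>G\<^esub> x \<otimes>\<^sub>G y \<in> C" "inv\<^bsub>G\<^esub> x \<otimes>\<^sub>G z \<in> C" using that by (auto simp: D_def)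
    have "\<chi>' (y \<otimes>\<^sub>G z) = \<chi> ((x \<otimes>\<^sub>G x) \<otimes>\<^sub>G ((inv\<^bsub>G\<^esub> x \<otimes>\<^sub>G y) \<otimes>\<^sub>G (inv\<^bsub>G\<^esub> x \<otimes>\<^sub>G z)))"
      using DD(1)[OF that] arg_cong[OF DD(2)[OF that], of \<chi>] by (simp add: \<chi>'_def)
    also have "... = (d \<otimes> d) \<otimes> (\<chi> (inv\<^bsub>G\<^esub> x \<otimes>\<^sub>G y) \<otimes> \<chi> (inv\<^bsub>G\<^esub> x \<otimes>\<^sub>G z))"
      by (simp only: \<chi>m[OF x(3) C.m_closed[OF u]] \<chi>m[OF u] d(2))
    finally have "\<chi>' (y \<otimes>\<^sub>G z) = (d \<otimes> d) \<otimes> (\<chi> (inv\<^bsub>G\<^esub> x \<otimes>\<^sub>G y) \<otimes> \<chi> (inv\<^bsub>G\<^esub> x \<otimes>\<^sub>G z))" .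
    also have "... = \<chi>' y \<otimes> \<chi>' z"
      using disj that d(1) \<chi>c[OF u(1) u(1)] \<chi>c[OF u(2) u(2)] by (simp add: \<chi>'_def m_ac)
    finally show ?thesis .
  qed
  have hom: "\<chi>' \<in> hom (G\<lparr>carrier := C \<union> D\<rparr>) A"
  proof (rule homI)
    fix y assume y: "y \<in> carrier (G\<lparr>carrier := C \<union> D\<rparr>)"
    then show "\<chi>' y \<in> carrier A" using \<chi>c d by (auto simp: \<chi>'_def D_def)
    then have 1: "\<chi>' y \<in> carrier A" .
    fix z assume z: "z \<in> carrier (G\<lparr>carrier := C \<union> D\<rparr>)"
    then have 2: "\<chi>' z \<in> carrier A" using \<chi>c d by (auto simp: \<chi>'_def D_def)
    have G': "y \<in> carrier G" "z \<in> carrier G" using y z by (auto simp: D_def)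
    consider "y \<in> C" "z \<in> C" | "y \<in> C" "z \<in> D" | "y \<in> D" "z \<in> C" | "y \<in> D" "z \<in> D"
      using y z by auto
    then have "\<chi>' (y \<otimes>\<^sub>G z) = \<chi>' y \<otimes> \<chi>' z"
    proof cases
      case 1
      then show ?thesis using C.m_closed[OF 1] by (simp only: \<chi>'_def if_True \<chi>m)
    next
      case 3
      show ?thesis unfolding G.m_comm[OF G'] hom1[OF 3(2,1)] using m_comm[OF \<open>\<chi>' z \<in> carrier A\<close> 1] .
    qed (use hom1 hom2 in blast)+
    then show "\<chi>' (y \<otimes>\<^bsub>G\<lparr>carrier := C \<union> D\<rparr>\<^esub> z) = \<chi>' y \<otimes> \<chi>' z" by simp
  qed
  have "x \<in> D" using x by (simp add: D_def)
  then have "C \<subset> C \<union> D" using x by auto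
  then show ?thesis using sub hom by (intro exI[of _ "C \<union> D"] exI[of _ \<chi>']) (auto simp: \<chi>'_def)
qed

text \<open>In a 2-group every element outside \<open>C\<close> has a last iterated square outside
  \<open>C\<close>, and that element satisfies the hypothesis of the one-step extension.\<close>

lemma character_extension:
  assumes G: "comm_group G" and n: "order G = 2 ^ r" and C: "subgroup C G"
    and \<chi>: "\<chi> \<in> hom (G\<lparr>carrier := C\<rparr>) A"
  shows "\<exists>\<chi>'\<in>hom G A. \<forall>y\<in>C. \<chi>' y = \<chi> y"
  using C \<chi>
proof (induction "card (carrier G - C)" arbitrary: C \<chi> rule: less_induct)
  case less
  interpret G: comm_group G by fact
  interpret C: subgroup C G by fact
  have fin: "finite (carrier G)" using n by (metis card.infinite order_def power_not_zero zero_neq_numeral)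
  show ?case
  proof (cases "C = carrier G")
    case True
    then have "G\<lparr>carrier := C\<rparr> = G" by simp
    then show ?thesis using less by metis
  next
    case False
    then obtain y where y: "y \<in> carrier G" "y \<notin> C" using C.subset by blast
    have yr: "y [^]\<^bsub>G\<^esub> (2 ^ r :: nat) \<in> C" using G.pow_order_eq_1[OF y(1)] n by simp
    define j where "j = (LEAST j. y [^]\<^bsub>G\<^esub> (2 ^ j :: nat) \<in> C)"
    have jC: "y [^]\<^bsub>G\<^esub> (2 ^ j :: nat) \<in> C" unfolding j_def by (rule LeastI[of "\<lambda>j. y [^]\<^bsub>G\<^esub> (2 ^ j :: nat) \<in> C", OF yr])
    have "j \<noteq> 0" using jC y by (intro notI) simp
    then obtain i where i: "j = Suc i" using not0_implies_Suc by blast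
    define x where "x = y [^]\<^bsub>G\<^esub> (2 ^ i :: nat)"
    have "x \<notin> C" unfolding x_def
      using not_less_Least[of i "\<lambda>j. y [^]\<^bsub>G\<^esub> (2 ^ j :: nat) \<in> C"] i unfolding j_def by simp
    have x2: "x \<otimes>\<^sub>G x \<in> C"
      using jC G.nat_pow_mult[OF y(1), of "2 ^ i" "2 ^ i"] by (simp add: x_def i mult_2)
    have xG: "x \<in> carrier G" using y by (simp add: x_def)
    obtain C' \<chi>' where C': "subgroup C' G" "C \<subset> C'" "\<chi>' \<in> hom (G\<lparr>carrier := C'\<rparr>) A"
      and eq: "\<forall>y\<in>C. \<chi>' y = \<chi> y"
      using character_extension_step[OF G less.prems xG \<open>x \<notin> C\<close> x2] by metis
    interpret C': subgroup C' G by (rule C'(1))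
    have "card (carrier G - C') < card (carrier G - C)"
      using C'(2) C'.subset fin by (intro psubset_card_mono) blast+
    from less.hyps[OF this C'(1,3)] show ?thesis using eq C'(2) by (metis psubsetD)
  qed
qed

text \<open>A cyclic subgroup of maximal order splits off: a faithful character of it extends to
  \<open>G\<close>, and the kernel of the extension is a complement. The bicharacter is an
  orthogonal sum of the standard form on the cyclic part and, by induction, one on the
  complement.\<close>

lemma nondegenerate_bicharacter:
  assumes "comm_group G" "order G = 2 ^ r"
  shows "\<exists>b. (\<forall>x\<in>carrier G. b x \<in> hom G A) \<and> (\<forall>x\<in>carrier G. \<forall>y\<in>carrier G. b x y = b y x) \<and>
    (\<forall>x\<in>carrier G. (\<forall>y\<in>carrier G. b x y = \<one>) \<longrightarrow> x = \<one>\<^sub>G)"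
  using assms
proof (induction r arbitrary: G rule: less_induct)
  case (less r)
  interpret G: comm_group G by fact
  have fin: "finite (carrier G)"
    using less by (metis card.infinite order_def power_not_zero zero_neq_numeral)
  \<comment> \<open>\<open>2 ^ q\<close> is the exponent of \<open>G\<close>. By minimality some
    \<open>g\<close> has exactly this order, so every value of a character on \<open>G\<close> is
    already a power of a primitive root \<open>d\<close> of the same order.\<close>
  define q where "q = (LEAST q. \<forall>x\<in>carrier G. x [^]\<^bsub>G\<^esub> (2 ^ q :: nat) = \<one>\<^sub>G)"
  have q: "x [^]\<^bsub>G\<^esub> (2 ^ q :: nat) = \<one>\<^sub>G" if "x \<in> carrier G" for x
  proof -
    have "\<forall>x\<in>carrier G. x [^]\<^bsub>G\<^esub> (2 ^ r :: nat) = \<one>\<^sub>G" using G.pow_order_eq_1 less.prems(2) by metis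
    then have "\<forall>x\<in>carrier G. x [^]\<^bsub>G\<^esub> (2 ^ q :: nat) = \<one>\<^sub>G" unfolding q_def by (rule LeastI)
    then show ?thesis using that by blast
  qed
  show ?case
  proof (cases q)
    case 0
    then have "x = \<one>\<^sub>G" if "x \<in> carrier G" for x using q[OF that] that by simp
    then show ?thesis by (intro exI[of _ "\<lambda>_ _. \<one>"]) (auto simp: hom_def)
  next
    case (Suc p)
    then obtain g where g: "g \<in> carrier G" "g [^]\<^bsub>G\<^esub> (2 ^ p :: nat) \<noteq> \<one>\<^sub>G"
      using not_less_Least[of p "\<lambda>q. \<forall>x\<in>carrier G. x [^]\<^bsub>G\<^esub> (2 ^ q :: nat) = \<one>\<^sub>G"] unfolding q_def by auto
    have "G.ord g dvd 2 ^ q" using q[OF g(1)] G.pow_eq_id[OF g(1)] by blast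
    then obtain k where k: "k \<le> q" "G.ord g = 2 ^ k" using divides_primepow_nat[of 2 "G.ord g" q] by auto
    have "k = q"
    proof (rule ccontr)
      assume "k \<noteq> q"
      then have "G.ord g dvd 2 ^ p" using k Suc by (simp add: le_imp_power_dvd)
      then show False using g G.pow_eq_id by metis
    qed
    obtain d where d: "d \<in> carrier A" "\<And>x. \<lbrakk>x \<in> carrier A; x [^] (2 ^ q :: nat) = \<one>\<rbrakk> \<Longrightarrow> \<exists>i::nat. x = d [^] i"
      "\<And>i::nat. d [^] i = \<one> \<longleftrightarrow> 2 ^ q dvd i"
      using primitive_root[of q] by blast
    have "ord d = 2 ^ q"
      using d(1,3) by (metis dvd_antisym dvd_refl pow_eq_id)
    have gd: "g [^]\<^bsub>G\<^esub> i = g [^]\<^bsub>G\<^esub> j \<longleftrightarrow> d [^] i = d [^] j" for i j :: nat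
      using G.int_pow_eq[OF g(1), of "int i" "int j"] int_pow_eq[OF d(1), of "int i" "int j"]
        \<open>ord d = 2 ^ q\<close> \<open>k = q\<close> k(2) by (simp add: int_pow_int)
    define C where "C = (\<lambda>i::nat. g [^]\<^bsub>G\<^esub> i) ` UNIV"
    have sC: "subgroup C G"
    proof (rule G.subgroupI)
      fix y assume "y \<in> C"
      then obtain i where i: "y = g [^]\<^bsub>G\<^esub> (i::nat)" unfolding C_def by blast
      then have "y \<in> carrier G" using g by simp
      then have "inv\<^bsub>G\<^esub> y = y [^]\<^bsub>G\<^esub> (2 ^ q - 1 :: nat)"
        using q[OF \<open>y \<in> carrier G\<close>]
        by (intro G.inv_equality) (simp_all add: G.nat_pow_Suc[symmetric] del: G.nat_pow_Suc)
      then show "inv\<^bsub>G\<^esub> y \<in> C" unfolding i C_def using g by (simp add: G.nat_pow_pow)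
      fix z assume "z \<in> C"
      then obtain j where "z = g [^]\<^bsub>G\<^esub> (j::nat)" unfolding C_def by blast
      then show "y \<otimes>\<^sub>G z \<in> C" unfolding i C_def using g by (simp add: G.nat_pow_mult)
    qed (use g in \<open>auto simp: C_def\<close>)
    \<comment> \<open>The choice of exponent is harmless: powers of \<open>g\<close> and of
      \<open>d\<close> coincide for the same exponents.\<close>
    define \<chi>0 where "\<chi>0 y = d [^] (SOME i::nat. y = g [^]\<^bsub>G\<^esub> i)" for y
    have \<chi>0: "\<chi>0 (g [^]\<^bsub>G\<^esub> i) = d [^] i" for i :: nat
      unfolding \<chi>0_def using gd by (metis (mono_tags, lifting) someI)
    have "\<chi>0 \<in> hom (G\<lparr>carrier := C\<rparr>) A"
      using g d(1) by (intro homI) (auto simp: C_def \<chi>0 G.nat_pow_mult nat_pow_mult)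
    then obtain \<chi> where \<chi>: "\<chi> \<in> hom G A" "\<And>y. y \<in> C \<Longrightarrow> \<chi> y = \<chi>0 y"
      using character_extension[OF less.prems sC] by blast
    interpret \<chi>: group_hom G A \<chi> by unfold_locales (rule \<chi>(1))
    have \<chi>g: "\<chi> (g [^]\<^bsub>G\<^esub> i) = d [^] i" for i :: nat using \<chi>(2) \<chi>0 by (auto simp: C_def)
    have \<chi>g1: "\<chi> g = d" using \<chi>g[of 1] by (simp only: G.nat_pow_eone[OF g(1)] nat_pow_eone[OF d(1)])
    define L where "L = kernel G A \<chi>"
    have Lmem: "y \<in> L \<longleftrightarrow> y \<in> carrier G \<and> \<chi> y = \<one>" for y
      unfolding L_def kernel_def mem_Collect_eq ..
    have sL: "subgroup L G" unfolding L_def by (rule \<chi>.subgroup_kernel)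
    then interpret L: subgroup L G .
    define G' where "G' = G\<lparr>carrier := L\<rparr>"
    have "group G'" unfolding G'_def by (rule subgroup.subgroup_is_group[OF sL G.is_group])
    then have "comm_group G'"
      by (rule group.group_comm_groupI) (auto simp: G'_def intro: G.m_comm)
    have "card L dvd order G" using G.lagrange[OF sL] by (metis dvd_triv_right)
    then obtain r' where r': "r' \<le> r" "order G' = 2 ^ r'"
      using divides_primepow_nat[of 2 "card L" r] less.prems(2) by (auto simp: order_def G'_def)
    have "g \<notin> L"
    proof
      assume "g \<in> L"
      then have "d = \<one>" using \<chi>g1 by (simp only: L_def kernel_def mem_Collect_eq)
      then show False using g(2) gd[of "2 ^ p" 0] by (simp only: nat_pow_one nat_pow_0 G.nat_pow_0 simp_thms)
    qed
    then have "card L < card (carrier G)"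
      using g(1) L.subset by (intro psubset_card_mono[OF fin] psubsetI) auto
    then have "r' < r" using r' less.prems(2) by (auto simp: order_def G'_def)
    from less.IH[OF this \<open>comm_group G'\<close> r'(2)] obtain b' where
      B: "\<forall>x\<in>carrier G'. b' x \<in> hom G' A" "\<forall>x\<in>carrier G'. \<forall>y\<in>carrier G'. b' x y = b' y x"
        "\<forall>x\<in>carrier G'. (\<forall>y\<in>carrier G'. b' x y = \<one>) \<longrightarrow> x = \<one>\<^bsub>G'\<^esub>"
      by blast
    have [simp]: "carrier G' = L" "\<one>\<^bsub>G'\<^esub> = \<one>\<^sub>G" by (simp_all add: G'_def)
    have b': "\<And>x. x \<in> L \<Longrightarrow> b' x \<in> hom G' A" "\<And>x y. \<lbrakk>x \<in> L; y \<in> L\<rbrakk> \<Longrightarrow> b' x y = b' y x"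
        "\<And>x. \<lbrakk>x \<in> L; \<And>y. y \<in> L \<Longrightarrow> b' x y = \<one>\<rbrakk> \<Longrightarrow> x = \<one>\<^sub>G"
      using B by simp_all
    \<comment> \<open>A discrete logarithm of the character to base \<open>d\<close>. It is
      determined modulo \<open>2 ^ q\<close> only, hence not additive; sums of logarithms are
      compared after passing to powers of \<open>g\<close>.\<close>
    define idx where "idx x = (SOME i::nat. \<chi> x = d [^] i)" for x
    have idx: "\<chi> x = d [^] idx x" if "x \<in> carrier G" for x
    proof -
      have "\<chi> x [^] (2 ^ q :: nat) = \<one>"
        using q[OF that] \<chi>.hom_nat_pow[OF that, of "2 ^ q"] by (simp only: \<chi>.hom_one)
      then have "\<exists>i::nat. \<chi> x = d [^] i" using d(2) \<chi>.hom_closed[OF that] by simp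
      then show ?thesis unfolding idx_def by (rule someI_ex)
    qed
    \<comment> \<open>The projection onto the kernel of \<open>\<chi>\<close> along the powers of
      \<open>g\<close>.\<close>
    define l where "l x = x \<otimes>\<^sub>G inv\<^bsub>G\<^esub> (g [^]\<^bsub>G\<^esub> idx x)" for x
    have lL: "l x \<in> L" if "x \<in> carrier G" for x
    proof -
      have gc: "g [^]\<^bsub>G\<^esub> idx x \<in> carrier G" using g(1) by (rule G.nat_pow_closed)
      have "\<chi> (l x) = \<chi> x \<otimes> inv (\<chi> x)"
        unfolding l_def \<chi>.hom_mult[OF that G.inv_closed[OF gc]] \<chi>.hom_inv[OF gc] \<chi>g
        by (simp only: idx[OF that, symmetric])
      then show ?thesis
        unfolding L_def kernel_def l_def
        using G.m_closed[OF that G.inv_closed[OF gc]] r_inv[OF \<chi>.hom_closed[OF that]] by simp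
    qed
    have lm: "l (x \<otimes>\<^sub>G y) = l x \<otimes>\<^sub>G l y" if "x \<in> carrier G" "y \<in> carrier G" for x y
    proof -
      have "d [^] idx (x \<otimes>\<^sub>G y) = d [^] (idx x + idx y)"
        by (simp only: nat_pow_mult[OF d(1), symmetric] idx[OF that(1), symmetric] idx[OF that(2), symmetric]
            idx[OF G.m_closed[OF that], symmetric] \<chi>.hom_mult[OF that])
      then have "g [^]\<^bsub>G\<^esub> idx (x \<otimes>\<^sub>G y) = g [^]\<^bsub>G\<^esub> idx x \<otimes>\<^sub>G g [^]\<^bsub>G\<^esub> idx y"
        by (simp only: gd G.nat_pow_mult[OF g(1)])
      then show ?thesis using that g(1) by (simp add: l_def G.inv_mult G.m_ac)
    qed
    \<comment> \<open>The first factor is \<open>d\<close> raised to the product of the two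
      logarithms, which is why it is symmetric. Testing against \<open>g\<close> detects the cyclic
      component, testing against the kernel detects the other one.\<close>
    define b where "b x y = \<chi> y [^] idx x \<otimes> b' (l x) (l y)" for x y
    have b'c: "b' x y \<in> carrier A" if "x \<in> L" "y \<in> L" for x y
      using b'(1)[OF that(1)] that(2) by (auto simp: hom_def G'_def)
    have b'm: "b' x (y \<otimes>\<^sub>G z) = b' x y \<otimes> b' x z" if "x \<in> L" "y \<in> L" "z \<in> L" for x y z
      using b'(1)[OF that(1)] that(2,3) by (auto simp: hom_def G'_def)
    have b'1: "b' x \<one>\<^sub>G = \<one>" if "x \<in> L" for x
      using b'm[OF that L.one_closed L.one_closed] b'c[OF that L.one_closed] G.one_closed by (simp only: G.l_one l_cancel_one')
    have bhom: "b x \<in> hom G A" if "x \<in> carrier G" for x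
    proof (rule homI)
      fix y assume y: "y \<in> carrier G"
      then show "b x y \<in> carrier A" using that b'c lL by (simp add: b_def)
      fix z assume z: "z \<in> carrier G"
      note c = \<chi>.hom_closed[OF y] \<chi>.hom_closed[OF z]
        b'c[OF lL[OF that] lL[OF y]] b'c[OF lL[OF that] lL[OF z]]
      have "b x (y \<otimes>\<^sub>G z) = (\<chi> y [^] idx x \<otimes> \<chi> z [^] idx x) \<otimes> (b' (l x) (l y) \<otimes> b' (l x) (l z))"
        using pow_mult_distrib[OF m_comm[OF c(1,2)] c(1,2)]
        by (simp only: b_def lm[OF y z] \<chi>.hom_mult[OF y z] b'm[OF lL[OF that] lL[OF y] lL[OF z]])
      also have "... = b x y \<otimes> b x z"
        using c unfolding b_def by (simp only: m_ac m_closed nat_pow_closed)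
      finally show "b x (y \<otimes>\<^sub>G z) = b x y \<otimes> b x z" .
    qed
    have bsym: "b x y = b y x" if "x \<in> carrier G" "y \<in> carrier G" for x y
      unfolding b_def b'(2)[OF lL[OF that(1)] lL[OF that(2)]] idx[OF that(1)] idx[OF that(2)]
        nat_pow_pow[OF d(1)] mult.commute[of "idx x"] ..
    have bnd: "x = \<one>\<^sub>G" if x: "x \<in> carrier G" and tr: "\<And>y. y \<in> carrier G \<Longrightarrow> b x y = \<one>" for x
    proof -
      have idL: "l y = y" if "y \<in> L" for y
      proof -
        have y: "y \<in> carrier G" "\<chi> y = \<one>" using that unfolding Lmem by (rule conjunct1, rule conjunct2)
        then have "d [^] idx y = d [^] (0::nat)" using idx[of y] by (simp only: nat_pow_0)
        then have "g [^]\<^bsub>G\<^esub> idx y = \<one>\<^sub>G" using gd[of "idx y" 0] by (simp only: G.nat_pow_0)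
        then show ?thesis by (simp only: l_def G.inv_one G.r_one[OF y(1)])
      qed
      have "b' (l x) y = \<one>" if "y \<in> L" for y
      proof -
        have y: "y \<in> carrier G" "\<chi> y = \<one>" using that unfolding Lmem by (rule conjunct1, rule conjunct2)
        then show ?thesis using tr[OF y(1)] b'c[OF lL[OF x] that]
          by (simp only: b_def idL[OF that] nat_pow_one l_one)
      qed
      then have lx: "l x = \<one>\<^sub>G" by (rule b'(3)[OF lL[OF x]])
      have "b' \<one>\<^sub>G (l g) = \<one>"
        unfolding b'(2)[OF L.one_closed lL[OF g(1)]] by (rule b'1[OF lL[OF g(1)]])
      then have "d [^] idx x = \<one>"
        using tr[OF g(1)] nat_pow_closed[OF d(1)] by (simp only: b_def lx \<chi>g1 r_one)
      then have "g [^]\<^bsub>G\<^esub> idx x = \<one>\<^sub>G" using gd[of "idx x" 0] by (simp only: nat_pow_0 G.nat_pow_0)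
      then show ?thesis using lx unfolding l_def by (simp only: G.inv_one G.r_one[OF x])
    qed
    show ?thesis
    proof (intro exI[of _ b] conjI ballI impI)
      fix x assume "x \<in> carrier G" "\<forall>y\<in>carrier G. b x y = \<one>"
      then show "x = \<one>\<^sub>G" by (intro bnd) auto
    qed (fact bhom bsym)+
  qed
qed

end

section \<open>Second cohomology\<close>

definition coboundary where
  "coboundary G A c = (\<lambda>(x, y)\<in>carrier G \<times> carrier G. c y \<otimes>\<^sub>A inv\<^bsub>A\<^esub> c (x \<otimes>\<^sub>G y) \<otimes>\<^sub>A c x)"

lemma two_coboundaries_eq: "two_coboundaries G A = coboundary G A ` (carrier G \<rightarrow> carrier A)"
  by (auto simp: two_coboundaries_def coboundary_def)

locale cohomology = G: comm_group G + A: comm_group A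
  for G :: "('g, 'e) monoid_scheme" and A :: "('c, 'd) monoid_scheme"
begin

lemma cocycle_iff:
  "f \<in> carrier (two_cocycles G A) \<longleftrightarrow> f \<in> extensional (carrier G \<times> carrier G) \<and>
    (\<forall>x\<in>carrier G. \<forall>y\<in>carrier G. f (x, y) \<in> carrier A) \<and>
    (\<forall>x\<in>carrier G. \<forall>y\<in>carrier G. \<forall>z\<in>carrier G. f (y, z) \<otimes>\<^sub>A f (x, y \<otimes>\<^sub>G z) = f (x \<otimes>\<^sub>G y, z) \<otimes>\<^sub>A f (x, y))"
  by (auto simp: two_cocycles_def PiE_def Pi_def)

lemma
  assumes "f \<in> carrier (two_cocycles G A)"
  shows cocycle_extensional: "f \<in> extensional (carrier G \<times> carrier G)"
    and cocycle_in: "\<lbrakk>x \<in> carrier G; y \<in> carrier G\<rbrakk> \<Longrightarrow> f (x, y) \<in> carrier A"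
    and cocycle_eq: "\<lbrakk>x \<in> carrier G; y \<in> carrier G; z \<in> carrier G\<rbrakk> \<Longrightarrow> f (y, z) \<otimes>\<^sub>A f (x, y \<otimes>\<^sub>G z) = f (x \<otimes>\<^sub>G y, z) \<otimes>\<^sub>A f (x, y)"
  using assms by (simp_all add: cocycle_iff)

lemma rearrange:
  "\<lbrakk>a \<in> carrier A; b \<in> carrier A; c \<in> carrier A; d \<in> carrier A\<rbrakk> \<Longrightarrow> (a \<otimes>\<^sub>A b) \<otimes>\<^sub>A (c \<otimes>\<^sub>A d) = (a \<otimes>\<^sub>A c) \<otimes>\<^sub>A (b \<otimes>\<^sub>A d)"
  by (simp add: A.m_ac)

lemma cocycle_mult_apply:
  "\<lbrakk>x \<in> carrier G; y \<in> carrier G\<rbrakk> \<Longrightarrow> (f \<otimes>\<^bsub>two_cocycles G A\<^esub> g) (x, y) = f (x, y) \<otimes>\<^sub>A g (x, y)"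
  by (simp add: two_cocycles_def)

lemma cocycle_eqI:
  assumes "f \<in> carrier (two_cocycles G A)" "g \<in> carrier (two_cocycles G A)"
    and "\<And>x y. \<lbrakk>x \<in> carrier G; y \<in> carrier G\<rbrakk> \<Longrightarrow> f (x, y) = g (x, y)"
  shows "f = g"
  using extensionalityI[OF cocycle_extensional[OF assms(1)] cocycle_extensional[OF assms(2)]] assms(3) by auto

lemma cocycle_mult:
  assumes f: "f \<in> carrier (two_cocycles G A)" and g: "g \<in> carrier (two_cocycles G A)"
  shows "f \<otimes>\<^bsub>two_cocycles G A\<^esub> g \<in> carrier (two_cocycles G A)"
  unfolding cocycle_iff
proof (intro conjI ballI)
  show "f \<otimes>\<^bsub>two_cocycles G A\<^esub> g \<in> extensional (carrier G \<times> carrier G)"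
    by (simp add: two_cocycles_def)
next
  fix x y assume "x \<in> carrier G" "y \<in> carrier G"
  then show "(f \<otimes>\<^bsub>two_cocycles G A\<^esub> g) (x, y) \<in> carrier A"
    using cocycle_in[OF f] cocycle_in[OF g] by (simp add: cocycle_mult_apply)
next
  fix x y z assume *: "x \<in> carrier G" "y \<in> carrier G" "z \<in> carrier G"
  then have c: "f (y, z) \<in> carrier A" "f (x, y \<otimes>\<^sub>G z) \<in> carrier A" "f (x \<otimes>\<^sub>G y, z) \<in> carrier A" "f (x, y) \<in> carrier A"
    "g (y, z) \<in> carrier A" "g (x, y \<otimes>\<^sub>G z) \<in> carrier A" "g (x \<otimes>\<^sub>G y, z) \<in> carrier A" "g (x, y) \<in> carrier A"
    using cocycle_in[OF f] cocycle_in[OF g] by auto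
  have "(f (y, z) \<otimes>\<^sub>A g (y, z)) \<otimes>\<^sub>A (f (x, y \<otimes>\<^sub>G z) \<otimes>\<^sub>A g (x, y \<otimes>\<^sub>G z)) =
      (f (x \<otimes>\<^sub>G y, z) \<otimes>\<^sub>A g (x \<otimes>\<^sub>G y, z)) \<otimes>\<^sub>A (f (x, y) \<otimes>\<^sub>A g (x, y))"
    unfolding rearrange[OF c(1,5,2,6)] rearrange[OF c(3,7,4,8)]
      cocycle_eq[OF f *] cocycle_eq[OF g *] ..
  then show "(f \<otimes>\<^bsub>two_cocycles G A\<^esub> g) (y, z) \<otimes>\<^sub>A (f \<otimes>\<^bsub>two_cocycles G A\<^esub> g) (x, y \<otimes>\<^sub>G z) =
      (f \<otimes>\<^bsub>two_cocycles G A\<^esub> g) (x \<otimes>\<^sub>G y, z) \<otimes>\<^sub>A (f \<otimes>\<^bsub>two_cocycles G A\<^esub> g) (x, y)"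
    using * by (simp add: cocycle_mult_apply)
qed

lemma coboundary_apply:
  "\<lbrakk>x \<in> carrier G; y \<in> carrier G\<rbrakk> \<Longrightarrow> coboundary G A c (x, y) = c y \<otimes>\<^sub>A inv\<^bsub>A\<^esub> c (x \<otimes>\<^sub>G y) \<otimes>\<^sub>A c x"
  by (simp add: coboundary_def)

lemma coboundary_cocycle:
  assumes c: "c \<in> carrier G \<rightarrow> carrier A"
  shows "coboundary G A c \<in> carrier (two_cocycles G A)"
  unfolding cocycle_iff
proof (intro conjI ballI)
  show "coboundary G A c \<in> extensional (carrier G \<times> carrier G)" by (simp add: coboundary_def)
next
  fix x y assume "x \<in> carrier G" "y \<in> carrier G"
  then show "coboundary G A c (x, y) \<in> carrier A" using c by (simp add: coboundary_apply Pi_iff)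
next
  fix x y z assume *: "x \<in> carrier G" "y \<in> carrier G" "z \<in> carrier G"
  \<comment> \<open>A rearrangement that brings \<open>q\<close> and \<open>s\<close> together; in
    its use below they are the value of \<open>c\<close> at the product of \<open>y\<close> and
    \<open>z\<close> and the inverse of that value.\<close>
  have m: "p \<otimes>\<^sub>A q \<otimes>\<^sub>A r \<otimes>\<^sub>A (s \<otimes>\<^sub>A t \<otimes>\<^sub>A u) = (p \<otimes>\<^sub>A r \<otimes>\<^sub>A u) \<otimes>\<^sub>A t \<otimes>\<^sub>A (q \<otimes>\<^sub>A s)"
    if "p \<in> carrier A" "q \<in> carrier A" "r \<in> carrier A" "s \<in> carrier A" "t \<in> carrier A" "u \<in> carrier A" for p q r s t u
    using that by (simp add: A.m_ac)
  have c': "c x \<in> carrier A" "c y \<in> carrier A" "c z \<in> carrier A" "c (x \<otimes>\<^sub>G y) \<in> carrier A" "c (y \<otimes>\<^sub>G z) \<in> carrier A" "c (x \<otimes>\<^sub>G (y \<otimes>\<^sub>G z)) \<in> carrier A"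
    using * c by auto
  have "c z \<otimes>\<^sub>A inv\<^bsub>A\<^esub> c (y \<otimes>\<^sub>G z) \<otimes>\<^sub>A c y \<otimes>\<^sub>A (c (y \<otimes>\<^sub>G z) \<otimes>\<^sub>A inv\<^bsub>A\<^esub> c (x \<otimes>\<^sub>G (y \<otimes>\<^sub>G z)) \<otimes>\<^sub>A c x) =
      (c z \<otimes>\<^sub>A c y \<otimes>\<^sub>A c x) \<otimes>\<^sub>A inv\<^bsub>A\<^esub> c (x \<otimes>\<^sub>G (y \<otimes>\<^sub>G z))"
    using m[of "c z" "inv\<^bsub>A\<^esub> c (y \<otimes>\<^sub>G z)" "c y" "c (y \<otimes>\<^sub>G z)" "inv\<^bsub>A\<^esub> c (x \<otimes>\<^sub>G (y \<otimes>\<^sub>G z))" "c x"] c' by simp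
  moreover have "c z \<otimes>\<^sub>A inv\<^bsub>A\<^esub> c (x \<otimes>\<^sub>G (y \<otimes>\<^sub>G z)) \<otimes>\<^sub>A c (x \<otimes>\<^sub>G y) \<otimes>\<^sub>A (c y \<otimes>\<^sub>A inv\<^bsub>A\<^esub> c (x \<otimes>\<^sub>G y) \<otimes>\<^sub>A c x) =
      (c z \<otimes>\<^sub>A c y \<otimes>\<^sub>A c x) \<otimes>\<^sub>A inv\<^bsub>A\<^esub> c (x \<otimes>\<^sub>G (y \<otimes>\<^sub>G z)) \<otimes>\<^sub>A (c (x \<otimes>\<^sub>G y) \<otimes>\<^sub>A inv\<^bsub>A\<^esub> c (x \<otimes>\<^sub>G y))"
    using c' by (simp only: A.m_ac A.m_closed A.inv_closed)
  ultimately have "c z \<otimes>\<^sub>A inv\<^bsub>A\<^esub> c (y \<otimes>\<^sub>G z) \<otimes>\<^sub>A c y \<otimes>\<^sub>A (c (y \<otimes>\<^sub>G z) \<otimes>\<^sub>A inv\<^bsub>A\<^esub> c (x \<otimes>\<^sub>G (y \<otimes>\<^sub>G z)) \<otimes>\<^sub>A c x) =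
     c z \<otimes>\<^sub>A inv\<^bsub>A\<^esub> c (x \<otimes>\<^sub>G (y \<otimes>\<^sub>G z)) \<otimes>\<^sub>A c (x \<otimes>\<^sub>G y) \<otimes>\<^sub>A (c y \<otimes>\<^sub>A inv\<^bsub>A\<^esub> c (x \<otimes>\<^sub>G y) \<otimes>\<^sub>A c x)"
    using c' by simp
  then show "coboundary G A c (y, z) \<otimes>\<^sub>A coboundary G A c (x, y \<otimes>\<^sub>G z) =
      coboundary G A c (x \<otimes>\<^sub>G y, z) \<otimes>\<^sub>A coboundary G A c (x, y)"
    using * by (simp add: coboundary_apply G.m_assoc)
qed

lemma cocycles_comm_group: "comm_group (two_cocycles G A)"
proof (rule comm_groupI)
  let ?Z = "two_cocycles G A"
  show one: "\<one>\<^bsub>?Z\<^esub> \<in> carrier ?Z"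
    by (auto simp: cocycle_iff two_cocycles_def)
  show m: "f \<otimes>\<^bsub>?Z\<^esub> g \<in> carrier ?Z" if "f \<in> carrier ?Z" "g \<in> carrier ?Z" for f g
    by (rule cocycle_mult[OF that])
  fix f assume f: "f \<in> carrier ?Z"
  show "\<one>\<^bsub>?Z\<^esub> \<otimes>\<^bsub>?Z\<^esub> f = f"
    by (rule cocycle_eqI[OF m[OF one f] f]) (simp add: cocycle_mult_apply, simp add: two_cocycles_def cocycle_in[OF f])
  define f' where "f' = (\<lambda>p\<in>carrier G \<times> carrier G. inv\<^bsub>A\<^esub> f p)"
  have f': "f' \<in> carrier ?Z"
    unfolding cocycle_iff
  proof (intro conjI ballI)
    fix x y z assume *: "x \<in> carrier G" "y \<in> carrier G" "z \<in> carrier G"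
    then have "inv\<^bsub>A\<^esub> (f (y, z) \<otimes>\<^sub>A f (x, y \<otimes>\<^sub>G z)) = inv\<^bsub>A\<^esub> (f (x \<otimes>\<^sub>G y, z) \<otimes>\<^sub>A f (x, y))"
      using cocycle_eq[OF f] by simp
    then show "f' (y, z) \<otimes>\<^sub>A f' (x, y \<otimes>\<^sub>G z) = f' (x \<otimes>\<^sub>G y, z) \<otimes>\<^sub>A f' (x, y)"
      using * cocycle_in[OF f] by (simp add: f'_def A.inv_mult)
  qed (use cocycle_in[OF f] in \<open>simp_all add: f'_def\<close>)
  show "\<exists>f'\<in>carrier ?Z. f' \<otimes>\<^bsub>?Z\<^esub> f = \<one>\<^bsub>?Z\<^esub>"
    by (rule bexI[OF _ f'], rule cocycle_eqI[OF m[OF f' f] one])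
      (simp add: cocycle_mult_apply, simp add: f'_def two_cocycles_def cocycle_in[OF f])
  fix g assume g: "g \<in> carrier ?Z"
  show "f \<otimes>\<^bsub>?Z\<^esub> g = g \<otimes>\<^bsub>?Z\<^esub> f"
    by (rule cocycle_eqI[OF m[OF f g] m[OF g f]])
      (simp add: cocycle_mult_apply A.m_comm cocycle_in[OF f] cocycle_in[OF g])
  fix h assume h: "h \<in> carrier ?Z"
  show "f \<otimes>\<^bsub>?Z\<^esub> g \<otimes>\<^bsub>?Z\<^esub> h = f \<otimes>\<^bsub>?Z\<^esub> (g \<otimes>\<^bsub>?Z\<^esub> h)"
    by (rule cocycle_eqI[OF m[OF m[OF f g] h] m[OF f m[OF g h]]])
      (simp add: cocycle_mult_apply A.m_assoc cocycle_in[OF f] cocycle_in[OF g] cocycle_in[OF h])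
qed

sublocale Z: comm_group "two_cocycles G A" by (rule cocycles_comm_group)

lemma coboundary_mult:
  assumes c: "c \<in> carrier G \<rightarrow> carrier A" and d: "d \<in> carrier G \<rightarrow> carrier A"
  shows "coboundary G A c \<otimes>\<^bsub>two_cocycles G A\<^esub> coboundary G A d = coboundary G A (\<lambda>x. c x \<otimes>\<^sub>A d x)"
proof (rule cocycle_eqI)
  fix x y assume *: "x \<in> carrier G" "y \<in> carrier G"
  have c': "c x \<in> carrier A" "c y \<in> carrier A" "c (x \<otimes>\<^sub>G y) \<in> carrier A" "d x \<in> carrier A" "d y \<in> carrier A" "d (x \<otimes>\<^sub>G y) \<in> carrier A" using * c d by auto
  then have "(c y \<otimes>\<^sub>A inv\<^bsub>A\<^esub> c (x \<otimes>\<^sub>G y) \<otimes>\<^sub>A c x) \<otimes>\<^sub>A (d y \<otimes>\<^sub>A inv\<^bsub>A\<^esub> d (x \<otimes>\<^sub>G y) \<otimes>\<^sub>A d x) =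
      c y \<otimes>\<^sub>A d y \<otimes>\<^sub>A (inv\<^bsub>A\<^esub> c (x \<otimes>\<^sub>G y) \<otimes>\<^sub>A inv\<^bsub>A\<^esub> d (x \<otimes>\<^sub>G y)) \<otimes>\<^sub>A (c x \<otimes>\<^sub>A d x)"
    by (simp only: A.m_ac A.m_closed A.inv_closed)
  then show "(coboundary G A c \<otimes>\<^bsub>two_cocycles G A\<^esub> coboundary G A d) (x, y) = coboundary G A (\<lambda>x. c x \<otimes>\<^sub>A d x) (x, y)"
    using * c' by (simp add: cocycle_mult_apply coboundary_apply A.inv_mult)
qed (use c d in \<open>auto intro!: coboundary_cocycle cocycle_mult\<close>)

lemma coboundaries_subgroup: "subgroup (two_coboundaries G A) (two_cocycles G A)"
proof (rule Z.subgroupI)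
  show "two_coboundaries G A \<subseteq> carrier (two_cocycles G A)"
    unfolding two_coboundaries_eq using coboundary_cocycle by blast
  show "two_coboundaries G A \<noteq> {}" unfolding two_coboundaries_eq using A.one_closed by blast
next
  fix f g assume "f \<in> two_coboundaries G A" "g \<in> two_coboundaries G A"
  then obtain c d where *: "c \<in> carrier G \<rightarrow> carrier A" "d \<in> carrier G \<rightarrow> carrier A"
    "f = coboundary G A c" "g = coboundary G A d" unfolding two_coboundaries_eq by blast
  then show "f \<otimes>\<^bsub>two_cocycles G A\<^esub> g \<in> two_coboundaries G A"
    unfolding two_coboundaries_eq using coboundary_mult[OF *(1,2)]
    by (intro image_eqI[of _ _ "\<lambda>x. c x \<otimes>\<^sub>A d x"]) auto
next
  fix f assume "f \<in> two_coboundaries G A"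
  then obtain c where c: "c \<in> carrier G \<rightarrow> carrier A" "f = coboundary G A c" unfolding two_coboundaries_eq by blast
  define d where "d x = inv\<^bsub>A\<^esub> c x" for x
  have d: "d \<in> carrier G \<rightarrow> carrier A" using c(1) by (auto simp: d_def Pi_iff)
  have "coboundary G A d \<otimes>\<^bsub>two_cocycles G A\<^esub> f = coboundary G A (\<lambda>x. d x \<otimes>\<^sub>A c x)"
    unfolding c(2) by (rule coboundary_mult[OF d c(1)])
  also have "... = \<one>\<^bsub>two_cocycles G A\<^esub>"
    using c(1) by (auto simp: coboundary_def two_cocycles_def d_def Pi_iff intro!: restrict_ext)
  finally have "inv\<^bsub>two_cocycles G A\<^esub> f = coboundary G A d"
    using coboundary_cocycle[OF c(1)] coboundary_cocycle[OF d] c(2) Z.inv_equality by simp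
  then show "inv\<^bsub>two_cocycles G A\<^esub> f \<in> two_coboundaries G A" using d unfolding two_coboundaries_eq by blast
qed

lemma second_cohomology_carrier:
  "carrier (second_cohomology G A) =
    (\<lambda>f. two_coboundaries G A #>\<^bsub>two_cocycles G A\<^esub> f) ` carrier (two_cocycles G A)"
  by (simp add: second_cohomology_def carrier_FactGroup)

lemma mem_coset:
  assumes "g \<in> two_coboundaries G A #>\<^bsub>two_cocycles G A\<^esub> f"
  shows "\<exists>c\<in>carrier G \<rightarrow> carrier A. g = coboundary G A c \<otimes>\<^bsub>two_cocycles G A\<^esub> f"
  using assms by (auto simp: r_coset_def two_coboundaries_eq)

text \<open>Multiply the cocycle identity over all values of its third variable. One product is
  invariant under translation, and the factor constant in that variable becomes the power.\<close>

lemma cocycle_power: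
  assumes f: "f \<in> carrier (two_cocycles G A)" and fin: "finite (carrier G)"
    and x: "x \<in> carrier G" and y: "y \<in> carrier G"
  defines "c \<equiv> \<lambda>x. finprod A (\<lambda>z. f (x, z)) (carrier G)"
  shows "f (x, y) [^]\<^bsub>A\<^esub> order G = coboundary G A c (x, y)"
proof -
  have fin_in: "(\<lambda>z. f (w, z)) \<in> carrier G \<rightarrow> carrier A" if "w \<in> carrier G" for w using cocycle_in[OF f that] by auto
  have c_in: "c w \<in> carrier A" if "w \<in> carrier G" for w unfolding c_def using fin_in[OF that] by (rule A.finprod_closed)
  have "c y \<otimes>\<^sub>A c x = c y \<otimes>\<^sub>A finprod A (\<lambda>z. f (x, y \<otimes>\<^sub>G z)) (carrier G)"
    unfolding c_def A.finprod_translate[OF G.is_group y fin_in[OF x]] ..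
  also have "... = finprod A (\<lambda>z. f (y, z) \<otimes>\<^sub>A f (x, y \<otimes>\<^sub>G z)) (carrier G)"
    unfolding c_def using cocycle_in[OF f] x y by (intro A.finprod_multf[symmetric]) auto
  also have "... = finprod A (\<lambda>z. f (x \<otimes>\<^sub>G y, z) \<otimes>\<^sub>A f (x, y)) (carrier G)"
    using cocycle_in[OF f] cocycle_eq[OF f] x y by (intro A.finprod_cong') auto
  also have "... = c (x \<otimes>\<^sub>G y) \<otimes>\<^sub>A f (x, y) [^]\<^bsub>A\<^esub> order G"
    unfolding c_def order_def using cocycle_in[OF f] x y
    by (subst A.finprod_multf) (auto simp: A.finprod_const)
  finally have eq: "c y \<otimes>\<^sub>A c x = c (x \<otimes>\<^sub>G y) \<otimes>\<^sub>A f (x, y) [^]\<^bsub>A\<^esub> order G" .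
  have "coboundary G A c (x, y) = inv\<^bsub>A\<^esub> c (x \<otimes>\<^sub>G y) \<otimes>\<^sub>A (c y \<otimes>\<^sub>A c x)"
    using c_in x y by (simp add: coboundary_apply A.m_ac)
  also have "... = f (x, y) [^]\<^bsub>A\<^esub> order G"
    unfolding eq using c_in x y cocycle_in[OF f x y] by (simp add: A.m_assoc[symmetric])
  finally show ?thesis ..
qed

end

text \<open>By \<open>cocycle_power\<close> the power of a cocycle by the group order is a
  coboundary. Taking roots of its inverse primitive corrects the cocycle to one with values in the
  roots of unity of that order, and there are finitely many such functions.\<close>

lemma (in square_closed_group) finite_second_cohomology:
  fixes G (structure)
  assumes G: "comm_group G" and order: "order G = 2 ^ r"
  shows "finite (carrier (second_cohomology G A))"
proof -
  interpret cohomology G A by (intro cohomology.intro G comm_group_axioms)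
  have fin: "finite (carrier G)"
    using order by (metis card.infinite order_def power_not_zero zero_neq_numeral)
  let ?Z = "two_cocycles G A" and ?B = "two_coboundaries G A"
  let ?F = "carrier G \<times> carrier G \<rightarrow>\<^sub>E {x \<in> carrier A. x [^]\<^bsub>A\<^esub> (2 ^ r :: nat) = \<one>\<^sub>A}"
  have "carrier (second_cohomology G A) \<subseteq> (\<lambda>f. ?B #>\<^bsub>?Z\<^esub> f) ` ?F"
  proof
    fix C assume "C \<in> carrier (second_cohomology G A)"
    then obtain f where f: "f \<in> carrier ?Z" "C = ?B #>\<^bsub>?Z\<^esub> f"
      by (auto simp: second_cohomology_carrier)
    define c where "c = (\<lambda>x. finprod A (\<lambda>z. f (x, z)) (carrier G))"
    have c: "c x \<in> carrier A" if "x \<in> carrier G" for x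
      unfolding c_def using cocycle_in[OF f(1) that] by (intro finprod_closed) auto
    have "\<forall>x\<in>carrier G. \<exists>d\<in>carrier A. d [^] (2 ^ r :: nat) = inv\<^bsub>A\<^esub> c x"
      using root_2_pow c by auto
    then obtain d where d: "\<And>x. x \<in> carrier G \<Longrightarrow> d x \<in> carrier A" "\<And>x. x \<in> carrier G \<Longrightarrow> d x [^] (2 ^ r :: nat) = inv\<^bsub>A\<^esub> c x"
      by metis
    have d': "d \<in> carrier G \<rightarrow> carrier A" using d by auto
    define g where "g = coboundary G A d \<otimes>\<^bsub>?Z\<^esub> f"
    have g: "g \<in> carrier ?Z" using cocycle_mult[OF coboundary_cocycle[OF d'] f(1)] by (simp add: g_def)
    have "g (x, y) [^] (2 ^ r :: nat) = \<one>\<^sub>A" if "x \<in> carrier G" "y \<in> carrier G" for x y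
    proof -
      have xy: "x \<otimes>\<^sub>G y \<in> carrier G" using that by simp
      have "g (x, y) [^] (2 ^ r :: nat) = coboundary G A d (x, y) [^] (2 ^ r :: nat) \<otimes>\<^sub>A f (x, y) [^] (2 ^ r :: nat)"
        using that cocycle_in[OF f(1)] cocycle_in[OF coboundary_cocycle[OF d']]
        by (simp add: g_def cocycle_mult_apply nat_pow_distrib)
      also have "coboundary G A d (x, y) [^] (2 ^ r :: nat) = inv\<^bsub>A\<^esub> c y \<otimes>\<^sub>A c (x \<otimes>\<^sub>G y) \<otimes>\<^sub>A inv\<^bsub>A\<^esub> c x"
        using that d c xy by (simp add: coboundary_apply nat_pow_distrib nat_pow_inv)
      also have "f (x, y) [^] (2 ^ r :: nat) = c y \<otimes>\<^sub>A inv\<^bsub>A\<^esub> c (x \<otimes>\<^sub>G y) \<otimes>\<^sub>A c x"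
        using cocycle_power[OF f(1) fin that] that by (simp add: order c_def coboundary_apply)
      also have "inv\<^bsub>A\<^esub> c y \<otimes>\<^sub>A c (x \<otimes>\<^sub>G y) \<otimes>\<^sub>A inv\<^bsub>A\<^esub> c x \<otimes>\<^sub>A (c y \<otimes>\<^sub>A inv\<^bsub>A\<^esub> c (x \<otimes>\<^sub>G y) \<otimes>\<^sub>A c x) =
          (c y \<otimes>\<^sub>A inv\<^bsub>A\<^esub> c y) \<otimes>\<^sub>A (c (x \<otimes>\<^sub>G y) \<otimes>\<^sub>A inv\<^bsub>A\<^esub> c (x \<otimes>\<^sub>G y)) \<otimes>\<^sub>A (c x \<otimes>\<^sub>A inv\<^bsub>A\<^esub> c x)"
        using c that xy by (simp only: m_ac m_closed inv_closed)
      also have "... = \<one>\<^sub>A" using c that xy by simp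
      finally show ?thesis .
    qed
    then have "g \<in> ?F"
      using cocycle_in[OF g] cocycle_extensional[OF g] by (auto simp: PiE_def)
    moreover have "C = ?B #>\<^bsub>?Z\<^esub> g"
      unfolding f(2)
      by (rule Z.repr_independence[OF _ f(1) coboundaries_subgroup])
        (use d' in \<open>auto simp: g_def r_coset_def two_coboundaries_eq\<close>)
    ultimately show "C \<in> (\<lambda>f. ?B #>\<^bsub>?Z\<^esub> f) ` ?F" by blast
  qed
  moreover have "finite ?F" using fin finite_roots[of r] by (intro finite_PiE) auto
  ultimately show ?thesis using finite_surj by blast
qed

section \<open>Counting the cocycles\<close>

text \<open>Otherwise every product of \<open>u\<close> with some \<open>b a\<close> is a nontrivial
  character and sums to zero. Summing over \<open>a\<close> first leaves only the unit of
  \<open>G\<close>, whose contribution is the group order.\<close>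

lemma (in domain) hom_eq_bicharacter:
  assumes Q: "comm_group G" "finite (carrier G)" and order: "[order G] \<cdot> \<one> \<noteq> \<zero>"
    and b: "\<And>a. a \<in> carrier G \<Longrightarrow> b a \<in> hom G (units_of R)"
    and sym: "\<And>a c. \<lbrakk>a \<in> carrier G; c \<in> carrier G\<rbrakk> \<Longrightarrow> b a c = b c a"
    and nd: "\<And>a. \<lbrakk>a \<in> carrier G; \<And>c. c \<in> carrier G \<Longrightarrow> b a c = \<one>\<rbrakk> \<Longrightarrow> a = \<one>\<^sub>G"
    and u: "u \<in> hom G (units_of R)"
  shows "\<exists>a\<in>carrier G. \<forall>g\<in>carrier G. u g \<otimes> b a g = \<one>"
proof (rule ccontr)
  assume neg: "\<not> ?thesis"
  interpret Q: comm_group G by fact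
  interpret U: comm_group "units_of R" by (rule units_comm_group)
  have u_in: "u g \<in> carrier R" and b_in: "b a g \<in> carrier R" if "a \<in> carrier G" "g \<in> carrier G" for a g
    using u b[of a] that by (auto simp: hom_def units_of_def Units_def)
  have zero: "(\<Oplus>g\<in>carrier G. u g \<otimes> b a g) = \<zero>" if a: "a \<in> carrier G" for a
  proof -
    have "(\<lambda>g. u g \<otimes> b a g) \<in> hom G (units_of R)"
      using u b[OF a] u_in b_in[OF a] by (auto simp: hom_def units_of_def m_ac)
    moreover obtain h where "h \<in> carrier G" "u h \<otimes> b a h \<noteq> \<one>" using neg a by blast
    ultimately show ?thesis by (rule hom_sum_zero[OF Q.is_group Q(2)])
  qed
  have "\<zero> = (\<Oplus>a\<in>carrier G. \<Oplus>g\<in>carrier G. u g \<otimes> b a g)"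
    using zero by (simp cong: finsum_cong')
  also have "... = (\<Oplus>g\<in>carrier G. \<Oplus>a\<in>carrier G. u g \<otimes> b a g)"
    using u_in b_in Q(2) by (intro finsum_swap) auto
  also have "... = (\<Oplus>g\<in>carrier G. u g \<otimes> (\<Oplus>a\<in>carrier G. b g a))"
    using u_in b_in Q(2) sym by (intro finsum_cong' refl) (auto simp: finsum_rdistr intro!: finsum_cong')
  also have "... = u \<one>\<^sub>G \<otimes> (\<Oplus>a\<in>carrier G. b \<one>\<^sub>G a)"
  proof (rule finsum_single[OF Q(2) Q.one_closed])
    fix g assume g: "g \<in> carrier G" "g \<noteq> \<one>\<^sub>G"
    then obtain h where "h \<in> carrier G" "b g h \<noteq> \<one>" using nd by blast
    then have "(\<Oplus>a\<in>carrier G. b g a) = \<zero>" using hom_sum_zero[OF Q.is_group Q(2) b[OF g(1)]] by blast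
    then show "u g \<otimes> (\<Oplus>a\<in>carrier G. b g a) = \<zero>" using u_in g by simp
  qed (use u_in b_in in \<open>auto intro!: m_closed finsum_closed\<close>)
  also have "(\<Oplus>a\<in>carrier G. b \<one>\<^sub>G a) = (\<Oplus>a\<in>carrier G. \<one>)"
  proof (intro finsum_cong' refl)
    fix a assume a: "a \<in> carrier G"
    interpret group_hom G "units_of R" "b a" by unfold_locales (rule b[OF a])
    show "b \<one>\<^sub>G a = \<one>" using hom_one sym[OF a Q.one_closed] by (simp add: units_of_one)
  qed auto
  also have "... = [order G] \<cdot> \<one>" using add.finprod_const[of \<one> "carrier G"] by (simp add: order_def)
  also have "u \<one>\<^sub>G = \<one>"
  proof -
    interpret group_hom G "units_of R" u by unfold_locales (rule u)
    show ?thesis using hom_one by (simp add: units_of_one)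
  qed
  finally show False using order by simp
qed

text \<open>Invariance at the moved point \<open>x\<close> makes a character trivial on the quotient
  \<open>w\<close> of \<open>\<tau> x\<close> by \<open>x\<close>. Through \<open>b\<close> such
  characters correspond to elements orthogonal to \<open>w\<close>, a proper subgroup by
  nondegeneracy.\<close>

lemma (in domain) invariant_hom_bound:
  assumes Q: "comm_group G" "finite (carrier G)" and order: "[order G] \<cdot> \<one> \<noteq> \<zero>"
    and b: "\<And>a. a \<in> carrier G \<Longrightarrow> b a \<in> hom G (units_of R)"
    and sym: "\<And>a c. \<lbrakk>a \<in> carrier G; c \<in> carrier G\<rbrakk> \<Longrightarrow> b a c = b c a"
    and nd: "\<And>a. \<lbrakk>a \<in> carrier G; \<And>c. c \<in> carrier G \<Longrightarrow> b a c = \<one>\<rbrakk> \<Longrightarrow> a = \<one>\<^sub>G"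
    and \<tau>: "x \<in> carrier G" "\<tau> x \<in> carrier G" "\<tau> x \<noteq> x"
  defines "I \<equiv> {u \<in> hom G (units_of R). u \<in> extensional (carrier G) \<and> u (\<tau> x) = u x}"
  shows "finite I \<and> 2 * card I \<le> order G"
proof -
  interpret Q: comm_group G by fact
  interpret U: comm_group "units_of R" by (rule units_comm_group)
  have u_in: "u g \<in> carrier R" if "u \<in> hom G (units_of R)" "g \<in> carrier G" for u g
    using that by (auto simp: hom_def units_of_def Units_def)
  have mult: "u (g \<otimes>\<^sub>G h) = u g \<otimes> u h" if "u \<in> hom G (units_of R)" "g \<in> carrier G" "h \<in> carrier G" for u g h
    using that by (auto simp: hom_def units_of_def)
  have cancel: "k = l" if "k \<otimes> m = l \<otimes> m" "m \<in> Units R" "k \<in> carrier R" "l \<in> carrier R" for k l m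
    using that by (metis Units_closed Units_r_inv Units_inv_closed m_assoc r_one)
  have b_unit: "b a g \<in> Units R" if "a \<in> carrier G" "g \<in> carrier G" for a g
    using b[OF that(1)] that(2) by (auto simp: hom_def units_of_def)
  define w where "w = \<tau> x \<otimes>\<^sub>G inv\<^bsub>G\<^esub> x"
  have w: "w \<in> carrier G" "w \<otimes>\<^sub>G x = \<tau> x" using \<tau> by (auto simp: w_def Q.m_assoc)
  have w1: "w \<noteq> \<one>\<^sub>G" using \<tau> w by auto
  obtain d where d: "d \<in> carrier G" "b w d \<noteq> \<one>" using nd[OF w(1)] w1 by blast
  have fix_iff: "u (\<tau> x) = u x \<longleftrightarrow> u w = \<one>" if u: "u \<in> hom G (units_of R)" for u
  proof
    have ux: "u x \<in> Units R" using u \<tau> by (auto simp: hom_def units_of_def)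
    have eq: "u (\<tau> x) = u w \<otimes> u x" using mult[OF u w(1) \<tau>(1)] w(2) by simp
    show "u w = \<one>" if "u (\<tau> x) = u x"
      using cancel[of "u w" "u x" \<one>] that ux u_in[OF u] w \<tau> eq by simp
    show "u (\<tau> x) = u x" if "u w = \<one>" using that eq ux Units_closed by simp
  qed
  define B where "B = {a \<in> carrier G. b a w = \<one>}"
  have B: "B \<subseteq> carrier G" "finite B" using Q(2) by (auto simp: B_def)
  obtain \<alpha> where \<alpha>: "\<And>u. u \<in> hom G (units_of R) \<Longrightarrow> \<alpha> u \<in> carrier G"
    "\<And>u g. \<lbrakk>u \<in> hom G (units_of R); g \<in> carrier G\<rbrakk> \<Longrightarrow> u g \<otimes> b (\<alpha> u) g = \<one>"
    using hom_eq_bicharacter[OF Q order b sym nd] by metis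
  have "\<alpha> ` I \<subseteq> B"
  proof
    fix a assume "a \<in> \<alpha> ` I"
    then obtain u where u: "u \<in> hom G (units_of R)" "u (\<tau> x) = u x" "a = \<alpha> u" by (auto simp: I_def)
    then have "u w = \<one>" using fix_iff by simp
    then show "a \<in> B" using \<alpha>[OF u(1)] u(3) w(1) u_in[OF b] by (force simp: B_def)
  qed
  moreover have "inj_on \<alpha> I"
  proof (rule inj_onI)
    fix u v assume uv: "u \<in> I" "v \<in> I" "\<alpha> u = \<alpha> v"
    show "u = v"
    proof (rule extensionalityI)
      show "u \<in> extensional (carrier G)" "v \<in> extensional (carrier G)" using uv by (auto simp: I_def)
      fix g assume g: "g \<in> carrier G"
      have "u \<in> hom G (units_of R)" "v \<in> hom G (units_of R)" using uv by (auto simp: I_def)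
      then show "u g = v g"
        using \<alpha> uv(3) g u_in b_unit cancel[of "u g" "b (\<alpha> v) g" "v g"] by metis
    qed
  qed
  ultimately have I: "finite I" "card I \<le> card B"
    using B finite_imageD[OF finite_subset] card_mono card_image by metis+
  \<comment> \<open>Translation by an element \<open>d\<close> that is not orthogonal to
    \<open>w\<close> carries \<open>B\<close> to a disjoint set, so \<open>B\<close> fills at most
    half of the group.\<close>
  have "((\<otimes>\<^bsub>G\<^esub>) d ` B) \<inter> B = {}"
  proof -
    have "b (d \<otimes>\<^sub>G a) w \<noteq> \<one>" if "a \<in> B" for a
    proof -
      have "b (d \<otimes>\<^sub>G a) w = b w d \<otimes> b w a"
        using that B w d sym mult[OF b[OF w(1)] d(1)] by (auto simp: B_def)
      also have "b w a = \<one>" using that sym[OF w(1), of a] by (auto simp: B_def)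
      finally show ?thesis using d u_in[OF b[OF w(1)] d(1)] by simp
    qed
    then show ?thesis by (auto simp: B_def)
  qed
  moreover have "card ((\<otimes>\<^bsub>G\<^esub>) d ` B) = card B"
    by (rule card_image) (use B d in \<open>auto intro!: inj_onI simp: subset_iff\<close>)
  ultimately have "2 * card B = card ((\<otimes>\<^bsub>G\<^esub>) d ` B \<union> B)"
    using B card_Un_disjoint[of "(\<otimes>\<^bsub>G\<^esub>) d ` B" B] by auto
  also have "... \<le> order G" unfolding order_def using B d by (intro card_mono Q(2)) auto
  finally show ?thesis using I by auto
qed

text \<open>Solutions \<open>s\<close> for fixed \<open>\<tau>\<close> and \<open>f\<close> form a
  torsor or an empty set: quotients by one solution embed them into the characters counted in
  \<open>invariant_hom_bound\<close>.\<close>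

lemma (in domain) crossed_datum_bound:
  assumes Q: "comm_group G" "finite (carrier G)" and order: "[order G] \<cdot> \<one> \<noteq> \<zero>"
    and b: "\<And>a. a \<in> carrier G \<Longrightarrow> b a \<in> hom G (units_of R)"
    and sym: "\<And>a c. \<lbrakk>a \<in> carrier G; c \<in> carrier G\<rbrakk> \<Longrightarrow> b a c = b c a"
    and nd: "\<And>a. \<lbrakk>a \<in> carrier G; \<And>c. c \<in> carrier G \<Longrightarrow> b a c = \<one>\<rbrakk> \<Longrightarrow> a = \<one>\<^sub>G"
    and \<tau>: "x \<in> carrier G" "\<tau> x \<in> carrier G" "\<tau> x \<noteq> x"
  shows "finite {s \<in> extensional (carrier G). crossed_datum R G \<tau> f s} \<and>
    2 * card {s \<in> extensional (carrier G). crossed_datum R G \<tau> f s} \<le> order G"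
proof (cases "{s \<in> extensional (carrier G). crossed_datum R G \<tau> f s} = {}")
  case False
  define D where "D = {s \<in> extensional (carrier G). crossed_datum R G \<tau> f s}"
  obtain t where t: "t \<in> D" using False by (auto simp: D_def)
  interpret Q: comm_group G by fact
  interpret U: comm_group "units_of R" by (rule units_comm_group)
  define I where "I = {u \<in> hom G (units_of R). u \<in> extensional (carrier G) \<and> u (\<tau> x) = u x}"
  have I: "finite I \<and> 2 * card I \<le> order G"
    unfolding I_def by (rule invariant_hom_bound[where b = b and \<tau> = \<tau> and x = x, OF Q order b sym nd \<tau>])
  have unit: "s a \<in> Units R" and inv: "s (\<tau> a) = s a"
    and rel: "c \<in> carrier G \<Longrightarrow> s (a \<otimes>\<^sub>G c) = f (a, c) \<otimes> (f (\<tau> a, \<tau> c) \<otimes> (s a \<otimes> s c))"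
    and f: "c \<in> carrier G \<Longrightarrow> f (a, c) \<in> Units R" and \<tau>G: "\<tau> a \<in> carrier G"
    if "s \<in> D" "a \<in> carrier G" for s a c
    using that by (auto simp: D_def crossed_datum_def two_cocycles_def units_of_def auto_def hom_def)
  have inv_mult: "inv (k \<otimes> l) = inv k \<otimes> inv l" if "k \<in> Units R" "l \<in> Units R" for k l
  proof (rule comm_inv_char)
    have "k \<otimes> l \<otimes> (inv k \<otimes> inv l) = (k \<otimes> inv k) \<otimes> (l \<otimes> inv l)"
      using that by (simp only: m_ac m_closed Units_closed Units_inv_closed)
    then show "k \<otimes> l \<otimes> (inv k \<otimes> inv l) = \<one>" using that by simp
  qed (use that in auto)
  \<comment> \<open>In the quotient of two solutions the factors coming from \<open>f\<close>
    cancel, which leaves a homomorphism.\<close>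
  define \<rho> where "\<rho> s = (\<lambda>a\<in>carrier G. s a \<otimes> inv t a)" for s
  have "\<rho> s \<in> I" if s: "s \<in> D" for s
  proof -
    have "\<rho> s (a \<otimes>\<^sub>G c) = \<rho> s a \<otimes> \<rho> s c" if a: "a \<in> carrier G" and c: "c \<in> carrier G" for a c
    proof -
      define k where "k = f (a, c) \<otimes> f (\<tau> a, \<tau> c)"
      have k: "k \<in> Units R" using f[OF s a c] f[OF s \<tau>G[OF s a] \<tau>G[OF s c]] by (simp add: k_def)
      have u: "s a \<in> Units R" "s c \<in> Units R" "t a \<in> Units R" "t c \<in> Units R" using unit s t a c by auto
      have fs: "f (a, c) \<in> carrier R" "f (\<tau> a, \<tau> c) \<in> carrier R"
        using f[OF s a c] f[OF s \<tau>G[OF s a] \<tau>G[OF s c]] by auto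
      have "s (a \<otimes>\<^sub>G c) = k \<otimes> (s a \<otimes> s c)" "t (a \<otimes>\<^sub>G c) = k \<otimes> (t a \<otimes> t c)"
        using rel[OF s a c] rel[OF t a c] fs u Units_closed by (simp_all add: k_def m_assoc)
      moreover have "inv (k \<otimes> (t a \<otimes> t c)) = inv k \<otimes> (inv t a \<otimes> inv t c)"
        using k u by (simp only: inv_mult Units_m_closed)
      moreover have "k \<otimes> (s a \<otimes> s c) \<otimes> (inv k \<otimes> (inv t a \<otimes> inv t c)) =
          (k \<otimes> inv k) \<otimes> ((s a \<otimes> inv t a) \<otimes> (s c \<otimes> inv t c))"
        using k u by (simp only: m_ac m_closed Units_closed Units_inv_closed)
      ultimately show ?thesis using a c k u Units_closed by (simp add: \<rho>_def)
    qed
    moreover have "\<rho> s a \<in> Units R" if "a \<in> carrier G" for a using unit[OF s that] unit[OF t that] that by (simp add: \<rho>_def)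
    moreover have "\<rho> s (\<tau> x) = \<rho> s x" using inv[OF s \<tau>(1)] inv[OF t \<tau>(1)] \<tau> by (simp add: \<rho>_def)
    ultimately show ?thesis by (auto simp: I_def hom_def units_of_def) (simp add: \<rho>_def)
  qed
  moreover have "inj_on \<rho> D"
  proof (rule inj_onI)
    fix s s' assume s: "s \<in> D" "s' \<in> D" "\<rho> s = \<rho> s'"
    show "s = s'"
    proof (rule extensionalityI)
      show "s \<in> extensional (carrier G)" "s' \<in> extensional (carrier G)" using s by (auto simp: D_def)
      fix a assume a: "a \<in> carrier G"
      have u: "s a \<in> carrier R" "s' a \<in> carrier R" "t a \<in> Units R" "inv t a \<in> carrier R" "t a \<in> carrier R"
        using unit s t a by auto
      have "s a \<otimes> inv t a \<otimes> t a = s' a \<otimes> inv t a \<otimes> t a" using fun_cong[OF s(3), of a] a by (simp add: \<rho>_def)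
      then show "s a = s' a" using u by (simp add: m_assoc)
    qed
  qed
  ultimately have "finite D" "card D \<le> card I"
    using I inj_on_finite[of \<rho> D I] card_inj_on_le[of \<rho> D I] by auto
  then show ?thesis using I unfolding D_def by auto
next
  case True
  then show ?thesis by (simp only: card.empty) simp
qed

section \<open>Isomorphisms and presentations\<close>

lemma bilinear_pullback:
  assumes \<beta>: "\<beta> \<in> bilinear_maps K V W U" and f: "f \<in> module_hom K V' V" and g: "g \<in> module_hom K W' W"
  shows "(\<lambda>u v. \<beta> (f u) (g v)) \<in> bilinear_maps K V' W' U"
  by (rule bilinear_mapsI[OF bilinear_hom_right[OF \<beta> g module_hom_in[OF f]] bilinear_hom_left[OF \<beta> f module_hom_in[OF g]]])

text \<open>The counit and the antipode are determined by the bialgebra structure.\<close>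

lemma hopf_isoI:
  fixes K :: "('k, 'r) ring_scheme" and H :: "('k, 'h, 'x) hopf_scheme" and L :: "('k, 'l, 'z) hopf_scheme"
  assumes "hopf_algebra K H" "hopf_algebra K L" and \<phi>: "\<phi> \<in> alg_hom K H L"
    and bij: "bij_betw \<phi> (carrier H) (carrier L)"
    and comult: "\<And>h. h \<in> carrier H \<Longrightarrow> comult L (\<phi> h) = tensor_map K L L \<phi> \<phi> (comult H h)"
  shows "\<phi> \<in> hopf_iso K H L"
proof -
  interpret H: hopf_algebra K H by fact
  interpret L: hopf_algebra K L by fact
  let ?B = "base_algebra K"
  have hom: "\<phi> \<in> module_hom K H L" and \<phi>_one: "\<phi> \<one>\<^sub>H = \<one>\<^sub>L"
    and \<phi>_mult: "\<And>x z. \<lbrakk>x \<in> carrier H; z \<in> carrier H\<rbrakk> \<Longrightarrow> \<phi> (x \<otimes>\<^sub>H z) = \<phi> x \<otimes>\<^sub>L \<phi> z"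
    using \<phi> by (auto simp: alg_hom_def ring_hom_def)
  note \<phi>_in = module_hom_in[OF hom]
  \<comment> \<open>Compatibility with the comultiplications in Sweedler form: sums over
    \<open>L\<close> are pulled back along \<open>\<phi>\<close> to sums over
    \<open>H\<close>.\<close>
  have sw: "L.sweedler U \<beta> (\<phi> h) = H.sweedler U (\<lambda>u v. \<beta> (\<phi> u) (\<phi> v)) h"
    if U: "module K U" and \<beta>: "\<beta> \<in> bilinear_maps K L L U" and h: "h \<in> carrier H" for \<beta> h and U :: "('k, 'u, 'w) module_scheme"
  proof -
    note b = bilinear_pullback[OF \<beta> hom hom] and pb = bilinear_pullback[OF L.pure_bilinear hom hom]
      and lift = tensor_lift_hom[OF L.H_module L.H_module U \<beta>]
    have "L.sweedler U \<beta> (\<phi> h) = tensor_lift K U \<beta> (H.sweedler (tensor K L L) (\<lambda>u v. pure_tensor K L L (\<phi> u) (\<phi> v)) h)"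
      unfolding L.sweedler_def comult[OF h] tensor_map_def H.sweedler_def ..
    also have "... = H.sweedler U (\<lambda>u v. tensor_lift K U \<beta> (pure_tensor K L L (\<phi> u) (\<phi> v))) h"
      by (rule H.sweedler_comp[OF L.HH_module U pb lift h])
    also have "... = H.sweedler U (\<lambda>u v. \<beta> (\<phi> u) (\<phi> v)) h"
      by (rule H.sweedler_cong[symmetric, OF U b h])
        (rule tensor_lift_pure[symmetric, OF L.H_module L.H_module U \<beta> \<phi>_in \<phi>_in])
    finally show ?thesis .
  qed
  \<comment> \<open>\<open>counit L\<close> after \<open>\<phi>\<close> is a left counit for
    \<open>H\<close>, as injectivity of \<open>\<phi>\<close> shows. A left and a right counit
    agree: evaluate both on the same Sweedler sum.\<close>
  have counit: "counit L (\<phi> h) = counit H h" if h: "h \<in> carrier H" for h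
  proof -
    have \<epsilon>': "(\<lambda>h. counit L (\<phi> h)) \<in> module_hom K H ?B" by (rule module_hom_comp[OF L.counit_module_hom hom])
    have bl: "(\<lambda>u v. counit L (\<phi> u) \<odot>\<^sub>H v) \<in> bilinear_maps K H H H"
      by (rule bilinear_mapsI[OF module_hom_smult_left[OF H.H_module module_hom_id L.counit_in[OF \<phi>_in]]
            module_hom_smult_right[OF H.H_module \<epsilon>']])
    have bL: "(\<lambda>u v. counit L u \<odot>\<^sub>L v) \<in> bilinear_maps K L L L"
      by (rule bilinear_mapsI[OF module_hom_smult_left[OF L.H_module module_hom_id L.counit_in]
            module_hom_smult_right[OF L.H_module L.counit_module_hom]])
    have "\<phi> (H.sweedler H (\<lambda>u v. counit L (\<phi> u) \<odot>\<^sub>H v) h) = H.sweedler L (\<lambda>u v. \<phi> (counit L (\<phi> u) \<odot>\<^sub>H v)) h"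
      by (rule H.sweedler_comp[OF H.H_module L.H_module bl hom h])
    also have "... = H.sweedler L (\<lambda>u v. counit L (\<phi> u) \<odot>\<^sub>L \<phi> v) h"
      by (rule H.sweedler_cong[OF L.H_module bilinear_comp[OF hom bl] h])
        (rule module_hom_smult[OF hom L.counit_in[OF \<phi>_in]])
    also have "... = L.sweedler L (\<lambda>u v. counit L u \<odot>\<^sub>L v) (\<phi> h)"
      by (rule sw[symmetric, OF L.H_module bL h])
    also have "... = \<phi> h" by (rule L.sweedler_counit_left[OF L.H_module module_hom_id \<phi>_in[OF h]])
    finally have eq: "H.sweedler H (\<lambda>u v. counit L (\<phi> u) \<odot>\<^sub>H v) h = h"
      using inj_onD[OF bij_betw_imp_inj_on[OF bij]] H.sweedler_in[OF H.H_module bl h] h by blast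
    have "counit H h = counit H (H.sweedler H (\<lambda>u v. counit L (\<phi> u) \<odot>\<^sub>H v) h)" using eq by simp
    also have "... = H.sweedler ?B (\<lambda>u v. counit H (counit L (\<phi> u) \<odot>\<^sub>H v)) h"
      by (rule H.sweedler_comp[OF H.H_module H.K_module bl H.counit_module_hom h])
    also have "... = H.sweedler ?B (\<lambda>u v. counit H v \<odot>\<^bsub>?B\<^esub> counit L (\<phi> u)) h"
      by (rule H.sweedler_cong[OF H.K_module bilinear_comp[OF H.counit_module_hom bl] h])
        (simp add: H.counit_smult L.counit_in[OF \<phi>_in] H.counit_in H.vec.R.m_comm)
    also have "... = counit L (\<phi> h)" by (rule H.sweedler_counit_right[OF H.K_module \<epsilon>' h])
    finally show ?thesis ..
  qed
  have antipode: "antipode L (\<phi> h) = \<phi> (antipode H h)" if h: "h \<in> carrier H" for h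
  proof -
    \<comment> \<open>Under convolution \<open>F\<close> is a left inverse of \<open>\<phi>\<close>
      and \<open>S\<close> is a right inverse. Bracketing \<open>F * \<phi> * S\<close> in two ways
      identifies them.\<close>
    define F where "F x = \<phi> (antipode H x)" for x
    define S where "S x = antipode L (\<phi> x)" for x
    have F: "F \<in> module_hom K H L" unfolding F_def by (rule module_hom_comp[OF hom H.antipode_linear])
    have S: "S \<in> module_hom K H L" unfolding S_def by (rule module_hom_comp[OF L.antipode_linear hom])
    have F_in: "F x \<in> carrier L" and S_in: "S x \<in> carrier L" if "x \<in> carrier H" for x
      using module_hom_in[OF F that] module_hom_in[OF S that] by auto
    have bl1: "(\<lambda>a b. \<phi> a \<otimes>\<^sub>L S b) \<in> bilinear_maps K H H L"
      by (rule bilinear_mapsI[OF L.mult_right_hom[OF S \<phi>_in] L.mult_left_hom[OF hom S_in]])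
    have bl2: "(\<lambda>a b. F a \<otimes>\<^sub>L \<phi> b) \<in> bilinear_maps K H H L"
      by (rule bilinear_mapsI[OF L.mult_right_hom[OF hom F_in] L.mult_left_hom[OF F \<phi>_in]])
    have bLS: "(\<lambda>a b. a \<otimes>\<^sub>L antipode L b) \<in> bilinear_maps K L L L"
      by (rule bilinear_mapsI[OF L.mult_right_hom[OF L.antipode_linear] L.mult_left_hom[OF module_hom_id L.antipode_in]])
    have S_inv: "H.sweedler L (\<lambda>a b. \<phi> a \<otimes>\<^sub>L S b) w = counit H w \<odot>\<^sub>L \<one>\<^sub>L" if w: "w \<in> carrier H" for w
      using sw[OF L.H_module bLS w] L.sweedler_antipode_right[OF L.H_module module_hom_id \<phi>_in[OF w]]
      by (simp add: S_def counit[OF w])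
    have F_inv: "H.sweedler L (\<lambda>a b. F a \<otimes>\<^sub>L \<phi> b) w = counit H w \<odot>\<^sub>L \<one>\<^sub>L" if w: "w \<in> carrier H" for w
    proof -
      have "H.sweedler L (\<lambda>a b. F a \<otimes>\<^sub>L \<phi> b) w = H.sweedler L (\<lambda>a b. \<phi> (antipode H a \<otimes>\<^sub>H b)) w"
        by (rule H.sweedler_cong[OF L.H_module bl2 w]) (simp only: F_def \<phi>_mult H.antipode_in)
      then show ?thesis using H.sweedler_antipode_left[OF L.H_module hom w] \<phi>_one by simp
    qed
    have b3: "(\<lambda>u w. H.sweedler L (\<lambda>a b. F u \<otimes>\<^sub>L (\<phi> a \<otimes>\<^sub>L S b)) w) \<in> bilinear_maps K H H L"
    proof (rule bilinear_mapsI)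
      show "(\<lambda>w. H.sweedler L (\<lambda>a b. F u \<otimes>\<^sub>L (\<phi> a \<otimes>\<^sub>L S b)) w) \<in> module_hom K H L" if u: "u \<in> carrier H" for u
        by (rule H.sweedler_hom[OF L.H_module bilinear_comp[OF L.mult_right_hom[OF module_hom_id F_in[OF u]] bl1] module_hom_id])
      show "(\<lambda>u. H.sweedler L (\<lambda>a b. F u \<otimes>\<^sub>L (\<phi> a \<otimes>\<^sub>L S b)) w) \<in> module_hom K H L" if w: "w \<in> carrier H" for w
        by (rule H.sweedler_param_hom[OF L.H_module H.H_module
              bilinear_comp[OF L.mult_right_hom[OF module_hom_id F_in] bl1]
              L.mult_left_hom[OF F L.m_closed[OF \<phi>_in S_in]] w])
    qed
    have b4: "(\<lambda>x b. H.sweedler L (\<lambda>u a. F u \<otimes>\<^sub>L (\<phi> a \<otimes>\<^sub>L S b)) x) \<in> bilinear_maps K H H L"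
    proof (rule bilinear_mapsI)
      have bb: "(\<lambda>u a. F u \<otimes>\<^sub>L (\<phi> a \<otimes>\<^sub>L S b)) \<in> bilinear_maps K H H L" if b: "b \<in> carrier H" for b
        by (rule bilinear_mapsI[OF L.mult_right_hom[OF L.mult_left_hom[OF hom S_in[OF b]] F_in]
              L.mult_left_hom[OF F L.m_closed[OF \<phi>_in S_in[OF b]]]])
      show "(\<lambda>x. H.sweedler L (\<lambda>u a. F u \<otimes>\<^sub>L (\<phi> a \<otimes>\<^sub>L S b)) x) \<in> module_hom K H L" if b: "b \<in> carrier H" for b
        by (rule H.sweedler_hom[OF L.H_module bb[OF b] module_hom_id])
      show "(\<lambda>b. H.sweedler L (\<lambda>u a. F u \<otimes>\<^sub>L (\<phi> a \<otimes>\<^sub>L S b)) x) \<in> module_hom K H L" if x: "x \<in> carrier H" for x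
        by (rule H.sweedler_param_hom[OF L.H_module H.H_module bb
              L.mult_right_hom[OF L.mult_right_hom[OF S \<phi>_in] F_in] x])
    qed
    have bF: "(\<lambda>u w. counit H w \<odot>\<^sub>L F u) \<in> bilinear_maps K H H L"
      by (rule bilinear_mapsI[OF module_hom_smult_right[OF L.H_module H.counit_module_hom F_in]
            module_hom_smult_left[OF L.H_module F H.counit_in]])
    have "F h = H.sweedler L (\<lambda>u w. counit H w \<odot>\<^sub>L F u) h"
      by (rule H.sweedler_counit_right[symmetric, OF L.H_module F h])
    also have "... = H.sweedler L (\<lambda>u w. H.sweedler L (\<lambda>a b. F u \<otimes>\<^sub>L (\<phi> a \<otimes>\<^sub>L S b)) w) h"
    proof (rule H.sweedler_cong[OF L.H_module bF h])
      fix u w assume u: "u \<in> carrier H" and w: "w \<in> carrier H"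
      have "H.sweedler L (\<lambda>a b. F u \<otimes>\<^sub>L (\<phi> a \<otimes>\<^sub>L S b)) w = F u \<otimes>\<^sub>L (counit H w \<odot>\<^sub>L \<one>\<^sub>L)"
        unfolding S_inv[OF w, symmetric]
        by (rule H.sweedler_comp[symmetric, OF L.H_module L.H_module bl1 L.mult_right_hom[OF module_hom_id F_in[OF u]] w])
      then show "counit H w \<odot>\<^sub>L F u = H.sweedler L (\<lambda>a b. F u \<otimes>\<^sub>L (\<phi> a \<otimes>\<^sub>L S b)) w"
        using F_in[OF u] H.counit_in[OF w] by (simp add: L.smult_mult_right)
    qed
    also have "... = H.sweedler L (\<lambda>x b. H.sweedler L (\<lambda>u a. F u \<otimes>\<^sub>L (\<phi> a \<otimes>\<^sub>L S b)) x) h"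
    proof (rule H.sweedler_assoc[symmetric, OF L.H_module _ _ _ h])
      fix a b assume a: "a \<in> carrier H" and b: "b \<in> carrier H"
      show "(\<lambda>u. F u \<otimes>\<^sub>L (\<phi> a \<otimes>\<^sub>L S b)) \<in> module_hom K H L"
        by (rule L.mult_left_hom[OF F L.m_closed[OF \<phi>_in[OF a] S_in[OF b]]])
      show "(\<lambda>u. F a \<otimes>\<^sub>L (\<phi> u \<otimes>\<^sub>L S b)) \<in> module_hom K H L"
        by (rule L.mult_right_hom[OF L.mult_left_hom[OF hom S_in[OF b]] F_in[OF a]])
      show "(\<lambda>u. F a \<otimes>\<^sub>L (\<phi> b \<otimes>\<^sub>L S u)) \<in> module_hom K H L"
        by (rule L.mult_right_hom[OF L.mult_right_hom[OF S \<phi>_in[OF b]] F_in[OF a]])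
    qed
    also have "... = H.sweedler L (\<lambda>x b. counit H x \<odot>\<^sub>L S b) h"
    proof (rule H.sweedler_cong[OF L.H_module b4 h])
      fix x b assume x: "x \<in> carrier H" and b: "b \<in> carrier H"
      have "H.sweedler L (\<lambda>u a. F u \<otimes>\<^sub>L \<phi> a) x \<otimes>\<^sub>L S b = H.sweedler L (\<lambda>u a. (F u \<otimes>\<^sub>L \<phi> a) \<otimes>\<^sub>L S b) x"
        by (rule H.sweedler_comp[OF L.H_module L.H_module bl2 L.mult_left_hom[OF module_hom_id S_in[OF b]] x])
      also have "... = H.sweedler L (\<lambda>u a. F u \<otimes>\<^sub>L (\<phi> a \<otimes>\<^sub>L S b)) x"
        by (rule H.sweedler_cong[OF L.H_module bilinear_comp[OF L.mult_left_hom[OF module_hom_id S_in[OF b]] bl2] x])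
          (rule L.m_assoc[OF F_in \<phi>_in S_in[OF b]])
      finally show "H.sweedler L (\<lambda>u a. F u \<otimes>\<^sub>L (\<phi> a \<otimes>\<^sub>L S b)) x = counit H x \<odot>\<^sub>L S b"
        unfolding F_inv[OF x] using S_in[OF b] H.counit_in[OF x] by (simp add: L.smult_mult_left)
    qed
    also have "... = S h" by (rule H.sweedler_counit_left[OF L.H_module S h])
    finally show ?thesis unfolding F_def S_def ..
  qed
  show ?thesis using \<phi> bij comult counit antipode by (simp add: hopf_iso_def)
qed

context crossed_presentation
begin

abbreviation ginv where "ginv \<equiv> m_inv G"

lemma p_in: "\<lbrakk>a \<in> carrier G; x \<in> carrier H\<rbrakk> \<Longrightarrow> p a x \<in> carrier K"
  and q_in: "\<lbrakk>a \<in> carrier G; x \<in> carrier H\<rbrakk> \<Longrightarrow> q a x \<in> carrier K"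
  using functional_in[OF p_hom] functional_in[OF q_hom] by auto

lemma basis_ext:
  assumes U: "module K U" and F: "F \<in> module_hom K H U" and F': "F' \<in> module_hom K H U"
    and e: "\<And>a. a \<in> carrier G \<Longrightarrow> F (e a) = F' (e a)" and y: "\<And>a. a \<in> carrier G \<Longrightarrow> F (y a) = F' (y a)" and x: "x \<in> carrier H"
  shows "F x = F' x"
proof -
  interpret U: module K U by fact
  have L: "L x = (\<Oplus>\<^bsub>U\<^esub> a\<in>carrier G. p a x \<odot>\<^sub>U L (e a) \<oplus>\<^sub>U q a x \<odot>\<^sub>U L (y a))" if L: "L \<in> module_hom K H U" for L
  proof -
    have "L x = L (\<Oplus>\<^bsub>H\<^esub> a\<in>carrier G. p a x \<odot>\<^sub>H e a \<oplus>\<^sub>H q a x \<odot>\<^sub>H y a)" using expand[OF x] by simp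
    also have "... = (\<Oplus>\<^bsub>U\<^esub> a\<in>carrier G. L (p a x \<odot>\<^sub>H e a \<oplus>\<^sub>H q a x \<odot>\<^sub>H y a))"
      using p_in q_in e_in y_in x by (intro module_hom_finsum[OF H_module U L finite_G]) auto
    also have "... = (\<Oplus>\<^bsub>U\<^esub> a\<in>carrier G. p a x \<odot>\<^sub>U L (e a) \<oplus>\<^sub>U q a x \<odot>\<^sub>U L (y a))"
      using p_in q_in e_in y_in x module_hom_in[OF L]
      by (intro U.M.finsum_cong') (auto simp: module_hom_add[OF L] module_hom_smult[OF L])
    finally show ?thesis .
  qed
  show ?thesis
    unfolding L[OF F] L[OF F'] using e y p_in q_in e_in y_in x module_hom_in[OF F']
    by (intro U.M.finsum_cong') auto
qed

lemma basis_ext2: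
  assumes U: "module K U" and \<beta>: "\<beta> \<in> bilinear_maps K H H U" and \<gamma>: "\<gamma> \<in> bilinear_maps K H H U"
    and "\<And>a c. \<lbrakk>a \<in> carrier G; c \<in> carrier G\<rbrakk> \<Longrightarrow> \<beta> (e a) (e c) = \<gamma> (e a) (e c)"
    and "\<And>a c. \<lbrakk>a \<in> carrier G; c \<in> carrier G\<rbrakk> \<Longrightarrow> \<beta> (e a) (y c) = \<gamma> (e a) (y c)"
    and "\<And>a c. \<lbrakk>a \<in> carrier G; c \<in> carrier G\<rbrakk> \<Longrightarrow> \<beta> (y a) (e c) = \<gamma> (y a) (e c)"
    and "\<And>a c. \<lbrakk>a \<in> carrier G; c \<in> carrier G\<rbrakk> \<Longrightarrow> \<beta> (y a) (y c) = \<gamma> (y a) (y c)"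
    and x: "x \<in> carrier H" and z: "z \<in> carrier H"
  shows "\<beta> x z = \<gamma> x z"
proof -
  have "\<beta> x v = \<gamma> x v" if v: "v \<in> carrier H" "\<And>a. a \<in> carrier G \<Longrightarrow> \<beta> (e a) v = \<gamma> (e a) v" "\<And>a. a \<in> carrier G \<Longrightarrow> \<beta> (y a) v = \<gamma> (y a) v" for v
    by (rule basis_ext[OF U bilinear_mapsD(2)[OF \<beta> v(1)] bilinear_mapsD(2)[OF \<gamma> v(1)] v(2,3) x])
  then show ?thesis
    using assms e_in y_in by (intro basis_ext[OF U bilinear_mapsD(1)[OF \<beta> x] bilinear_mapsD(1)[OF \<gamma> x] _ _ z]) auto
qed

lemma sweedler_e:
  assumes U: "module K U" and \<beta>: "\<beta> \<in> bilinear_maps K H H U" and a: "a \<in> carrier G"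
  shows "sweedler U \<beta> (e a) = (\<Oplus>\<^bsub>U\<^esub> c\<in>carrier G. \<beta> (e c) (e (ginv c \<otimes>\<^sub>G a)))"
proof -
  interpret U: module K U by fact
  have "sweedler U \<beta> (e a) = (\<Oplus>\<^bsub>U\<^esub> c\<in>carrier G. tensor_lift K U \<beta> (pure_tensor K H H (e c) (e (ginv c \<otimes>\<^sub>G a))))"
    unfolding sweedler_def comult_e[OF a] using a e_in
    by (intro module_hom_finsum[OF HH_module U tensor_lift_hom[OF H_module H_module U \<beta>] finite_G])
      (auto intro!: pure_tensor_in[OF H_module H_module])
  also have "... = (\<Oplus>\<^bsub>U\<^esub> c\<in>carrier G. \<beta> (e c) (e (ginv c \<otimes>\<^sub>G a)))"
    using a e_in bilinear_mapsD(3)[OF \<beta>]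
    by (intro U.M.finsum_cong') (auto simp: tensor_lift_pure[OF H_module H_module U \<beta>])
  finally show ?thesis .
qed

lemma sweedler_y:
  assumes U: "module K U" and \<beta>: "\<beta> \<in> bilinear_maps K H H U" and a: "a \<in> carrier G"
    and f: "\<And>c d. \<lbrakk>c \<in> carrier G; d \<in> carrier G\<rbrakk> \<Longrightarrow> f (c, d) \<in> carrier K"
  shows "sweedler U \<beta> (y a) = (\<Oplus>\<^bsub>U\<^esub> c\<in>carrier G. f (c, ginv c \<otimes>\<^sub>G a) \<odot>\<^sub>U \<beta> (y c) (y (ginv c \<otimes>\<^sub>G a)))"
proof -
  interpret U: module K U by fact
  interpret T: module K "HH" by (rule HH_module)
  note lift = tensor_lift_hom[OF H_module H_module U \<beta>]
  have pure: "pure_tensor K H H (y c) (y (ginv c \<otimes>\<^sub>G a)) \<in> carrier HH" if "c \<in> carrier G" for c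
    using that a y_in by (intro pure_tensor_in[OF H_module H_module]) auto
  have "sweedler U \<beta> (y a) = (\<Oplus>\<^bsub>U\<^esub> c\<in>carrier G.
      tensor_lift K U \<beta> (f (c, ginv c \<otimes>\<^sub>G a) \<odot>\<^bsub>HH\<^esub> pure_tensor K H H (y c) (y (ginv c \<otimes>\<^sub>G a))))"
    unfolding sweedler_def comult_y[OF a] using a f pure
    by (intro module_hom_finsum[OF HH_module U lift finite_G]) auto
  also have "... = (\<Oplus>\<^bsub>U\<^esub> c\<in>carrier G. f (c, ginv c \<otimes>\<^sub>G a) \<odot>\<^sub>U \<beta> (y c) (y (ginv c \<otimes>\<^sub>G a)))"
    using a f pure y_in bilinear_mapsD(3)[OF \<beta>]
    by (intro U.M.finsum_cong') (auto simp: tensor_lift_pure[OF H_module H_module U \<beta>] module_hom_smult[OF lift])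
  finally show ?thesis .
qed

text \<open>Used in contrapositive form: a noncommutative \<open>H\<close> must have a nontrivial
  \<open>\<tau>\<close>. With trivial action the multiplication table on the basis is
  symmetric.\<close>

lemma commutative_if_trivial_action:
  assumes "\<And>a. a \<in> carrier G \<Longrightarrow> \<tau> a = a"
  shows "commutative_alg H"
proof -
  have 1: "(\<lambda>x z. x \<otimes>\<^sub>H z) \<in> bilinear_maps K H H H"
    by (rule bilinear_mapsI[OF mult_right_hom[OF module_hom_id] mult_left_hom[OF module_hom_id]])
  have 2: "(\<lambda>x z. z \<otimes>\<^sub>H x) \<in> bilinear_maps K H H H"
    by (rule bilinear_mapsI[OF mult_left_hom[OF module_hom_id] mult_right_hom[OF module_hom_id]])
  have "x \<otimes>\<^sub>H z = z \<otimes>\<^sub>H x" if "x \<in> carrier H" "z \<in> carrier H" for x z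
    by (rule basis_ext2[OF H_module 1 2 _ _ _ _ that]) (auto simp: e_e e_y y_e y_y assms)
  then show ?thesis by (simp add: commutative_alg_def)
qed

text \<open>Exchanging the tensor factors in the comultiplication of a basis vector at
  \<open>a\<close> amounts to replacing \<open>c\<close> by the quotient of \<open>a\<close> by
  \<open>c\<close>, an involution of the index set. Only the coefficients \<open>f\<close> could
  notice it.\<close>

lemma cocommutative_if_symmetric:
  assumes f: "\<And>c d. \<lbrakk>c \<in> carrier G; d \<in> carrier G\<rbrakk> \<Longrightarrow> f (c, d) \<in> carrier K" and sym: "\<And>c d. \<lbrakk>c \<in> carrier G; d \<in> carrier G\<rbrakk> \<Longrightarrow> f (c, d) = f (d, c)"
  shows "cocommutative K H"
proof -
  let ?T = "HH"
  interpret T: module K ?T by (rule HH_module)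
  have flip: "(\<lambda>u v. pure_tensor K H H v u) \<in> bilinear_maps K H H ?T"
    using bilinear_mapsD(1,2)[OF pure_bilinear] by (intro bilinear_mapsI) auto
  have swap: "(\<Oplus>\<^bsub>?T\<^esub> c\<in>carrier G. F (ginv c \<otimes>\<^sub>G a) c) = (\<Oplus>\<^bsub>?T\<^esub> c\<in>carrier G. F c (ginv c \<otimes>\<^sub>G a))"
    if F: "\<And>c d. \<lbrakk>c \<in> carrier G; d \<in> carrier G\<rbrakk> \<Longrightarrow> F c d \<in> carrier ?T" and a: "a \<in> carrier G" for F a
  proof -
    have inv2: "ginv (ginv c \<otimes>\<^sub>G a) \<otimes>\<^sub>G a = c" if "c \<in> carrier G" for c
    proof -
      have "ginv (ginv c \<otimes>\<^sub>G a) \<otimes>\<^sub>G a = (ginv a \<otimes>\<^sub>G c) \<otimes>\<^sub>G a" using that a by (simp add: G.inv_mult_group)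
      also have "ginv a \<otimes>\<^sub>G c = c \<otimes>\<^sub>G ginv a" using that a by (simp add: G.m_comm)
      also have "(c \<otimes>\<^sub>G ginv a) \<otimes>\<^sub>G a = c" using that a by (simp add: G.m_assoc)
      finally show ?thesis .
    qed
    have inj: "inj_on (\<lambda>c. ginv c \<otimes>\<^sub>G a) (carrier G)" by (rule inj_on_inverseI[of _ "\<lambda>c. ginv c \<otimes>\<^sub>G a"]) (rule inv2)
    have im: "(\<lambda>c. ginv c \<otimes>\<^sub>G a) ` carrier G = carrier G"
    proof (intro equalityI subsetI)
      show "c \<in> (\<lambda>c. ginv c \<otimes>\<^sub>G a) ` carrier G" if "c \<in> carrier G" for c
        using inv2[OF that] that a by (intro image_eqI[of _ _ "ginv c \<otimes>\<^sub>G a"]) auto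
    qed (use a in auto)
    have "(\<Oplus>\<^bsub>?T\<^esub> c\<in>carrier G. F c (ginv c \<otimes>\<^sub>G a)) = (\<Oplus>\<^bsub>?T\<^esub> c\<in>(\<lambda>c. ginv c \<otimes>\<^sub>G a) ` carrier G. F c (ginv c \<otimes>\<^sub>G a))"
      unfolding im ..
    also have "... = (\<Oplus>\<^bsub>?T\<^esub> c\<in>carrier G. F (ginv c \<otimes>\<^sub>G a) (ginv (ginv c \<otimes>\<^sub>G a) \<otimes>\<^sub>G a))"
      using F a by (intro T.M.finsum_reindex inj) auto
    also have "... = (\<Oplus>\<^bsub>?T\<^esub> c\<in>carrier G. F (ginv c \<otimes>\<^sub>G a) c)"
      using F a by (intro T.M.finsum_cong') (auto simp: inv2)
    finally show ?thesis ..
  qed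
  have pure: "pure_tensor K H H u v \<in> carrier ?T" if "u \<in> carrier H" "v \<in> carrier H" for u v
    by (rule pure_tensor_in[OF H_module H_module that])
  have "sweedler ?T (\<lambda>u v. pure_tensor K H H v u) h = sweedler ?T (pure_tensor K H H) h" if h: "h \<in> carrier H" for h
  proof (rule basis_ext[OF HH_module sweedler_hom[OF HH_module flip module_hom_id]
        sweedler_hom[OF HH_module pure_bilinear module_hom_id] _ _ h])
    fix a assume a: "a \<in> carrier G"
    show "sweedler ?T (\<lambda>u v. pure_tensor K H H v u) (e a) = sweedler ?T (pure_tensor K H H) (e a)"
      unfolding sweedler_e[OF HH_module flip a] sweedler_e[OF HH_module pure_bilinear a]
      using swap[of "\<lambda>c d. pure_tensor K H H (e c) (e d)", OF _ a] pure e_in by simp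
    have "(\<Oplus>\<^bsub>?T\<^esub> c\<in>carrier G. f (c, ginv c \<otimes>\<^sub>G a) \<odot>\<^bsub>?T\<^esub> pure_tensor K H H (y (ginv c \<otimes>\<^sub>G a)) (y c)) =
        (\<Oplus>\<^bsub>?T\<^esub> c\<in>carrier G. f (ginv c \<otimes>\<^sub>G a, c) \<odot>\<^bsub>?T\<^esub> pure_tensor K H H (y (ginv c \<otimes>\<^sub>G a)) (y c))"
      using a f pure y_in sym by (intro T.M.finsum_cong') auto
    also have "... = (\<Oplus>\<^bsub>?T\<^esub> c\<in>carrier G. f (c, ginv c \<otimes>\<^sub>G a) \<odot>\<^bsub>?T\<^esub> pure_tensor K H H (y c) (y (ginv c \<otimes>\<^sub>G a)))"
      using swap[of "\<lambda>c d. f (c, d) \<odot>\<^bsub>?T\<^esub> pure_tensor K H H (y c) (y d)", OF _ a] f pure y_in by simp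
    also have "... = sweedler ?T (pure_tensor K H H) (y a)"
      by (rule sweedler_y[symmetric, OF HH_module pure_bilinear a f])
    finally show "sweedler ?T (\<lambda>u v. pure_tensor K H H v u) (y a) = sweedler ?T (pure_tensor K H H) (y a)"
      by (subst sweedler_y[OF HH_module flip a f])
  qed
  then show ?thesis
    using comult_sweedler by (simp add: cocommutative_def tensor_flip_def sweedler_def)
qed

end

text \<open>The products and comultiplications of basis vectors involve only \<open>\<tau>\<close>,
  \<open>f\<close> and \<open>s\<close>, so matching the bases respects them;
  \<open>hopf_isoI\<close> adds counit and antipode.\<close>

lemma crossed_presentation_iso:
  fixes K :: "('k, 'r) ring_scheme" and H :: "('k, 'h, 'x) hopf_scheme" and L :: "('k, 'l, 'z) hopf_scheme"
  assumes "crossed_presentation K H G \<tau> f s e y p q" "crossed_presentation K L G \<tau> f s e' y' p' q'"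
    and f: "\<And>c d. \<lbrakk>c \<in> carrier G; d \<in> carrier G\<rbrakk> \<Longrightarrow> f (c, d) \<in> carrier K" and s: "\<And>a. a \<in> carrier G \<Longrightarrow> s a \<in> carrier K"
  shows "hopf_iso K H L \<noteq> {}"
proof -
  interpret H: crossed_presentation K H G \<tau> f s e y p q by fact
  interpret L: crossed_presentation K L G \<tau> f s e' y' p' q' by fact
  \<comment> \<open>Stated for an arbitrary pair of presentations because it is applied in both
    directions, to obtain the inverse map as well.\<close>
  have exists: "\<exists>\<phi>\<in>module_hom K A U. \<forall>a\<in>carrier G. \<phi> (e1 a) = e2 a \<and> \<phi> (y1 a) = y2 a"
    if A: "crossed_presentation K A G \<tau> f s e1 y1 p1 q1" and U: "crossed_presentation K U G \<tau> f s e2 y2 p2 q2"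
    for A :: "('k, 'a1, 'b1) hopf_scheme" and U :: "('k, 'a2, 'b2) hopf_scheme" and e1 y1 p1 q1 e2 y2 p2 q2
  proof -
    interpret A: crossed_presentation K A G \<tau> f s e1 y1 p1 q1 by fact
    interpret U: crossed_presentation K U G \<tau> f s e2 y2 p2 q2 by fact
    define \<phi> where "\<phi> x = (\<Oplus>\<^bsub>U\<^esub> a\<in>carrier G. p1 a x \<odot>\<^sub>U e2 a \<oplus>\<^sub>U q1 a x \<odot>\<^sub>U y2 a)" for x
    have "\<phi> \<in> module_hom K A U"
      unfolding \<phi>_def
      by (intro module_hom_sum module_hom_plus module_hom_smult_right U.H_module A.H_module A.p_hom A.q_hom U.e_in U.y_in)
    moreover have "\<phi> (e1 c) = e2 c \<and> \<phi> (y1 c) = y2 c" if c: "c \<in> carrier G" for c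
    proof
      have "\<phi> (e1 c) = p1 c (e1 c) \<odot>\<^sub>U e2 c \<oplus>\<^sub>U q1 c (e1 c) \<odot>\<^sub>U y2 c"
        unfolding \<phi>_def using c U.e_in U.y_in
        by (intro U.vec.M.finsum_single A.finite_G) (auto simp: A.p_e A.q_e)
      then show "\<phi> (e1 c) = e2 c" using c U.e_in U.y_in by (simp add: A.p_e A.q_e)
      have "\<phi> (y1 c) = p1 c (y1 c) \<odot>\<^sub>U e2 c \<oplus>\<^sub>U q1 c (y1 c) \<odot>\<^sub>U y2 c"
        unfolding \<phi>_def using c U.e_in U.y_in
        by (intro U.vec.M.finsum_single A.finite_G) (auto simp: A.p_y A.q_y)
      then show "\<phi> (y1 c) = y2 c" using c U.e_in U.y_in by (simp add: A.p_y A.q_y)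
    qed
    ultimately show ?thesis by blast
  qed
  obtain \<phi> where \<phi>: "\<phi> \<in> module_hom K H L" "\<And>a. a \<in> carrier G \<Longrightarrow> \<phi> (e a) = e' a" "\<And>a. a \<in> carrier G \<Longrightarrow> \<phi> (y a) = y' a"
    using exists[OF assms(1,2)] by blast
  obtain \<theta> where \<theta>: "\<theta> \<in> module_hom K L H" "\<And>a. a \<in> carrier G \<Longrightarrow> \<theta> (e' a) = e a" "\<And>a. a \<in> carrier G \<Longrightarrow> \<theta> (y' a) = y a"
    using exists[OF assms(2,1)] by blast
  note \<phi>_in = module_hom_in[OF \<phi>(1)]
  have "\<theta> (\<phi> x) = x" if "x \<in> carrier H" for x
    by (rule H.basis_ext[OF H.H_module module_hom_comp[OF \<theta>(1) \<phi>(1)] module_hom_id _ _ that]) (simp_all add: \<phi> \<theta>)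
  moreover have "\<phi> (\<theta> x) = x" if "x \<in> carrier L" for x
    by (rule L.basis_ext[OF L.H_module module_hom_comp[OF \<phi>(1) \<theta>(1)] module_hom_id _ _ that]) (simp_all add: \<phi> \<theta>)
  ultimately have bij: "bij_betw \<phi> (carrier H) (carrier L)"
    by (intro bij_betw_byWitness[where f' = \<theta>]) (auto intro: \<phi>_in module_hom_in[OF \<theta>(1)])
  have b1: "(\<lambda>x z. \<phi> (x \<otimes>\<^sub>H z)) \<in> bilinear_maps K H H L"
    by (rule bilinear_mapsI;
        rule module_hom_comp[OF \<phi>(1)], intro H.mult_left_hom H.mult_right_hom module_hom_id; assumption)
  have b2: "(\<lambda>x z. \<phi> x \<otimes>\<^sub>L \<phi> z) \<in> bilinear_maps K H H L"
    by (rule bilinear_mapsI[OF L.mult_right_hom[OF \<phi>(1) \<phi>_in] L.mult_left_hom[OF \<phi>(1) \<phi>_in]])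
  have \<phi>0: "\<phi> \<zero>\<^sub>H = \<zero>\<^sub>L" by (rule module_hom_zero[OF H.H_module L.H_module \<phi>(1)])
  have mult: "\<phi> (x \<otimes>\<^sub>H z) = \<phi> x \<otimes>\<^sub>L \<phi> z" if "x \<in> carrier H" "z \<in> carrier H" for x z
    by (rule H.basis_ext2[OF L.H_module b1 b2 _ _ _ _ that])
      (auto simp: \<phi> \<phi>0 H.e_e H.e_y H.y_e H.y_y L.e_e L.e_y L.y_e L.y_y module_hom_smult[OF \<phi>(1) s H.e_in])
  have "\<phi> \<one>\<^sub>H = (\<Oplus>\<^bsub>L\<^esub> a\<in>carrier G. \<phi> (e a))"
    unfolding H.sum_e[symmetric] using H.e_in
    by (intro module_hom_finsum[OF H.H_module L.H_module \<phi>(1) H.finite_G]) auto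
  also have "... = (\<Oplus>\<^bsub>L\<^esub> a\<in>carrier G. e' a)" using L.e_in by (intro L.vec.M.finsum_cong') (auto simp: \<phi>)
  finally have one: "\<phi> \<one>\<^sub>H = \<one>\<^sub>L" unfolding L.sum_e .
  have alg: "\<phi> \<in> alg_hom K H L"
    using \<phi>(1) mult one \<phi>_in module_hom_add[OF \<phi>(1)] by (auto simp: alg_hom_def ring_hom_def)
  have "comult L (\<phi> h) = tensor_map K L L \<phi> \<phi> (comult H h)" if h: "h \<in> carrier H" for h
  proof -
    let ?\<beta> = "\<lambda>u v. pure_tensor K L L (\<phi> u) (\<phi> v)"
    interpret T: module K "tensor K L L" by (rule L.HH_module)
    have pb: "?\<beta> \<in> bilinear_maps K H H (tensor K L L)" by (rule bilinear_pullback[OF L.pure_bilinear \<phi>(1) \<phi>(1)])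
    have "comult L (\<phi> h) = H.sweedler (tensor K L L) ?\<beta> h"
    proof (rule H.basis_ext[OF L.HH_module module_hom_comp[OF L.comult_module_hom \<phi>(1)]
          H.sweedler_hom[OF L.HH_module pb module_hom_id] _ _ h])
      fix a assume a: "a \<in> carrier G"
      show "comult L (\<phi> (e a)) = H.sweedler (tensor K L L) ?\<beta> (e a)"
        unfolding H.sweedler_e[OF L.HH_module pb a] \<phi>(2)[OF a] L.comult_e[OF a] using a
        by (intro T.M.finsum_cong') (auto simp: \<phi> intro!: pure_tensor_in[OF L.H_module L.H_module] L.e_in)
      have "comult L (\<phi> (y a)) =
          (\<Oplus>\<^bsub>tensor K L L\<^esub> c\<in>carrier G. f (c, inv\<^bsub>G\<^esub> c \<otimes>\<^sub>G a) \<odot>\<^bsub>tensor K L L\<^esub> ?\<beta> (y c) (y (inv\<^bsub>G\<^esub> c \<otimes>\<^sub>G a)))"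
        unfolding \<phi>(3)[OF a] L.comult_y[OF a] using a f
        by (intro T.M.finsum_cong')
          (auto simp: \<phi> intro!: T.smult_closed pure_tensor_in[OF L.H_module L.H_module] L.y_in)
      also have "... = H.sweedler (tensor K L L) ?\<beta> (y a)"
        by (rule H.sweedler_y[symmetric, OF L.HH_module pb a f])
      finally show "comult L (\<phi> (y a)) = H.sweedler (tensor K L L) ?\<beta> (y a)" .
    qed
    then show ?thesis by (simp add: H.sweedler_def tensor_map_def)
  qed
  then show ?thesis
    using hopf_isoI[OF H.hopf_algebra_axioms L.hopf_algebra_axioms alg bij] by blast
qed

section \<open>Normalising the presentation\<close>

definition presented where
  "presented K H G \<tau> f s \<longleftrightarrow> crossed_datum K G \<tau> f s \<and> (\<exists>e y p q. crossed_presentation K H G \<tau> f s e y p q)"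

lemma crossed_datumD:
  assumes "crossed_datum K G \<tau> f s"
  shows "\<tau> \<in> auto G" "f \<in> carrier (two_cocycles G (units_of K))"
    and "a \<in> carrier G \<Longrightarrow> \<tau> a \<in> carrier G" "a \<in> carrier G \<Longrightarrow> \<tau> (\<tau> a) = a" "\<lbrakk>a \<in> carrier G; c \<in> carrier G\<rbrakk> \<Longrightarrow> \<tau> (a \<otimes>\<^sub>G c) = \<tau> a \<otimes>\<^sub>G \<tau> c"
    and "\<lbrakk>a \<in> carrier G; c \<in> carrier G\<rbrakk> \<Longrightarrow> f (a, c) \<in> Units K"
    and "a \<in> carrier G \<Longrightarrow> s a \<in> Units K" "a \<in> carrier G \<Longrightarrow> s (\<tau> a) = s a"
    and "\<lbrakk>a \<in> carrier G; c \<in> carrier G\<rbrakk> \<Longrightarrow> s (a \<otimes>\<^sub>G c) = f (a, c) \<otimes>\<^sub>K (f (\<tau> a, \<tau> c) \<otimes>\<^sub>K (s a \<otimes>\<^sub>K s c))"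
  using assms by (auto simp: crossed_datum_def two_cocycles_def units_of_def auto_def hom_def)

text \<open>A presentation reads \<open>s\<close> on the carrier only, and extensional functions are
  the ones that can be counted.\<close>

lemma presented_restrict:
  assumes "presented K H G \<tau> f s"
  shows "presented K H G \<tau> f (restrict s (carrier G))"
proof -
  obtain e y p q where P: "crossed_presentation K H G \<tau> f s e y p q" and D: "crossed_datum K G \<tau> f s"
    using assms by (auto simp: presented_def)
  interpret crossed_presentation K H G \<tau> f s e y p q by fact
  have "crossed_presentation K H G \<tau> f (restrict s (carrier G)) e y p q"
    using P by (simp add: crossed_presentation_def crossed_presentation_axioms_def)
  moreover have "crossed_datum K G \<tau> f (restrict s (carrier G))"
    using D crossed_datumD(3)[OF D] by (simp add: crossed_datum_def)
  ultimately show ?thesis unfolding presented_def by blast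
qed

text \<open>The vectors and functionals at \<open>a\<close> are replaced by those at
  \<open>\<sigma> a\<close>. The hypothesis \<open>conj\<close> is conjugacy of the two
  automorphisms written without an inverse.\<close>

lemma presented_conjugate:
  assumes P: "presented K H G \<tau> f s" and \<sigma>: "\<sigma> \<in> auto G" and \<tau>': "\<tau>' \<in> auto G"
    and conj: "\<And>a. a \<in> carrier G \<Longrightarrow> \<sigma> (\<tau>' a) = \<tau> (\<sigma> a)"
  shows "\<exists>f' s'. presented K H G \<tau>' f' s'"
proof -
  obtain e y p q where "crossed_presentation K H G \<tau> f s e y p q" and D: "crossed_datum K G \<tau> f s"
    using P by (auto simp: presented_def)
  interpret crossed_presentation K H G \<tau> f s e y p q by fact
  note d = crossed_datumD[OF D]
  have \<sigma>_in: "\<sigma> a \<in> carrier G" and \<sigma>_mult: "c \<in> carrier G \<Longrightarrow> \<sigma> (a \<otimes>\<^sub>G c) = \<sigma> a \<otimes>\<^sub>G \<sigma> c" if "a \<in> carrier G" for a c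
    using \<sigma> that by (auto simp: auto_def hom_def)
  have \<tau>'_in: "\<tau>' a \<in> carrier G" if "a \<in> carrier G" for a using \<tau>' that by (auto simp: auto_def hom_def)
  have \<sigma>_inj: "inj_on \<sigma> (carrier G)" and \<sigma>_im: "\<sigma> ` carrier G = carrier G"
    using \<sigma> by (auto simp: auto_def Bij_def bij_betw_def)
  have \<sigma>_eq: "\<sigma> a = \<sigma> c \<longleftrightarrow> a = c" if "a \<in> carrier G" "c \<in> carrier G" for a c using \<sigma>_inj that by (auto dest: inj_onD)
  interpret \<sigma>: group_hom G G \<sigma> using \<sigma> by unfold_locales (auto simp: auto_def)
  define f' where "f' = (\<lambda>(a, c)\<in>carrier G \<times> carrier G. f (\<sigma> a, \<sigma> c))"
  define s' where "s' a = s (\<sigma> a)" for a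
  have reindex: "(\<Oplus>\<^bsub>U\<^esub> a\<in>carrier G. F (\<sigma> a)) = (\<Oplus>\<^bsub>U\<^esub> a\<in>carrier G. F a)"
    if "module K U" "\<And>a. a \<in> carrier G \<Longrightarrow> F a \<in> carrier U" for F and U :: "('a, 'u, 'w) module_scheme"
  proof -
    interpret U: module K U by fact
    show ?thesis using U.M.finsum_reindex[of F \<sigma> "carrier G"] that(2) \<sigma>_inj by (simp add: \<sigma>_im Pi_iff)
  qed
  interpret T: module K "tensor K H H" by (rule HH_module)
  have pure: "pure_tensor K H H u v \<in> carrier (tensor K H H)" if "u \<in> carrier H" "v \<in> carrier H" for u v
    by (rule pure_tensor_in[OF H_module H_module that])
  have "crossed_presentation K H G \<tau>' f' s' (\<lambda>a. e (\<sigma> a)) (\<lambda>a. y (\<sigma> a)) (\<lambda>a. p (\<sigma> a)) (\<lambda>a. q (\<sigma> a))"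
  proof (intro crossed_presentation.intro crossed_presentation_axioms.intro)
    fix x assume x: "x \<in> carrier H"
    show "x = (\<Oplus>\<^bsub>H\<^esub> a\<in>carrier G. p (\<sigma> a) x \<odot>\<^sub>H e (\<sigma> a) \<oplus>\<^sub>H q (\<sigma> a) x \<odot>\<^sub>H y (\<sigma> a))"
      using reindex[OF H_module, of "\<lambda>a. p a x \<odot>\<^sub>H e a \<oplus>\<^sub>H q a x \<odot>\<^sub>H y a"] expand[OF x] x p_in q_in e_in y_in by simp
  next
    show "(\<Oplus>\<^bsub>H\<^esub> a\<in>carrier G. e (\<sigma> a)) = \<one>\<^sub>H" using reindex[OF H_module, of e] e_in sum_e by simp
  next
    fix a assume a: "a \<in> carrier G"
    have "comult H (e (\<sigma> a)) = (\<Oplus>\<^bsub>tensor K H H\<^esub> c\<in>carrier G. pure_tensor K H H (e (\<sigma> c)) (e (inv\<^bsub>G\<^esub> \<sigma> c \<otimes>\<^sub>G \<sigma> a)))"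
      unfolding comult_e[OF \<sigma>_in[OF a]] using a e_in \<sigma>_in
      by (intro reindex[symmetric, OF HH_module]) (auto intro!: pure)
    also have "... = (\<Oplus>\<^bsub>tensor K H H\<^esub> c\<in>carrier G. pure_tensor K H H (e (\<sigma> c)) (e (\<sigma> (inv\<^bsub>G\<^esub> c \<otimes>\<^sub>G a))))"
      using a e_in \<sigma>_in by (intro T.M.finsum_cong') (auto intro!: pure simp: \<sigma>_mult)
    finally show "comult H (e (\<sigma> a)) =
      (\<Oplus>\<^bsub>tensor K H H\<^esub> c\<in>carrier G. pure_tensor K H H (e (\<sigma> c)) (e (\<sigma> (inv\<^bsub>G\<^esub> c \<otimes>\<^sub>G a))))" .
    have f_in: "f (b, c) \<in> carrier K" if "b \<in> carrier G" "c \<in> carrier G" for b c using d(6)[OF that] by auto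
    have "comult H (y (\<sigma> a)) = (\<Oplus>\<^bsub>tensor K H H\<^esub> c\<in>carrier G.
        f (\<sigma> c, inv\<^bsub>G\<^esub> \<sigma> c \<otimes>\<^sub>G \<sigma> a) \<odot>\<^bsub>tensor K H H\<^esub> pure_tensor K H H (y (\<sigma> c)) (y (inv\<^bsub>G\<^esub> \<sigma> c \<otimes>\<^sub>G \<sigma> a)))"
      unfolding comult_y[OF \<sigma>_in[OF a]] using a y_in \<sigma>_in
      by (intro reindex[symmetric, OF HH_module]) (auto intro!: T.smult_closed pure f_in)
    also have "... = (\<Oplus>\<^bsub>tensor K H H\<^esub> c\<in>carrier G.
        f' (c, inv\<^bsub>G\<^esub> c \<otimes>\<^sub>G a) \<odot>\<^bsub>tensor K H H\<^esub> pure_tensor K H H (y (\<sigma> c)) (y (\<sigma> (inv\<^bsub>G\<^esub> c \<otimes>\<^sub>G a))))"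
      using a y_in \<sigma>_in by (intro T.M.finsum_cong') (auto intro!: T.smult_closed pure f_in simp: \<sigma>_mult f'_def)
    finally show "comult H (y (\<sigma> a)) = (\<Oplus>\<^bsub>tensor K H H\<^esub> c\<in>carrier G.
        f' (c, inv\<^bsub>G\<^esub> c \<otimes>\<^sub>G a) \<odot>\<^bsub>tensor K H H\<^esub> pure_tensor K H H (y (\<sigma> c)) (y (\<sigma> (inv\<^bsub>G\<^esub> c \<otimes>\<^sub>G a))))" .
  next
    fix a c assume "a \<in> carrier G" "c \<in> carrier G"
    then show "y (\<sigma> a) \<otimes>\<^sub>H e (\<sigma> c) = (if c = \<tau>' a then y (\<sigma> a) else \<zero>\<^sub>H)"
      and "y (\<sigma> a) \<otimes>\<^sub>H y (\<sigma> c) = (if c = \<tau>' a then s' a \<odot>\<^sub>H e (\<sigma> a) else \<zero>\<^sub>H)"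
      using \<sigma>_eq[of c "\<tau>' a"] by (auto simp: y_e y_y \<sigma>_in \<tau>'_in conj s'_def)
  qed (simp_all add: hopf_algebra_axioms G.comm_group_axioms finite_G e_in y_in \<sigma>_in p_hom q_hom p_e p_y q_e q_y e_e e_y \<sigma>_eq)
  moreover have "crossed_datum K G \<tau>' f' s'"
  proof -
    have "\<tau>' (\<tau>' a) = a" if "a \<in> carrier G" for a
      using \<sigma>_eq[of "\<tau>' (\<tau>' a)" a] that by (simp add: \<tau>'_in conj \<sigma>_in d(4))
    moreover have "f' \<in> carrier (two_cocycles G (units_of K))"
      using d(2,6) by (auto simp: two_cocycles_def f'_def \<sigma>_in \<sigma>_mult units_of_def)
    ultimately show ?thesis
      using \<tau>' d(7,8,9) by (auto simp: crossed_datum_def s'_def f'_def \<sigma>_in \<sigma>_mult \<tau>'_in conj)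
  qed
  ultimately show ?thesis unfolding presented_def by blast
qed

text \<open>Each \<open>y a\<close> is divided by \<open>c a\<close>. In its comultiplication this
  leaves \<open>c\<close> at both indices over \<open>c\<close> at their product, which is the
  coboundary of \<open>c\<close>.\<close>

lemma presented_rescale:
  assumes P: "presented K H G \<tau> f s" and c: "c \<in> carrier G \<rightarrow> Units K"
  shows "\<exists>s'. presented K H G \<tau> (coboundary G (units_of K) c \<otimes>\<^bsub>two_cocycles G (units_of K)\<^esub> f) s'"
proof -
  obtain e y p q where "crossed_presentation K H G \<tau> f s e y p q" and D: "crossed_datum K G \<tau> f s"
    using P by (auto simp: presented_def)
  interpret crossed_presentation K H G \<tau> f s e y p q by fact
  note d = crossed_datumD[OF D]
  interpret U: comm_group "units_of K" by (rule vec.R.units_comm_group)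
  interpret C: cohomology G "units_of K" by unfold_locales
  let ?Z = "two_cocycles G (units_of K)"
  define f' where "f' = coboundary G (units_of K) c \<otimes>\<^bsub>?Z\<^esub> f"
  have c': "c \<in> carrier G \<rightarrow> carrier (units_of K)" using c by (simp add: units_of_carrier)
  have f': "f' \<in> carrier ?Z" unfolding f'_def by (rule C.cocycle_mult[OF C.coboundary_cocycle[OF c'] d(2)])
  have cU: "c a \<in> Units K" if "a \<in> carrier G" for a using c that by auto
  define i where "i a = inv\<^bsub>K\<^esub> (c a)" for a
  have iU: "i a \<in> Units K" and ci: "c a \<otimes>\<^sub>K i a = \<one>\<^sub>K" "i a \<otimes>\<^sub>K c a = \<one>\<^sub>K" if "a \<in> carrier G" for a using cU[OF that] by (auto simp: i_def)
  have cK: "c a \<in> carrier K" "i a \<in> carrier K" "s a \<in> carrier K" if "a \<in> carrier G" for a using cU[OF that] iU[OF that] d(7)[OF that] by auto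
  have fK: "f (a, b) \<in> carrier K" if "a \<in> carrier G" "b \<in> carrier G" for a b using d(6)[OF that] by auto
  have f'_eq: "f' (a, b) = c b \<otimes>\<^sub>K i (a \<otimes>\<^sub>G b) \<otimes>\<^sub>K c a \<otimes>\<^sub>K f (a, b)" if "a \<in> carrier G" "b \<in> carrier G" for a b
    using that cU by (simp add: f'_def C.cocycle_mult_apply C.coboundary_apply units_of_mult vec.R.units_of_inv i_def)
  \<comment> \<open>The product of the rescaled vectors at \<open>a\<close> and at
    \<open>\<tau> a\<close> collects an inverse from each of them.\<close>
  define s' where "s' a = s a \<otimes>\<^sub>K i a \<otimes>\<^sub>K i (\<tau> a)" for a
  define y' where "y' a = i a \<odot>\<^sub>H y a" for a
  define q' where "q' a x = c a \<otimes>\<^sub>K q a x" for a x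
  have y'_in: "y' a \<in> carrier H" if "a \<in> carrier G" for a using cK[OF that] y_in[OF that] by (simp add: y'_def)
  have q'_y: "q' a x \<odot>\<^sub>H y' a = q a x \<odot>\<^sub>H y a" if a: "a \<in> carrier G" and x: "x \<in> carrier H" for a x
  proof -
    have "q' a x \<odot>\<^sub>H y' a = (q a x \<otimes>\<^sub>K (c a \<otimes>\<^sub>K i a)) \<odot>\<^sub>H y a"
      using cK[OF a] q_in[OF a x] y_in[OF a] by (simp add: q'_def y'_def vec.smult_assoc1[symmetric] vec.R.m_ac)
    then show ?thesis using ci[OF a] q_in[OF a x] by simp
  qed
  interpret T: module K "tensor K H H" by (rule HH_module)
  have pure: "pure_tensor K H H u v \<in> carrier (tensor K H H)" if "u \<in> carrier H" "v \<in> carrier H" for u v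
    by (rule pure_tensor_in[OF H_module H_module that])
  have "crossed_presentation K H G \<tau> f' s' e y' p q'"
  proof (intro crossed_presentation.intro crossed_presentation_axioms.intro)
    fix x assume x: "x \<in> carrier H"
    have "x = (\<Oplus>\<^bsub>H\<^esub> a\<in>carrier G. p a x \<odot>\<^sub>H e a \<oplus>\<^sub>H q a x \<odot>\<^sub>H y a)" by (rule expand[OF x])
    also have "... = (\<Oplus>\<^bsub>H\<^esub> a\<in>carrier G. p a x \<odot>\<^sub>H e a \<oplus>\<^sub>H q' a x \<odot>\<^sub>H y' a)"
      using x p_in q_in e_in y_in by (intro vec.M.finsum_cong') (auto simp: q'_y)
    finally show "x = (\<Oplus>\<^bsub>H\<^esub> a\<in>carrier G. p a x \<odot>\<^sub>H e a \<oplus>\<^sub>H q' a x \<odot>\<^sub>H y' a)" .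
  next
    fix a assume a: "a \<in> carrier G"
    show "q' a \<in> module_hom K H (base_algebra K)"
      unfolding q'_def using scalar_mult_right_hom[OF q_hom[OF a]] cK[OF a] by simp
    show "comult H (e a) = (\<Oplus>\<^bsub>tensor K H H\<^esub> c\<in>carrier G. pure_tensor K H H (e c) (e (inv\<^bsub>G\<^esub> c \<otimes>\<^sub>G a)))"
      by (rule comult_e[OF a])
    have "comult H (y' a) = i a \<odot>\<^bsub>tensor K H H\<^esub> comult H (y a)"
      unfolding y'_def by (rule module_hom_smult[OF comult_module_hom cK(2)[OF a] y_in[OF a]])
    also have "... = (\<Oplus>\<^bsub>tensor K H H\<^esub> b\<in>carrier G. i a \<odot>\<^bsub>tensor K H H\<^esub>
        (f (b, inv\<^bsub>G\<^esub> b \<otimes>\<^sub>G a) \<odot>\<^bsub>tensor K H H\<^esub> pure_tensor K H H (y b) (y (inv\<^bsub>G\<^esub> b \<otimes>\<^sub>G a))))"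
      unfolding comult_y[OF a]
      using a y_in fK pure cK
      by (intro module_hom_finsum[OF HH_module HH_module module_hom_smult_left[OF HH_module module_hom_id] finite_G])
        (auto intro!: T.smult_closed pure)
    also have "... = (\<Oplus>\<^bsub>tensor K H H\<^esub> b\<in>carrier G.
        f' (b, inv\<^bsub>G\<^esub> b \<otimes>\<^sub>G a) \<odot>\<^bsub>tensor K H H\<^esub> pure_tensor K H H (y' b) (y' (inv\<^bsub>G\<^esub> b \<otimes>\<^sub>G a)))"
    proof (rule T.M.finsum_cong'[OF refl])
      show "(\<lambda>b. f' (b, inv\<^bsub>G\<^esub> b \<otimes>\<^sub>G a) \<odot>\<^bsub>tensor K H H\<^esub> pure_tensor K H H (y' b) (y' (inv\<^bsub>G\<^esub> b \<otimes>\<^sub>G a)))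
          \<in> carrier G \<rightarrow> carrier (tensor K H H)"
        using a y'_in cK fK by (auto intro!: T.smult_closed pure simp: f'_eq)
      fix b assume b: "b \<in> carrier G"
      define g where "g = inv\<^bsub>G\<^esub> b \<otimes>\<^sub>G a"
      have g: "g \<in> carrier G" "b \<otimes>\<^sub>G g = a" using a b by (auto simp: g_def G.m_assoc[symmetric])
      note pt = pure[OF y_in[OF b] y_in[OF g(1)]]
      have "pure_tensor K H H (y' b) (y' g) = i b \<odot>\<^bsub>tensor K H H\<^esub> (i g \<odot>\<^bsub>tensor K H H\<^esub> pure_tensor K H H (y b) (y g))"
        unfolding y'_def module_hom_smult[OF bilinear_mapsD(2)[OF pure_bilinear y'_in[OF g(1), unfolded y'_def]] cK(2)[OF b] y_in[OF b]]
          module_hom_smult[OF bilinear_mapsD(1)[OF pure_bilinear y_in[OF b]] cK(2)[OF g(1)] y_in[OF g(1)]] ..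
      then have "f' (b, g) \<odot>\<^bsub>tensor K H H\<^esub> pure_tensor K H H (y' b) (y' g) =
          (c g \<otimes>\<^sub>K i a \<otimes>\<^sub>K c b \<otimes>\<^sub>K f (b, g) \<otimes>\<^sub>K i b \<otimes>\<^sub>K i g) \<odot>\<^bsub>tensor K H H\<^esub> pure_tensor K H H (y b) (y g)"
        using cK[OF a] cK[OF b] cK[OF g(1)] fK[OF b g(1)] pt by (simp add: f'_eq[OF b g(1)] g(2) T.smult_assoc1)
      also have "c g \<otimes>\<^sub>K i a \<otimes>\<^sub>K c b \<otimes>\<^sub>K f (b, g) \<otimes>\<^sub>K i b \<otimes>\<^sub>K i g =
          (i a \<otimes>\<^sub>K f (b, g)) \<otimes>\<^sub>K (c b \<otimes>\<^sub>K i b) \<otimes>\<^sub>K (c g \<otimes>\<^sub>K i g)"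
        using cK[OF a] cK[OF b] cK[OF g(1)] fK[OF b g(1)] by (simp only: vec.R.m_ac vec.R.m_closed)
      also have "... = i a \<otimes>\<^sub>K f (b, g)" using ci[OF b] ci[OF g(1)] cK[OF a] fK[OF b g(1)] by simp
      finally show "i a \<odot>\<^bsub>tensor K H H\<^esub> (f (b, inv\<^bsub>G\<^esub> b \<otimes>\<^sub>G a) \<odot>\<^bsub>tensor K H H\<^esub> pure_tensor K H H (y b) (y (inv\<^bsub>G\<^esub> b \<otimes>\<^sub>G a))) =
          f' (b, inv\<^bsub>G\<^esub> b \<otimes>\<^sub>G a) \<odot>\<^bsub>tensor K H H\<^esub> pure_tensor K H H (y' b) (y' (inv\<^bsub>G\<^esub> b \<otimes>\<^sub>G a))"
        unfolding g_def[symmetric] using T.smult_assoc1[OF cK(2)[OF a] fK[OF b g(1)] pt] by simp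
    qed
    finally show "comult H (y' a) = (\<Oplus>\<^bsub>tensor K H H\<^esub> b\<in>carrier G.
        f' (b, inv\<^bsub>G\<^esub> b \<otimes>\<^sub>G a) \<odot>\<^bsub>tensor K H H\<^esub> pure_tensor K H H (y' b) (y' (inv\<^bsub>G\<^esub> b \<otimes>\<^sub>G a)))" .
  next
    fix a b assume ab: "a \<in> carrier G" "b \<in> carrier G"
    note k = cK[OF ab(1)] cK[OF ab(2)] y_in[OF ab(1)] y_in[OF ab(2)] e_in[OF ab(1)] e_in[OF ab(2)]
    show "p a (y' b) = \<zero>\<^sub>K" unfolding y'_def module_hom_smult[OF p_hom[OF ab(1)] k(5) k(8)] using k p_y[OF ab] by simp
    show "q' a (e b) = \<zero>\<^sub>K" using k q_e[OF ab] by (simp add: q'_def)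
    show "q' a (y' b) = (if a = b then \<one>\<^sub>K else \<zero>\<^sub>K)"
      unfolding q'_def y'_def module_hom_smult[OF q_hom[OF ab(1)] k(5) k(8)] using k q_y[OF ab] ci[OF ab(1)] ci[OF ab(2)] by simp
    show "e a \<otimes>\<^sub>H y' b = (if a = b then y' b else \<zero>\<^sub>H)" using k e_y[OF ab] by (simp add: y'_def smult_mult_right)
    show "y' a \<otimes>\<^sub>H e b = (if b = \<tau> a then y' a else \<zero>\<^sub>H)" using k y_e[OF ab] by (simp add: y'_def smult_mult_left)
    show "y' a \<otimes>\<^sub>H y' b = (if b = \<tau> a then s' a \<odot>\<^sub>H e a else \<zero>\<^sub>H)"
      using k y_y[OF ab] by (auto simp: y'_def s'_def smult_mult_left smult_mult_right vec.smult_assoc1[symmetric] vec.R.m_ac)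
  qed (rule hopf_algebra_axioms G.comm_group_axioms finite_G e_in p_hom p_e e_e sum_e y'_in; assumption?)+
  moreover have "crossed_datum K G \<tau> f' s'"
    unfolding crossed_datum_def
  proof (intro conjI ballI)
    show "\<tau> \<in> auto G" "f' \<in> carrier ?Z" by fact+
    fix a assume a: "a \<in> carrier G"
    show "\<tau> (\<tau> a) = a" by (rule d(4)[OF a])
    show "s' a \<in> Units K" using iU d(7) d(3) a by (simp add: s'_def)
    show "s' (\<tau> a) = s' a" using cK d(3,4,8) a by (simp add: s'_def vec.R.m_ac)
    fix b assume b: "b \<in> carrier G"
    note t = d(3)[OF a] d(3)[OF b]
    note ks = cK[OF a] cK[OF b] cK[OF t(1)] cK[OF t(2)] cK[OF G.m_closed[OF a b]] cK[OF G.m_closed[OF t]] fK[OF a b] fK[OF t]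
    have "f' (a, b) \<otimes>\<^sub>K (f' (\<tau> a, \<tau> b) \<otimes>\<^sub>K (s' a \<otimes>\<^sub>K s' b)) =
        (f (a, b) \<otimes>\<^sub>K (f (\<tau> a, \<tau> b) \<otimes>\<^sub>K (s a \<otimes>\<^sub>K s b)) \<otimes>\<^sub>K i (a \<otimes>\<^sub>G b) \<otimes>\<^sub>K i (\<tau> a \<otimes>\<^sub>G \<tau> b)) \<otimes>\<^sub>K
          (c a \<otimes>\<^sub>K i a) \<otimes>\<^sub>K (c b \<otimes>\<^sub>K i b) \<otimes>\<^sub>K (c (\<tau> a) \<otimes>\<^sub>K i (\<tau> a)) \<otimes>\<^sub>K (c (\<tau> b) \<otimes>\<^sub>K i (\<tau> b))"
      unfolding f'_eq[OF a b] f'_eq[OF t] s'_def using ks by (simp only: vec.R.m_ac vec.R.m_closed)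
    also have "... = s' (a \<otimes>\<^sub>G b)"
      unfolding s'_def d(9)[OF a b] d(5)[OF a b] ci(1)[OF a] ci(1)[OF b] ci(1)[OF t(1)] ci(1)[OF t(2)] using ks by simp
    finally show "s' (a \<otimes>\<^sub>G b) = f' (a, b) \<otimes>\<^sub>K (f' (\<tau> a, \<tau> b) \<otimes>\<^sub>K (s' a \<otimes>\<^sub>K s' b))" ..
  qed
  ultimately show ?thesis unfolding f'_def[symmetric] presented_def by blast
qed

section \<open>Counting isomorphism classes\<close>

text \<open>The kernel of the counit is a left ideal. The component of the unit in a complementary
  left ideal has counit one, and multiplied by an element of counit zero it falls into both
  ideals.\<close>

lemma (in hopf_algebra) semisimple_integral:
  assumes "semisimple_ring H"
  shows "\<exists>\<Lambda>\<in>carrier H. counit H \<Lambda> = \<one> \<and> (\<forall>h\<in>carrier H. h \<otimes>\<^sub>H \<Lambda> = counit H h \<odot>\<^sub>H \<Lambda>)"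
proof -
  define I where "I = {x \<in> carrier H. counit H x = \<zero>}"
  have neg: "counit H (\<ominus>\<^bsub>H\<^esub> x) = \<ominus> \<one> \<otimes> counit H x" if "x \<in> carrier H" for x
    using counit_smult[of "\<ominus> \<one>" x] that by (simp add: vec.smult_minus_1)
  have "left_ideal H I"
    unfolding left_ideal_def
  proof (intro conjI ballI)
    show "additive_subgroup I H"
    proof (rule additive_subgroup.intro, rule group.subgroupI[OF vec.M.a_group])
      show "I \<subseteq> carrier (add_monoid H)" by (auto simp: I_def)
      show "I \<noteq> {}" using module_hom_zero[OF H_module K_module counit_module_hom] by (auto simp: I_def)
    qed (auto simp: I_def counit_add neg a_inv_def[symmetric])
    show "a \<otimes>\<^sub>H x \<in> I" if "a \<in> carrier H" "x \<in> I" for a x using that counit_in by (auto simp: I_def counit_mult)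
  qed
  then obtain J where J: "left_ideal H J" "I \<inter> J = {\<zero>\<^sub>H}" "I <+>\<^bsub>H\<^esub> J = carrier H"
    using assms unfolding semisimple_ring_def by blast
  interpret J: additive_subgroup J H using J(1) by (simp add: left_ideal_def)
  have "\<one>\<^sub>H \<in> I <+>\<^bsub>H\<^esub> J" using J(3) by simp
  then obtain i \<Lambda> where i\<Lambda>: "i \<in> I" "\<Lambda> \<in> J" "\<one>\<^sub>H = i \<oplus>\<^sub>H \<Lambda>" by (auto simp: set_add_def' )
  have \<Lambda>: "\<Lambda> \<in> carrier H" using i\<Lambda> J.a_subset by auto
  have i: "i \<in> carrier H" "counit H i = \<zero>" using i\<Lambda> by (auto simp: I_def)
  have "\<one> = counit H (i \<oplus>\<^sub>H \<Lambda>)" using counit_one i\<Lambda>(3) by simp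
  then have \<epsilon>: "counit H \<Lambda> = \<one>" using i \<Lambda> counit_in by (simp add: counit_add)
  moreover have "h \<otimes>\<^sub>H \<Lambda> = counit H h \<odot>\<^sub>H \<Lambda>" if h: "h \<in> carrier H" for h
  proof -
    define k where "k = h \<ominus>\<^sub>H counit H h \<odot>\<^sub>H \<one>\<^sub>H"
    have k: "k \<in> carrier H" using h counit_in by (simp add: k_def)
    have \<epsilon>k: "counit H k = \<zero>"
      using h counit_in[OF h] by (simp add: k_def counit_diff counit_smult counit_one vec.R.minus_eq vec.R.r_neg)
    have "k \<otimes>\<^sub>H \<Lambda> \<in> J" using J(1) k i\<Lambda>(2) by (simp add: left_ideal_def)
    moreover have "k \<otimes>\<^sub>H \<Lambda> \<in> I" using k \<Lambda> \<epsilon>k counit_in by (simp add: I_def counit_mult)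
    ultimately have "k \<otimes>\<^sub>H \<Lambda> = \<zero>\<^sub>H" using J(2) by blast
    moreover have "k \<otimes>\<^sub>H \<Lambda> = h \<otimes>\<^sub>H \<Lambda> \<ominus>\<^sub>H counit H h \<odot>\<^sub>H \<Lambda>"
      using h \<Lambda> counit_in[OF h] by (simp add: k_def a_minus_def l_distr l_minus smult_mult_left)
    ultimately show ?thesis using h \<Lambda> counit_in by simp
  qed
  ultimately show ?thesis using \<Lambda> by blast
qed

lemma (in hopf_algebra) grouplikes_mult:
  assumes "g \<in> carrier (grouplikes K H)" "h \<in> carrier (grouplikes K H)"
  shows "g \<otimes>\<^sub>H h \<in> carrier (grouplikes K H)"
proof -
  have g: "g \<in> carrier H" "comult H g = pure_tensor K H H g g" "counit H g = \<one>"
    and h: "h \<in> carrier H" "comult H h = pure_tensor K H H h h" "counit H h = \<one>"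
    using assms by (auto simp: grouplikes_def)
  have b: "(\<lambda>a b. pure_tensor K H H (a' \<otimes>\<^sub>H a) (b' \<otimes>\<^sub>H b)) \<in> bilinear_maps K H H HH" if "a' \<in> carrier H" "b' \<in> carrier H" for a' b'
    by (rule bilinear_pullback[OF pure_bilinear mult_right_hom[OF module_hom_id that(1)] mult_right_hom[OF module_hom_id that(2)]])
  have b': "(\<lambda>a b. pure_tensor K H H (a \<otimes>\<^sub>H h) (b \<otimes>\<^sub>H h)) \<in> bilinear_maps K H H HH"
    by (rule bilinear_pullback[OF pure_bilinear mult_left_hom[OF module_hom_id h(1)] mult_left_hom[OF module_hom_id h(1)]])
  have "comult H (g \<otimes>\<^sub>H h) = sweedler HH (pure_tensor K H H) (g \<otimes>\<^sub>H h)"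
    using comult_sweedler g(1) h(1) by simp
  also have "... = sweedler HH (\<lambda>a b. sweedler HH (\<lambda>c d. pure_tensor K H H (a \<otimes>\<^sub>H c) (b \<otimes>\<^sub>H d)) h) g"
    by (rule sweedler_mult[OF HH_module pure_bilinear g(1) h(1)])
  also have "... = sweedler HH (\<lambda>a b. pure_tensor K H H (a \<otimes>\<^sub>H h) (b \<otimes>\<^sub>H h)) g"
    by (rule sweedler_cong[symmetric, OF HH_module b' g(1)])
      (rule sweedler_pure[symmetric, OF HH_module b h(1) h(1) h(2)])
  also have "... = pure_tensor K H H (g \<otimes>\<^sub>H h) (g \<otimes>\<^sub>H h)"
    by (rule sweedler_pure[OF HH_module b' g(1) g(1) g(2)])
  finally show ?thesis using g h by (simp add: grouplikes_def counit_mult)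
qed

text \<open>The hypothesis gives a map out of the group-likes, whereas the construction starts from
  \<open>G\<close>. The inverse bijection is multiplicative because products of group-likes stay in
  the domain of the given map.\<close>

lemma (in hopf_algebra) grouplikes_iso:
  assumes "grouplikes K H \<cong> G"
  shows "\<exists>\<iota>. \<iota> \<in> iso G (grouplikes K H)"
proof -
  obtain \<theta> where \<theta>: "\<theta> \<in> iso (grouplikes K H) G" using assms by (auto simp: is_iso_def)
  have hom: "\<theta> \<in> hom (grouplikes K H) G" and bij: "bij_betw \<theta> (carrier (grouplikes K H)) (carrier G)"
    using \<theta> by (auto simp: iso_def)
  define \<iota> where "\<iota> = inv_into (carrier (grouplikes K H)) \<theta>"
  have inv: "bij_betw \<iota> (carrier G) (carrier (grouplikes K H))"
    unfolding \<iota>_def by (rule bij_betw_inv_into[OF bij])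
  have \<theta>\<iota>: "\<theta> (\<iota> a) = a" if "a \<in> carrier G" for a
    using bij_betw_inv_into_right[OF bij that] by (simp add: \<iota>_def)
  have \<iota>_in: "\<iota> a \<in> carrier (grouplikes K H)" if "a \<in> carrier G" for a using bij_betwE[OF inv] that by blast
  have "\<iota> (a \<otimes>\<^sub>G c) = \<iota> a \<otimes>\<^bsub>grouplikes K H\<^esub> \<iota> c" if "a \<in> carrier G" "c \<in> carrier G" for a c
  proof -
    have *: "\<iota> a \<otimes>\<^bsub>grouplikes K H\<^esub> \<iota> c \<in> carrier (grouplikes K H)"
      using grouplikes_mult[OF \<iota>_in[OF that(1)] \<iota>_in[OF that(2)]] by (simp add: grouplikes_def)
    have "\<theta> (\<iota> a \<otimes>\<^bsub>grouplikes K H\<^esub> \<iota> c) = a \<otimes>\<^sub>G c"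
      using hom_mult[OF hom \<iota>_in[OF that(1)] \<iota>_in[OF that(2)]] \<theta>\<iota> that by simp
    then show ?thesis using bij_betw_inv_into_left[OF bij *] by (simp add: \<iota>_def)
  qed
  then have "\<iota> \<in> iso G (grouplikes K H)" using inv \<iota>_in by (auto simp: iso_def hom_def)
  then show ?thesis by blast
qed

lemma algebraically_closed_square_root:
  assumes "algebraically_closed K" and a: "a \<in> carrier K"
  shows "\<exists>c\<in>carrier K. c \<otimes>\<^sub>K c = a"
proof -
  interpret algebraically_closed K by fact
  \<comment> \<open>The polynomial \<open>X^2 - a\<close>, leading coefficient first; it splits, so
    it has two roots counted with multiplicity.\<close>
  let ?P = "[\<one>\<^sub>K, \<zero>\<^sub>K, \<ominus>\<^sub>K a]"
  have P: "?P \<in> carrier (poly_ring K)"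
    using a by (simp add: univ_poly_carrier[symmetric] polynomial_def)
  have "size (roots ?P) = 2" using roots_over_carrier[OF P] by (simp add: splitted_def)
  then obtain c where "c \<in># roots ?P" by (metis multiset_nonemptyE size_empty zero_neq_numeral)
  then have c: "c \<in> carrier K" "eval ?P c = \<zero>\<^sub>K" using roots_mem_iff_is_root[OF P] by (auto simp: is_root_def)
  then have "c \<otimes>\<^sub>K c \<ominus>\<^sub>K a = \<zero>\<^sub>K" using a by (simp add: numeral_2_eq_2 a_minus_def)
  then show ?thesis using c a by (intro bexI[of _ c]) simp_all
qed

lemma (in field) two_nonzero_of_char_zero: "char_zero R \<Longrightarrow> \<one> \<oplus> \<one> \<noteq> \<zero>"
  unfolding char_zero_def by (metis add.nat_pow_Suc add.nat_pow_0 l_zero numeral_2_eq_2 one_closed pos2)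

text \<open>Characteristic zero is what separates minus one from one; a field has no other square
  roots of one.\<close>

lemma algebraically_closed_units:
  assumes "algebraically_closed K" and char: "char_zero K"
  shows "square_closed_group (units_of K) (\<ominus>\<^bsub>K\<^esub> \<one>\<^sub>K)"
proof -
  interpret algebraically_closed K by fact
  interpret U: comm_group "units_of K" by (rule units_comm_group)
  have two: "\<one>\<^sub>K \<oplus>\<^sub>K \<one>\<^sub>K \<noteq> \<zero>\<^sub>K" by (rule two_nonzero_of_char_zero[OF char])
  show ?thesis
  proof unfold_locales
    fix a assume "a \<in> carrier (units_of K)"
    then have a: "a \<in> carrier K" "a \<noteq> \<zero>\<^sub>K" by (auto simp: units_of_def field_Units)
    obtain c where c: "c \<in> carrier K" "c \<otimes>\<^sub>K c = a" using algebraically_closed_square_root[OF assms(1) a(1)] by blast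
    then have "c \<noteq> \<zero>\<^sub>K" using a by auto
    then show "\<exists>d\<in>carrier (units_of K). d \<otimes>\<^bsub>units_of K\<^esub> d = a"
      using c by (auto simp: units_of_def field_Units)
  next
    show "\<ominus>\<^sub>K \<one>\<^sub>K \<in> carrier (units_of K)" using Units_minus_one_closed by (simp add: units_of_def)
    show "\<ominus>\<^sub>K \<one>\<^sub>K \<noteq> \<one>\<^bsub>units_of K\<^esub>" using two by (metis units_of_one one_closed r_neg)
    show "\<ominus>\<^sub>K \<one>\<^sub>K \<otimes>\<^bsub>units_of K\<^esub> \<ominus>\<^sub>K \<one>\<^sub>K = \<one>\<^bsub>units_of K\<^esub>" by (simp add: units_of_def l_minus r_minus)
  next
    fix x assume "x \<in> carrier (units_of K)" and sq: "x \<otimes>\<^bsub>units_of K\<^esub> x = \<one>\<^bsub>units_of K\<^esub>"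
    then have x: "x \<in> carrier K" "x \<otimes>\<^sub>K x = \<one>\<^sub>K" by (auto simp: units_of_def)
    then show "x = \<one>\<^bsub>units_of K\<^esub> \<or> x = \<ominus>\<^sub>K \<one>\<^sub>K" using square_eq_one by (auto simp: units_of_one)
  qed
qed

text \<open>Algebraic closure supplies the bicharacter, semisimplicity the integral, and the
  dimension the plane structure; characteristic zero makes the group order and two
  invertible.\<close>

lemma exists_presentation:
  fixes K :: "('k, 'r) ring_scheme" and G :: "('g, 'e) monoid_scheme" and H :: "('k, 'h) hopf"
  assumes K: "algebraically_closed K" "char_zero K" and G: "comm_group G" "order G = 2 ^ r"
    and H: "hopf_algebra K H" "semisimple_ring H"
      "vectorspace.fin_dim K H" "vectorspace.dim K H = 2 * order G" "grouplikes K H \<cong> G"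
  shows "\<exists>\<tau> f s. presented K H G \<tau> f s"
proof -
  interpret K: algebraically_closed K by fact
  interpret G: comm_group G by fact
  interpret hopf_algebra K H by fact
  interpret A: square_closed_group "units_of K" "\<ominus>\<^sub>K \<one>\<^sub>K" by (rule algebraically_closed_units[OF K])
  obtain b where b: "\<And>a. a \<in> carrier G \<Longrightarrow> b a \<in> hom G (units_of K)" "\<And>a c. \<lbrakk>a \<in> carrier G; c \<in> carrier G\<rbrakk> \<Longrightarrow> b a c = b c a"
    "\<And>a. \<lbrakk>a \<in> carrier G; \<forall>c\<in>carrier G. b a c = \<one>\<^bsub>units_of K\<^esub>\<rbrakk> \<Longrightarrow> a = \<one>\<^sub>G"
    using A.nondegenerate_bicharacter[OF G] by blast
  obtain \<iota> where \<iota>: "\<iota> \<in> iso G (grouplikes K H)" using grouplikes_iso[OF H(5)] by blast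
  obtain \<Lambda> where \<Lambda>: "\<Lambda> \<in> carrier H" "counit H \<Lambda> = \<one>\<^sub>K" "\<And>h. h \<in> carrier H \<Longrightarrow> h \<otimes>\<^sub>H \<Lambda> = counit H h \<odot>\<^sub>H \<Lambda>"
    using semisimple_integral[OF H(2)] by blast
  have fin: "finite (carrier G)" using G(2) by (metis card.infinite order_def power_not_zero zero_neq_numeral)
  have n: "[order G] \<cdot>\<^bsub>K\<^esub> \<one>\<^sub>K \<noteq> \<zero>\<^sub>K" using K(2) G(2) unfolding char_zero_def by (metis pos2 zero_less_power)
  interpret hopf_grouplikes_integral K H G \<iota> b \<Lambda>
    by unfold_locales (use fin \<iota> b \<Lambda> n K.two_nonzero_of_char_zero[OF K(2)] H in \<open>auto simp: units_of_one\<close>)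
  obtain \<psi> where "\<psi> \<in> module_hom K H (base_algebra K)" "\<forall>x\<in>carrier H. \<forall>y\<in>carrier H. \<psi> (x \<otimes>\<^sub>H y) = \<psi> x \<otimes>\<^sub>K \<psi> y"
    "\<forall>g\<in>carrier G. \<psi> (\<iota> g) = \<one>\<^sub>K" "\<exists>z\<in>carrier H. counit H z = \<zero>\<^sub>K \<and> \<psi> z = \<one>\<^sub>K"
    "\<forall>h\<in>carrier H. sweedler (base_algebra K) (\<lambda>u v. \<psi> u \<otimes>\<^sub>K \<psi> v) h = counit H h"
    using exists_character by blast
  then interpret hopf_index_two K H G \<iota> b \<psi> by unfold_locales auto
  show ?thesis using exists_crossed_presentation unfolding presented_def by blast
qed

text \<open>Contrapositives of the two triviality criteria. On an abelian group a coboundary is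
  symmetric in its arguments, and symmetry of \<open>f\<close> would make \<open>H\<close>
  cocommutative.\<close>

lemma presented_nontrivial:
  assumes P: "presented K H G \<tau> f s" and nt: "nontrivial_hopf K H"
  shows "\<exists>x\<in>carrier G. \<tau> x \<noteq> x" and "f \<notin> two_coboundaries G (units_of K)"
proof -
  obtain e y p q where "crossed_presentation K H G \<tau> f s e y p q" and D: "crossed_datum K G \<tau> f s"
    using P by (auto simp: presented_def)
  interpret crossed_presentation K H G \<tau> f s e y p q by fact
  interpret U: comm_group "units_of K" by (rule vec.R.units_comm_group)
  show "\<exists>x\<in>carrier G. \<tau> x \<noteq> x" using commutative_if_trivial_action nt by (auto simp: nontrivial_hopf_def)
  show "f \<notin> two_coboundaries G (units_of K)"
  proof
    assume "f \<in> two_coboundaries G (units_of K)"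
    then obtain c where c: "c \<in> carrier G \<rightarrow> carrier (units_of K)" "f = coboundary G (units_of K) c"
      unfolding two_coboundaries_eq by blast
    have "f (a, d) = f (d, a)" if "a \<in> carrier G" "d \<in> carrier G" for a d
    proof -
      have *: "c a \<in> carrier (units_of K)" "c d \<in> carrier (units_of K)" "c (a \<otimes>\<^sub>G d) \<in> carrier (units_of K)"
        using c(1) that by auto
      show ?thesis using that * by (simp add: c(2) coboundary_def G.m_comm[of d a] U.m_ac)
    qed
    moreover have "f (a, d) \<in> carrier K" if "a \<in> carrier G" "d \<in> carrier G" for a d using crossed_datumD(6)[OF D that] by auto
    ultimately show False using cocommutative_if_symmetric nt by (auto simp: nontrivial_hopf_def)
  qed
qed

section \<open>Involutions of the automorphism group and their conjugacy classes\<close>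

lemma (in group) AutoGroup_mult_apply:
  "\<lbrakk>\<sigma> \<in> auto G; \<tau> \<in> auto G; a \<in> carrier G\<rbrakk> \<Longrightarrow> (\<sigma> \<otimes>\<^bsub>AutoGroup G\<^esub> \<tau>) a = \<sigma> (\<tau> a)"
  by (simp add: AutoGroup_def BijGroup_def auto_def compose_def)

text \<open>Members of \<open>auto G\<close> are extensional, so being the unit is a pointwise
  condition on the carrier; order two means that the order divides two and is not one.\<close>

lemma (in group) auto_involution:
  assumes "\<tau> \<in> auto G"
  shows "group.ord (AutoGroup G) \<tau> = 2 \<longleftrightarrow> (\<forall>a\<in>carrier G. \<tau> (\<tau> a) = a) \<and> (\<exists>a\<in>carrier G. \<tau> a \<noteq> a)"
proof -
  interpret A: group "AutoGroup G" by (rule AutoGroup)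
  have carrier: "carrier (AutoGroup G) = auto G" and one: "\<one>\<^bsub>AutoGroup G\<^esub> = (\<lambda>a\<in>carrier G. a)"
    by (simp_all add: AutoGroup_def BijGroup_def)
  have ext: "\<sigma> = \<rho> \<longleftrightarrow> (\<forall>a\<in>carrier G. \<sigma> a = \<rho> a)" if "\<sigma> \<in> auto G" "\<rho> \<in> auto G" for \<sigma> \<rho>
    using that by (auto simp: auto_def Bij_def intro: extensionalityI)
  have one_iff: "\<sigma> = \<one>\<^bsub>AutoGroup G\<^esub> \<longleftrightarrow> (\<forall>a\<in>carrier G. \<sigma> a = a)" if "\<sigma> \<in> auto G" for \<sigma>
    using ext[OF that id_in_auto] by (simp add: one)
  have \<tau>: "\<tau> \<in> carrier (AutoGroup G)" using assms by (simp add: carrier)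
  have "A.ord \<tau> = 2 \<longleftrightarrow> A.ord \<tau> dvd 2 \<and> A.ord \<tau> \<noteq> 1"
    using dvd_imp_le[of "A.ord \<tau>" 2] by (auto simp: le_Suc_eq numeral_2_eq_2 dest: dvd_0_left)
  also have "A.ord \<tau> dvd 2 \<longleftrightarrow> \<tau> \<otimes>\<^bsub>AutoGroup G\<^esub> \<tau> = \<one>\<^bsub>AutoGroup G\<^esub>"
    unfolding A.pow_eq_id[OF \<tau>, symmetric] using \<tau> by (simp add: numeral_2_eq_2)
  also have "... \<longleftrightarrow> (\<forall>a\<in>carrier G. \<tau> (\<tau> a) = a)"
    using one_iff[of "\<tau> \<otimes>\<^bsub>AutoGroup G\<^esub> \<tau>"] A.m_closed[OF \<tau> \<tau>] AutoGroup_mult_apply[OF assms assms] by (simp add: carrier)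
  also have "A.ord \<tau> \<noteq> 1 \<longleftrightarrow> (\<exists>a\<in>carrier G. \<tau> a \<noteq> a)"
    using A.ord_eq_1[OF \<tau>] one_iff[OF assms] by auto
  finally show ?thesis .
qed

text \<open>An element lies in its own class, by conjugation with the unit, hence in the class of
  the other. Clearing the inverse gives the form that \<open>presented_conjugate\<close>
  takes.\<close>

lemma (in group) conjugacy_class_auto:
  assumes \<tau>: "\<tau> \<in> auto G" and \<rho>: "\<rho> \<in> auto G"
    and eq: "conjugacy_class (AutoGroup G) \<tau> = conjugacy_class (AutoGroup G) \<rho>"
  shows "\<exists>\<sigma>\<in>auto G. \<forall>a\<in>carrier G. \<sigma> (\<rho> a) = \<tau> (\<sigma> a)"
proof -
  interpret A: group "AutoGroup G" by (rule AutoGroup)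
  have carrier: "carrier (AutoGroup G) = auto G" by (simp add: AutoGroup_def)
  have "\<tau> \<in> conjugacy_class (AutoGroup G) \<tau>"
    unfolding conjugacy_class_def orbit_def using \<tau> A.one_closed
    by (auto simp: carrier[symmetric] intro!: exI[of _ "\<one>\<^bsub>AutoGroup G\<^esub>"])
  then obtain \<sigma> where \<sigma>: "\<sigma> \<in> carrier (AutoGroup G)"
    "\<tau> = \<sigma> \<otimes>\<^bsub>AutoGroup G\<^esub> \<rho> \<otimes>\<^bsub>AutoGroup G\<^esub> inv\<^bsub>AutoGroup G\<^esub> \<sigma>"
    unfolding eq using \<rho> by (auto simp: conjugacy_class_def orbit_def carrier)
  have "\<tau> \<otimes>\<^bsub>AutoGroup G\<^esub> \<sigma> = \<sigma> \<otimes>\<^bsub>AutoGroup G\<^esub> \<rho>"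
    using \<sigma> \<rho> by (simp add: A.m_assoc carrier[symmetric])
  then have "\<sigma> (\<rho> a) = \<tau> (\<sigma> a)" if "a \<in> carrier G" for a
    using AutoGroup_mult_apply[of \<tau> \<sigma> a] AutoGroup_mult_apply[of \<sigma> \<rho> a] \<tau> \<rho> \<sigma>(1) that by (simp add: carrier)
  then show ?thesis using \<sigma>(1) by (auto simp: carrier)
qed

lemma (in group) finite_involution_classes:
  assumes "finite (carrier G)"
  shows "finite (involution_classes (AutoGroup G))"
proof -
  have "carrier (AutoGroup G) \<subseteq> carrier G \<rightarrow>\<^sub>E carrier G"
    by (auto simp: AutoGroup_def auto_def hom_def Bij_def PiE_def)
  then have "finite (carrier (AutoGroup G))" using assms by (meson finite_PiE finite_subset)
  then show ?thesis by (simp add: involution_classes_def)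
qed

theorem corollary3p9:
  fixes K :: "('k, 'r) ring_scheme"
    and G :: "('g, 'e) monoid_scheme"
    and m :: nat
    and S :: "('k, 'h) hopf set"
  assumes "algebraically_closed K" and "char_zero K"
    and "comm_group G" and "1 \<le> m" and "order G = 2 ^ (m - 1)"
    and "\<And>H. H \<in> S \<Longrightarrow> hopf_algebra K H"
    and "\<And>H. H \<in> S \<Longrightarrow> semisimple_ring H"
    and "\<And>H. H \<in> S \<Longrightarrow> nontrivial_hopf K H"
    and "\<And>H. H \<in> S \<Longrightarrow> vectorspace.fin_dim K H \<and> vectorspace.dim K H = 2 ^ m"
    and "\<And>H. H \<in> S \<Longrightarrow> grouplikes K H \<cong> G"
    and "pairwise (\<lambda>H L. hopf_iso K H L = {}) S"
  shows "finite S \<and>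
    real (card S) \<le> real (card (involution_classes (AutoGroup G))) *
      (real (order G) * real (order (schur_multiplier K G)) / 2 - 1)"
proof -
  interpret algebraically_closed K by fact
  interpret G: comm_group G by fact
  interpret A: square_closed_group "units_of K" "\<ominus>\<^sub>K \<one>\<^sub>K" by (rule algebraically_closed_units[OF assms(1,2)])
  interpret C: cohomology G "units_of K" by unfold_locales
  define Inv where "Inv = involution_classes (AutoGroup G)"
  define Coh where "Coh = carrier (schur_multiplier K G)"
  let ?Z = "two_cocycles G (units_of K)" and ?B = "two_coboundaries G (units_of K)"
  have fin: "finite (carrier G)" using assms(5) by (metis card.infinite order_def power_not_zero zero_neq_numeral)
  have n: "[order G] \<cdot>\<^bsub>K\<^esub> \<one>\<^sub>K \<noteq> \<zero>\<^sub>K" using assms(2,5) unfolding char_zero_def by (metis pos2 zero_less_power)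
  obtain b where b: "\<And>a. a \<in> carrier G \<Longrightarrow> b a \<in> hom G (units_of K)" "\<And>a c. \<lbrakk>a \<in> carrier G; c \<in> carrier G\<rbrakk> \<Longrightarrow> b a c = b c a"
    "\<And>a. \<lbrakk>a \<in> carrier G; \<forall>c\<in>carrier G. b a c = \<one>\<^bsub>units_of K\<^esub>\<rbrakk> \<Longrightarrow> a = \<one>\<^sub>G"
    using A.nondegenerate_bicharacter[OF assms(3,5)] by blast
  have b_nd: "a = \<one>\<^sub>G" if "a \<in> carrier G" "\<And>c. c \<in> carrier G \<Longrightarrow> b a c = \<one>\<^sub>K" for a
    using b(3)[OF that(1)] that(2) by (simp add: units_of_one)
  have Inv: "finite Inv" unfolding Inv_def by (rule G.finite_involution_classes[OF fin])
  \<comment> \<open>Essential for the bound as stated: \<open>order\<close> is zero on an infinite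
    carrier.\<close>
  have Coh: "finite Coh"
    unfolding Coh_def schur_multiplier_def by (rule A.finite_second_cohomology[OF assms(3,5)])
  have Coh_eq: "Coh = (\<lambda>f. ?B #>\<^bsub>?Z\<^esub> f) ` carrier ?Z"
    unfolding Coh_def schur_multiplier_def by (rule C.second_cohomology_carrier)
  \<comment> \<open>The trivial class is discarded from the codes below, which produces the factor
    \<open>M - 1\<close>.\<close>
  have B: "?B \<in> Coh"
    unfolding Coh_eq using C.Z.coset_join2[OF C.Z.one_closed C.coboundaries_subgroup] C.coboundaries_subgroup
    by (intro image_eqI[of _ _ "\<one>\<^bsub>?Z\<^esub>"]) (auto simp: subgroup.one_closed)
  \<comment> \<open>One involution is fixed in each conjugacy class, and \<open>rf\<close> fixes one
    cocycle in each cohomology class. Presentations are moved to these representatives, so only the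
    scalars remain to be counted.\<close>
  define rt where "rt c = (SOME \<tau>. \<tau> \<in> auto G \<and> group.ord (AutoGroup G) \<tau> = 2 \<and> conjugacy_class (AutoGroup G) \<tau> = c)" for c
  have rt: "rt c \<in> auto G" "group.ord (AutoGroup G) (rt c) = 2" "conjugacy_class (AutoGroup G) (rt c) = c"
    if "c \<in> Inv" for c
  proof -
    have "\<exists>\<tau>. \<tau> \<in> auto G \<and> group.ord (AutoGroup G) \<tau> = 2 \<and> conjugacy_class (AutoGroup G) \<tau> = c"
      using that by (auto simp: Inv_def involution_classes_def AutoGroup_def)
    from someI_ex[OF this] show "rt c \<in> auto G" "group.ord (AutoGroup G) (rt c) = 2"
      "conjugacy_class (AutoGroup G) (rt c) = c" unfolding rt_def by auto
  qed
  define rf :: "('g \<times> 'g \<Rightarrow> 'k) set \<Rightarrow> 'g \<times> 'g \<Rightarrow> 'k" where "rf k = (SOME f. f \<in> k)" for k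
  define Sol where "Sol c k = {s \<in> extensional (carrier G). crossed_datum K G (rt c) (rf k) s}" for c k
  have moved: "\<exists>x\<in>carrier G. rt c x \<noteq> x" and rt_in: "x \<in> carrier G \<Longrightarrow> rt c x \<in> carrier G" if "c \<in> Inv" for c x
    using G.auto_involution[OF rt(1)[OF that]] rt[OF that] by (auto simp: auto_def hom_def)
  have Sol: "finite (Sol c k) \<and> 2 * card (Sol c k) \<le> order G" if c: "c \<in> Inv" for c k
  proof -
    obtain x where x: "x \<in> carrier G" "rt c x \<noteq> x" using moved[OF c] by blast
    show ?thesis
      unfolding Sol_def
      by (rule crossed_datum_bound[where b = b and x = x and \<tau> = "rt c", OF assms(3) fin n b(1,2) b_nd x(1) rt_in[OF c x(1)] x(2)])
  qed
  \<comment> \<open>Codes for Hopf algebras: a class of involutions, a nontrivial cohomology class,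
    and a solution for the chosen representatives.\<close>
  define Data where "Data = (SIGMA c:Inv. SIGMA k:Coh - {?B}. Sol c k)"
  have Data: "finite Data" unfolding Data_def using Inv Coh Sol by (intro finite_SigmaI) auto
  have "\<exists>(c, k, s)\<in>Data. presented K H G (rt c) (rf k) s" if H: "H \<in> S" for H
  proof -
    \<comment> \<open>\<open>1 \<le> m\<close> matters here: with truncated subtraction
      \<open>2 ^ m\<close> is twice \<open>2 ^ (m - 1)\<close> only for positive
      \<open>m\<close>.\<close>
    have dim: "vectorspace.fin_dim K H" "vectorspace.dim K H = 2 * order G"
      using assms(9)[OF H] assms(4,5) power_Suc[of "2::nat" "m - 1"] by (auto simp del: power_Suc simp: power_Suc[symmetric])
    obtain \<tau> f s where P: "presented K H G \<tau> f s"
      using exists_presentation[OF assms(1,2,3,5) assms(6,7)[OF H] dim assms(10)[OF H]] by blast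
    have D: "crossed_datum K G \<tau> f s" using P by (simp add: presented_def)
    have inv: "group.ord (AutoGroup G) \<tau> = 2"
      using G.auto_involution[OF crossed_datumD(1)[OF D]] crossed_datumD(4)[OF D] presented_nontrivial(1)[OF P assms(8)[OF H]]
      by blast
    define c where "c = conjugacy_class (AutoGroup G) \<tau>"
    have c: "c \<in> Inv" using crossed_datumD(1)[OF D] inv by (auto simp: c_def Inv_def involution_classes_def AutoGroup_def)
    obtain \<sigma> where "\<sigma> \<in> auto G" "\<forall>a\<in>carrier G. \<sigma> (rt c a) = \<tau> (\<sigma> a)"
      using G.conjugacy_class_auto[OF crossed_datumD(1)[OF D] rt(1)[OF c]] rt(3)[OF c] by (auto simp: c_def)
    then obtain f' s' where P': "presented K H G (rt c) f' s'"
      using presented_conjugate[OF P _ rt(1)[OF c]] by blast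
    have f': "f' \<in> carrier ?Z" using P' crossed_datumD(2) by (auto simp: presented_def)
    define k where "k = ?B #>\<^bsub>?Z\<^esub> f'"
    have f'_k: "f' \<in> k" unfolding k_def by (rule C.Z.rcos_self[OF f' C.coboundaries_subgroup])
    have rf: "rf k \<in> k" unfolding rf_def by (rule someI[of "\<lambda>f. f \<in> k", OF f'_k])
    \<comment> \<open>If \<open>k\<close> were the class of coboundaries, its member
      \<open>f'\<close> would be one, against noncocommutativity.\<close>
    have k: "k \<in> Coh - {?B}"
      using f' f'_k presented_nontrivial(2)[OF P' assms(8)[OF H]] by (auto simp: k_def Coh_eq)
    \<comment> \<open>The chosen cocycle and \<open>f'\<close> lie in the same coset, so they differ
      by a coboundary, which a rescaling of the basis absorbs.\<close>
    obtain d where d: "d \<in> carrier G \<rightarrow> carrier (units_of K)" "rf k = coboundary G (units_of K) d \<otimes>\<^bsub>?Z\<^esub> f'"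
      using C.mem_coset rf unfolding k_def by blast
    obtain s'' where "presented K H G (rt c) (rf k) s''"
      using presented_rescale[OF P', of d] d by (auto simp: units_of_carrier)
    then have P'': "presented K H G (rt c) (rf k) (restrict s'' (carrier G))" by (rule presented_restrict)
    then have "restrict s'' (carrier G) \<in> Sol c k" by (simp add: Sol_def presented_def)
    then show ?thesis using c k P'' by (force simp: Data_def)
  qed
  then obtain D where D: "\<And>H. H \<in> S \<Longrightarrow> D H \<in> Data"
    "\<And>H c k s. \<lbrakk>H \<in> S; D H = (c, k, s)\<rbrakk> \<Longrightarrow> presented K H G (rt c) (rf k) s"
    by (metis (no_types, lifting) case_prodE case_prod_conv)
  \<comment> \<open>Equal codes mean presentations by identical data, hence isomorphic Hopf
    algebras, which distinct members of \<open>S\<close> are not.\<close>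
  have "inj_on D S"
  proof (rule inj_onI, rule ccontr)
    fix H L assume HL: "H \<in> S" "L \<in> S" "D H = D L" "H \<noteq> L"
    obtain c k s where "D H = (c, k, s)" by (metis prod_cases3)
    then have P: "presented K H G (rt c) (rf k) s" "presented K L G (rt c) (rf k) s" using D(2) HL by auto
    then have dat: "crossed_datum K G (rt c) (rf k) s" by (simp add: presented_def)
    obtain e y p q where 1: "crossed_presentation K H G (rt c) (rf k) s e y p q" using P by (auto simp: presented_def)
    obtain e' y' p' q' where 2: "crossed_presentation K L G (rt c) (rf k) s e' y' p' q'" using P by (auto simp: presented_def)
    have "hopf_iso K H L \<noteq> {}"
      by (rule crossed_presentation_iso[OF 1 2]) (use crossed_datumD(6,7)[OF dat] in auto)
    then show False using assms(11) HL by (auto simp: pairwise_def)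
  qed
  moreover have "D ` S \<subseteq> Data" using D(1) by blast
  ultimately have S: "finite S" "card S \<le> card Data"
    using Data inj_on_finite card_inj_on_le by blast+
  define M where "M = order (schur_multiplier K G)"
  have M_Coh: "card Coh = M" by (simp only: M_def order_def Coh_def)
  have M: "card (Coh - {?B}) = M - 1" using card_Diff_singleton[OF B] M_Coh by (simp only:)
  have M_pos: "1 \<le> M" unfolding M_Coh[symmetric] using card_gt_0_iff[of Coh] B Coh by (metis One_nat_def Suc_leI empty_iff)
  have "card Data = (\<Sum>c\<in>Inv. \<Sum>k\<in>Coh - {?B}. card (Sol c k))"
  proof -
    have fin_Sol: "\<forall>k\<in>Coh - {?B}. finite (Sol c k)" if "c \<in> Inv" for c using Sol[OF that] by blast
    have inner: "finite (SIGMA k:Coh - {?B}. Sol c k)"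
      "card (SIGMA k:Coh - {?B}. Sol c k) = (\<Sum>k\<in>Coh - {?B}. card (Sol c k))" if "c \<in> Inv" for c
      using finite_SigmaI[OF finite_Diff[OF Coh], of "{?B}" "Sol c"] card_SigmaI[OF finite_Diff[OF Coh] fin_Sol[OF that]]
        fin_Sol[OF that] by blast+
    have "card Data = (\<Sum>c\<in>Inv. card (SIGMA k:Coh - {?B}. Sol c k))"
      unfolding Data_def by (rule card_SigmaI[OF Inv]) (use inner(1) in blast)
    then show ?thesis by (simp only: inner(2) cong: sum.cong)
  qed
  then have "2 * card Data = (\<Sum>c\<in>Inv. \<Sum>k\<in>Coh - {?B}. 2 * card (Sol c k))"
    by (simp only: sum_distrib_left)
  also have "... \<le> (\<Sum>c\<in>Inv. \<Sum>k\<in>Coh - {?B}. order G)" using Sol by (intro sum_mono) auto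
  also have "... = card Inv * ((M - 1) * order G)" by (simp only: sum_constant M of_nat_id)
  finally have "2 * card S \<le> card Inv * ((M - 1) * order G)" using S by linarith
  then have "real (2 * card S) \<le> real (card Inv * ((M - 1) * order G))" by linarith
  then have bound: "2 * real (card S) \<le> real (card Inv) * ((real M - 1) * real (order G))"
    using M_pos by (simp add: of_nat_diff)
  \<comment> \<open>For nonempty \<open>Inv\<close> this amounts to \<open>2 \<le> order G\<close>,
    which holds since an involution moves some \<open>x\<close> and so provides two elements.
    Without involutions both sides are zero.\<close>
  have "real (card Inv) * ((real M - 1) * real (order G)) \<le> real (card Inv) * (real (order G) * real M - 2)"
  proof (cases "Inv = {}")
    case False
    then obtain c x where "c \<in> Inv" "x \<in> carrier G" "rt c x \<noteq> x" using moved by blast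
    then have "{x, rt c x} \<subseteq> carrier G" "card {x, rt c x} = 2" using rt_in by auto
    then have "2 \<le> order G" unfolding order_def using card_mono[OF fin] by metis
    then show ?thesis by (intro mult_left_mono) (auto simp: algebra_simps)
  qed simp
  then show ?thesis using S(1) bound unfolding Inv_def[symmetric] M_def[symmetric] by (simp add: algebra_simps)
qed

end
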